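(* Let $X$ be an irreducible normal affine variety over $\mathbb{K}$ with finitely generated divisor class group $\mathrm{Cl}(X)$ and Neron-Severi quasitorus $N$. Assume that $\mathbb{K}[X]^\times=\mathbb{K}^\times$. Then there is an exact sequence of groups $$1\to N\xrightarrow{\ \alpha\ }\widetilde{\mathrm{Aut}}(R(X))\xrightarrow{\ \beta\ }\mathrm{Aut}(X)\to 1,$$ where $\alpha$ is given by the action of $N$ on $R(X)$ by homogeneous automorphisms, and $\beta$ sends $\phi\in\widetilde{\mathrm{Aut}}(R(X))$ to the automorphism of $X$ corresponding to the restriction of $\phi$ to $R(X)_0=\mathbb{K}[X]$ (with $\mathrm{Aut}(X)$ identified with the group of $\mathbb{K}$-algebra automorphisms of $\mathbb{K}[X]$ via $\psi\mapsto(\psi^{-1})^*$).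
   Context: $\mathbb{K}$ is an algebraically closed field of characteristic zero. Cox ring. Let $X$ be an irreducible normal variety with finitely generated divisor class group $\mathrm{Cl}(X)$ and $\mathbb{K}[X]^\times=\mathbb{K}^\times$. For a Weil divisor $D$ put $\mathcal{O}(X,D)=\{f\in\mathbb{K}(X)\mid \mathrm{div}(f)+D\ge 0\}$ (with $f=0$ included). Let $K\subset\mathrm{WDiv}(X)$ be a finitely generated subgroup projecting surjectively onto $\mathrm{Cl}(X)$, $K^0$ the kernel of $K\to\mathrm{Cl}(X)$, and $T_K(X)=\bigoplus_{D\in K}\mathcal{O}(X,D)$ with multiplication induced by that of rational functions. Choose a coherent set $\mathcal{F}=\{F_D\in\mathbb{K}(X)^\times : D\in K^0\}$, i.e. $\mathrm{div}(F_D)=D$ and $F_{D+D'}=F_DF_{D'}$. Let $I(K,\mathcal{F})$ be the ideal of $T_K(X)$ spanned by all $f-F_{D_1-D_2}f$ with $D_1,D_2\in K$, $D_1-D_2\in K^0$, $f\in\mathcal{O}(X,D_1)$ (where $F_{D_1-D_2}f$ is taken in $\mathcal{O}(X,D_2)$). The Cox ring is $R(X)=T_K(X)/I(K,\mathcal{F})$; it is naturally graded by $K/K^0\cong\mathrm{Cl}(X)$, $R(X)_0=\mathbb{K}[X]$, and it does not depend on $K,\mathcal{F}$ up to isomorphism. A quasitorus is an algebraic group isomorphic to the direct product of a torus and a finite abelian group. The Neron-Severi quasitorus $N$ of $X$ is the quasitorus with character group identified with $\mathrm{Cl}(X)$; it acts by automorphisms on $R(X)$ so that $R(X)_u$ is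 the weight subspace of weight $u\in\mathrm{Cl}(X)$. For an algebra $R=\bigoplus_{u\in M}R_u$ graded by a finitely generated abelian group $M$, the group of automorphisms normalizing the grading is $$\widetilde{\mathrm{Aut}}(R)=\{\phi\in\mathrm{Aut}(R)\mid \exists\,\phi_0\in\mathrm{Aut}(M):\ \phi(R_u)=R_{\phi_0(u)}\ \ \forall u\in M\},$$ where $\mathrm{Aut}(R)$ is the group of $\mathbb{K}$-algebra automorphisms. Here it is applied with $R=R(X)$, $M=\mathrm{Cl}(X)$. *)

theory Defs
  imports
    "HOL-Analysis.Finite_Cartesian_Product"
    "HOL-Algebra.Free_Abelian_Groups"
    "HOL-Algebra.Multiplicative_Group"
    "HOL-Algebra.QuotRing"
    "HOL-Algebra.Bij"
    "HOL-Computational_Algebra.Polynomial"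
begin

section \<open>Affine varieties\<close>

inductive_set algebra_of_functions :: "('a \<Rightarrow> 'k::field) set \<Rightarrow> ('a \<Rightarrow> 'k) set"
  for G :: "('a \<Rightarrow> 'k) set" where
  gen: "g \<in> G \<Longrightarrow> g \<in> algebra_of_functions G"
| const: "(\<lambda>_. c) \<in> algebra_of_functions G"
| add: "f \<in> algebra_of_functions G \<Longrightarrow> g \<in> algebra_of_functions G \<Longrightarrow>
    (\<lambda>x. f x + g x) \<in> algebra_of_functions G"
| mult: "f \<in> algebra_of_functions G \<Longrightarrow> g \<in> algebra_of_functions G \<Longrightarrow>
    (\<lambda>x. f x * g x) \<in> algebra_of_functions G"

definition polynomial_functions :: "('k::field ^ 'n \<Rightarrow> 'k) set" where
  "polynomial_functions = algebra_of_functions (range (\<lambda>i x. x $ i))"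

definition zariski_closed :: "('k::field ^ 'n) set \<Rightarrow> bool" where
  "zariski_closed V \<longleftrightarrow> (\<exists>S \<subseteq> polynomial_functions. V = {x. \<forall>p\<in>S. p x = 0})"

definition irreducible_closed :: "('k::field ^ 'n) set \<Rightarrow> bool" where
  "irreducible_closed V \<longleftrightarrow> zariski_closed V \<and> V \<noteq> {} \<and>
     (\<forall>Y Z. zariski_closed Y \<and> zariski_closed Z \<and> V = Y \<union> Z \<longrightarrow> V = Y \<or> V = Z)"

text \<open>Functions on \<open>V\<close> are extensional, i.e. \<open>undefined\<close> outside \<open>V\<close>.\<close>

definition regular_functions :: "('k::field ^ 'n) set \<Rightarrow> ('k ^ 'n \<Rightarrow> 'k) set" where
  "regular_functions V = (\<lambda>p. restrict p V) ` polynomial_functions"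

definition coordinate_ring :: "('k::field ^ 'n) set \<Rightarrow> ('k ^ 'n \<Rightarrow> 'k) ring" where
  "coordinate_ring V =
    \<lparr>carrier = regular_functions V,
     monoid.mult = (\<lambda>f g. \<lambda>x\<in>V. f x * g x),
     one = (\<lambda>x\<in>V. 1),
     zero = (\<lambda>x\<in>V. 0),
     add = (\<lambda>f g. \<lambda>x\<in>V. f x + g x)\<rparr>"

definition const_fun :: "('k::field ^ 'n) set \<Rightarrow> 'k \<Rightarrow> 'k ^ 'n \<Rightarrow> 'k" where
  "const_fun V c = (\<lambda>x\<in>V. c)"

definition regular_map ::
  "('k::field ^ 'n) set \<Rightarrow> ('k ^ 'm) set \<Rightarrow> ('k ^ 'n \<Rightarrow> 'k ^ 'm) \<Rightarrow> bool" where
  "regular_map V Y \<psi> \<longleftrightarrow> \<psi> \<in> V \<rightarrow> Y \<and> (\<forall>i. (\<lambda>x\<in>V. \<psi> x $ i) \<in> regular_functions V)"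

definition variety_automorphisms :: "('k::field ^ 'n) set \<Rightarrow> ('k ^ 'n \<Rightarrow> 'k ^ 'n) monoid" where
  "variety_automorphisms V = BijGroup V
     \<lparr>carrier := {\<psi> \<in> Bij V. regular_map V V \<psi> \<and> regular_map V V (inv_into V \<psi>)}\<rparr>"

definition pullback :: "('k::field ^ 'n) set \<Rightarrow> ('k ^ 'n \<Rightarrow> 'k ^ 'm) \<Rightarrow> ('k ^ 'm \<Rightarrow> 'k) \<Rightarrow> 'k ^ 'n \<Rightarrow> 'k" where
  "pullback V \<psi> f = (\<lambda>x\<in>V. f (\<psi> x))"

section \<open>Rational functions\<close>

definition frac :: "('a, 'b) ring_scheme \<Rightarrow> 'a \<Rightarrow> 'a \<Rightarrow> ('a \<times> 'a) set" where
  "frac R a b = {(c, d). c \<in> carrier R \<and> d \<in> carrier R - {\<zero>\<^bsub>R\<^esub>} \<and> a \<otimes>\<^bsub>R\<^esub> d = c \<otimes>\<^bsub>R\<^esub> b}"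

text \<open>The field of fractions of a domain. The unions are over all representatives; every
  member of the union is the same set.\<close>

definition fraction_field :: "('a, 'b) ring_scheme \<Rightarrow> ('a \<times> 'a) set ring" where
  "fraction_field R =
    \<lparr>carrier = {frac R a b | a b. a \<in> carrier R \<and> b \<in> carrier R - {\<zero>\<^bsub>R\<^esub>}},
     monoid.mult = (\<lambda>Q Q'. \<Union>(a, b)\<in>Q. \<Union>(c, d)\<in>Q'. frac R (a \<otimes>\<^bsub>R\<^esub> c) (b \<otimes>\<^bsub>R\<^esub> d)),
     one = frac R \<one>\<^bsub>R\<^esub> \<one>\<^bsub>R\<^esub>,
     zero = frac R \<zero>\<^bsub>R\<^esub> \<one>\<^bsub>R\<^esub>,
     add = (\<lambda>Q Q'. \<Union>(a, b)\<in>Q. \<Union>(c, d)\<in>Q'.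
       frac R ((a \<otimes>\<^bsub>R\<^esub> d) \<oplus>\<^bsub>R\<^esub> (c \<otimes>\<^bsub>R\<^esub> b)) (b \<otimes>\<^bsub>R\<^esub> d))\<rparr>"

definition to_frac :: "('a, 'b) ring_scheme \<Rightarrow> 'a \<Rightarrow> ('a \<times> 'a) set" where
  "to_frac R a = frac R a \<one>\<^bsub>R\<^esub>"

definition integral_over :: "('a, 'b) ring_scheme \<Rightarrow> 'a set \<Rightarrow> 'a \<Rightarrow> bool" where
  "integral_over L S z \<longleftrightarrow> (\<exists>n::nat. \<exists>c \<in> {..<n} \<rightarrow> S.
     (z [^]\<^bsub>L\<^esub> n) \<oplus>\<^bsub>L\<^esub> (\<Oplus>\<^bsub>L\<^esub>i\<in>{..<n}. c i \<otimes>\<^bsub>L\<^esub> (z [^]\<^bsub>L\<^esub> i)) = \<zero>\<^bsub>L\<^esub>)"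

definition integrally_closed_domain :: "('a, 'b) ring_scheme \<Rightarrow> bool" where
  "integrally_closed_domain R \<longleftrightarrow> domain R \<and>
     (\<forall>z \<in> carrier (fraction_field R).
        integral_over (fraction_field R) (to_frac R ` carrier R) z \<longrightarrow> z \<in> to_frac R ` carrier R)"

type_synonym ('k, 'n) ratfun = "(('k ^ 'n \<Rightarrow> 'k) \<times> ('k ^ 'n \<Rightarrow> 'k)) set"

definition function_field :: "('k::field ^ 'n) set \<Rightarrow> ('k, 'n) ratfun ring" where
  "function_field V = fraction_field (coordinate_ring V)"

definition normal_affine_variety :: "('k::field ^ 'n) set \<Rightarrow> bool" where
  "normal_affine_variety V \<longleftrightarrow>
     irreducible_closed V \<and> integrally_closed_domain (coordinate_ring V)"

section \<open>Weil divisors\<close>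

text \<open>Irreducible closed subsets of codimension one: no irreducible closed set lies strictly
  between \<open>P\<close> and \<open>V\<close>.\<close>

definition prime_divisors :: "('k::field ^ 'n) set \<Rightarrow> ('k ^ 'n) set set" where
  "prime_divisors V = {P. irreducible_closed P \<and> P \<subset> V \<and>
     \<not> (\<exists>Z. irreducible_closed Z \<and> P \<subset> Z \<and> Z \<subset> V)}"

text \<open>The local ring of \<open>V\<close> along \<open>P\<close> and its maximal ideal, as subsets of the function field.\<close>

definition local_ring :: "('k::field ^ 'n) set \<Rightarrow> ('k ^ 'n) set \<Rightarrow> ('k, 'n) ratfun set" where
  "local_ring V P = {frac (coordinate_ring V) a b | a b.
     a \<in> regular_functions V \<and> b \<in> regular_functions V \<and> (\<exists>x\<in>P. b x \<noteq> 0)}"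

definition local_max_ideal :: "('k::field ^ 'n) set \<Rightarrow> ('k ^ 'n) set \<Rightarrow> ('k, 'n) ratfun set" where
  "local_max_ideal V P = {frac (coordinate_ring V) a b | a b.
     a \<in> regular_functions V \<and> b \<in> regular_functions V \<and> (\<forall>x\<in>P. a x = 0) \<and> (\<exists>x\<in>P. b x \<noteq> 0)}"

text \<open>The discrete valuation of the local ring: \<open>f = u t\<^sup>n\<close> with a unit \<open>u\<close> and a generator
  \<open>t\<close> of the maximal ideal. Only meant for \<open>f \<noteq> 0\<close>, \<open>V\<close> normal and \<open>P\<close> a prime divisor.\<close>

definition ord_along :: "('k::field ^ 'n) set \<Rightarrow> ('k ^ 'n) set \<Rightarrow> ('k, 'n) ratfun \<Rightarrow> int" where
  "ord_along V P f = (THE n::int. \<exists>t u.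
     local_max_ideal V P = (\<lambda>h. t \<otimes>\<^bsub>function_field V\<^esub> h) ` local_ring V P \<and>
     t \<in> local_max_ideal V P \<and>
     u \<in> Units (function_field V\<lparr>carrier := local_ring V P\<rparr>) \<and>
     f = u \<otimes>\<^bsub>function_field V\<^esub> (t [^]\<^bsub>function_field V\<^esub> n))"

type_synonym ('k, 'n) divisor = "('k ^ 'n) set \<Rightarrow>\<^sub>0 int"

definition WDiv :: "('k::field ^ 'n) set \<Rightarrow> ('k, 'n) divisor monoid" where
  "WDiv V = free_Abelian_group (prime_divisors V)"

text \<open>\<open>Abs_poly_mapping\<close> is meaningful here since a nonzero rational function has
  nonzero order along finitely many prime divisors only.\<close>

definition div_of :: "('k::field ^ 'n) set \<Rightarrow> ('k, 'n) ratfun \<Rightarrow> ('k, 'n) divisor" where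
  "div_of V f = Abs_poly_mapping (\<lambda>P. if P \<in> prime_divisors V then ord_along V P f else 0)"

definition effective :: "('k, 'n) divisor \<Rightarrow> bool" where
  "effective D \<longleftrightarrow> (\<forall>P. Poly_Mapping.lookup D P \<ge> 0)"

definition principal_divisors :: "('k::field ^ 'n) set \<Rightarrow> ('k, 'n) divisor set" where
  "principal_divisors V = div_of V ` carrier (mult_of (function_field V))"

definition Cl :: "('k::field ^ 'n) set \<Rightarrow> ('k, 'n) divisor set monoid" where
  "Cl V = WDiv V Mod principal_divisors V"

definition div_class :: "('k::field ^ 'n) set \<Rightarrow> ('k, 'n) divisor \<Rightarrow> ('k, 'n) divisor set" where
  "div_class V D = principal_divisors V #>\<^bsub>WDiv V\<^esub> D"

definition finitely_generated_group :: "('a, 'b) monoid_scheme \<Rightarrow> bool" where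
  "finitely_generated_group G \<longleftrightarrow>
     group G \<and> (\<exists>S. finite S \<and> S \<subseteq> carrier G \<and> generate G S = carrier G)"

definition sections :: "('k::field ^ 'n) set \<Rightarrow> ('k, 'n) divisor \<Rightarrow> ('k, 'n) ratfun set" where
  "sections V D = {f \<in> carrier (function_field V).
     f = \<zero>\<^bsub>function_field V\<^esub> \<or> effective (div_of V f + D)}"

section \<open>The Cox ring\<close>

text \<open>Throughout, \<open>K\<close> is a subgroup of \<open>WDiv V\<close>. An element of the direct sum of the
  \<open>sections V D\<close>, \<open>D \<in> K\<close>, is a function of \<open>D\<close> with finite support contained in \<open>K\<close>.\<close>

type_synonym ('k, 'n) divisorial = "('k, 'n) divisor \<Rightarrow> ('k, 'n) ratfun"

definition divisorial_algebra ::
  "('k::field ^ 'n) set \<Rightarrow> ('k, 'n) divisor set \<Rightarrow> ('k, 'n) divisorial ring" where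
  "divisorial_algebra V K = (let L = function_field V in
    \<lparr>carrier = {s. (\<forall>D\<in>K. s D \<in> sections V D) \<and> (\<forall>D. D \<notin> K \<longrightarrow> s D = \<zero>\<^bsub>L\<^esub>) \<and>
                   finite {D. s D \<noteq> \<zero>\<^bsub>L\<^esub>}},
     monoid.mult = (\<lambda>s t D. \<Oplus>\<^bsub>L\<^esub>E\<in>{E. s E \<noteq> \<zero>\<^bsub>L\<^esub>}. s E \<otimes>\<^bsub>L\<^esub> t (D - E)),
     one = (\<lambda>D. if D = 0 then \<one>\<^bsub>L\<^esub> else \<zero>\<^bsub>L\<^esub>),
     zero = (\<lambda>D. \<zero>\<^bsub>L\<^esub>),
     add = (\<lambda>s t D. s D \<oplus>\<^bsub>L\<^esub> t D)\<rparr>)"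

definition homogeneous ::
  "('k::field ^ 'n) set \<Rightarrow> ('k, 'n) divisor \<Rightarrow> ('k, 'n) ratfun \<Rightarrow> ('k, 'n) divisorial" where
  "homogeneous V D f = (\<lambda>E. if E = D then f else \<zero>\<^bsub>function_field V\<^esub>)"

definition principal_subgroup ::
  "('k::field ^ 'n) set \<Rightarrow> ('k, 'n) divisor set \<Rightarrow> ('k, 'n) divisor set" where
  "principal_subgroup V K = {D \<in> K. div_class V D = \<one>\<^bsub>Cl V\<^esub>}"

definition coherent ::
  "('k::field ^ 'n) set \<Rightarrow> ('k, 'n) divisor set \<Rightarrow> (('k, 'n) divisor \<Rightarrow> ('k, 'n) ratfun) \<Rightarrow> bool" where
  "coherent V K F \<longleftrightarrow>
     (\<forall>D\<in>principal_subgroup V K. F D \<in> carrier (mult_of (function_field V)) \<and> div_of V (F D) = D) \<and>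
     (\<forall>D\<in>principal_subgroup V K. \<forall>D'\<in>principal_subgroup V K. F (D + D') = F D \<otimes>\<^bsub>function_field V\<^esub> F D')"

definition cox_ideal ::
  "('k::field ^ 'n) set \<Rightarrow> ('k, 'n) divisor set \<Rightarrow> (('k, 'n) divisor \<Rightarrow> ('k, 'n) ratfun)
     \<Rightarrow> ('k, 'n) divisorial set" where
  "cox_ideal V K F = (let T = divisorial_algebra V K in
     Idl\<^bsub>T\<^esub> {homogeneous V D\<^sub>1 f \<ominus>\<^bsub>T\<^esub> homogeneous V D\<^sub>2 (F (D\<^sub>1 - D\<^sub>2) \<otimes>\<^bsub>function_field V\<^esub> f) | D\<^sub>1 D\<^sub>2 f.
       D\<^sub>1 \<in> K \<and> D\<^sub>2 \<in> K \<and> D\<^sub>1 - D\<^sub>2 \<in> principal_subgroup V K \<and> f \<in> sections V D\<^sub>1})"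

definition cox_ring ::
  "('k::field ^ 'n) set \<Rightarrow> ('k, 'n) divisor set \<Rightarrow> (('k, 'n) divisor \<Rightarrow> ('k, 'n) ratfun)
     \<Rightarrow> ('k, 'n) divisorial set ring" where
  "cox_ring V K F = divisorial_algebra V K Quot cox_ideal V K F"

text \<open>The component of degree \<open>u\<close>, where \<open>u\<close> is a divisor class and hence a set of divisors.\<close>

definition cox_component ::
  "('k::field ^ 'n) set \<Rightarrow> ('k, 'n) divisor set \<Rightarrow> (('k, 'n) divisor \<Rightarrow> ('k, 'n) ratfun)
     \<Rightarrow> ('k, 'n) divisor set \<Rightarrow> ('k, 'n) divisorial set set" where
  "cox_component V K F u =
     {cox_ideal V K F +>\<^bsub>divisorial_algebra V K\<^esub> s | s.
        s \<in> carrier (divisorial_algebra V K) \<and> (\<forall>D. s D \<noteq> \<zero>\<^bsub>function_field V\<^esub> \<longrightarrow> D \<in> u)}"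

text \<open>The identification of the coordinate ring with the component of degree zero; on constants
  it is the structure map of the \<open>\<bbbK>\<close>-algebra \<open>cox_ring V K F\<close>.\<close>

definition cox_embed ::
  "('k::field ^ 'n) set \<Rightarrow> ('k, 'n) divisor set \<Rightarrow> (('k, 'n) divisor \<Rightarrow> ('k, 'n) ratfun)
     \<Rightarrow> ('k ^ 'n \<Rightarrow> 'k) \<Rightarrow> ('k, 'n) divisorial set" where
  "cox_embed V K F f =
     cox_ideal V K F +>\<^bsub>divisorial_algebra V K\<^esub> homogeneous V 0 (to_frac (coordinate_ring V) f)"

definition cox_scalar ::
  "('k::field ^ 'n) set \<Rightarrow> ('k, 'n) divisor set \<Rightarrow> (('k, 'n) divisor \<Rightarrow> ('k, 'n) ratfun)
     \<Rightarrow> 'k \<Rightarrow> ('k, 'n) divisorial set" where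
  "cox_scalar V K F c = cox_embed V K F (const_fun V c)"

text \<open>The automorphisms of the \<open>\<bbbK>\<close>-algebra \<open>cox_ring V K F\<close> normalizing the grading by \<open>Cl V\<close>.\<close>

definition graded_automorphisms ::
  "('k::field ^ 'n) set \<Rightarrow> ('k, 'n) divisor set \<Rightarrow> (('k, 'n) divisor \<Rightarrow> ('k, 'n) ratfun)
     \<Rightarrow> (('k, 'n) divisorial set \<Rightarrow> ('k, 'n) divisorial set) monoid" where
  "graded_automorphisms V K F = BijGroup (carrier (cox_ring V K F))
     \<lparr>carrier := {\<phi> \<in> Bij (carrier (cox_ring V K F)).
        \<phi> \<in> ring_hom (cox_ring V K F) (cox_ring V K F) \<and>
        (\<forall>c. \<phi> (cox_scalar V K F c) = cox_scalar V K F c) \<and>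
        (\<exists>\<phi>\<^sub>0 \<in> auto (Cl V). \<forall>u \<in> carrier (Cl V).
           \<phi> ` cox_component V K F u = cox_component V K F (\<phi>\<^sub>0 u))}\<rparr>"

section \<open>Quasitori\<close>

definition Gm :: "'k::field monoid" where
  "Gm = \<lparr>carrier = UNIV - {0}, monoid.mult = (*), one = 1\<rparr>"

definition affine_algebraic_group :: "('k::field ^ 'm) monoid \<Rightarrow> bool" where
  "affine_algebraic_group G \<longleftrightarrow> group G \<and> zariski_closed (carrier G) \<and>
     (\<forall>i. (\<lambda>z \<in> carrier G \<times> carrier G. (fst z \<otimes>\<^bsub>G\<^esub> snd z) $ i) \<in>
        (\<lambda>p. restrict p (carrier G \<times> carrier G)) `
          algebra_of_functions (range (\<lambda>j z. fst z $ j) \<union> range (\<lambda>j z. snd z $ j))) \<and>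
     regular_map (carrier G) (carrier G) (\<lambda>x. inv\<^bsub>G\<^esub> x)"

definition torus :: "nat \<Rightarrow> (nat \<Rightarrow> 'k::field) monoid" where
  "torus r = product_group {..<r} (\<lambda>_. Gm)"

text \<open>The regular functions on the direct product of \<open>torus r\<close> and a finite group: Laurent
  polynomials on the torus, arbitrary functions on the finite group.\<close>

definition torus_finite_functions ::
  "nat \<Rightarrow> nat monoid \<Rightarrow> ((nat \<Rightarrow> 'k::field) \<times> nat \<Rightarrow> 'k) set" where
  "torus_finite_functions r A =
     (\<lambda>p. restrict p (carrier (torus r \<times>\<times> A))) ` algebra_of_functions
       ((\<lambda>i z. fst z i) ` {..<r} \<union> (\<lambda>i z. inverse (fst z i)) ` {..<r} \<union>
        range (\<lambda>g z. g (snd z)))"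

text \<open>An isomorphism of affine algebraic groups is a group isomorphism under which the regular
  functions correspond. Any finite group is isomorphic to one with elements in \<^typ>\<open>nat\<close>.\<close>

definition quasitorus :: "('k::field ^ 'm) monoid \<Rightarrow> bool" where
  "quasitorus G \<longleftrightarrow> affine_algebraic_group G \<and>
     (\<exists>r A \<phi>. comm_group A \<and> finite (carrier A) \<and> \<phi> \<in> iso G (torus r \<times>\<times> A) \<and>
        (\<lambda>h. \<lambda>x \<in> carrier G. h (\<phi> x)) ` torus_finite_functions r A = regular_functions (carrier G))"

definition character_group :: "('k::field ^ 'm) monoid \<Rightarrow> ('k ^ 'm \<Rightarrow> 'k) monoid" where
  "character_group G =
    \<lparr>carrier = {\<eta> \<in> regular_functions (carrier G). \<eta> \<in> hom G Gm},
     monoid.mult = (\<lambda>\<eta> \<xi>. \<lambda>x \<in> carrier G. \<eta> x * \<xi> x),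
     one = (\<lambda>x \<in> carrier G. 1)\<rparr>"

section \<open>Exactness\<close>

text \<open>Unlike \<open>short_exact_sequence\<close>, this allows groups of different types.\<close>

definition exact_1_1 ::
  "('a, 'x) monoid_scheme \<Rightarrow> ('b, 'y) monoid_scheme \<Rightarrow> ('c, 'z) monoid_scheme
     \<Rightarrow> ('a \<Rightarrow> 'b) \<Rightarrow> ('b \<Rightarrow> 'c) \<Rightarrow> bool" where
  "exact_1_1 A B C f g \<longleftrightarrow> group A \<and> group B \<and> group C \<and>
     f \<in> mon A B \<and> g \<in> epi B C \<and> f ` carrier A = kernel B C g"

end

theory Submission
 imports Defs "HOL-Library.Function_Algebras"
begin

text \<open>The homomorphism to \<open>Aut(X)\<close> is onto because automorphisms of \<open>X\<close> lift to the Cox ring. The latter depends on the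
choice of \<open>K\<close> and of the functions \<open>F\<close>, so divisors cannot simply be transported. A homogeneous element, given by a
section \<open>f\<close> of \<open>D \<in> K\<close>, has an intrinsic invariant, the effective divisor \<open>div f + D\<close>. It determines the element up to
a constant. The constant is recorded by a second invariant \<open>p D f\<close>, where \<open>p\<close> is a character of \<open>K \<times> \<bbbK>(X)\<^sup>\<times>\<close> that is
prescribed on the subgroup of all \<open>(E, c F\<^sub>E\<^sup>-\<^sup>1)\<close>; it exists since \<open>\<bbbK>\<^sup>\<times>\<close> is divisible (\<open>character_extends\<close>). An
automorphism of the function field that preserves regularity is lifted by transporting the divisor and multiplying
the second invariant by a character of the group of Weil divisors. That the lift restricts to the given automorphism in
degree zero prescribes this character on principal divisors, and again it extends (\<open>correction_character\<close>). The lift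
is additive, since on the sections of one divisor it is the field automorphism followed by multiplication with one
function, and it is multiplicative since both invariants are (\<open>lifts_exists\<close>).

Exactness in the middle concerns an automorphism that is the identity in degree zero. Multiplying with a section of
\<open>- D\<close> shows that it multiplies all sections of \<open>D\<close> by one rational function \<open>h\<close>, onto the sections of some \<open>D'\<close>. Sections
attain at each prime divisor the smallest order that their divisor allows, hence \<open>div h = D - D'\<close>
(\<open>multiplier_divisor\<close>), and the relation between the degrees \<open>D\<close> and \<open>D'\<close> turns \<open>h\<close> into a constant. These constants
form a character of the class group. Regular functions on a quasitorus are linear combinations of characters, and
these are linearly independent; therefore a character of the character group is the evaluation at a point
(\<open>character_of_characters_is_evaluation\<close>), which is unique as characters separate points.

The statements about orders and sections rest on the theory of discrete valuations of a Noetherian normal domain: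
localizations at primes of height one are discrete valuation rings, their intersection is the domain, only finitely
many of the valuations of a function are not zero, and orders can be prescribed (\<open>exists_prescribed_valuation\<close>). The
basis theorem makes the coordinate ring Noetherian, and the Nullstellensatz identifies prime divisors with primes
of height one.\<close>

abbreviation "poly_funs \<equiv> polynomial_functions"

section \<open>The field of fractions\<close>

context domain begin

lemma frac_self: "a \<in> carrier R ==> b \<in> carrier R - {\<zero>} ==> (a, b) \<in> frac R a b"
 by (simp add: frac_def)

lemma frac_eq_iff:
 assumes "a \<in> carrier R" "b \<in> carrier R - {\<zero>}" "c \<in> carrier R" "d \<in> carrier R - {\<zero>}"
 shows "frac R a b = frac R c d \<longleftrightarrow> a \<otimes> d = c \<otimes> b"
proof
 assume "frac R a b = frac R c d"
 then have "(c, d) \<in> frac R a b" using frac_self[OF assms(3,4)] by simp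
 then show "a \<otimes> d = c \<otimes> b" by (simp add: frac_def)
next
 have *: "a \<otimes> f = e \<otimes> b" if eq: "a \<otimes> d = c \<otimes> b" "c \<otimes> f = e \<otimes> d"
  and R: "a \<in> carrier R" "b \<in> carrier R" "c \<in> carrier R" "d \<in> carrier R - {\<zero>}" "e \<in> carrier R" "f \<in> carrier R"
  for a b c d e f
 proof -
  have "d \<otimes> (a \<otimes> f) = (a \<otimes> d) \<otimes> f" using R by (simp add: m_ac)
  also have "... = (c \<otimes> f) \<otimes> b" unfolding eq(1) using R by (simp add: m_ac)
  also have "... = d \<otimes> (e \<otimes> b)" unfolding eq(2) using R by (simp add: m_ac)
  finally show ?thesis using R m_lcancel by (metis DiffE insertCI m_closed)
 qed
 assume eq: "a \<otimes> d = c \<otimes> b"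
 have R: "a \<in> carrier R" "b \<in> carrier R" "c \<in> carrier R" "d \<in> carrier R" using assms by auto
 show "frac R a b = frac R c d" unfolding frac_def
 proof (intro Collect_cong prod.case_cong refl conj_cong)
  fix e f assume "e \<in> carrier R" and "f \<in> carrier R - {\<zero>}"
  then have ef: "e \<in> carrier R" "f \<in> carrier R" by auto
  show "a \<otimes> f = e \<otimes> b \<longleftrightarrow> c \<otimes> f = e \<otimes> d"
   using *[OF eq _ R(1-3) assms(4) ef] *[OF eq[symmetric] _ R(3,4,1) assms(2) ef] by blast
 qed
qed

lemma fraction_field_cases:
 assumes "x \<in> carrier (fraction_field R)"
 obtains a b where "a \<in> carrier R" "b \<in> carrier R - {\<zero>}" "x = frac R a b"
 using assms by (auto simp: fraction_field_def)

lemma frac_closed: "a \<in> carrier R ==> b \<in> carrier R - {\<zero>} ==> frac R a b \<in> carrier (fraction_field R)"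
 by (auto simp: fraction_field_def)

lemma frac_memD:
 assumes "(c, d) \<in> frac R a b" "a \<in> carrier R" "b \<in> carrier R - {\<zero>}"
 shows "c \<in> carrier R" "d \<in> carrier R - {\<zero>}" "frac R c d = frac R a b"
 using assms frac_eq_iff[of a b c d] by (auto simp: frac_def)

lemma denom_mult: "b \<in> carrier R - {\<zero>} ==> d \<in> carrier R - {\<zero>} ==> b \<otimes> d \<in> carrier R - {\<zero>}"
 using integral by auto

lemma frac_mult_cong:
 assumes "a \<in> carrier R" "b \<in> carrier R - {\<zero>}" "c \<in> carrier R" "d \<in> carrier R - {\<zero>}"
  "a' \<in> carrier R" "b' \<in> carrier R - {\<zero>}" "c' \<in> carrier R" "d' \<in> carrier R - {\<zero>}"
  "frac R a b = frac R a' b'" "frac R c d = frac R c' d'"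
 shows "frac R (a \<otimes> c) (b \<otimes> d) = frac R (a' \<otimes> c') (b' \<otimes> d')"
  "frac R ((a \<otimes> d) \<oplus> (c \<otimes> b)) (b \<otimes> d) = frac R ((a' \<otimes> d') \<oplus> (c' \<otimes> b')) (b' \<otimes> d')"
proof -
 have R: "a \<in> carrier R" "b \<in> carrier R" "c \<in> carrier R" "d \<in> carrier R" 
  "a' \<in> carrier R" "b' \<in> carrier R" "c' \<in> carrier R" "d' \<in> carrier R" using assms by auto
 have e: "a \<otimes> b' = a' \<otimes> b" "c \<otimes> d' = c' \<otimes> d" using assms by (auto simp: frac_eq_iff)
 have "(a \<otimes> c) \<otimes> (b' \<otimes> d') = (a \<otimes> b') \<otimes> (c \<otimes> d')" using R by (simp add: m_ac)
 also have "... = (a' \<otimes> c') \<otimes> (b \<otimes> d)" unfolding e using R by (simp add: m_ac)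
 finally show "frac R (a \<otimes> c) (b \<otimes> d) = frac R (a' \<otimes> c') (b' \<otimes> d')"
  using assms denom_mult by (subst frac_eq_iff) auto
 have "((a \<otimes> d) \<oplus> (c \<otimes> b)) \<otimes> (b' \<otimes> d') = (a \<otimes> b') \<otimes> (d \<otimes> d') \<oplus> (c \<otimes> d') \<otimes> (b \<otimes> b')"
  using R by algebra
 also have "... = ((a' \<otimes> d') \<oplus> (c' \<otimes> b')) \<otimes> (b \<otimes> d)" unfolding e using R by algebra
 finally show "frac R ((a \<otimes> d) \<oplus> (c \<otimes> b)) (b \<otimes> d) = frac R ((a' \<otimes> d') \<oplus> (c' \<otimes> b')) (b' \<otimes> d')"
  using assms denom_mult by (subst frac_eq_iff) auto
qed

lemma frac_mult_add:
 assumes "a \<in> carrier R" "b \<in> carrier R - {\<zero>}" "c \<in> carrier R" "d \<in> carrier R - {\<zero>}"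
 shows "frac R a b \<otimes>\<^bsub>fraction_field R\<^esub> frac R c d = frac R (a \<otimes> c) (b \<otimes> d)"
  "frac R a b \<oplus>\<^bsub>fraction_field R\<^esub> frac R c d = frac R ((a \<otimes> d) \<oplus> (c \<otimes> b)) (b \<otimes> d)"
proof -
 have *: "frac R (a' \<otimes> c') (b' \<otimes> d') = frac R (a \<otimes> c) (b \<otimes> d)"
  "frac R ((a' \<otimes> d') \<oplus> (c' \<otimes> b')) (b' \<otimes> d') = frac R ((a \<otimes> d) \<oplus> (c \<otimes> b)) (b \<otimes> d)"
  if "(a', b') \<in> frac R a b" "(c', d') \<in> frac R c d" for a' b' c' d'
  using frac_mult_cong[OF frac_memD(1,2)[OF that(1) assms(1,2)] frac_memD(1,2)[OF that(2) assms(3,4)] assms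
    frac_memD(3)[OF that(1) assms(1,2)] frac_memD(3)[OF that(2) assms(3,4)]] by simp_all
 have ne: "(a, b) \<in> frac R a b" "(c, d) \<in> frac R c d" using assms frac_self by auto
 have "(\<Union>(a', b')\<in>frac R a b. \<Union>(c', d')\<in>frac R c d. frac R (a' \<otimes> c') (b' \<otimes> d')) = frac R (a \<otimes> c) (b \<otimes> d)"
  using *(1) ne by fast
 then show "frac R a b \<otimes>\<^bsub>fraction_field R\<^esub> frac R c d = frac R (a \<otimes> c) (b \<otimes> d)"
  by (simp add: fraction_field_def)
 have "(\<Union>(a', b')\<in>frac R a b. \<Union>(c', d')\<in>frac R c d. frac R ((a' \<otimes> d') \<oplus> (c' \<otimes> b')) (b' \<otimes> d')) =
   frac R ((a \<otimes> d) \<oplus> (c \<otimes> b)) (b \<otimes> d)"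
  using *(2) ne by fast
 then show "frac R a b \<oplus>\<^bsub>fraction_field R\<^esub> frac R c d = frac R ((a \<otimes> d) \<oplus> (c \<otimes> b)) (b \<otimes> d)"
  by (simp add: fraction_field_def)
qed

lemma fraction_field_one_zero:
 "\<one>\<^bsub>fraction_field R\<^esub> = frac R \<one> \<one>" "\<zero>\<^bsub>fraction_field R\<^esub> = frac R \<zero> \<one>"
 by (simp_all add: fraction_field_def)

lemma frac_eq_zero_iff:
 "a \<in> carrier R ==> b \<in> carrier R - {\<zero>} ==> frac R a b = \<zero>\<^bsub>fraction_field R\<^esub> \<longleftrightarrow> a = \<zero>"
 by (simp add: fraction_field_one_zero frac_eq_iff)

lemma field_fraction_field: "field (fraction_field R)"
proof -
 let ?L = "fraction_field R"
 note E = frac_mult_add fraction_field_one_zero denom_mult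
 have cring: "cring ?L"
 proof (rule cringI)
  show "abelian_group ?L"
  proof (rule abelian_groupI)
   fix x y z assume "x \<in> carrier ?L" "y \<in> carrier ?L" "z \<in> carrier ?L"
   then obtain a b c d e f where *: "a \<in> carrier R" "b \<in> carrier R - {\<zero>}" "c \<in> carrier R" "d \<in> carrier R - {\<zero>}"
    "e \<in> carrier R" "f \<in> carrier R - {\<zero>}" and xyz: "x = frac R a b" "y = frac R c d" "z = frac R e f"
    by (metis fraction_field_cases)
   then have R: "a \<in> carrier R" "b \<in> carrier R" "c \<in> carrier R" "d \<in> carrier R" "e \<in> carrier R" "f \<in> carrier R" by auto
   have dd: "b \<otimes> d \<in> carrier R - {\<zero>}" "d \<otimes> f \<in> carrier R - {\<zero>}" using denom_mult * by auto
   have s: "a \<otimes> d \<oplus> c \<otimes> b \<in> carrier R" "c \<otimes> f \<oplus> e \<otimes> d \<in> carrier R" using R by auto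
   show "x \<oplus>\<^bsub>?L\<^esub> y \<in> carrier ?L" unfolding xyz frac_mult_add(2)[OF *(1-4)] using s dd frac_closed by blast
   show "x \<oplus>\<^bsub>?L\<^esub> y \<oplus>\<^bsub>?L\<^esub> z = x \<oplus>\<^bsub>?L\<^esub> (y \<oplus>\<^bsub>?L\<^esub> z)"
    unfolding xyz frac_mult_add(2)[OF *(1-4)] frac_mult_add(2)[OF *(3-6)]
     frac_mult_add(2)[OF s(1) dd(1) *(5,6)] frac_mult_add(2)[OF *(1,2) s(2) dd(2)]
   proof (subst frac_eq_iff)
    show "((a \<otimes> d \<oplus> c \<otimes> b) \<otimes> f \<oplus> e \<otimes> (b \<otimes> d)) \<otimes> (b \<otimes> (d \<otimes> f)) =
     (a \<otimes> (d \<otimes> f) \<oplus> (c \<otimes> f \<oplus> e \<otimes> d) \<otimes> b) \<otimes> (b \<otimes> d \<otimes> f)" using R by algebra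
   qed (use R denom_mult[OF dd(1) *(6)] denom_mult[OF *(2) dd(2)] in auto)
   have "a \<otimes> d \<oplus> c \<otimes> b = c \<otimes> b \<oplus> a \<otimes> d" "b \<otimes> d = d \<otimes> b" using R by algebra+
   then show "x \<oplus>\<^bsub>?L\<^esub> y = y \<oplus>\<^bsub>?L\<^esub> x" unfolding xyz using * by (simp add: frac_mult_add)
  next
   show "\<zero>\<^bsub>?L\<^esub> \<in> carrier ?L" by (simp add: E frac_closed)
   fix x assume "x \<in> carrier ?L"
   then obtain a b where *: "a \<in> carrier R" "b \<in> carrier R - {\<zero>}" and x: "x = frac R a b" by (metis fraction_field_cases)
   show "\<zero>\<^bsub>?L\<^esub> \<oplus>\<^bsub>?L\<^esub> x = x" unfolding x using * by (simp add: E)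
   have R: "a \<in> carrier R" "b \<in> carrier R" using * by auto
   have "\<ominus> a \<otimes> b \<oplus> a \<otimes> b = \<zero>" using R by algebra
   then have "frac R (\<ominus> a) b \<oplus>\<^bsub>?L\<^esub> x = \<zero>\<^bsub>?L\<^esub>" unfolding x using * denom_mult[of b b]
    by (simp add: frac_mult_add frac_eq_zero_iff)
   then show "\<exists>y\<in>carrier ?L. y \<oplus>\<^bsub>?L\<^esub> x = \<zero>\<^bsub>?L\<^esub>" using * frac_closed by (meson a_inv_closed)
  qed
  show "comm_monoid ?L"
  proof (rule comm_monoidI)
   fix x y z assume "x \<in> carrier ?L" "y \<in> carrier ?L" "z \<in> carrier ?L"
   then obtain a b c d e f where *: "a \<in> carrier R" "b \<in> carrier R - {\<zero>}" "c \<in> carrier R" "d \<in> carrier R - {\<zero>}"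
    "e \<in> carrier R" "f \<in> carrier R - {\<zero>}" and xyz: "x = frac R a b" "y = frac R c d" "z = frac R e f"
    by (metis fraction_field_cases)
   have dd: "b \<otimes> d \<in> carrier R - {\<zero>}" "d \<otimes> f \<in> carrier R - {\<zero>}" using denom_mult * by auto
   have ac: "a \<otimes> c \<in> carrier R" "c \<otimes> e \<in> carrier R" using * by auto
   show "x \<otimes>\<^bsub>?L\<^esub> y \<in> carrier ?L"
    unfolding xyz frac_mult_add(1)[OF *(1-4)] by (rule frac_closed[OF ac(1) dd(1)])
   have "a \<otimes> c \<otimes> e = a \<otimes> (c \<otimes> e)" "b \<otimes> d \<otimes> f = b \<otimes> (d \<otimes> f)" using * by (auto simp: m_assoc)
   then show "x \<otimes>\<^bsub>?L\<^esub> y \<otimes>\<^bsub>?L\<^esub> z = x \<otimes>\<^bsub>?L\<^esub> (y \<otimes>\<^bsub>?L\<^esub> z)"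
    unfolding xyz frac_mult_add(1)[OF *(1-4)] frac_mult_add(1)[OF *(3-6)]
     frac_mult_add(1)[OF ac(1) dd(1) *(5,6)] frac_mult_add(1)[OF *(1,2) ac(2) dd(2)] by simp
   have "a \<otimes> c = c \<otimes> a" "b \<otimes> d = d \<otimes> b" using * by (auto simp: m_comm)
   then show "x \<otimes>\<^bsub>?L\<^esub> y = y \<otimes>\<^bsub>?L\<^esub> x" unfolding xyz frac_mult_add(1)[OF *(1-4)] frac_mult_add(1)[OF *(3,4,1,2)] by simp
  next
   show "\<one>\<^bsub>?L\<^esub> \<in> carrier ?L" by (simp add: E frac_closed)
   fix x assume "x \<in> carrier ?L"
   then obtain a b where *: "a \<in> carrier R" "b \<in> carrier R - {\<zero>}" and x: "x = frac R a b" by (metis fraction_field_cases)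
   show "\<one>\<^bsub>?L\<^esub> \<otimes>\<^bsub>?L\<^esub> x = x" unfolding x using * by (simp add: E)
  qed
  fix x y z assume "x \<in> carrier ?L" "y \<in> carrier ?L" "z \<in> carrier ?L"
  then obtain a b c d e f where *: "a \<in> carrier R" "b \<in> carrier R - {\<zero>}" "c \<in> carrier R" "d \<in> carrier R - {\<zero>}"
   "e \<in> carrier R" "f \<in> carrier R - {\<zero>}" and xyz: "x = frac R a b" "y = frac R c d" "z = frac R e f"
   by (metis fraction_field_cases)
  then have R: "a \<in> carrier R" "b \<in> carrier R" "c \<in> carrier R" "d \<in> carrier R" "e \<in> carrier R" "f \<in> carrier R" by auto
  have dd: "b \<otimes> d \<in> carrier R - {\<zero>}" "d \<otimes> f \<in> carrier R - {\<zero>}" "b \<otimes> f \<in> carrier R - {\<zero>}" using denom_mult * by auto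
  have ae: "a \<otimes> e \<in> carrier R" "c \<otimes> e \<in> carrier R" "a \<otimes> d \<oplus> c \<otimes> b \<in> carrier R" using R by auto
  show "(x \<oplus>\<^bsub>?L\<^esub> y) \<otimes>\<^bsub>?L\<^esub> z = x \<otimes>\<^bsub>?L\<^esub> z \<oplus>\<^bsub>?L\<^esub> y \<otimes>\<^bsub>?L\<^esub> z"
   unfolding xyz frac_mult_add(2)[OF *(1-4)] frac_mult_add(1)[OF ae(3) dd(1) *(5,6)]
    frac_mult_add(1)[OF *(1,2,5,6)] frac_mult_add(1)[OF *(3,4,5,6)] frac_mult_add(2)[OF ae(1) dd(3) ae(2) dd(2)]
  proof (subst frac_eq_iff)
   show "(a \<otimes> d \<oplus> c \<otimes> b) \<otimes> e \<otimes> (b \<otimes> f \<otimes> (d \<otimes> f)) =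
    (a \<otimes> e \<otimes> (d \<otimes> f) \<oplus> c \<otimes> e \<otimes> (b \<otimes> f)) \<otimes> (b \<otimes> d \<otimes> f)" using R by algebra
  qed (use R denom_mult[OF dd(1) *(6)] denom_mult[OF dd(3) dd(2)] in auto)
 qed
 then interpret L: cring ?L .
 show ?thesis
 proof (rule L.cring_fieldI2)
  show "\<zero>\<^bsub>?L\<^esub> \<noteq> \<one>\<^bsub>?L\<^esub>" using frac_eq_zero_iff[of \<one> \<one>] by (simp add: fraction_field_one_zero(1))
  fix x assume "x \<in> carrier ?L" "x \<noteq> \<zero>\<^bsub>?L\<^esub>"
  then obtain a b where *: "a \<in> carrier R" "b \<in> carrier R - {\<zero>}" and x: "x = frac R a b" "a \<noteq> \<zero>"
   by (metis fraction_field_cases frac_eq_zero_iff)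
  then have "x \<otimes>\<^bsub>?L\<^esub> frac R b a = \<one>\<^bsub>?L\<^esub>"
   using denom_mult[of b a] by (simp add: frac_mult_add fraction_field_one_zero frac_eq_iff m_comm)
  then show "\<exists>y\<in>carrier ?L. x \<otimes>\<^bsub>?L\<^esub> y = \<one>\<^bsub>?L\<^esub>" using * x by (intro bexI[of _ "frac R b a"] frac_closed) auto
 qed
qed

lemma to_frac_hom: "to_frac R \<in> ring_hom R (fraction_field R)"
 unfolding to_frac_def
 by (rule ring_hom_memI) (auto simp: frac_closed frac_mult_add fraction_field_one_zero)

lemma to_frac_inj: "a \<in> carrier R ==> b \<in> carrier R ==> to_frac R a = to_frac R b \<longleftrightarrow> a = b"
 by (simp add: to_frac_def frac_eq_iff)

lemma frac_times_denominator:
 "a \<in> carrier R ==> b \<in> carrier R - {\<zero>} ==> frac R a b \<otimes>\<^bsub>fraction_field R\<^esub> to_frac R b = to_frac R a"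
 by (simp add: to_frac_def frac_mult_add frac_eq_iff m_assoc)

end

section \<open>Noetherian rings and the basis theorem\<close>

definition subring1 :: "'r::comm_ring_1 set \<Rightarrow> bool" where
 "subring1 B \<longleftrightarrow> 1 \<in> B \<and> (\<forall>x\<in>B. \<forall>y\<in>B. x - y \<in> B \<and> x * y \<in> B)"

text \<open>Subrings of a commutative ring are sets here, so polynomials over them are polynomials over the ambient ring
with restricted coefficients, and adjoining an element means evaluating them.\<close>

definition polys :: "'r::comm_ring_1 set \<Rightarrow> 'r poly set" where
 "polys B = {p. \<forall>i. coeff p i \<in> B}"

definition adjoin :: "'r::comm_ring_1 set \<Rightarrow> 'r \<Rightarrow> 'r set" where
 "adjoin B s = (\<lambda>p. poly p s) ` polys B"

lemma subring1D:
 assumes "subring1 B"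
 shows "1 \<in> B" "0 \<in> B" "x \<in> B ==> - x \<in> B" "x \<in> B ==> y \<in> B ==> x + y \<in> B"
  "x \<in> B ==> y \<in> B ==> x - y \<in> B" "x \<in> B ==> y \<in> B ==> x * y \<in> B" "x \<in> B ==> x ^ n \<in> B"
proof -
 show 1: "1 \<in> B" and m: "\<And>x y. x \<in> B ==> y \<in> B ==> x - y \<in> B"
  and t: "\<And>x y. x \<in> B ==> y \<in> B ==> x * y \<in> B"
  using assms by (auto simp: subring1_def)
 show 0: "0 \<in> B" using m[OF 1 1] by simp
 show n: "\<And>x. x \<in> B ==> - x \<in> B" using m[OF 0] by simp
 show "\<And>x y. x \<in> B ==> y \<in> B ==> x + y \<in> B" using m n by (metis diff_minus_eq_add)
 show "x \<in> B ==> x ^ n \<in> B" by (induction n) (auto intro: 1 t)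
qed

lemma subring1_sum:
 assumes "subring1 B" "\<And>i. i \<in> I ==> f i \<in> B" shows "sum f I \<in> B"
 using assms(2) by (induction I rule: infinite_finite_induct) (auto intro: subring1D[OF assms(1)])

lemma polysD: "p \<in> polys B ==> coeff p i \<in> B"
 by (simp add: polys_def)

lemma polys_closed:
 assumes "subring1 B"
 shows "0 \<in> polys B" "1 \<in> polys B" "c \<in> B ==> [:c:] \<in> polys B" "[:0, 1:] \<in> polys B"
  "c \<in> B ==> monom c n \<in> polys B"
  "p \<in> polys B ==> q \<in> polys B ==> p + q \<in> polys B"
  "p \<in> polys B ==> q \<in> polys B ==> p - q \<in> polys B"
  "p \<in> polys B ==> q \<in> polys B ==> p * q \<in> polys B"
  "c \<in> B ==> q \<in> polys B ==> smult c q \<in> polys B"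
 using subring1D[OF assms]
 by (auto simp: polys_def coeff_pCons coeff_mult split: nat.splits intro!: subring1_sum[OF assms])

lemma subring1_adjoin:
 assumes B: "subring1 B" shows "subring1 (adjoin B s)"
 unfolding subring1_def adjoin_def
proof (intro conjI ballI)
 show "1 \<in> (\<lambda>p. poly p s) ` polys B"
  using polys_closed(2)[OF B] by (metis (mono_tags, lifting) image_eqI poly_1)
 fix x y assume "x \<in> (\<lambda>p. poly p s) ` polys B" "y \<in> (\<lambda>p. poly p s) ` polys B"
 then obtain p q where *: "p \<in> polys B" "q \<in> polys B" and xy: "x = poly p s" "y = poly q s" by auto
 show "x - y \<in> (\<lambda>p. poly p s) ` polys B" "x * y \<in> (\<lambda>p. poly p s) ` polys B"
  using polys_closed(7,8)[OF B *] xy by (metis imageI poly_diff, metis imageI poly_mult)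
qed

lemma adjoin_base: assumes "subring1 B" shows "B \<subseteq> adjoin B s"
proof
 fix b assume "b \<in> B"
 then have "[:b:] \<in> polys B" by (rule polys_closed(3)[OF assms])
 then show "b \<in> adjoin B s" unfolding adjoin_def by force
qed

lemma adjoin_gen: assumes "subring1 B" shows "s \<in> adjoin B s"
 using polys_closed(4)[OF assms] unfolding adjoin_def by force

text \<open>Being Noetherian, in the form in which it is used: in every sequence some term is a linear
 combination of the terms before it.\<close>

definition seq_noetherian :: "'r::comm_ring_1 set \<Rightarrow> bool" where
 "seq_noetherian B \<longleftrightarrow> (\<forall>a :: nat \<Rightarrow> _. range a \<subseteq> B \<longrightarrow>
   (\<exists>n c. (\<forall>i<n. c i \<in> B) \<and> a n = (\<Sum>i<n. c i * a i)))"

lemma degree_sub_leading_less: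
 fixes p q :: "'r::comm_ring_1 poly"
 assumes "degree q \<le> d" "degree p \<le> d" "coeff p d = coeff q d" "d > 0"
 shows "degree (p - q) < d"
proof (rule degree_lessI)
 show "p - q \<noteq> 0 \<or> 0 < d" using assms by simp
 show "\<forall>k\<ge>d. coeff (p - q) k = 0" using assms by (metis coeff_diff coeff_eq_0 diff_self le_neq_implies_less order.strict_trans1)
qed

text \<open>Hilbert's basis theorem. If no term of a sequence in \<open>B[s]\<close> were a combination of the earlier ones,
 build a sequence of polynomials of minimal degree with values outside of the ideal generated so far;
 a relation between the leading coefficients lowers the degree.\<close>

lemma hilbert_basis:
 assumes B: "subring1 B" and N: "seq_noetherian B"
 shows "seq_noetherian (adjoin B s)"
 unfolding seq_noetherian_def
proof (intro allI impI)
 let ?C = "adjoin B s"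
 note C = subring1_adjoin[OF B, of s]
 fix a :: "nat \<Rightarrow> 'a" assume a: "range a \<subseteq> ?C"
 define J where "J = {x. \<exists>n c. (\<forall>i<n. c i \<in> ?C) \<and> x = (\<Sum>i<n. c i * a i)}"
 define span where "span f n = {x. \<exists>c. (\<forall>i<n. c i \<in> ?C) \<and> x = (\<Sum>i<n. c i * poly (f i) s)}"
  for f :: "nat \<Rightarrow> 'a poly" and n :: nat
 have spanI: "x \<in> span f n" if "\<forall>i<n. c i \<in> ?C" "x = (\<Sum>i<n. c i * poly (f i) s)" for x f n c
  unfolding span_def using that by blast
 show "\<exists>n c. (\<forall>i<n. c i \<in> ?C) \<and> a n = (\<Sum>i<n. c i * a i)"
 proof (rule ccontr)
  assume no: "\<nexists>n c. (\<forall>i<n. c i \<in> ?C) \<and> a n = (\<Sum>i<n. c i * a i)"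
  have JI: "x \<in> J" if "\<forall>i<n. c i \<in> ?C" "x = (\<Sum>i<n. c i * a i)" for x n c
   unfolding J_def using that by blast
  have Jadd: "x + y \<in> J" if "x \<in> J" "y \<in> J" for x y
  proof -
   obtain n c where c: "\<forall>i<n. c i \<in> ?C" "x = (\<Sum>i<n. c i * a i)" using \<open>x \<in> J\<close> J_def by auto
   obtain m d where d: "\<forall>i<m. d i \<in> ?C" "y = (\<Sum>i<m. d i * a i)" using \<open>y \<in> J\<close> J_def by auto
   define e where "e i = (if i < n then c i else 0) + (if i < m then d i else 0)" for i
   have "x = (\<Sum>i<max n m. (if i < n then c i else 0) * a i)" unfolding c
    by (rule sum.mono_neutral_cong_left) auto
   moreover have "y = (\<Sum>i<max n m. (if i < m then d i else 0) * a i)" unfolding d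
    by (rule sum.mono_neutral_cong_left) auto
   ultimately have "x + y = (\<Sum>i<max n m. e i * a i)"
    by (simp add: e_def sum.distrib distrib_right)
   moreover have "\<forall>i<max n m. e i \<in> ?C" using c d subring1D[OF C] by (simp add: e_def)
   ultimately show ?thesis by (intro JI)
  qed
  have Jmult: "r * x \<in> J" if "r \<in> ?C" "x \<in> J" for r x
  proof -
   obtain n c where c: "\<forall>i<n. c i \<in> ?C" "x = (\<Sum>i<n. c i * a i)" using \<open>x \<in> J\<close> J_def by auto
   have "r * x = (\<Sum>i<n. (r * c i) * a i)" by (simp add: c sum_distrib_left mult.assoc)
   then show ?thesis using c(1) subring1D(6)[OF C \<open>r \<in> ?C\<close>] by (intro JI[where c = "\<lambda>i. r * c i"]) auto
  qed
  have J0: "0 \<in> J" by (rule JI[of 0]) auto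
  have Jsum: "sum g I \<in> J" if "\<And>i. i \<in> I ==> g i \<in> J" for g :: "nat \<Rightarrow> 'a" and I
   using that by (induction I rule: infinite_finite_induct) (auto intro: J0 Jadd)
  have Ja: "a n \<in> J" for n
   by (rule JI[of "Suc n" "\<lambda>i. if i = n then 1 else 0"])
    (auto simp: if_distrib[of "\<lambda>x. x * _"] subring1D(1,2)[OF C] cong: if_cong)
  have JC: "J \<subseteq> ?C"
  proof
   fix x assume "x \<in> J"
   then obtain n c where "\<forall>i<n. c i \<in> ?C" "x = (\<Sum>i<n. c i * a i)" using J_def by auto
   then show "x \<in> ?C" using a by (auto intro!: subring1_sum[OF C] subring1D(6)[OF C])
  qed
  have ex: "\<exists>p. p \<in> polys B \<and> poly p s \<in> J \<and> poly p s \<notin> span f n"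
   if f: "\<And>i. i < n ==> poly (f i) s \<in> J" for f n
  proof (rule ccontr)
   assume "\<not> ?thesis"
   then have all: "J \<subseteq> span f n" using JC unfolding adjoin_def by blast
   have "\<exists>M. \<forall>x \<in> span f n. \<exists>c. (\<forall>i<M. c i \<in> ?C) \<and> x = (\<Sum>i<M. c i * a i)"
    using f
   proof (induction n)
    case 0 then show ?case by (auto simp: span_def intro!: exI[of _ 0])
   next
    case (Suc n)
    then obtain M where M: "\<forall>x \<in> span f n. \<exists>c. (\<forall>i<M. c i \<in> ?C) \<and> x = (\<Sum>i<M. c i * a i)" by auto
    obtain m d where d: "\<forall>i<m. d i \<in> ?C" "poly (f n) s = (\<Sum>i<m. d i * a i)"
     using Suc.prems[of n] J_def by auto
    show ?case
    proof (intro exI[of _ "max M m"] ballI)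
     fix x assume "x \<in> span f (Suc n)"
     then obtain c where c: "\<forall>i<Suc n. c i \<in> ?C" "x = (\<Sum>i<n. c i * poly (f i) s) + c n * poly (f n) s"
      by (auto simp: span_def)
     then have "(\<Sum>i<n. c i * poly (f i) s) \<in> span f n" unfolding span_def
      by (intro CollectI exI[of _ c]) auto
     then obtain c' where c': "\<forall>i<M. c' i \<in> ?C" "(\<Sum>i<n. c i * poly (f i) s) = (\<Sum>i<M. c' i * a i)"
      using M by blast
     define e where "e i = (if i < M then c' i else 0) + (if i < m then c n * d i else 0)" for i
     have "(\<Sum>i<M. c' i * a i) = (\<Sum>i<max M m. (if i < M then c' i else 0) * a i)"
      by (rule sum.mono_neutral_cong_left) auto
     moreover have "c n * poly (f n) s = (\<Sum>i<m. (c n * d i) * a i)"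
      by (simp add: d sum_distrib_left mult.assoc)
     moreover have "... = (\<Sum>i<max M m. (if i < m then c n * d i else 0) * a i)"
      by (rule sum.mono_neutral_cong_left) auto
     ultimately have "x = (\<Sum>i<max M m. e i * a i)"
      using c c' by (simp add: e_def sum.distrib distrib_right)
     moreover have "\<forall>i<max M m. e i \<in> ?C" using c' d c(1) subring1D[OF C] by (simp add: e_def)
     ultimately show "\<exists>c. (\<forall>i<max M m. c i \<in> ?C) \<and> x = (\<Sum>i<max M m. c i * a i)" by blast
    qed
   qed
   then obtain M where "\<forall>x \<in> span f n. \<exists>c. (\<forall>i<M. c i \<in> ?C) \<and> x = (\<Sum>i<M. c i * a i)" ..
   then show False using all Ja[of M] no by blast
  qed
  define pick where "pick n f = (ARG_MIN degree p. p \<in> polys B \<and> poly p s \<in> J \<and> poly p s \<notin> span f n)"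
   for n f
  \<comment> \<open>the sequence is built by course-of-values recursion on the list of earlier terms\<close>
  define L where "L = rec_nat [] (\<lambda>n xs. xs @ [pick n (nth xs)])"
  define f where "f n = L (Suc n) ! n" for n
  have lenL: "length (L n) = n" for n by (induction n) (auto simp: L_def)
  have L_Suc: "L (Suc n) = L n @ [pick n (nth (L n))]" for n by (simp add: L_def)
  have Lnth: "i < n ==> L n ! i = f i" for i n
  proof (induction n)
   case (Suc n)
   then show ?case by (cases "i = n") (auto simp: L_Suc nth_append lenL f_def)
  qed simp
  have span_cong: "span g n = span h n" if "\<And>i. i < n ==> g i = h i" for g h n
   unfolding span_def using that by (intro Collect_cong ex_cong) (auto intro!: sum.cong)
  have fpick: "f n = pick n f" for n
  proof -
   have "f n = pick n (nth (L n))" by (simp add: f_def L_Suc nth_append lenL)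
   then show ?thesis using span_cong[of n "nth (L n)" f] Lnth by (simp add: pick_def)
  qed
  have fprop: "f n \<in> polys B \<and> poly (f n) s \<in> J \<and> poly (f n) s \<notin> span f n" for n
  proof (induction n rule: less_induct)
   case (less n)
   obtain p where "p \<in> polys B \<and> poly p s \<in> J \<and> poly p s \<notin> span f n" using ex[of n f] less by blast
   then show ?case unfolding fpick[of n] pick_def
    by (rule arg_min_natI[where P = "\<lambda>p. p \<in> polys B \<and> poly p s \<in> J \<and> poly p s \<notin> span f n"])
  qed
  have fmin: "degree (f n) \<le> degree p" if "p \<in> polys B" "poly p s \<in> J" "poly p s \<notin> span f n" for p n
   unfolding fpick[of n] pick_def using that
   by (intro arg_min_nat_le[where P = "\<lambda>p. p \<in> polys B \<and> poly p s \<in> J \<and> poly p s \<notin> span f n"]) simp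
  have span_mono: "span f m \<subseteq> span f n" if "m \<le> n" for m n
  proof
   fix x assume "x \<in> span f m"
   then obtain c where c: "\<forall>i<m. c i \<in> ?C" "x = (\<Sum>i<m. c i * poly (f i) s)" by (auto simp: span_def)
   have "x = (\<Sum>i<n. (if i < m then c i else 0) * poly (f i) s)" unfolding c
    by (rule sum.mono_neutral_cong_left) (use that in auto)
   then show "x \<in> span f n" unfolding span_def using c subring1D(2)[OF C] 
    by (intro CollectI exI[of _ "\<lambda>i. if i < m then c i else 0"]) auto
  qed
  have degmono: "degree (f i) \<le> degree (f n)" if "i \<le> n" for i n
   using fmin[of "f n" i] fprop[of n] span_mono[OF that] by blast
  have "range (\<lambda>n. lead_coeff (f n)) \<subseteq> B" using fprop polysD by blast
  then have "\<exists>n c. (\<forall>i<n. c i \<in> B) \<and> lead_coeff (f n) = (\<Sum>i<n. c i * lead_coeff (f i))"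
   by (rule N[unfolded seq_noetherian_def, rule_format])
  then obtain n c where c: "\<forall>i<n. c i \<in> B" "lead_coeff (f n) = (\<Sum>i<n. c i * lead_coeff (f i))"
   by blast
  define d where "d = degree (f n)"
  define g where "g = (\<Sum>i<n. monom (c i) (d - degree (f i)) * f i)"
  have gB: "g \<in> polys B"
  proof -
   have "monom (c i) (d - degree (f i)) * f i \<in> polys B" if "i < n" for i
    using polys_closed[OF B] c that fprop by simp
   then show ?thesis unfolding g_def polys_def by (auto simp: coeff_sum intro!: subring1_sum[OF B])
  qed
  have gs: "poly g s \<in> span f n"
  proof -
   have "poly g s = (\<Sum>i<n. (c i * s ^ (d - degree (f i))) * poly (f i) s)"
    by (simp add: g_def poly_sum poly_monom)
   moreover have "\<forall>i<n. c i * s ^ (d - degree (f i)) \<in> ?C"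
    using c(1) adjoin_base[OF B, of s]
    by (intro allI impI subring1D(6)[OF C] subring1D(7)[OF C] adjoin_gen[OF B]) auto
   ultimately show ?thesis by (intro spanI)
  qed
  have gJ: "poly g s \<in> J"
   unfolding g_def poly_sum poly_mult poly_monom using c adjoin_base[OF B, of s] adjoin_gen[OF B, of s] fprop
   by (intro Jsum Jmult subring1D(6)[OF C] subring1D(7)[OF C]) auto
  have gdeg: "degree g \<le> d" unfolding g_def
  proof (rule degree_sum_le)
   fix i assume "i \<in> {..<n}"
   then have "degree (f i) \<le> d" using degmono[of i n] by (simp add: d_def)
   moreover have "degree (monom (c i) (d - degree (f i))) \<le> d - degree (f i)" by (rule degree_monom_le)
   ultimately show "degree (monom (c i) (d - degree (f i)) * f i) \<le> d"
    using degree_mult_le[of "monom (c i) (d - degree (f i))" "f i"] by linarith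
  qed simp
  have gco: "coeff g d = coeff (f n) d"
  proof -
   have "coeff (monom (c i) (d - degree (f i)) * f i) d = c i * lead_coeff (f i)" if "i < n" for i
    using degmono[of i n] that by (simp add: d_def coeff_monom_mult)
   then show ?thesis using c by (simp add: g_def coeff_sum d_def)
  qed
  define h where "h = f n - g"
  have hs: "poly h s \<notin> span f n"
  proof
   assume "poly h s \<in> span f n"
   then obtain c1 where c1: "\<forall>i<n. c1 i \<in> ?C" "poly h s = (\<Sum>i<n. c1 i * poly (f i) s)" by (auto simp: span_def)
   from gs obtain c2 where c2: "\<forall>i<n. c2 i \<in> ?C" "poly g s = (\<Sum>i<n. c2 i * poly (f i) s)" by (auto simp: span_def)
   have "poly (f n) s = (\<Sum>i<n. (c1 i + c2 i) * poly (f i) s)"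
    unfolding distrib_right sum.distrib c1(2)[symmetric] c2(2)[symmetric] by (simp add: h_def)
   then have "poly (f n) s \<in> span f n"
    using c1 c2 subring1D(4)[OF C] by (intro spanI[where c = "\<lambda>i. c1 i + c2 i"]) auto
   then show False using fprop by blast
  qed
  have hJ: "poly h s \<in> J"
   using Jadd[of "poly (f n) s" "- 1 * poly g s"] Jmult[OF _ gJ, of "-1"] fprop[of n] subring1D(1,3)[OF C]
   by (simp add: h_def)
  have hB: "h \<in> polys B" using polys_closed(7)[OF B] fprop gB h_def by blast
  have "d > 0"
  proof (rule ccontr)
   assume "\<not> d > 0"
   then have "d = 0" by simp
   then have "h = 0" using gdeg gco unfolding h_def d_def by (metis degree_eq_zeroE coeff_pCons_0 diff_self le_zero_eq)
   then show False using hs unfolding span_def by (auto dest!: spec[of _ "\<lambda>_. 0"] intro: subring1D(2)[OF C])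
  qed
  then have "degree h < d" unfolding h_def using gdeg gco by (intro degree_sub_leading_less) (auto simp: d_def)
  then show False using fmin[OF hB hJ hs] by (simp add: d_def)
 qed
qed

section \<open>The Nullstellensatz\<close>

definition prime_in :: "'r::comm_ring_1 set \<Rightarrow> 'r set \<Rightarrow> bool" where
 "prime_in C q \<longleftrightarrow> q \<subseteq> C \<and> 0 \<in> q \<and> (\<forall>x\<in>q. \<forall>y\<in>q. x + y \<in> q) \<and> (\<forall>r\<in>C. \<forall>x\<in>q. r * x \<in> q) \<and>
   1 \<notin> q \<and> (\<forall>x\<in>C. \<forall>y\<in>C. x * y \<in> q \<longrightarrow> x \<in> q \<or> y \<in> q)"

text \<open>Homomorphisms from an algebra \<open>C\<close> with structure map \<open>\<iota>\<close> to the ground field that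
 vanish on \<open>q\<close>; they stand for points of the zero set of \<open>q\<close>.\<close>

definition point_hom :: "('k::field \<Rightarrow> 'r::comm_ring_1) \<Rightarrow> 'r set \<Rightarrow> 'r set \<Rightarrow> ('r \<Rightarrow> 'k) \<Rightarrow> bool" where
 "point_hom \<iota> C q xi \<longleftrightarrow> xi 1 = 1 \<and> (\<forall>c. xi (\<iota> c) = c) \<and>
   (\<forall>x\<in>C. \<forall>y\<in>C. xi (x + y) = xi x + xi y \<and> xi (x * y) = xi x * xi y) \<and> (\<forall>x\<in>q. xi x = 0)"

lemma prime_inD:
 assumes "prime_in C q"
 shows "q \<subseteq> C" "0 \<in> q" "x \<in> q ==> y \<in> q ==> x + y \<in> q" "r \<in> C ==> x \<in> q ==> r * x \<in> q"
  "1 \<notin> q" "x \<in> C ==> y \<in> C ==> x * y \<in> q ==> x \<in> q \<or> y \<in> q"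
 using assms unfolding prime_in_def by blast+

lemma prime_in_diff:
 assumes "subring1 C" "prime_in C q" "x \<in> q" "y \<in> q" shows "x - y \<in> q"
proof -
 have "- 1 * y \<in> q" using assms prime_inD(4) subring1D(1,3) by metis
 then show ?thesis using prime_inD(3)[OF assms(2,3)] by fastforce
qed

lemma prime_in_sum:
 assumes "prime_in C q" "\<And>i. i \<in> I ==> f i \<in> q" shows "sum f I \<in> q"
 using assms(2) by (induction I rule: infinite_finite_induct) (auto intro: prime_inD[OF assms(1)])

lemma prime_in_power:
 assumes "subring1 C" "prime_in C q" "x \<in> C" "x ^ n \<in> q" shows "x \<in> q"
 using assms(4)
proof (induction n)
 case (Suc n)
 then have "x * x ^ n \<in> q" by simp
 then show ?case using prime_inD(6)[OF assms(2), of x "x ^ n"] Suc.IH assms(3) subring1D(7)[OF assms(1)] by blast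
qed (use prime_inD(5)[OF assms(2)] in simp)

lemma pseudo_division_over:
 assumes B: "subring1 B" and p: "p \<in> polys B" and g: "g \<in> polys B" and e: "degree g > 0"
 shows "\<exists>N Q T. Q \<in> polys B \<and> T \<in> polys B \<and> smult (lead_coeff g ^ N) p = g * Q + T \<and>
  degree T < degree g \<and> degree Q \<le> degree p - degree g"
 using p
proof (induction "degree p" arbitrary: p rule: less_induct)
 case less
 note P = polys_closed[OF B]
 let ?b = "lead_coeff g" let ?e = "degree g" let ?d = "degree p"
 have b: "?b \<in> B" "lead_coeff p \<in> B" using g less.prems polysD by blast+
 show ?case
 proof (cases "?d < ?e")
  case True
  have "0 \<in> polys B \<and> p \<in> polys B \<and> smult (?b ^ 0) p = g * 0 + p \<and> degree p < ?e \<and> degree (0 :: 'a poly) \<le> ?d - ?e"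
   using True less.prems P(1) by simp
  then show ?thesis by blast
 next
  case False
  let ?m = "monom (lead_coeff p) (?d - ?e)"
  let ?p1 = "smult ?b p - ?m * g"
  have p1: "?p1 \<in> polys B" using P g less.prems b by simp
  have "degree ?p1 < ?d"
  proof (rule degree_sub_leading_less)
   show "degree (?m * g) \<le> ?d"
    using degree_mult_le[of ?m g] degree_monom_le[of "lead_coeff p" "?d - ?e"] False by linarith
   show "degree (smult ?b p) \<le> ?d" by (rule degree_smult_le)
   show "coeff (smult ?b p) ?d = coeff (?m * g) ?d" using False by (simp add: coeff_monom_mult)
   show "0 < ?d" using False e by linarith
  qed
  from less.hyps[OF this p1] obtain N Q T where IH: "Q \<in> polys B" "T \<in> polys B"
   "smult (?b ^ N) ?p1 = g * Q + T" "degree T < ?e" "degree Q \<le> degree ?p1 - ?e" by blast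
  let ?Q = "Q + smult (?b ^ N) ?m"
  have "smult (?b ^ Suc N) p = smult (?b ^ N) ?p1 + smult (?b ^ N) (?m * g)"
   by (simp add: smult_diff_right mult.commute)
  also have "... = g * ?Q + T" unfolding IH(3) by (simp add: algebra_simps)
  finally have "smult (?b ^ Suc N) p = g * ?Q + T" .
  moreover have "degree ?Q \<le> ?d - ?e"
   using IH(5) \<open>degree ?p1 < ?d\<close> degree_monom_le[of "lead_coeff p" "?d - ?e"] degree_smult_le[of "?b ^ N" ?m]
   by (intro degree_add_le) linarith+
  moreover have "?Q \<in> polys B" using IH P b subring1D(7)[OF B] by simp
  ultimately show ?thesis using IH(2,4) by blast
 qed
qed

lemma point_homD:
 assumes "point_hom \<iota> C q xi"
 shows "xi 1 = 1" "xi (\<iota> c) = c" "x \<in> C ==> y \<in> C ==> xi (x + y) = xi x + xi y"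
  "x \<in> C ==> y \<in> C ==> xi (x * y) = xi x * xi y" "x \<in> q ==> xi x = 0"
 using assms unfolding point_hom_def by blast+

context
 fixes \<iota> :: "'k::{alg_closed_field,field_char_0} \<Rightarrow> 'r::comm_ring_1"
  and B q :: "'r set" and xi :: "'r \<Rightarrow> 'k"
 assumes B: "subring1 B" and xi: "point_hom \<iota> B q xi"
begin

lemma point_hom_zero: "xi 0 = 0"
 using point_homD(3)[OF xi, of 0 0] subring1D(2)[OF B] by simp

lemma point_hom_diff: "x \<in> B ==> y \<in> B ==> xi (x - y) = xi x - xi y"
 using point_homD(3)[OF xi, of "x - y" y] subring1D(5)[OF B] by simp

lemma point_hom_power: "x \<in> B ==> xi (x ^ n) = xi x ^ n"
 by (induction n) (auto simp: point_homD(1,4)[OF xi] subring1D(7)[OF B])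

lemma point_hom_sum: "(\<And>i. i \<in> I ==> f i \<in> B) ==> xi (sum f I) = (\<Sum>i\<in>I. xi (f i))"
 by (induction I rule: infinite_finite_induct)
  (auto simp: point_hom_zero point_homD(3)[OF xi] subring1_sum[OF B])

lemma map_poly_point_hom:
 assumes "p \<in> polys B" "p' \<in> polys B"
 shows "map_poly xi (p + p') = map_poly xi p + map_poly xi p'"
  "map_poly xi (p - p') = map_poly xi p - map_poly xi p'"
  "map_poly xi (p * p') = map_poly xi p * map_poly xi p'"
  "c \<in> B ==> map_poly xi (smult c p) = smult (xi c) (map_poly xi p)"
  "map_poly xi [:c:] = [:xi c:]" "map_poly xi 1 = 1"
 using assms
 by (auto intro!: poly_eqI simp: coeff_map_poly point_hom_zero point_homD(1,3,4)[OF xi] point_hom_diff polysD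
   coeff_mult point_hom_sum subring1D(6)[OF B] map_poly_pCons map_poly_1')

lemma point_hom_adjoin:
 assumes q': "\<And>p. p \<in> polys B ==> poly p s \<in> q' ==> poly (map_poly xi p) r = 0" and q'C: "q' \<subseteq> adjoin B s"
  and q'0: "0 \<in> q'" and \<iota>: "range \<iota> \<subseteq> B"
 shows "\<exists>xi'. point_hom \<iota> (adjoin B s) q' xi' \<and> (\<forall>p\<in>polys B. xi' (poly p s) = poly (map_poly xi p) r)"
proof -
 note P = polys_closed[OF B] and M = map_poly_point_hom
 define xi' where "xi' x = poly (map_poly xi (SOME p. p \<in> polys B \<and> poly p s = x)) r" for x
 have ev: "xi' (poly p s) = poly (map_poly xi p) r" if p: "p \<in> polys B" for p
 proof -
  define p' where "p' = (SOME p'. p' \<in> polys B \<and> poly p' s = poly p s)"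
  have "p' \<in> polys B \<and> poly p' s = poly p s" unfolding p'_def by (rule someI) (use p in simp)
  then have "poly (map_poly xi (p' - p)) r = 0" using q'[of "p' - p"] P p q'0 by simp
  then show ?thesis using M(2)[of p' p] p \<open>p' \<in> polys B \<and> _\<close> by (simp add: xi'_def p'_def)
 qed
 have "point_hom \<iota> (adjoin B s) q' xi'" unfolding point_hom_def
 proof (intro conjI allI ballI)
  show "xi' 1 = 1" using ev[OF P(2)] M(6)[OF P(2) P(2)] by simp
  show "xi' (\<iota> c) = c" for c
  proof -
   have "\<iota> c \<in> B" using \<iota> by blast
   then show ?thesis using ev[OF P(3)[of "\<iota> c"]] M(5)[OF P(1) P(1)] point_homD(2)[OF xi] by simp
  qed
  fix x y assume "x \<in> adjoin B s" "y \<in> adjoin B s"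
  then obtain p p' where *: "p \<in> polys B" "p' \<in> polys B" "x = poly p s" "y = poly p' s"
   unfolding adjoin_def by auto
  show "xi' (x + y) = xi' x + xi' y" using ev[OF P(6)[OF *(1,2)]] ev[OF *(1)] ev[OF *(2)] M(1)[OF *(1,2)] * by simp
  show "xi' (x * y) = xi' x * xi' y" using ev[OF P(8)[OF *(1,2)]] ev[OF *(1)] ev[OF *(2)] M(3)[OF *(1,2)] * by simp
 next
  fix x assume x: "x \<in> q'"
  then obtain p where *: "p \<in> polys B" "x = poly p s" using q'C unfolding adjoin_def by auto
  then show "xi' x = 0" using ev q' x by simp
 qed
 then show ?thesis using ev by blast
qed

end

text \<open>The inductive step of the Nullstellensatz: a point of the smaller algebra outside of a suitable
 hypersurface extends. If \<open>s\<close> is transcendental modulo \<open>q\<close>, almost every value of \<open>s\<close> will do. Otherwise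
 \<open>s\<close> is sent to a root of its minimal polynomial; the image of \<open>f\<close> is not zero, since minimality makes
 some multiple of \<open>f\<close> an element of \<open>B\<close> modulo \<open>q\<close>.\<close>

lemma point_hom_extends:
 fixes \<iota> :: "'k::{alg_closed_field,field_char_0} \<Rightarrow> 'r::comm_ring_1"
 assumes B: "subring1 B" and q: "prime_in (adjoin B s) q" and f: "f \<in> adjoin B s" "f \<notin> q"
  and \<iota>: "range \<iota> \<subseteq> B"
 shows "\<exists>g\<in>B. g \<notin> q \<and> (\<forall>xi. point_hom \<iota> B (q \<inter> B) xi \<and> xi g \<noteq> 0 \<longrightarrow>
   (\<exists>xi'. point_hom \<iota> (adjoin B s) q xi' \<and> xi' f \<noteq> 0))"
proof -
 let ?C = "adjoin B s"
 note P = polys_closed[OF B] and C = subring1_adjoin[OF B, of s] and BC = adjoin_base[OF B, of s]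
  and sC = adjoin_gen[OF B, of s] and Q = prime_inD[OF q]
 obtain pf where pf: "pf \<in> polys B" "f = poly pf s" using f unfolding adjoin_def by auto
 have val: "poly p s \<in> ?C" if "p \<in> polys B" for p using that unfolding adjoin_def by blast
 show ?thesis
 proof (cases "\<exists>p\<in>polys B. poly p s \<in> q \<and> (\<exists>i. coeff p i \<notin> q)")
  case False
  obtain i where i: "coeff pf i \<notin> q"
  proof (rule ccontr)
   assume "\<not> thesis"
   then have "coeff pf i \<in> q" for i using that by blast
   then have "coeff pf i * s ^ i \<in> q" for i using Q(4)[of "s ^ i" "coeff pf i"] subring1D(7)[OF C sC] by (simp add: mult.commute)
   then have "f \<in> q" unfolding pf(2) poly_altdef by (rule prime_in_sum[OF q])
   then show False using f by blast
  qed
  show ?thesis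
  proof (intro bexI[of _ "coeff pf i"] conjI allI impI)
   show "coeff pf i \<notin> q" "coeff pf i \<in> B" using i polysD[OF pf(1)] by auto
   fix xi assume "point_hom \<iota> B (q \<inter> B) xi \<and> xi (coeff pf i) \<noteq> 0"
   then have xi: "point_hom \<iota> B (q \<inter> B) xi" and nz: "xi (coeff pf i) \<noteq> 0" by auto
   note z = point_hom_zero[OF B xi]
   have "map_poly xi pf \<noteq> 0" using nz z by (metis coeff_0 coeff_map_poly)
   then have "finite {r. poly (map_poly xi pf) r = 0}" by (rule poly_roots_finite)
   then obtain r where r: "poly (map_poly xi pf) r \<noteq> 0"
    using infinite_UNIV_char_0 by (metis (mono_tags, lifting) UNIV_eq_I mem_Collect_eq)
   have "poly (map_poly xi p) r = 0" if "p \<in> polys B" "poly p s \<in> q" for p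
   proof -
    have "xi (coeff p i) = 0" for i using that False polysD[OF that(1)] point_homD(5)[OF xi] by blast
    then have "map_poly xi p = 0" by (intro poly_eqI) (simp add: coeff_map_poly z)
    then show ?thesis by simp
   qed
   then obtain xi' where "point_hom \<iota> ?C q xi'" "\<forall>p\<in>polys B. xi' (poly p s) = poly (map_poly xi p) r"
    using point_hom_adjoin[OF B xi, of s q r] Q(1,2) \<iota> by blast
   then show "\<exists>xi'. point_hom \<iota> ?C q xi' \<and> xi' f \<noteq> 0" using r pf by auto
  qed
 next
  case True
  define rel where "rel p \<longleftrightarrow> p \<in> polys B \<and> poly p s \<in> q \<and> (\<exists>i. coeff p i \<notin> q)" for p
  obtain p0 where "rel p0" using True rel_def by blast
  define p where "p = (ARG_MIN degree p. rel p)"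
  have p: "p \<in> polys B" "poly p s \<in> q" "\<exists>i. coeff p i \<notin> q"
   using arg_min_natI[of rel p0 degree] \<open>rel p0\<close> unfolding p_def[symmetric] rel_def by auto
  have pmin: "coeff p' i \<in> q" if "p' \<in> polys B" "poly p' s \<in> q" "degree p' < degree p" for p' i
   using arg_min_nat_le[of rel p' degree] that unfolding p_def[symmetric] rel_def by fastforce
  define d where "d = degree p" define b where "b = lead_coeff p"
  have bB: "b \<in> B" using p(1) polysD b_def by blast
  have bq: "b \<notin> q"
  proof
   assume bq: "b \<in> q"
   have "coeff p i \<in> q" for i
   proof (cases "d = 0")
    case True
    then show ?thesis using bq Q(2) unfolding b_def d_def by (cases "i = 0") (auto simp: coeff_eq_0)
   next
    case False
    let ?p' = "p - monom b d"
    have 1: "?p' \<in> polys B" using P p(1) bB by simp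
    have 2: "degree ?p' < d"
     using degree_sub_leading_less[of "monom b d" d p] False degree_monom_le[of b d] by (simp add: b_def d_def)
    have "b * s ^ d \<in> q" using Q(4)[of "s ^ d" b] bq subring1D(7)[OF C sC] by (simp add: mult.commute)
    then have "poly ?p' s \<in> q" using prime_in_diff[OF C q p(2)] by (simp add: poly_monom)
    then have "coeff ?p' i \<in> q" using pmin[OF 1] 2 d_def by blast
    moreover have "coeff p i = coeff ?p' i + (if i = d then b else 0)" by simp
    ultimately show ?thesis using Q(2,3) bq by metis
   qed
   then show False using p(3) by blast
  qed
  have d0: "d > 0"
  proof (rule ccontr)
   assume "\<not> d > 0"
   then have "p = [:b:]" unfolding b_def d_def by (metis degree_0_id gr0I of_nat_0 lead_coeff_pCons(2) degree_eq_zeroE)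
   then have "b \<in> q" using p(2) by simp
   then show False using bq by blast
  qed
  \<comment> \<open>\<open>mul g\<close>: the value of \<open>g\<close> is a multiple of \<open>f\<close> modulo \<open>q\<close> and not zero modulo \<open>q\<close>\<close>
  define mul where "mul g \<longleftrightarrow> g \<in> polys B \<and> poly g s \<notin> q \<and> (\<exists>w\<in>polys B. poly g s - poly w s * f \<in> q)" for g
  have "mul pf" unfolding mul_def using pf f P(2) Q(2) by (auto intro!: bexI[of _ 1])
  define g where "g = (ARG_MIN degree g. mul g)"
  have "mul g" using arg_min_natI[of mul pf degree] \<open>mul pf\<close> unfolding g_def by auto
  then obtain w where g: "g \<in> polys B" "poly g s \<notin> q" and w: "w \<in> polys B" "poly g s - poly w s * f \<in> q"
   unfolding mul_def by auto
  have gmin: "degree g \<le> degree h" if "mul h" for h using arg_min_nat_le[of mul h degree] that unfolding g_def by auto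
  have g0: "degree g = 0"
  proof (rule ccontr)
   assume "degree g \<noteq> 0"
   then have e: "degree g > 0" by simp
   have "degree g < d"
   proof (rule ccontr)
    assume ge: "\<not> degree g < d"
    obtain N Q' T where T: "Q' \<in> polys B" "T \<in> polys B" "smult (b ^ N) g = p * Q' + T" "degree T < d"
     using pseudo_division_over[OF B g(1) p(1)] d0 unfolding b_def d_def by blast
    have eq: "b ^ N * poly g s = poly p s * poly Q' s + poly T s" using arg_cong[OF T(3), of "\<lambda>p. poly p s"] by simp
    have bN: "b ^ N \<in> ?C" using BC bB subring1D(7)[OF C] by blast
    have pq: "poly p s * poly Q' s \<in> q" using Q(4)[OF val[OF T(1)] p(2)] by (simp add: mult.commute)
    have "poly T s \<notin> q"
    proof
     assume "poly T s \<in> q"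
     then have "b ^ N * poly g s \<in> q" using eq Q(3)[OF pq] by simp
     then show False using Q(6)[OF bN val[OF g(1)]] g(2) prime_in_power[OF C q _, of b N] bq bB BC by blast
    qed
    moreover have "poly T s - poly (smult (b ^ N) w) s * f = b ^ N * (poly g s - poly w s * f) - poly p s * poly Q' s"
     using eq by (simp add: algebra_simps)
    then have "poly T s - poly (smult (b ^ N) w) s * f \<in> q"
     using prime_in_diff[OF C q Q(4)[OF bN w(2)] pq] by simp
    moreover have "smult (b ^ N) w \<in> polys B" using P w(1) bB subring1D(7)[OF B] by simp
    ultimately have "mul T" unfolding mul_def using T(2) by blast
    then show False using gmin T(4) ge by fastforce
   qed
   define b' where "b' = lead_coeff g"
   have b'B: "b' \<in> B" using g(1) polysD b'_def by blast
   have b'q: "b' \<notin> q"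
   proof
    assume b'q: "b' \<in> q"
    let ?h = "g - monom b' (degree g)"
    have "b' * s ^ degree g \<in> q" using Q(4)[of "s ^ degree g" b'] b'q subring1D(7)[OF C sC] by (simp add: mult.commute)
    then have m: "poly (monom b' (degree g)) s \<in> q" by (simp add: poly_monom)
    have "poly ?h s \<notin> q" using Q(3)[OF _ m, of "poly ?h s"] g(2) by auto
    moreover have "poly ?h s - poly w s * f \<in> q" using prime_in_diff[OF C q w(2) m] by (simp add: algebra_simps)
    ultimately have "mul ?h" unfolding mul_def using P g(1) w(1) b'B by simp blast
    moreover have "degree ?h < degree g"
     by (rule degree_sub_leading_less) (use e in \<open>auto simp: b'_def degree_monom_le\<close>)
    ultimately show False using gmin[of ?h] by linarith
   qed
   obtain N Q' T where T: "Q' \<in> polys B" "T \<in> polys B" "smult (b' ^ N) p = g * Q' + T"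
    "degree T < degree g" "degree Q' \<le> d - degree g"
    using pseudo_division_over[OF B p(1) g(1) e] unfolding b'_def d_def by blast
   have eq: "b' ^ N * poly p s = poly g s * poly Q' s + poly T s" using arg_cong[OF T(3), of "\<lambda>p. poly p s"] by simp
   have bN: "b' ^ N \<in> ?C" using BC b'B subring1D(7)[OF C] by blast
   have "poly T s \<in> q"
   proof (rule ccontr)
    assume Tq: "poly T s \<notin> q"
    have "poly T s - poly (- (Q' * w)) s * f = b' ^ N * poly p s - poly Q' s * (poly g s - poly w s * f)"
     using eq by (simp add: algebra_simps)
    also have "... \<in> q" by (rule prime_in_diff[OF C q Q(4)[OF bN p(2)] Q(4)[OF val[OF T(1)] w(2)]])
    finally have "poly T s - poly (- (Q' * w)) s * f \<in> q" .
    moreover have "- (Q' * w) \<in> polys B" using P(7)[OF P(1) P(8)[OF T(1) w(1)]] by simp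
    ultimately have "mul T" unfolding mul_def using Tq T(2) by blast
    then show False using gmin T(4) by fastforce
   qed
   then have "poly g s * poly Q' s \<in> q" using eq prime_in_diff[OF C q Q(4)[OF bN p(2)], of "poly T s"] by simp
   then have "poly Q' s \<in> q" using Q(6)[OF val[OF g(1)] val[OF T(1)]] g(2) by blast
   moreover have "degree Q' < degree p" using T(5) e \<open>degree g < d\<close> d_def by linarith
   ultimately have Qc: "coeff Q' i \<in> q" for i using pmin[OF T(1)] by blast
   have "coeff (g * Q') d \<in> q" unfolding coeff_mult
    using Q(4) BC polysD[OF g(1)] Qc by (intro prime_in_sum[OF q]) blast
   moreover have "coeff (g * Q') d = b' ^ N * b"
    using arg_cong[OF T(3), of "\<lambda>p. coeff p d"] T(4) \<open>degree g < d\<close> by (simp add: b_def d_def coeff_eq_0)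
   ultimately show False using Q(6)[OF bN, of b] bB BC bq prime_in_power[OF C q _, of b' N] b'q b'B by auto
  qed
  define c where "c = coeff g 0"
  have gc: "g = [:c:]" using g0 unfolding c_def by (metis coeff_pCons_0 degree_eq_zeroE)
  have c: "c \<in> B" "c \<notin> q"
   using g(2) polysD[OF g(1)] unfolding c_def[symmetric] by (simp add: c_def, subst (asm) gc, simp)
  show ?thesis
  proof (intro bexI[of _ "b * c"] conjI allI impI)
   show "b * c \<in> B" using bB c subring1D(6)[OF B] by blast
   show "b * c \<notin> q" using Q(6)[of b c] bB c bq BC by blast
   fix xi assume "point_hom \<iota> B (q \<inter> B) xi \<and> xi (b * c) \<noteq> 0"
   then have xi: "point_hom \<iota> B (q \<inter> B) xi" and nz: "xi b \<noteq> 0" "xi c \<noteq> 0"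
    using point_homD(4)[of \<iota> B "q \<inter> B" xi b c] bB c by auto
   note z = point_hom_zero[OF B xi] and M = map_poly_point_hom[OF B xi]
   have "degree (map_poly xi p) \<noteq> 0"
   proof -
    have "coeff (map_poly xi p) d \<noteq> 0" using nz z by (simp add: coeff_map_poly d_def b_def)
    then show ?thesis using d0 le_degree by fastforce
   qed
   then obtain r where r: "poly (map_poly xi p) r = 0" using alg_closed_imp_poly_has_root by blast
   have zero: "poly (map_poly xi p') r = 0" if p': "p' \<in> polys B" "poly p' s \<in> q" for p'
   proof -
    obtain N Q' T where T: "Q' \<in> polys B" "T \<in> polys B" "smult (b ^ N) p' = p * Q' + T" "degree T < d"
     using pseudo_division_over[OF B p'(1) p(1)] d0 unfolding b_def d_def by metis
    have bN: "b ^ N \<in> B" using bB subring1D(7)[OF B] by blast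
    have eq: "b ^ N * poly p' s = poly p s * poly Q' s + poly T s" using arg_cong[OF T(3), of "\<lambda>p. poly p s"] by simp
    have "poly T s \<in> q"
     using eq prime_in_diff[OF C q Q(4)[OF _ p'(2), of "b ^ N"] Q(4)[OF val[OF T(1)] p(2)]] bN BC by (auto simp: mult.commute)
    then have "coeff T i \<in> q" for i using pmin[OF T(2)] T(4) d_def by blast
    then have "xi (coeff T i) = 0" for i using polysD[OF T(2)] point_homD(5)[OF xi] by blast
    then have "map_poly xi T = 0" by (intro poly_eqI) (simp add: coeff_map_poly z)
    then have "smult (xi (b ^ N)) (map_poly xi p') = map_poly xi p * map_poly xi Q'"
     using arg_cong[OF T(3), of "map_poly xi"] M(4)[OF p'(1) p'(1) bN] M(1)[OF P(8)[OF p(1) T(1)] T(2)] M(3)[OF p(1) T(1)] by simp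
    then have "poly (smult (xi (b ^ N)) (map_poly xi p')) r = 0" using r by simp
    then have "xi b ^ N * poly (map_poly xi p') r = 0" using point_hom_power[OF B xi bB] by simp
    then show ?thesis using nz by simp
   qed
   then obtain xi' where xi': "point_hom \<iota> ?C q xi'" "\<forall>p\<in>polys B. xi' (poly p s) = poly (map_poly xi p) r"
    using point_hom_adjoin[OF B xi, of s q r] Q(1,2) \<iota> by blast
   have "poly (map_poly xi (g - w * pf)) r = 0"
    using zero[of "g - w * pf"] P(7)[OF g(1) P(8)[OF w(1) pf(1)]] w(2) pf(2) by simp
   then have "xi c = poly (map_poly xi w) r * poly (map_poly xi pf) r"
    using M(2)[OF g(1) P(8)[OF w(1) pf(1)]] M(3)[OF w(1) pf(1)] M(5)[OF g(1) g(1), of c] gc by simp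
   then have "xi' f \<noteq> 0" using nz xi' pf by auto
   then show "\<exists>xi'. point_hom \<iota> ?C q xi' \<and> xi' f \<noteq> 0" using xi' by blast
  qed
 qed
qed

lemma algebra_of_functions_subring: "subring1 (algebra_of_functions G)"
 unfolding subring1_def
proof (intro conjI ballI)
 note A = algebra_of_functions.intros
 show "1 \<in> algebra_of_functions G" using A(2)[of 1 G] by (simp add: one_fun_def)
 fix f g assume fg: "f \<in> algebra_of_functions G" "g \<in> algebra_of_functions G"
 show "f * g \<in> algebra_of_functions G" using A(4)[OF fg] by (simp add: times_fun_def)
 have "(\<lambda>x. f x + -1 * g x) \<in> algebra_of_functions G" by (intro A(3) A(4) fg A(2))
 then show "f - g \<in> algebra_of_functions G" by (simp add: fun_diff_def)
qed

lemma algebra_of_functions_mono: "G \<subseteq> H ==> algebra_of_functions G \<subseteq> algebra_of_functions H"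
proof
 fix f assume "f \<in> algebra_of_functions G" "G \<subseteq> H"
 then show "f \<in> algebra_of_functions H" by induction (auto intro: algebra_of_functions.intros)
qed

lemma algebra_of_functions_insert:
 "algebra_of_functions (insert s G) = adjoin (algebra_of_functions G) s"
proof
 let ?B = "algebra_of_functions G" and ?C = "algebra_of_functions (insert s G)"
 note B = algebra_of_functions_subring[of G] and C = algebra_of_functions_subring[of "insert s G"]
 show "?C \<subseteq> adjoin ?B s"
 proof
  note D = subring1D[OF subring1_adjoin[OF B, of s]]
  fix f assume "f \<in> ?C"
  then show "f \<in> adjoin ?B s"
  proof induction
   case (gen g) then show ?case using adjoin_gen[OF B, of s] adjoin_base[OF B, of s] by (auto intro: algebra_of_functions.gen)
  next
   case (const c) then show ?case using adjoin_base[OF B, of s] algebra_of_functions.const by blast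
  next
   case (add f g) then show ?case using D(4)[of f g] by (simp add: plus_fun_def)
  next
   case (mult f g) then show ?case using D(6)[of f g] by (simp add: times_fun_def)
  qed
 qed
 have s: "s \<in> ?C" by (auto intro: algebra_of_functions.gen)
 have "?B \<subseteq> ?C" by (rule algebra_of_functions_mono) auto
 then show "adjoin ?B s \<subseteq> ?C"
  unfolding adjoin_def poly_altdef using s
  by (auto simp: polys_def intro!: subring1_sum[OF C] subring1D(6)[OF C] subring1D(7)[OF C])
qed

lemma algebra_of_functions_empty: "algebra_of_functions {} = range (\<lambda>c _. c)"
proof
 show "algebra_of_functions {} \<subseteq> range (\<lambda>c _. c)"
 proof
  fix f assume "f \<in> algebra_of_functions {}" then show "f \<in> range (\<lambda>c _. c)"
   by induction auto
 qed
qed (auto intro: algebra_of_functions.const)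

text \<open>By induction on the number of generators, from the basis theorem.\<close>

lemma algebra_of_functions_noetherian:
 fixes G :: "('x \<Rightarrow> 'k::field) set"
 assumes "finite G" shows "seq_noetherian (algebra_of_functions G)"
 using assms
proof induction
 case empty
 show ?case unfolding algebra_of_functions_empty seq_noetherian_def
 proof (intro allI impI)
  fix a :: "nat \<Rightarrow> 'x \<Rightarrow> 'k" assume a: "range a \<subseteq> range (\<lambda>c _. c)"
  show "\<exists>n c. (\<forall>i<n. c i \<in> range (\<lambda>c _. c)) \<and> a n = (\<Sum>i<n. c i * a i)"
  proof (cases "a 0 = 0")
   case True then show ?thesis by (intro exI[of _ 0]) simp
  next
   case False
   have "a 0 \<in> range (\<lambda>c _. c)" "a 1 \<in> range (\<lambda>c _. c)" using a by blast+
   then obtain u v where uv: "a 0 = (\<lambda>_. u)" "a 1 = (\<lambda>_. v)" by auto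
   then have "u \<noteq> 0" using False by (auto simp: zero_fun_def)
   then show ?thesis using uv by (intro exI[of _ 1] exI[of _ "\<lambda>_ _. v / u"]) (auto simp: fun_eq_iff)
  qed
 qed
next
 case (insert s G)
 then show ?case unfolding algebra_of_functions_insert by (intro hilbert_basis algebra_of_functions_subring)
qed

lemma prime_in_Int:
 assumes "prime_in C q" "B \<subseteq> C" "subring1 B" shows "prime_in B (q \<inter> B)"
 unfolding prime_in_def
proof (intro conjI ballI impI)
 note Q = prime_inD[OF assms(1)] and B = subring1D[OF assms(3)]
 show "q \<inter> B \<subseteq> B" "0 \<in> q \<inter> B" "1 \<notin> q \<inter> B" using Q B by auto
 show "x + y \<in> q \<inter> B" if "x \<in> q \<inter> B" "y \<in> q \<inter> B" for x y using that Q(3) B(4) by blast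
 show "r * x \<in> q \<inter> B" if "r \<in> B" "x \<in> q \<inter> B" for r x using that Q(4) B(6) assms(2) by blast
 show "x \<in> q \<inter> B \<or> y \<in> q \<inter> B" if "x \<in> B" "y \<in> B" "x * y \<in> q \<inter> B" for x y using that Q(6) assms(2) by blast
qed

text \<open>Adjoin the generators one at a time and extend the homomorphism at each step.\<close>

lemma point_hom_exists:
 fixes G :: "('x \<Rightarrow> 'k::{alg_closed_field,field_char_0}) set"
 assumes "finite G" "prime_in (algebra_of_functions G) q" "f \<in> algebra_of_functions G" "f \<notin> q"
 shows "\<exists>xi. point_hom (\<lambda>c _. c) (algebra_of_functions G) q xi \<and> xi f \<noteq> 0"
 using assms
proof (induction arbitrary: q f)
 case empty
 define x :: 'x where "x = undefined"
 have q: "g x = 0" if "g \<in> q" for g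
 proof (rule ccontr)
  assume nz: "g x \<noteq> 0"
  have "g \<in> range (\<lambda>c _. c)" using prime_inD(1)[OF empty.prems(1)] that algebra_of_functions_empty by blast
  then obtain c where c: "g = (\<lambda>_. c)" by auto
  have "(\<lambda>_. inverse c) * g \<in> q"
   using prime_inD(4)[OF empty.prems(1) algebra_of_functions.const that] by simp
  also have "(\<lambda>_. inverse c) * g = 1" using nz c by (auto simp: fun_eq_iff)
  finally show False using prime_inD(5)[OF empty.prems(1)] by (rule notE[rotated])
 qed
 have "f x \<noteq> 0"
 proof
  assume "f x = 0"
  moreover have "f \<in> range (\<lambda>c _. c)" using empty.prems algebra_of_functions_empty by blast
  ultimately have "f = 0" by (auto simp: zero_fun_def)
  then show False using empty.prems prime_inD(2) by blast
 qed
 then show ?case using q by (intro exI[of _ "\<lambda>g. g x"]) (auto simp: point_hom_def)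
next
 case (insert s G)
 let ?B = "algebra_of_functions G"
 note B = algebra_of_functions_subring[of G]
 have "range (\<lambda>c _. c) \<subseteq> ?B" by (auto intro: algebra_of_functions.const)
 then obtain g where g: "g \<in> ?B" "g \<notin> q" and ext: "\<And>xi. point_hom (\<lambda>c _. c) ?B (q \<inter> ?B) xi ==> xi g \<noteq> 0 ==>
   (\<exists>xi'. point_hom (\<lambda>c _. c) (adjoin ?B s) q xi' \<and> xi' f \<noteq> 0)"
  using point_hom_extends[OF B insert.prems(1)[unfolded algebra_of_functions_insert]
    insert.prems(2)[unfolded algebra_of_functions_insert] insert.prems(3)] by meson
 have "prime_in ?B (q \<inter> ?B)"
  by (rule prime_in_Int[OF insert.prems(1) _ B]) (rule algebra_of_functions_mono, auto)
 then obtain xi where "point_hom (\<lambda>c _. c) ?B (q \<inter> ?B) xi" "xi g \<noteq> 0" using insert.IH[of "q \<inter> ?B" g] g by blast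
 then show ?case using ext unfolding algebra_of_functions_insert by blast
qed

text \<open>A homomorphism from the algebra of polynomial functions is the evaluation at the point whose
 coordinates are the images of the coordinate functions.\<close>

lemma polynomial_hom_is_evaluation:
 fixes xi :: "('k::field ^ 'n \<Rightarrow> 'k) \<Rightarrow> 'k"
 assumes "\<And>c. xi (\<lambda>_. c) = c"
  and "\<And>f g. f \<in> poly_funs ==> g \<in> poly_funs ==> xi (\<lambda>x. f x + g x) = xi f + xi g"
  and "\<And>f g. f \<in> poly_funs ==> g \<in> poly_funs ==> xi (\<lambda>x. f x * g x) = xi f * xi g"
  and "f \<in> poly_funs"
 shows "xi f = f (vec_lambda (\<lambda>i. xi (\<lambda>x. x $ i)))"
 using assms(4) assms(1-3) unfolding polynomial_functions_def
 by induction auto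

text \<open>A function outside of a prime ideal has a value other than zero at some homomorphism that kills the ideal,
and such homomorphisms are points.\<close>

lemma nullstellensatz:
 fixes q :: "('k::{alg_closed_field,field_char_0} ^ 'n::finite \<Rightarrow> 'k) set"
 assumes "prime_in poly_funs q" "f \<in> poly_funs" "f \<notin> q"
 shows "\<exists>x. (\<forall>g\<in>q. g x = 0) \<and> f x \<noteq> 0"
proof -
 have "finite (range (\<lambda>i (x :: 'k ^ 'n). x $ i))" by simp
 then obtain xi where xi: "point_hom (\<lambda>c _. c) poly_funs q xi" "xi f \<noteq> 0"
  using point_hom_exists assms unfolding polynomial_functions_def by blast
 note H = point_homD[OF xi(1)]
 have ev: "xi g = g (vec_lambda (\<lambda>i. xi (\<lambda>x. x $ i)))" if "g \<in> poly_funs" for g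
 proof (rule polynomial_hom_is_evaluation[OF _ _ _ that])
  show "xi (\<lambda>_. c) = c" for c by (rule H(2))
  show "xi (\<lambda>x. f x + g x) = xi f + xi g" if "f \<in> poly_funs" "g \<in> poly_funs" for f g
   using H(3)[OF that] by (simp add: plus_fun_def)
  show "xi (\<lambda>x. f x * g x) = xi f * xi g" if "f \<in> poly_funs" "g \<in> poly_funs" for f g
   using H(4)[OF that] by (simp add: times_fun_def)
 qed
 show ?thesis
 proof (intro exI[of _ "vec_lambda (\<lambda>i. xi (\<lambda>x. x $ i))"] conjI ballI)
  show "g (vec_lambda (\<lambda>i. xi (\<lambda>x. x $ i))) = 0" if "g \<in> q" for g
   using ev[of g] H(5)[OF that] prime_inD(1)[OF assms(1)] that by auto
  show "f (vec_lambda (\<lambda>i. xi (\<lambda>x. x $ i))) \<noteq> 0" using ev[OF assms(2)] xi(2) by simp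
 qed
qed

section \<open>Discrete valuations of Noetherian normal domains\<close>

context field begin

lemma nonzero_inv:
 assumes "x \<in> carrier R" "x \<noteq> \<zero>"
 shows "inv x \<in> carrier R" "inv x \<noteq> \<zero>" "x \<otimes> inv x = \<one>" "inv x \<otimes> x = \<one>"
proof -
 have u: "x \<in> Units R" using assms field_Units by auto
 then show "inv x \<in> carrier R" "x \<otimes> inv x = \<one>" "inv x \<otimes> x = \<one>" by auto
 then show "inv x \<noteq> \<zero>" using assms by (metis l_null zero_not_one)
qed

lemma nonzero_mult: "x \<in> carrier R ==> y \<in> carrier R ==> x \<noteq> \<zero> ==> y \<noteq> \<zero> ==> x \<otimes> y \<noteq> \<zero>"
 using integral by blast

lemma nonzero_pow: "x \<in> carrier R ==> x \<noteq> \<zero> ==> x [^] (n::nat) \<noteq> \<zero>"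
 by (induction n) (use nonzero_mult in auto)

lemma cancel_inv:
 assumes "x \<in> carrier R" "x \<noteq> \<zero>" "y \<in> carrier R"
 shows "inv x \<otimes> (x \<otimes> y) = y" "x \<otimes> (inv x \<otimes> y) = y"
 using assms nonzero_inv[OF assms(1,2)] by (simp_all add: m_assoc[symmetric])

lemma inv_unique_field: "x \<in> carrier R ==> y \<in> carrier R ==> x \<otimes> y = \<one> ==> inv x = y"
 by (metis comm_inv_char)

lemma int_pow_mult_of: "x \<in> carrier R ==> x \<noteq> \<zero> ==> x [^]\<^bsub>mult_of R\<^esub> (i::int) = x [^] i"
proof -
 assume x: "x \<in> carrier R" "x \<noteq> \<zero>"
 then have "x [^] nat (- i) \<in> carrier (mult_of R)" using nonzero_pow[of x] by simp
 then show ?thesis unfolding int_pow_def2 nat_pow_mult_of by (simp only: m_inv_mult_of)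
qed

lemma int_pow_field:
 assumes "x \<in> carrier R" "x \<noteq> \<zero>"
 shows "x [^] (i::int) \<in> carrier R" "x [^] i \<noteq> \<zero>" "x [^] (i + j) = x [^] i \<otimes> x [^] j"
  "inv (x [^] i) = x [^] (- i)"
proof -
 interpret M: group "mult_of R" by (rule field_mult_group)
 have x: "x \<in> carrier (mult_of R)" using assms by simp
 have c: "x [^] (i::int) \<in> carrier (mult_of R)" for i using M.int_pow_closed[OF x, of i] int_pow_mult_of[OF assms] by simp
 from c show "x [^] i \<in> carrier R" "x [^] i \<noteq> \<zero>" by auto
 show "x [^] (i + j) = x [^] i \<otimes> x [^] j" using M.int_pow_mult[OF x, of i j] int_pow_mult_of[OF assms] by simp
 show "inv (x [^] i) = x [^] (- i)" using M.int_pow_neg[OF x, of i] m_inv_mult_of[OF c] int_pow_mult_of[OF assms] by simp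
qed

end

lemma (in abelian_monoid) finsum_in:
 assumes "X \<subseteq> carrier G" "\<zero> \<in> X" "\<And>x y. x \<in> X ==> y \<in> X ==> x \<oplus> y \<in> X" "finite A" "\<And>i. i \<in> A ==> f i \<in> X"
 shows "finsum G f A \<in> X"
 using assms(4,5)
proof (induction rule: finite_induct)
 case (insert x A)
 have "f \<in> A \<rightarrow> carrier G" "f x \<in> carrier G" using insert.prems assms(1) by auto
 then show ?case using insert assms(3) by (simp add: finsum_insert)
qed (use assms(2) in simp)

text \<open>The ring is a subset of its field of fractions, so that localizations, conductors and fractional elements
all live in \<open>L\<close>. Being integrally closed and Noetherian are stated in the elementary forms that are used.\<close>

locale noetherian_normal_domain = field L for L (structure) +
 fixes S
 assumes sub: "S \<subseteq> carrier L" "\<one> \<in> S" "\<And>x y. x \<in> S ==> y \<in> S ==> x \<oplus> y \<in> S"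
   "\<And>x y. x \<in> S ==> y \<in> S ==> x \<otimes> y \<in> S" "\<And>x. x \<in> S ==> \<ominus> x \<in> S"
  and quotients: "x \<in> carrier L ==> \<exists>a\<in>S. \<exists>b\<in>S - {\<zero>}. x \<otimes> b = a"
  and noetherian: "\<And>a :: nat \<Rightarrow> _. range a \<subseteq> S ==> \<exists>n c. (\<forall>i<n. c i \<in> S) \<and> a n = (\<Oplus>i\<in>{..<n}. c i \<otimes> a i)"
  and int_closed: "x \<in> carrier L ==> integral_over L S x ==> x \<in> S"
begin

lemma zero_S: "\<zero> \<in> S"
 using sub(3)[OF sub(2) sub(5)[OF sub(2)]] by (simp add: r_neg)

lemma S_carrier: "x \<in> S ==> x \<in> carrier L"
 using sub(1) by blast

lemma pow_S: "x \<in> S ==> x [^] (n::nat) \<in> S"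
 by (induction n) (auto intro: sub)

definition ideal_in :: "'a set \<Rightarrow> bool" where
 "ideal_in J \<longleftrightarrow> J \<subseteq> S \<and> \<zero> \<in> J \<and> (\<forall>x\<in>J. \<forall>y\<in>J. x \<oplus> y \<in> J) \<and> (\<forall>s\<in>S. \<forall>x\<in>J. s \<otimes> x \<in> J)"

definition prime_id :: "'a set \<Rightarrow> bool" where
 "prime_id p \<longleftrightarrow> ideal_in p \<and> \<one> \<notin> p \<and> (\<forall>x\<in>S. \<forall>y\<in>S. x \<otimes> y \<in> p \<longrightarrow> x \<in> p \<or> y \<in> p)"

definition height_one :: "'a set \<Rightarrow> bool" where
 "height_one p \<longleftrightarrow> prime_id p \<and> p \<noteq> {\<zero>} \<and> (\<forall>q. prime_id q \<and> q \<noteq> {\<zero>} \<and> q \<subseteq> p \<longrightarrow> q = p)"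

text \<open>Being regular at \<open>p\<close> means that some denominator avoids \<open>p\<close>; no choice of a representing fraction is needed.\<close>

definition loc :: "'a set \<Rightarrow> 'a set" where
 "loc p = {f \<in> carrier L. \<exists>h\<in>S - p. h \<otimes> f \<in> S}"

definition loc_max :: "'a set \<Rightarrow> 'a set" where
 "loc_max p = {f \<in> carrier L. \<exists>h\<in>S - p. h \<otimes> f \<in> p}"

lemma ideal_inD:
 assumes "ideal_in J"
 shows "J \<subseteq> S" "\<zero> \<in> J" "x \<in> J ==> y \<in> J ==> x \<oplus> y \<in> J" "s \<in> S ==> x \<in> J ==> s \<otimes> x \<in> J"
 using assms unfolding ideal_in_def by blast+

lemma prime_idD:
 assumes "prime_id p"
 shows "ideal_in p" "p \<subseteq> S" "\<zero> \<in> p" "x \<in> p ==> y \<in> p ==> x \<oplus> y \<in> p" "s \<in> S ==> x \<in> p ==> s \<otimes> x \<in> p"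
  "\<one> \<notin> p" "x \<in> S ==> y \<in> S ==> x \<otimes> y \<in> p ==> x \<in> p \<or> y \<in> p"
 using assms unfolding prime_id_def ideal_in_def by blast+

lemma prime_id_pow: "prime_id p ==> x \<in> S ==> x [^] (n::nat) \<in> p ==> x \<in> p"
proof (induction n)
 case (Suc n)
 then show ?case using prime_idD(7)[OF Suc.prems(1), of "x [^] n" x] pow_S by auto
qed (use prime_idD(6) in simp)

lemma ideal_in_finsum: "ideal_in J ==> finite A ==> (\<And>i. i \<in> A ==> f i \<in> J) ==> finsum L f A \<in> J"
proof -
 assume J: "ideal_in J" and A: "finite A" "\<And>i. i \<in> A ==> f i \<in> J"
 have "J \<subseteq> carrier L" using ideal_inD(1)[OF J] sub(1) by blast
 then show ?thesis by (rule finsum_in) (use A ideal_inD(2,3)[OF J] in auto)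
qed

text \<open>A strictly increasing chain of ideals would yield a sequence none of whose terms is a combination of the
earlier ones.\<close>

lemma maximal_ideal_exists:
 assumes "F \<noteq> {}" "\<And>J. J \<in> F ==> ideal_in J"
 shows "\<exists>J\<in>F. \<forall>J'\<in>F. J \<subseteq> J' \<longrightarrow> J' = J"
proof (rule ccontr)
 assume "\<not> ?thesis"
 then have step: "\<exists>J'\<in>F. J \<subset> J'" if "J \<in> F" for J using that by blast
 obtain J0 where "J0 \<in> F" using assms(1) by blast
 then obtain J where J: "\<And>n. J n \<in> F" "\<And>n. J n \<subset> J (Suc n)"
  using dependent_nat_choice[of "\<lambda>_ J. J \<in> F" "\<lambda>_ J J'. J \<subset> J'"] step by metis
 have "\<exists>x. x \<in> J (Suc n) - J n" for n using J(2)[of n] by blast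
 then obtain a where a: "\<And>n. a n \<in> J (Suc n) - J n" by metis
 have I: "ideal_in (J n)" for n using J(1) assms(2) by blast
 have "range a \<subseteq> S" using a ideal_inD(1)[OF I] by blast
 then obtain n c where c: "\<forall>i<n. c i \<in> S" "a n = (\<Oplus>i\<in>{..<n}. c i \<otimes> a i)" using noetherian by blast
 have "a i \<in> J n" if "i < n" for i
 proof -
  have "J (Suc i) \<subseteq> J n" using lift_Suc_mono_le[of J "Suc i" n] J(2) that by (simp add: psubset_imp_subset)
  then show ?thesis using a by blast
 qed
 then have "a n \<in> J n" unfolding c(2) using c(1) ideal_inD(4)[OF I]
  by (intro ideal_in_finsum[OF I]) auto
 then show False using a by blast
qed

context
 fixes p assumes p: "prime_id p"
begin

lemma not_in_prime_mult: "h \<in> S - p ==> k \<in> S - p ==> h \<otimes> k \<in> S - p"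
 using prime_idD(7)[OF p] sub(4) by blast

lemma not_in_prime_nonzero: "h \<in> S - p ==> h \<in> carrier L \<and> h \<noteq> \<zero>"
 using prime_idD(3)[OF p] S_carrier by blast

lemma locI: "h \<in> S - p ==> f \<in> carrier L ==> h \<otimes> f \<in> S ==> f \<in> loc p"
 unfolding loc_def by blast

lemma loc_maxI: "h \<in> S - p ==> f \<in> carrier L ==> h \<otimes> f \<in> p ==> f \<in> loc_max p"
 unfolding loc_max_def by blast

lemma S_loc: "S \<subseteq> loc p"
 using locI[of \<one>] sub prime_idD(6)[OF p] S_carrier by auto

lemma p_loc_max: "p \<subseteq> loc_max p"
proof
 fix x assume "x \<in> p"
 then show "x \<in> loc_max p" using loc_maxI[of \<one> x] sub prime_idD(2,6)[OF p] S_carrier by auto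
qed

lemma loc_closed:
 assumes "f \<in> loc p" "g \<in> loc p"
 shows "f \<in> carrier L" "f \<oplus> g \<in> loc p" "f \<otimes> g \<in> loc p"
proof -
 obtain h where h: "h \<in> S - p" "h \<otimes> f \<in> S" and f: "f \<in> carrier L" using assms(1) loc_def by auto
 obtain k where k: "k \<in> S - p" "k \<otimes> g \<in> S" and g: "g \<in> carrier L" using assms(2) loc_def by auto
 show "f \<in> carrier L" by fact
 have c: "h \<in> carrier L" "k \<in> carrier L" using h k S_carrier by auto
 have "h \<otimes> k \<otimes> (f \<oplus> g) = k \<otimes> (h \<otimes> f) \<oplus> h \<otimes> (k \<otimes> g)" using c f g by (simp add: r_distr m_ac)
 also have "... \<in> S" using h k sub(3,4) by blast
 finally show "f \<oplus> g \<in> loc p" using locI[OF not_in_prime_mult[OF h(1) k(1)]] f g by auto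
 have "h \<otimes> k \<otimes> (f \<otimes> g) = (h \<otimes> f) \<otimes> (k \<otimes> g)" using c f g by (simp add: m_ac)
 also have "... \<in> S" using h k sub(4) by blast
 finally show "f \<otimes> g \<in> loc p" using locI[OF not_in_prime_mult[OF h(1) k(1)]] f g by auto
qed

lemma loc_max_closed:
 assumes "f \<in> loc_max p"
 shows "f \<in> carrier L" "f \<in> loc p" "g \<in> loc_max p ==> f \<oplus> g \<in> loc_max p" "g \<in> loc p ==> g \<otimes> f \<in> loc_max p"
proof -
 obtain h where h: "h \<in> S - p" "h \<otimes> f \<in> p" and f: "f \<in> carrier L" using assms(1) loc_max_def by auto
 show "f \<in> carrier L" by fact
 show "f \<in> loc p" using locI h f prime_idD(2)[OF p] by blast
 show "f \<oplus> g \<in> loc_max p" if gm: "g \<in> loc_max p"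
 proof -
  obtain k where k: "k \<in> S - p" "k \<otimes> g \<in> p" and g: "g \<in> carrier L" using gm loc_max_def by auto
  have c: "h \<in> carrier L" "k \<in> carrier L" using h k S_carrier by auto
  have "h \<otimes> k \<otimes> (f \<oplus> g) = k \<otimes> (h \<otimes> f) \<oplus> h \<otimes> (k \<otimes> g)" using c f g by (simp add: r_distr m_ac)
  also have "... \<in> p" using h k prime_idD(4,5)[OF p] by blast
  finally show ?thesis using loc_maxI[OF not_in_prime_mult[OF h(1) k(1)]] f g by auto
 qed
 show "g \<otimes> f \<in> loc_max p" if gl: "g \<in> loc p"
 proof -
  obtain k where k: "k \<in> S - p" "k \<otimes> g \<in> S" and g: "g \<in> carrier L" using gl loc_def by auto
  have c: "h \<in> carrier L" "k \<in> carrier L" using h k S_carrier by auto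
  have "h \<otimes> k \<otimes> (g \<otimes> f) = (k \<otimes> g) \<otimes> (h \<otimes> f)" using c f g by (simp add: m_ac)
  also have "... \<in> p" using h k prime_idD(5)[OF p] by blast
  finally show ?thesis using loc_maxI[OF not_in_prime_mult[OF h(1) k(1)]] f g by auto
 qed
qed

lemma one_not_loc_max: "\<one> \<notin> loc_max p"
proof
 assume "\<one> \<in> loc_max p"
 then show False unfolding loc_max_def using S_carrier by auto
qed

lemma loc_max_zero: "\<zero> \<in> loc_max p"
 using p_loc_max prime_idD(3)[OF p] by blast

lemma loc_one: "\<one> \<in> loc p" using S_loc sub(2) by blast

lemma loc_pow: "f \<in> loc p ==> f [^] (n::nat) \<in> loc p"
 by (induction n) (auto intro: loc_closed loc_one)

lemma loc_divide: "h \<in> S - p ==> f \<in> carrier L ==> h \<otimes> f \<in> loc p ==> f \<in> loc p"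
proof -
 assume h: "h \<in> S - p" and f: "f \<in> carrier L" and "h \<otimes> f \<in> loc p"
 then obtain k where k: "k \<in> S - p" "k \<otimes> (h \<otimes> f) \<in> S" unfolding loc_def by auto
 then have "k \<otimes> h \<otimes> f \<in> S" using h f S_carrier by (simp add: m_assoc)
 then show ?thesis using locI not_in_prime_mult k h f by blast
qed

lemma loc_inv: assumes "f \<in> loc p" "f \<notin> loc_max p" shows "f \<noteq> \<zero>" "inv f \<in> loc p" "inv f \<notin> loc_max p"
proof -
 show nz: "f \<noteq> \<zero>" using assms(2) loc_max_zero by blast
 obtain h where h: "h \<in> S - p" "h \<otimes> f \<in> S" and f: "f \<in> carrier L" using assms(1) loc_def by auto
 note i = nonzero_inv[OF f nz]
 have "h \<otimes> f \<in> S - p" using h f assms(2) loc_maxI by blast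
 moreover have "h \<otimes> f \<otimes> inv f = h" using h f i S_carrier by (simp add: m_assoc)
 ultimately show li: "inv f \<in> loc p" using locI[of "h \<otimes> f" "inv f"] i h by auto
 show "inv f \<notin> loc_max p"
 proof
  assume "inv f \<in> loc_max p"
  then have "f \<otimes> inv f \<in> loc_max p" using loc_max_closed(4) assms(1) by blast
  then show False using i one_not_loc_max by simp
 qed
qed

lemma loc_max_finsum: "finite A ==> (\<And>i. i \<in> A ==> f i \<in> loc_max p) ==> finsum L f A \<in> loc_max p"
 by (rule finsum_in) (use loc_max_closed(1,3) loc_max_zero in auto)

lemma loc_noetherian:
 fixes a :: "nat \<Rightarrow> 'a"
 assumes "range a \<subseteq> loc p"
 shows "\<exists>n c. (\<forall>i<n. c i \<in> loc p) \<and> a n = (\<Oplus>i\<in>{..<n}. c i \<otimes> a i)"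
proof -
 have "\<exists>h. h \<in> S - p \<and> h \<otimes> a n \<in> S" for n using assms unfolding loc_def by blast
 then obtain h where h: "\<And>n. h n \<in> S - p" "\<And>n. h n \<otimes> a n \<in> S" by metis
 have "range (\<lambda>n. h n \<otimes> a n) \<subseteq> S" using h by blast
 from noetherian[OF this] obtain n c where c: "\<forall>i<n. c i \<in> S" "h n \<otimes> a n = (\<Oplus>i\<in>{..<n}. c i \<otimes> (h i \<otimes> a i))"
  by blast
 have hc: "h i \<in> carrier L" "h i \<noteq> \<zero>" "a i \<in> carrier L" for i
  using h not_in_prime_nonzero assms loc_closed(1) by blast+
 note i = nonzero_inv[OF hc(1,2)]
 have inS: "inv (h n) \<in> loc p" using locI[of "h n" "inv (h n)"] h i sub(2) by simp
 have "a n = inv (h n) \<otimes> (h n \<otimes> a n)" using hc i by (simp add: cancel_inv)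
 also have "... = (\<Oplus>i\<in>{..<n}. inv (h n) \<otimes> (c i \<otimes> (h i \<otimes> a i)))" unfolding c(2)
  by (rule finsum_rdistr) (use i hc c S_carrier in auto)
 also have "... = (\<Oplus>i\<in>{..<n}. (inv (h n) \<otimes> (c i \<otimes> h i)) \<otimes> a i)"
  by (rule finsum_cong') (use i hc c S_carrier in \<open>auto simp: m_assoc\<close>)
 finally have "a n = (\<Oplus>i\<in>{..<n}. (inv (h n) \<otimes> (c i \<otimes> h i)) \<otimes> a i)" .
 moreover have "\<forall>i<n. inv (h n) \<otimes> (c i \<otimes> h i) \<in> loc p"
  using inS S_loc c(1) h(1) sub(4) by (intro allI impI loc_closed(3)) auto
 ultimately show ?thesis by (intro exI conjI)
qed

text \<open>Clearing denominators in an integral equation over the local ring makes a multiple of the root integral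
over \<open>S\<close>.\<close>

lemma loc_integrally_closed:
 fixes n :: nat
 assumes z: "z \<in> carrier L" and c: "\<And>i. i < n ==> c i \<in> loc p" and eq: "z [^] n = (\<Oplus>i\<in>{..<n}. c i \<otimes> z [^] i)"
 shows "z \<in> loc p"
proof -
 have "\<exists>h\<in>S - p. \<forall>i<m. h \<otimes> c i \<in> S" if "m \<le> n" for m
  using that
 proof (induction m)
  case 0
  then show ?case using sub(2) prime_idD(6)[OF p] by blast
 next
  case (Suc m)
  then obtain h where h: "h \<in> S - p" "\<forall>i<m. h \<otimes> c i \<in> S" by auto
  obtain k where k: "k \<in> S - p" "k \<otimes> c m \<in> S" using c[of m] Suc.prems unfolding loc_def by auto
  have "h \<otimes> k \<otimes> c i \<in> S" if "i < Suc m" for i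
  proof -
   have cc: "h \<in> carrier L" "k \<in> carrier L" "c i \<in> carrier L" using h k S_carrier c[of i] that Suc.prems loc_closed(1) by auto
   have "h \<otimes> k \<otimes> c i = k \<otimes> (h \<otimes> c i)" "h \<otimes> k \<otimes> c i = h \<otimes> (k \<otimes> c i)" using cc by (simp_all add: m_ac)
   then show ?thesis using that h k sub(4) by (cases "i = m") auto
  qed
  then show ?case using not_in_prime_mult[OF h(1) k(1)] by blast
 qed
 then obtain h where h: "h \<in> S - p" "\<And>i. i < n ==> h \<otimes> c i \<in> S" by blast
 define d where "d i = h [^] (n - Suc i) \<otimes> (h \<otimes> c i)" for i
 have hL: "h \<in> carrier L" using h S_carrier by blast
 have cL: "i < n ==> c i \<in> carrier L" for i using c loc_closed(1) by blast
 have dS: "d i \<in> S" if "i < n" for i unfolding d_def using h that pow_S sub(4) by blast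
 have wz: "(h \<otimes> z) [^] m = h [^] m \<otimes> z [^] m" for m :: nat using hL z by (rule nat_pow_distrib)
 have "(h \<otimes> z) [^] n = h [^] n \<otimes> (\<Oplus>i\<in>{..<n}. c i \<otimes> z [^] i)" unfolding wz eq ..
 also have "... = (\<Oplus>i\<in>{..<n}. h [^] n \<otimes> (c i \<otimes> z [^] i))"
  by (rule finsum_rdistr) (use hL z cL in auto)
 also have "... = (\<Oplus>i\<in>{..<n}. d i \<otimes> (h \<otimes> z) [^] i)"
 proof (rule finsum_cong')
  fix i assume "i \<in> {..<n}"
  then have i: "i < n" by simp
  then have "n = (n - Suc i) + Suc i" by simp
  then have "h [^] n = h [^] (n - Suc i) \<otimes> (h [^] i \<otimes> h)" using hL nat_pow_mult[of h "n - Suc i" "Suc i"] by simp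
  then show "h [^] n \<otimes> (c i \<otimes> z [^] i) = d i \<otimes> (h \<otimes> z) [^] i"
   unfolding d_def wz using hL z cL[OF i] by (simp add: m_ac)
 qed (use dS S_carrier hL z in auto)
 finally have E: "(h \<otimes> z) [^] n = (\<Oplus>i\<in>{..<n}. d i \<otimes> (h \<otimes> z) [^] i)" .
 have hz: "h \<otimes> z \<in> carrier L" using hL z by simp
 have dL: "d i \<in> carrier L" if "i < n" for i using dS[OF that] S_carrier by blast
 have "(\<Oplus>i\<in>{..<n}. (\<ominus> d i) \<otimes> (h \<otimes> z) [^] i) = (\<Oplus>i\<in>{..<n}. (\<ominus> \<one>) \<otimes> (d i \<otimes> (h \<otimes> z) [^] i))"
  by (rule finsum_cong') (use dL hz in \<open>auto simp: l_minus\<close>)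
 also have "... = (\<ominus> \<one>) \<otimes> (h \<otimes> z) [^] n" unfolding E
  by (rule finsum_rdistr[symmetric]) (use dL hz in auto)
 finally have "(h \<otimes> z) [^] n \<oplus> (\<Oplus>i\<in>{..<n}. (\<ominus> d i) \<otimes> (h \<otimes> z) [^] i) = \<zero>"
  using hz by (simp add: l_minus r_neg)
 moreover have "(\<lambda>i. \<ominus> d i) \<in> {..<n} \<rightarrow> S" using dS sub(5) by auto
 ultimately have "integral_over L S (h \<otimes> z)" unfolding integral_over_def
  by (intro exI[of _ n] bexI[of _ "\<lambda>i. \<ominus> d i"])
 then have "h \<otimes> z \<in> S" using int_closed hz by blast
 then show ?thesis using locI h z by blast
qed

text \<open>An element \<open>z\<close> outside of the local ring that the maximal ideal multiplies into it generates that
 ideal by its inverse: otherwise \<open>z\<close> maps the maximal ideal to itself, hence is integral.\<close>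

lemma loc_max_principal:
 assumes p0: "p \<noteq> {\<zero>}" and z: "z \<in> carrier L" "z \<notin> loc p" and zp: "\<And>s. s \<in> p ==> s \<otimes> z \<in> loc p"
 shows "inv z \<in> loc_max p" "loc_max p = (\<lambda>h. inv z \<otimes> h) ` loc p"
proof -
 have zm: "z \<otimes> m \<in> loc p" if mm: "m \<in> loc_max p" for m
 proof -
  obtain h where h: "h \<in> S - p" "h \<otimes> m \<in> p" and m: "m \<in> carrier L" using mm loc_max_def by auto
  have "h \<otimes> (z \<otimes> m) = h \<otimes> m \<otimes> z" using h m z S_carrier by (simp add: m_ac)
  also have "... \<in> loc p" by (rule zp[OF h(2)])
  finally show ?thesis using loc_divide[OF h(1)] z m by blast
 qed
 have z0: "z \<noteq> \<zero>" using z S_loc zero_S by blast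
 note iz = nonzero_inv[OF z(1) z0]
 have "\<exists>s\<in>loc_max p. z \<otimes> s \<notin> loc_max p"
 proof (rule ccontr)
  assume "\<not> ?thesis"
  then have stay: "z \<otimes> s \<in> loc_max p" if "s \<in> loc_max p" for s using that by blast
  obtain a where a: "a \<in> p" "a \<noteq> \<zero>" using p0 prime_idD(3)[OF p] by blast
  have aL: "a \<in> carrier L" using a prime_idD(2)[OF p] S_carrier by blast
  have "a \<otimes> z [^] (n::nat) \<in> loc_max p" for n
  proof (induction n)
   case 0 then show ?case using a p_loc_max aL by auto
  next
   case (Suc n)
   have "a \<otimes> z [^] Suc n = z \<otimes> (a \<otimes> z [^] n)" using aL z by (simp add: m_ac)
   then show ?case using stay Suc by simp
  qed
  then have "range (\<lambda>n::nat. a \<otimes> z [^] n) \<subseteq> loc p" using loc_max_closed(2) by blast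
  from loc_noetherian[OF this] obtain n :: nat and c where c: "\<forall>i<n. c i \<in> loc p" 
   "a \<otimes> z [^] n = (\<Oplus>i\<in>{..<n}. c i \<otimes> (a \<otimes> z [^] i))" by blast
  have cL: "i < n ==> c i \<in> carrier L" for i using c loc_closed(1) by blast
  note ia = nonzero_inv[OF aL a(2)]
  have "z [^] n = inv a \<otimes> (a \<otimes> z [^] n)" using cancel_inv[OF aL a(2)] z by simp
  also have "... = (\<Oplus>i\<in>{..<n}. inv a \<otimes> (c i \<otimes> (a \<otimes> z [^] i)))" unfolding c(2)
   by (rule finsum_rdistr) (use ia aL z cL in auto)
  also have "... = (\<Oplus>i\<in>{..<n}. c i \<otimes> z [^] i)"
  proof (rule finsum_cong')
   fix i assume "i \<in> {..<n}"
   then have ci: "c i \<in> carrier L" using cL by simp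
   have "inv a \<otimes> (c i \<otimes> (a \<otimes> z [^] i)) = inv a \<otimes> (a \<otimes> (c i \<otimes> z [^] i))" using ia aL z ci by (simp add: m_ac)
   then show "inv a \<otimes> (c i \<otimes> (a \<otimes> z [^] i)) = c i \<otimes> z [^] i" using cancel_inv[OF aL a(2)] z ci by simp
  qed (use cL z in auto)
  finally have "z \<in> loc p" using loc_integrally_closed z(1) c(1) by blast
  then show False using z by blast
 qed
 then obtain s where s: "s \<in> loc_max p" "z \<otimes> s \<notin> loc_max p" by blast
 define y where "y = z \<otimes> s"
 have y: "y \<in> loc p" "y \<notin> loc_max p" using zm s by (auto simp: y_def)
 have sL: "s \<in> carrier L" using s loc_max_closed(1) by blast
 have yL: "y \<in> carrier L" using sL z y_def by simp
 have y0: "y \<noteq> \<zero>" "inv y \<in> loc p" using loc_inv y by auto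
 have "inv z = inv y \<otimes> s"
 proof (rule inv_unique_field[OF z(1)])
  have "z \<otimes> (inv y \<otimes> s) = inv y \<otimes> y" using z sL nonzero_inv[OF yL y0(1)] by (simp add: y_def m_ac)
  then show "z \<otimes> (inv y \<otimes> s) = \<one>" using nonzero_inv[OF yL y0(1)] by simp
 qed (use sL nonzero_inv[OF yL y0(1)] in auto)
 then show 1: "inv z \<in> loc_max p" using loc_max_closed(4)[OF s(1) y0(2)] by simp
 show "loc_max p = (\<lambda>h. inv z \<otimes> h) ` loc p"
 proof (intro equalityI subsetI)
  fix m assume m: "m \<in> loc_max p"
  then have "m = inv z \<otimes> (z \<otimes> m)" using cancel_inv[OF z(1) z0] loc_max_closed(1) by simp
  then show "m \<in> (\<lambda>h. inv z \<otimes> h) ` loc p" using zm[OF m] by blast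
 next
  fix m assume "m \<in> (\<lambda>h. inv z \<otimes> h) ` loc p"
  then obtain h where h: "h \<in> loc p" "m = inv z \<otimes> h" by blast
  then have "m = h \<otimes> inv z" using loc_closed(1) iz by (simp add: m_comm)
  then show "m \<in> loc_max p" using loc_max_closed(4)[OF 1 h(1)] by simp
 qed
qed

end

text \<open>A conductor \<open>{s \<in> S. s z \<in> O}\<close> that is maximal among those of elements outside of \<open>O\<close> is prime.\<close>

lemma prime_conductor:
 assumes SO: "S \<subseteq> O'" and O: "O' \<subseteq> carrier L" "\<And>x y. x \<in> O' ==> y \<in> O' ==> x \<oplus> y \<in> O'" "\<And>x y. x \<in> O' ==> y \<in> O' ==> x \<otimes> y \<in> O'"
  and f: "f \<in> carrier L" "f \<notin> O'"
 shows "\<exists>z. z \<in> carrier L \<and> z \<notin> O' \<and> prime_id {s \<in> S. s \<otimes> z \<in> O'} \<and> {s \<in> S. s \<otimes> z \<in> O'} \<noteq> {\<zero>} \<and>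
   {s \<in> S. s \<otimes> f \<in> O'} \<subseteq> {s \<in> S. s \<otimes> z \<in> O'}"
proof -
 define C where "C z = {s \<in> S. s \<otimes> z \<in> O'}" for z
 define F where "F = C ` {z \<in> carrier L. z \<notin> O' \<and> C f \<subseteq> C z}"
 have ideal: "ideal_in (C z)" if z: "z \<in> carrier L" for z
  unfolding ideal_in_def
 proof (intro conjI ballI)
  show "C z \<subseteq> S" by (auto simp: C_def)
  show "\<zero> \<in> C z" using z zero_S SO by (auto simp: C_def)
  show "x \<oplus> y \<in> C z" if "x \<in> C z" "y \<in> C z" for x y
   using that z O(2) sub(3) S_carrier by (auto simp: C_def l_distr)
  show "s \<otimes> x \<in> C z" if "s \<in> S" "x \<in> C z" for s x
  proof -
   have "s \<otimes> x \<otimes> z = s \<otimes> (x \<otimes> z)" using that z S_carrier by (auto simp: C_def m_assoc)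
   then show ?thesis using that O(3)[of s "x \<otimes> z"] SO sub(4) by (auto simp: C_def)
  qed
 qed
 have "F \<noteq> {}" using f by (auto simp: F_def)
 moreover have "ideal_in J" if "J \<in> F" for J using that ideal by (auto simp: F_def)
 ultimately obtain J where J: "J \<in> F" "\<And>J'. J' \<in> F ==> J \<subseteq> J' ==> J' = J" using maximal_ideal_exists[of F] by blast
 then obtain z where z: "z \<in> carrier L" "z \<notin> O'" "C f \<subseteq> C z" "J = C z" by (auto simp: F_def)
 have "prime_id (C z)" unfolding prime_id_def
 proof (intro conjI ballI impI)
  show "ideal_in (C z)" by (rule ideal[OF z(1)])
  show "\<one> \<notin> C z" using z by (auto simp: C_def)
  fix x y assume xy: "x \<in> S" "y \<in> S" "x \<otimes> y \<in> C z"
  show "x \<in> C z \<or> y \<in> C z"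
  proof (rule disjCI)
   assume y: "y \<notin> C z"
   have L: "x \<in> carrier L" "y \<in> carrier L" using xy S_carrier by auto
   have "C z \<subseteq> C (y \<otimes> z)"
   proof
    fix s assume "s \<in> C z"
    then have s: "s \<in> S" "s \<otimes> z \<in> O'" by (auto simp: C_def)
    have "s \<otimes> (y \<otimes> z) = y \<otimes> (s \<otimes> z)" using s L z S_carrier by (simp add: m_ac)
    then show "s \<in> C (y \<otimes> z)" using s O(3)[of y "s \<otimes> z"] xy SO by (auto simp: C_def)
   qed
   moreover have "y \<otimes> z \<notin> O'" using y xy by (auto simp: C_def)
   ultimately have "C (y \<otimes> z) = C z" using J(2)[of "C (y \<otimes> z)"] z L unfolding F_def by auto
   moreover have "x \<in> C (y \<otimes> z)" using xy L z by (auto simp: C_def m_assoc)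
   ultimately show "x \<in> C z" by simp
  qed
 qed
 moreover have "C z \<noteq> {\<zero>}"
 proof -
  obtain a b where ab: "a \<in> S" "b \<in> S - {\<zero>}" "z \<otimes> b = a" using quotients[OF z(1)] by blast
  then have "b \<in> C z" using SO z S_carrier by (auto simp: C_def m_comm)
  then show ?thesis using ab by blast
 qed
 ultimately show ?thesis using z unfolding C_def by blast
qed

text \<open>A conductor with respect to the local ring consists of elements of \<open>p\<close>. If it is prime and not zero it
equals \<open>p\<close>, as \<open>p\<close> has height one, and the preceding lemmas apply to an element that defines it.\<close>

lemma height_one_uniformizer:
 assumes "height_one p"
 shows "\<exists>t\<in>loc_max p. loc_max p = (\<lambda>h. t \<otimes> h) ` loc p"
proof -
 have p: "prime_id p" "p \<noteq> {\<zero>}" using assms height_one_def by auto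
 obtain a where a: "a \<in> p" "a \<noteq> \<zero>" using p prime_idD(3) by blast
 have aL: "a \<in> carrier L" using a prime_idD(2)[OF p(1)] S_carrier by blast
 note ia = nonzero_inv[OF aL a(2)]
 have "inv a \<notin> loc p"
 proof
  assume "inv a \<in> loc p"
  then have "inv a \<otimes> a \<in> loc_max p" using loc_max_closed(4)[OF p(1)] p_loc_max[OF p(1)] a(1) by blast
  then show False using one_not_loc_max[OF p(1)] ia by simp
 qed
 have "loc p \<subseteq> carrier L" by (auto simp: loc_def)
 from prime_conductor[OF S_loc[OF p(1)] this loc_closed(2,3)[OF p(1)] ia(1) \<open>inv a \<notin> loc p\<close>]
 obtain z where z: "z \<in> carrier L" "z \<notin> loc p" "prime_id {s \<in> S. s \<otimes> z \<in> loc p}" "{s \<in> S. s \<otimes> z \<in> loc p} \<noteq> {\<zero>}"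
  by blast
 have "{s \<in> S. s \<otimes> z \<in> loc p} \<subseteq> p" using z(1,2) loc_divide[OF p(1)] by blast
 then have "{s \<in> S. s \<otimes> z \<in> loc p} = p" using assms z(3,4) unfolding height_one_def by blast
 then have "\<And>s. s \<in> p ==> s \<otimes> z \<in> loc p" by blast
 from loc_max_principal[OF p z(1,2) this] show ?thesis by blast
qed

lemma Units_loc:
 assumes p: "prime_id p"
 shows "Units (L\<lparr>carrier := loc p\<rparr>) = loc p - loc_max p"
proof (intro equalityI subsetI)
 fix u assume "u \<in> Units (L\<lparr>carrier := loc p\<rparr>)"
 then obtain v where u: "u \<in> loc p" "v \<in> loc p" "v \<otimes> u = \<one>" unfolding Units_def by auto
 then show "u \<in> loc p - loc_max p" using loc_max_closed(4)[OF p _ u(2), of u] one_not_loc_max[OF p] by auto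
next
 fix u assume u: "u \<in> loc p - loc_max p"
 then have "u \<in> carrier L" "u \<noteq> \<zero>" "inv u \<in> loc p" using loc_inv[OF p] loc_closed(1)[OF p] by auto
 then show "u \<in> Units (L\<lparr>carrier := loc p\<rparr>)" unfolding Units_def using u nonzero_inv[of u] by auto
qed

text \<open>The valuation of the local ring, in the form \<open>f = u t\<^sup>n\<close>.\<close>

definition valuation :: "'a set \<Rightarrow> 'a \<Rightarrow> int" where
 "valuation p f = (THE n::int. \<exists>t u. loc_max p = (\<lambda>h. t \<otimes> h) ` loc p \<and> t \<in> loc_max p \<and>
   u \<in> Units (L\<lparr>carrier := loc p\<rparr>) \<and> f = u \<otimes> (t [^] n))"

context
 fixes p t assumes p: "prime_id p" "p \<noteq> {\<zero>}" and t: "t \<in> loc_max p" "loc_max p = (\<lambda>h. t \<otimes> h) ` loc p"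
begin

lemma unif_L: "t \<in> carrier L" "t \<noteq> \<zero>"
proof -
 show tL: "t \<in> carrier L" using loc_max_closed(1)[OF p(1) t(1)] .
 show "t \<noteq> \<zero>"
 proof
  assume "t = \<zero>"
  then have "loc_max p \<subseteq> {\<zero>}" unfolding t(2) using loc_closed(1)[OF p(1)] by auto
  then show False using p_loc_max[OF p(1)] p(2) prime_idD(3)[OF p(1)] by blast
 qed
qed

lemma unit_pow_unique:
 assumes "u \<in> loc p - loc_max p" "v \<in> loc p - loc_max p" "u \<otimes> t [^] (n::int) = v \<otimes> t [^] (m::int)"
 shows "n \<ge> m"
proof (rule ccontr)
 assume "\<not> n \<ge> m"
 define k where "k = nat (m - n) - 1"
 have mk: "m = n + (1 + int k)" using \<open>\<not> n \<ge> m\<close> by (simp add: k_def)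
 note T = int_pow_field[OF unif_L]
 have L: "u \<in> carrier L" "v \<in> carrier L" using assms loc_closed(1)[OF p(1)] by auto
 have "t [^] n \<otimes> u = t [^] n \<otimes> (v \<otimes> t [^] (1 + int k))"
  using assms(3) L T(1) unfolding mk T(3)[of n] by (simp add: m_ac)
 then have "u = v \<otimes> t [^] (1 + int k)" using m_lcancel[OF T(2)[of n] T(1)[of n]] L T(1) by simp
 also have "t [^] (1 + int k) = t [^] int (Suc k)" by simp
 also have "t [^] int (Suc k) = t [^] k \<otimes> t" by (simp only: int_pow_int nat_pow_Suc)
 finally have "u = (v \<otimes> t [^] k) \<otimes> t" using L unif_L by (simp add: m_assoc)
 moreover have "v \<otimes> t [^] k \<in> loc p" using assms(2) loc_closed(3)[OF p(1)] loc_pow[OF p(1)] loc_max_closed(2)[OF p(1) t(1)] by blast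
 ultimately show False using assms(1) loc_max_closed(4)[OF p(1) t(1)] by simp
qed

text \<open>If \<open>f\<close> were divisible by all powers of \<open>t\<close>, the quotients \<open>f t\<^sup>-\<^sup>n\<close> would form a sequence in the local ring that
contradicts the Noetherian property.\<close>

lemma loc_decompose_exists:
 assumes f: "f \<in> loc p" "f \<noteq> \<zero>"
 shows "\<exists>u\<in>loc p - loc_max p. \<exists>n::nat. f = u \<otimes> t [^] n"
proof -
 have fL: "f \<in> carrier L" using f loc_closed(1)[OF p(1)] by blast
 note it = nonzero_inv[OF unif_L]
 define g where "g n = f \<otimes> inv t [^] n" for n :: nat
 have gL: "g n \<in> carrier L" for n using fL it by (simp add: g_def)
 have gt: "g n \<otimes> t [^] n = f" for n
 proof -
  have "g n \<otimes> t [^] n = f \<otimes> (inv t \<otimes> t) [^] n"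
   unfolding nat_pow_distrib[OF it(1) unif_L(1)] using fL it unif_L by (simp add: g_def m_assoc)
  then show ?thesis using it fL by simp
 qed
 have "\<not> range g \<subseteq> loc p"
 proof
  assume "range g \<subseteq> loc p"
  from loc_noetherian[OF p(1) this] obtain n :: nat and c where c: "\<forall>i<n. c i \<in> loc p" "g n = (\<Oplus>i\<in>{..<n}. c i \<otimes> g i)" by blast
  have cL: "i < n ==> c i \<in> carrier L" for i using c loc_closed(1)[OF p(1)] by blast
  have "f = g n \<otimes> t [^] n" using gt by simp
  also have "... = (\<Oplus>i\<in>{..<n}. c i \<otimes> g i \<otimes> t [^] n)" unfolding c(2)
   by (rule finsum_ldistr) (use cL gL unif_L in auto)
  also have "... = (\<Oplus>i\<in>{..<n}. f \<otimes> (c i \<otimes> t [^] (n - i)))"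
  proof (rule finsum_cong')
   fix i assume "i \<in> {..<n}"
   then have i: "i < n" by simp
   then have "t [^] n = t [^] i \<otimes> t [^] (n - i)" using nat_pow_mult[OF unif_L(1), of i "n - i"] by simp
   then have "c i \<otimes> g i \<otimes> t [^] n = (g i \<otimes> t [^] i) \<otimes> (c i \<otimes> t [^] (n - i))"
    using cL[OF i] gL unif_L by (simp add: m_ac)
   then show "c i \<otimes> g i \<otimes> t [^] n = f \<otimes> (c i \<otimes> t [^] (n - i))" by (simp add: gt)
  qed (use cL fL unif_L in auto)
  also have "... = f \<otimes> (\<Oplus>i\<in>{..<n}. c i \<otimes> t [^] (n - i))"
   by (rule finsum_rdistr[symmetric]) (use cL fL unif_L in auto)
  finally have "f \<otimes> \<one> = f \<otimes> (\<Oplus>i\<in>{..<n}. c i \<otimes> t [^] (n - i))" using fL by simp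
  moreover have "(\<Oplus>i\<in>{..<n}. c i \<otimes> t [^] (n - i)) \<in> loc_max p"
  proof (rule loc_max_finsum[OF p(1)])
   fix i assume "i \<in> {..<n}"
   then have i: "i < n" by simp
   then obtain k where k: "n - i = Suc k" by (metis Suc_diff_Suc)
   have "t [^] (n - i) = t [^] k \<otimes> t" unfolding k by simp
   then show "c i \<otimes> t [^] (n - i) \<in> loc_max p"
    using c(1) i loc_max_closed(4)[OF p(1)] t(1) loc_pow[OF p(1)] loc_max_closed(2)[OF p(1) t(1)] by simp
  qed simp
  ultimately have "\<one> \<in> loc_max p" using m_lcancel[OF f(2) fL] loc_max_closed(1)[OF p(1)] by (metis one_closed)
  then show False using one_not_loc_max[OF p(1)] by blast
 qed
 then obtain n where "g n \<notin> loc p" by blast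
 define N where "N = (LEAST n. g n \<notin> loc p)"
 have N: "g N \<notin> loc p" unfolding N_def by (rule LeastI, fact)
 have "g 0 \<in> loc p" using f fL by (simp add: g_def)
 then obtain M where M: "N = Suc M" using N by (cases N) auto
 have gM: "g M \<in> loc p" using not_less_Least[of M "\<lambda>n. g n \<notin> loc p"] M unfolding N_def[symmetric] by auto
 moreover have "g M \<notin> loc_max p"
 proof
  assume "g M \<in> loc_max p"
  then obtain h where h: "h \<in> loc p" "g M = t \<otimes> h" unfolding t(2) by blast
  have "g N = inv t \<otimes> g M" using fL it M by (simp add: g_def m_ac)
  then have "g N = h" using h cancel_inv[OF unif_L] loc_closed(1)[OF p(1)] by simp
  then show False using N h by simp
 qed
 ultimately show ?thesis using gt[of M, symmetric] by (intro bexI[of _ "g M"] exI[of _ M]) auto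
qed

lemma unit_mult:
 assumes "u \<in> loc p - loc_max p" "v \<in> loc p - loc_max p"
 shows "u \<otimes> v \<in> loc p - loc_max p" "inv u \<in> loc p - loc_max p" "u \<in> carrier L" "u \<noteq> \<zero>"
proof -
 show "u \<in> carrier L" "u \<noteq> \<zero>" "inv u \<in> loc p - loc_max p"
  using assms(1) loc_closed(1)[OF p(1)] loc_inv[OF p(1)] by auto
 have "u \<otimes> v \<notin> loc_max p"
 proof
  assume "u \<otimes> v \<in> loc_max p"
  then have "inv u \<otimes> (u \<otimes> v) \<in> loc_max p" using loc_max_closed(4)[OF p(1)] assms(1) loc_inv[OF p(1)] by blast
  then show False using cancel_inv[of u v] assms loc_closed(1)[OF p(1)] loc_inv[OF p(1)] by auto
 qed
 then show "u \<otimes> v \<in> loc p - loc_max p" using assms loc_closed(3)[OF p(1)] by blast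
qed

lemma decompose_exists:
 assumes f: "f \<in> carrier L" "f \<noteq> \<zero>"
 shows "\<exists>u\<in>loc p - loc_max p. \<exists>n::int. f = u \<otimes> t [^] n"
proof -
 obtain a b where ab: "a \<in> S" "b \<in> S - {\<zero>}" "f \<otimes> b = a" using quotients[OF f(1)] by blast
 have bL: "b \<in> carrier L" "b \<noteq> \<zero>" using ab S_carrier by auto
 have "a \<noteq> \<zero>" using ab f nonzero_mult bL by blast
 then obtain u n where u: "u \<in> loc p - loc_max p" "a = u \<otimes> t [^] (n::nat)"
  using loc_decompose_exists[of a] S_loc[OF p(1)] ab(1) by blast
 obtain v m where v: "v \<in> loc p - loc_max p" "b = v \<otimes> t [^] (m::nat)"
  using loc_decompose_exists[of b] S_loc[OF p(1)] ab(2) by blast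
 note T = int_pow_field[OF unif_L] and uL = unit_mult(3,4)[OF u(1) v(1)] and vL = unit_mult(3,4)[OF v(1) v(1)]
 note iv = nonzero_inv[OF vL]
 have "f \<otimes> b = (u \<otimes> inv v \<otimes> t [^] (int n - int m)) \<otimes> b"
 proof -
  have "(u \<otimes> inv v \<otimes> t [^] (int n - int m)) \<otimes> b = u \<otimes> ((inv v \<otimes> v) \<otimes> (t [^] (int n - int m) \<otimes> t [^] int m))"
   unfolding v(2) using uL(1) vL(1) iv(1) T(1) unif_L(1) by (simp add: m_ac int_pow_int del: Units_l_inv Units_r_inv)
  also have "... = u \<otimes> t [^] int n" using iv uL T(1) T(3)[of "int n - int m" "int m"] by simp
  finally show ?thesis using ab(3) u(2) by (simp add: int_pow_int)
 qed
 then have "f = u \<otimes> inv v \<otimes> t [^] (int n - int m)" using m_rcancel[OF bL(2,1) f(1)] uL iv T(1) by simp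
 moreover have "u \<otimes> inv v \<in> loc p - loc_max p" using unit_mult u(1) v(1) by blast
 ultimately show ?thesis by blast
qed

lemma valuation_eqI:
 assumes u: "u \<in> loc p - loc_max p" "f = u \<otimes> t [^] (n::int)"
 shows "valuation p f = n"
 unfolding valuation_def
proof (rule the_equality)
 show "\<exists>t u. loc_max p = (\<lambda>h. t \<otimes> h) ` loc p \<and> t \<in> loc_max p \<and> u \<in> Units (L\<lparr>carrier := loc p\<rparr>) \<and> f = u \<otimes> t [^] n"
  using t u unfolding Units_loc[OF p(1)] by blast
 fix m :: int assume "\<exists>t u. loc_max p = (\<lambda>h. t \<otimes> h) ` loc p \<and> t \<in> loc_max p \<and> u \<in> Units (L\<lparr>carrier := loc p\<rparr>) \<and> f = u \<otimes> t [^] m"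
 then obtain t' v where t': "loc_max p = (\<lambda>h. t' \<otimes> h) ` loc p" "t' \<in> loc_max p" and v: "v \<in> loc p - loc_max p" "f = v \<otimes> t' [^] m"
  unfolding Units_loc[OF p(1)] by blast
 obtain h where h: "h \<in> loc p" "t' = t \<otimes> h" using t'(2) unfolding t(2) by blast
 obtain h' where h': "h' \<in> loc p" "t = t' \<otimes> h'" using t(1) unfolding t'(1) by blast
 have hL: "h \<in> carrier L" "h' \<in> carrier L" using h h' loc_closed(1)[OF p(1)] by auto
 have "t \<otimes> (h \<otimes> h') = t \<otimes> \<one>" using h h' hL unif_L by (simp add: m_assoc[symmetric])
 then have hh: "h \<otimes> h' = \<one>" using m_lcancel[OF unif_L(2,1)] hL by simp
 have hu: "h \<in> loc p - loc_max p"
  using h loc_max_closed(4)[OF p(1) _ h'(1), of h] hh hL one_not_loc_max[OF p(1)] by (auto simp: m_comm)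
 have hn: "h \<noteq> \<zero>" using hu unit_mult by blast
 interpret M: comm_group "mult_of L"
  by (rule group.group_comm_groupI[OF field_mult_group]) (auto simp: m_comm)
 have "t' [^] m = t [^] m \<otimes> h [^] m"
  using M.int_pow_mult_distrib[of t h m] h(2) unif_L hL hn int_pow_mult_of[of "t \<otimes> h" m] int_pow_mult_of[of t m]
   int_pow_mult_of[of h m] nonzero_mult[of t h] by (simp add: m_comm)
 moreover have "h [^] m \<in> loc p - loc_max p"
 proof -
  have nat: "x [^] (k::nat) \<in> loc p - loc_max p" if "x \<in> loc p - loc_max p" for x k
  proof (induction k)
   case 0 then show ?case using loc_one[OF p(1)] one_not_loc_max[OF p(1)] by simp
  next
   case (Suc k) then show ?case using unit_mult(1)[OF Suc that] by simp
  qed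
  show ?thesis
  proof (cases "m < 0")
   case True
   then have "h [^] m = inv (h [^] nat (- m))" by (simp only: int_pow_def2 if_True)
   then show ?thesis using unit_mult(2)[OF nat[OF hu] hu] by metis
  next
   case False
   then have "h [^] m = h [^] nat m" by (simp only: int_pow_def2 if_False)
   then show ?thesis using nat[OF hu] by metis
  qed
 qed
 ultimately have "f = (v \<otimes> h [^] m) \<otimes> t [^] m" and w: "v \<otimes> h [^] m \<in> loc p - loc_max p"
  using v unit_mult hL int_pow_field[OF unif_L] int_pow_field[OF hL(1) hn] loc_closed(1)[OF p(1)] by (auto simp: m_ac)
 then show "m = n" using unit_pow_unique[OF w u(1), of m n] unit_pow_unique[OF u(1) w, of n m] u(2) by fastforce
qed

lemma decompose_valuation:
 assumes "f \<in> carrier L" "f \<noteq> \<zero>"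
 obtains u where "u \<in> loc p - loc_max p" "f = u \<otimes> t [^] (valuation p f)"
 using decompose_exists[OF assms] valuation_eqI by metis

lemma valuation_mult_unif:
 assumes f: "f \<in> carrier L" "f \<noteq> \<zero>" and g: "g \<in> carrier L" "g \<noteq> \<zero>"
 shows "valuation p (f \<otimes> g) = valuation p f + valuation p g"
proof -
 obtain u where u: "u \<in> loc p - loc_max p" "f = u \<otimes> t [^] (valuation p f)" using decompose_valuation[OF f] .
 obtain v where v: "v \<in> loc p - loc_max p" "g = v \<otimes> t [^] (valuation p g)" using decompose_valuation[OF g] .
 note T = int_pow_field[OF unif_L]
 have L: "u \<in> carrier L" "v \<in> carrier L" using unit_mult(3)[OF u(1) v(1)] unit_mult(3)[OF v(1) u(1)] by auto
 have "f \<otimes> g = (u \<otimes> t [^] (valuation p f)) \<otimes> (v \<otimes> t [^] (valuation p g))" using u(2) v(2) by simp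
 also have "... = (u \<otimes> v) \<otimes> t [^] (valuation p f + valuation p g)"
  using L T(1) by (simp add: T(3) m_ac)
 finally show ?thesis by (rule valuation_eqI[OF unit_mult(1)[OF u(1) v(1)]])
qed

lemma valuation_nonneg_iff_unif:
 assumes f: "f \<in> carrier L" "f \<noteq> \<zero>"
 shows "0 \<le> valuation p f \<longleftrightarrow> f \<in> loc p" "0 < valuation p f \<longleftrightarrow> f \<in> loc_max p"
proof -
 define n where "n = valuation p f"
 obtain u where u: "u \<in> loc p - loc_max p" "f = u \<otimes> t [^] n"
  using decompose_valuation[OF f] unfolding n_def .
 show nn: "0 \<le> valuation p f \<longleftrightarrow> f \<in> loc p" unfolding n_def[symmetric]
 proof
  assume "0 \<le> n"
  then have "t [^] n = t [^] nat n" by (simp only: pow_nat)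
  then have "t [^] n \<in> loc p" using loc_pow[OF p(1)] loc_max_closed(2)[OF p(1) t(1)] by simp
  then show "f \<in> loc p" using u loc_closed(3)[OF p(1), of u] by simp
 next
  assume "f \<in> loc p"
  then obtain v m where v: "v \<in> loc p - loc_max p" "f = v \<otimes> t [^] (m::nat)" using loc_decompose_exists[OF _ f(2)] by blast
  have "n = int m" unfolding n_def
   by (rule valuation_eqI[OF v(1)]) (simp add: v(2) int_pow_int)
  then show "0 \<le> n" by simp
 qed
 show "0 < valuation p f \<longleftrightarrow> f \<in> loc_max p" unfolding n_def[symmetric]
 proof
  assume "0 < n"
  then obtain k where k: "n = int (Suc k)" using zero_less_imp_eq_int by (metis Suc_pred)
  have "f = (u \<otimes> t [^] k) \<otimes> t" using u(2) unit_mult(3)[OF u(1) u(1)] unif_L unfolding k int_pow_int by (simp add: m_assoc)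
  moreover have "u \<otimes> t [^] k \<in> loc p" using u(1) loc_closed(3)[OF p(1)] loc_pow[OF p(1)] loc_max_closed(2)[OF p(1) t(1)] by blast
  ultimately show "f \<in> loc_max p" using loc_max_closed(4)[OF p(1) t(1)] by simp
 next
  assume m: "f \<in> loc_max p"
  then have "0 \<le> n" using nn[folded n_def] loc_max_closed(2)[OF p(1)] by blast
  moreover have "n \<noteq> 0"
  proof
   assume 0: "n = 0"
   have "f = u" using u(2) unit_mult(3)[OF u(1) u(1)] unfolding 0 by simp
   then show False using m u(1) by blast
  qed
  ultimately show "0 < n" by simp
 qed
qed

lemma principal_imp_height_one: "height_one p"
 unfolding height_one_def
proof (intro conjI allI impI)
 fix q assume q: "prime_id q \<and> q \<noteq> {\<zero>} \<and> q \<subseteq> p"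
 then have qp: "prime_id q" "q \<subseteq> p" and "q \<noteq> {\<zero>}" by auto
 then obtain x where x: "x \<in> q" "x \<noteq> \<zero>" using prime_idD(3) by blast
 have xS: "x \<in> S" using x prime_idD(2)[OF qp(1)] by blast
 obtain u n where u: "u \<in> loc p - loc_max p" "x = u \<otimes> t [^] (n::nat)"
  using loc_decompose_exists[of x] x S_loc[OF p(1)] xS by blast
 note uL = unit_mult(3,4)[OF u(1) u(1)]
 show "q = p"
 proof
  show "p \<subseteq> q"
  proof
   fix y assume y: "y \<in> p"
   then have yS: "y \<in> S" using prime_idD(2)[OF p(1)] by blast
   obtain w where w: "w \<in> loc p" "y = t \<otimes> w" using y p_loc_max[OF p(1)] unfolding t(2) by blast
   have wL: "w \<in> carrier L" using w loc_closed(1)[OF p(1)] by blast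
   have "inv u \<otimes> w [^] n \<in> loc p" using loc_closed(3)[OF p(1)] loc_pow[OF p(1) w(1)] unit_mult(2)[OF u(1) u(1)] by blast
   then obtain h where h: "h \<in> S - p" "h \<otimes> (inv u \<otimes> w [^] n) \<in> S" unfolding loc_def by blast
   have hL: "h \<in> carrier L" using h S_carrier by blast
   have iu: "inv u \<in> carrier L" using nonzero_inv[OF uL] by blast
   have "h \<otimes> y [^] n = h \<otimes> (t [^] n \<otimes> w [^] n)" unfolding w(2) nat_pow_distrib[OF unif_L(1) wL] ..
   also have "... = h \<otimes> (inv u \<otimes> (u \<otimes> (t [^] n \<otimes> w [^] n)))" using cancel_inv(1)[OF uL] unif_L wL by simp
   also have "... = (h \<otimes> (inv u \<otimes> w [^] n)) \<otimes> x" unfolding u(2) using hL iu wL uL(1) unif_L(1)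
    by (simp add: m_ac del: Units_l_inv Units_r_inv)
   also have "... \<in> q" by (rule prime_idD(5)[OF qp(1) h(2) x(1)])
   finally have "h \<in> q \<or> y [^] n \<in> q" using prime_idD(7)[OF qp(1)] h(1) pow_S[OF yS] by blast
   then show "y \<in> q" using h(1) qp(2) prime_id_pow[OF qp(1) yS] by blast
  qed
 qed (rule qp(2))
qed (use p in auto)

end

lemma height_one_cases:
 assumes "height_one p"
 obtains t where "prime_id p" "p \<noteq> {\<zero>}" "t \<in> loc_max p" "loc_max p = (\<lambda>h. t \<otimes> h) ` loc p"
 using assms height_one_uniformizer[OF assms] unfolding height_one_def by blast

lemma valuation_mult:
 assumes "height_one p" "f \<in> carrier L" "f \<noteq> \<zero>" "g \<in> carrier L" "g \<noteq> \<zero>"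
 shows "valuation p (f \<otimes> g) = valuation p f + valuation p g"
 using height_one_cases[OF assms(1)] valuation_mult_unif assms(2-) by metis

lemma valuation_nonneg_iff:
 assumes "height_one p" "f \<in> carrier L" "f \<noteq> \<zero>"
 shows "0 \<le> valuation p f \<longleftrightarrow> f \<in> loc p" "0 < valuation p f \<longleftrightarrow> f \<in> loc_max p"
 using height_one_cases[OF assms(1)] valuation_nonneg_iff_unif assms(2-) by metis+

lemma valuation_one: "height_one p ==> valuation p \<one> = 0"
 using valuation_mult[of p \<one> \<one>] by simp

lemma valuation_inv:
 assumes "height_one p" "f \<in> carrier L" "f \<noteq> \<zero>"
 shows "valuation p (inv f) = - valuation p f"
 using valuation_mult[OF assms, of "inv f"] nonzero_inv[OF assms(2,3)] valuation_one[OF assms(1)] by simp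

lemma valuation_pow:
 assumes "height_one p" "f \<in> carrier L" "f \<noteq> \<zero>"
 shows "valuation p (f [^] (n::nat)) = int n * valuation p f"
 by (induction n) (use assms valuation_one valuation_mult nonzero_pow in \<open>auto simp: algebra_simps\<close>)

lemma exists_valuation_eq:
 assumes "height_one p"
 shows "\<exists>f\<in>carrier L. f \<noteq> \<zero> \<and> valuation p f = n"
proof -
 obtain t where t: "prime_id p" "p \<noteq> {\<zero>}" "t \<in> loc_max p" "loc_max p = (\<lambda>h. t \<otimes> h) ` loc p"
  using height_one_cases[OF assms] .
 note T = int_pow_field[OF unif_L[OF t]]
 have "valuation p (t [^] n) = n"
 proof (rule valuation_eqI[OF t])
  show "\<one> \<in> loc p - loc_max p" using loc_one[OF t(1)] one_not_loc_max[OF t(1)] by blast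
  show "t [^] n = \<one> \<otimes> t [^] n" using T by simp
 qed
 then show ?thesis using T by blast
qed

lemma valuation_add:
 assumes "height_one p" "f \<in> carrier L" "f \<noteq> \<zero>" "g \<in> carrier L" "g \<noteq> \<zero>" "f \<oplus> g \<noteq> \<zero>"
  and n: "n \<le> valuation p f" "n \<le> valuation p g"
 shows "n \<le> valuation p (f \<oplus> g)"
proof -
 have p: "prime_id p" using assms(1) height_one_def by blast
 obtain t where t: "t \<in> carrier L" "t \<noteq> \<zero>" "valuation p t = - n" using exists_valuation_eq[OF assms(1)] by blast
 have "t \<otimes> f \<in> loc p" "t \<otimes> g \<in> loc p"
  using valuation_nonneg_iff(1)[OF assms(1), of "t \<otimes> f"] valuation_nonneg_iff(1)[OF assms(1), of "t \<otimes> g"]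
   valuation_mult[OF assms(1) t(1,2)] nonzero_mult[of t] t assms by auto
 then have "t \<otimes> (f \<oplus> g) \<in> loc p" using loc_closed(2)[OF p] t assms by (simp add: r_distr)
 then show ?thesis
  using valuation_nonneg_iff(1)[OF assms(1), of "t \<otimes> (f \<oplus> g)"] valuation_mult[OF assms(1) t(1,2), of "f \<oplus> g"]
   nonzero_mult[of t "f \<oplus> g"] t assms by auto
qed

lemma valuation_S:
 assumes "height_one p" "x \<in> S" "x \<noteq> \<zero>"
 shows "0 \<le> valuation p x" "0 < valuation p x \<longleftrightarrow> x \<in> p"
proof -
 have p: "prime_id p" using assms(1) height_one_def by blast
 show "0 \<le> valuation p x" using valuation_nonneg_iff(1)[OF assms(1)] S_loc[OF p] S_carrier assms(2,3) by blast
 have "x \<in> loc_max p \<longleftrightarrow> x \<in> p"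
  using p_loc_max[OF p] prime_idD(7)[OF p] assms(2) unfolding loc_max_def by blast
 then show "0 < valuation p x \<longleftrightarrow> x \<in> p" using valuation_nonneg_iff(2)[OF assms(1)] S_carrier assms(2,3) by blast
qed

text \<open>Otherwise some element has a prime conductor over that of the given one. The maximal ideal at that
prime is principal, so the prime has height one, and the given element is not regular there.\<close>

lemma intersection_of_localizations:
 assumes f: "f \<in> carrier L" "f \<noteq> \<zero>" and nn: "\<And>p. height_one p ==> 0 \<le> valuation p f"
 shows "f \<in> S"
proof (rule ccontr)
 assume "f \<notin> S"
 from prime_conductor[OF subset_refl sub(1,3,4) f(1) this]
 obtain z where z: "z \<in> carrier L" "z \<notin> S" "prime_id {s \<in> S. s \<otimes> z \<in> S}" "{s \<in> S. s \<otimes> z \<in> S} \<noteq> {\<zero>}"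
  "{s \<in> S. s \<otimes> f \<in> S} \<subseteq> {s \<in> S. s \<otimes> z \<in> S}" by blast
 define q where "q = {s \<in> S. s \<otimes> z \<in> S}"
 have q: "prime_id q" "q \<noteq> {\<zero>}" using z by (auto simp: q_def)
 have "z \<notin> loc q" by (auto simp: loc_def q_def)
 moreover have "s \<otimes> z \<in> loc q" if "s \<in> q" for s using that S_loc[OF q(1)] by (auto simp: q_def)
 ultimately have "inv z \<in> loc_max q" "loc_max q = (\<lambda>h. inv z \<otimes> h) ` loc q"
  using loc_max_principal[OF q z(1)] by blast+
 then have h1: "height_one q" using principal_imp_height_one[OF q] by blast
 have "f \<notin> loc q" using z(5) by (auto simp: loc_def q_def)
 then show False using nn[OF h1] valuation_nonneg_iff(1)[OF h1 f] by blast
qed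

text \<open>An ideal that is maximal among those contained in infinitely many primes of height one is prime. It lies in
more than one prime of height one, which contradicts their minimality.\<close>

lemma finite_height_one_containing:
 assumes x: "x \<in> S" "x \<noteq> \<zero>"
 shows "finite {p. height_one p \<and> x \<in> p}"
proof (rule ccontr)
 assume inf: "infinite {p. height_one p \<and> x \<in> p}"
 define F where "F = {J. ideal_in J \<and> x \<in> J \<and> infinite {p. height_one p \<and> J \<subseteq> p}}"
 have h1: "prime_id p" if "height_one p" for p using that height_one_def by blast
 have principal: "ideal_in ((\<lambda>s. s \<otimes> x) ` S)" unfolding ideal_in_def
 proof (intro conjI ballI)
  have xL: "x \<in> carrier L" using x S_carrier by blast
  show "(\<lambda>s. s \<otimes> x) ` S \<subseteq> S" using x sub(4) by blast
  show "\<zero> \<in> (\<lambda>s. s \<otimes> x) ` S" using zero_S xL by (auto intro!: image_eqI[of _ _ \<zero>])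
  fix a assume "a \<in> (\<lambda>s. s \<otimes> x) ` S"
  then obtain s where s: "s \<in> S" "a = s \<otimes> x" by blast
  show "a \<oplus> b \<in> (\<lambda>s. s \<otimes> x) ` S" if "b \<in> (\<lambda>s. s \<otimes> x) ` S" for b
  proof -
   obtain s' where s': "s' \<in> S" "b = s' \<otimes> x" using \<open>b \<in> (\<lambda>s. s \<otimes> x) ` S\<close> by blast
   have "a \<oplus> b = (s \<oplus> s') \<otimes> x" using s s' xL S_carrier by (simp add: l_distr)
   then show ?thesis using s s' sub(3) by blast
  qed
  show "r \<otimes> a \<in> (\<lambda>s. s \<otimes> x) ` S" if "r \<in> S" for r
  proof -
   have "r \<otimes> a = (r \<otimes> s) \<otimes> x" using s that xL S_carrier by (simp add: m_assoc)
   then show ?thesis using s that sub(4) by blast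
  qed
 qed
 have xx: "x \<in> (\<lambda>s. s \<otimes> x) ` S" using sub(2) x S_carrier by (auto intro!: image_eqI[of _ _ \<one>])
 have "{p. height_one p \<and> x \<in> p} \<subseteq> {p. height_one p \<and> (\<lambda>s. s \<otimes> x) ` S \<subseteq> p}"
  using h1 prime_idD(5) by blast
 then have "infinite {p. height_one p \<and> (\<lambda>s. s \<otimes> x) ` S \<subseteq> p}" using inf finite_subset by blast
 then have "(\<lambda>s. s \<otimes> x) ` S \<in> F" using principal xx by (simp add: F_def)
 then have "F \<noteq> {}" by blast
 moreover have "\<And>J. J \<in> F ==> ideal_in J" by (simp add: F_def)
 ultimately obtain J where J: "J \<in> F" "\<And>J'. J' \<in> F ==> J \<subseteq> J' ==> J' = J" using maximal_ideal_exists[of F] by blast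
 then have JI: "ideal_in J" and xJ: "x \<in> J" and Jinf: "infinite {p. height_one p \<and> J \<subseteq> p}" by (auto simp: F_def)
 obtain p0 where "height_one p0" "J \<subseteq> p0" using Jinf not_finite_existsD by blast
 then have "\<one> \<notin> J" using h1 prime_idD(6) by blast
 have "\<not> prime_id J"
 proof
  assume pJ: "prime_id J"
  have "J \<noteq> {\<zero>}" using xJ x by blast
  then have "{p. height_one p \<and> J \<subseteq> p} \<subseteq> {J}" using pJ unfolding height_one_def by blast
  then show False using Jinf finite_subset by blast
 qed
 then obtain a b where ab: "a \<in> S" "b \<in> S" "a \<otimes> b \<in> J" "a \<notin> J" "b \<notin> J"
  using JI \<open>\<one> \<notin> J\<close> unfolding prime_id_def by blast
 define Jp where "Jp c = {j \<oplus> s \<otimes> c | j s. j \<in> J \<and> s \<in> S}" for c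
 have JS: "J \<subseteq> carrier L" using ideal_inD(1)[OF JI] sub(1) by blast
 have Jp: "J \<subseteq> Jp c" "c \<in> Jp c" "ideal_in (Jp c)" if c: "c \<in> S" for c
 proof -
  have cL: "c \<in> carrier L" using c S_carrier by blast
  show "J \<subseteq> Jp c"
  proof
   fix j assume "j \<in> J"
   moreover have "j = j \<oplus> \<zero> \<otimes> c" using \<open>j \<in> J\<close> JS cL by auto
   ultimately show "j \<in> Jp c" unfolding Jp_def using zero_S by blast
  qed
  have "c = \<zero> \<oplus> \<one> \<otimes> c" using cL by simp
  then show "c \<in> Jp c" unfolding Jp_def using ideal_inD(2)[OF JI] sub(2) by blast
  show "ideal_in (Jp c)" unfolding ideal_in_def
  proof (intro conjI ballI)
   show "Jp c \<subseteq> S" using ideal_inD(1)[OF JI] c sub(3,4) by (auto simp: Jp_def)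
   show "\<zero> \<in> Jp c" using \<open>J \<subseteq> Jp c\<close> ideal_inD(2)[OF JI] by blast
   fix y assume "y \<in> Jp c"
   then obtain j s where js: "j \<in> J" "s \<in> S" "y = j \<oplus> s \<otimes> c" unfolding Jp_def by blast
   have jsL: "j \<in> carrier L" "s \<in> carrier L" using js JS S_carrier by auto
   show "y \<oplus> y' \<in> Jp c" if "y' \<in> Jp c" for y'
   proof -
    obtain j' s' where js': "j' \<in> J" "s' \<in> S" "y' = j' \<oplus> s' \<otimes> c" using \<open>y' \<in> Jp c\<close> unfolding Jp_def by blast
    have "y \<oplus> y' = (j \<oplus> j') \<oplus> (s \<oplus> s') \<otimes> c" using js js' jsL JS S_carrier cL by (auto simp: l_distr a_ac)
    then show ?thesis unfolding Jp_def using ideal_inD(3)[OF JI] js js' sub(3) by blast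
   qed
   show "r \<otimes> y \<in> Jp c" if "r \<in> S" for r
   proof -
    have "r \<otimes> y = r \<otimes> j \<oplus> (r \<otimes> s) \<otimes> c" using js jsL that S_carrier cL by (simp add: r_distr m_assoc)
    then show ?thesis unfolding Jp_def using ideal_inD(4)[OF JI] js that sub(4) by blast
   qed
  qed
 qed
 have "{p. height_one p \<and> J \<subseteq> p} \<subseteq> {p. height_one p \<and> Jp a \<subseteq> p} \<union> {p. height_one p \<and> Jp b \<subseteq> p}"
 proof
  fix p assume p: "p \<in> {p. height_one p \<and> J \<subseteq> p}"
  then have pp: "prime_id p" and Jp': "J \<subseteq> p" using h1 by auto
  have "Jp c \<subseteq> p" if "c \<in> p" for c using prime_idD(4,5)[OF pp] Jp' that by (auto simp: Jp_def)
  moreover have "a \<in> p \<or> b \<in> p" using prime_idD(7)[OF pp ab(1,2)] ab(3) Jp' by blast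
  ultimately show "p \<in> {p. height_one p \<and> Jp a \<subseteq> p} \<union> {p. height_one p \<and> Jp b \<subseteq> p}" using p by blast
 qed
 then obtain c where "c \<in> {a, b}" "infinite {p. height_one p \<and> Jp c \<subseteq> p}"
  using Jinf by (metis finite_Un finite_subset insertCI)
 then have "Jp c \<in> F" "J \<subseteq> Jp c" "c \<in> Jp c" "c \<notin> J" using Jp[of c] ab xJ by (auto simp: F_def)
 then show False using J(2) by blast
qed

lemma finite_valuation_nonzero:
 assumes f: "f \<in> carrier L" "f \<noteq> \<zero>"
 shows "finite {p. height_one p \<and> valuation p f \<noteq> 0}"
proof -
 obtain a b where ab: "a \<in> S" "b \<in> S - {\<zero>}" "f \<otimes> b = a" using quotients[OF f(1)] by blast
 then have bL: "b \<in> S" "b \<in> carrier L" "b \<noteq> \<zero>" using S_carrier by auto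
 have a0: "a \<noteq> \<zero>" using ab(3) f bL nonzero_mult by blast
 have "{p. height_one p \<and> valuation p f \<noteq> 0} \<subseteq> {p. height_one p \<and> a \<in> p} \<union> {p. height_one p \<and> b \<in> p}"
 proof
  fix p assume "p \<in> {p. height_one p \<and> valuation p f \<noteq> 0}"
  then have p: "height_one p" "valuation p f \<noteq> 0" by auto
  have "valuation p f + valuation p b = valuation p a" using valuation_mult[OF p(1) f bL(2,3)] ab(3) by simp
  then have "valuation p a \<noteq> 0 \<or> valuation p b \<noteq> 0" using p(2) by linarith
  then show "p \<in> {p. height_one p \<and> a \<in> p} \<union> {p. height_one p \<and> b \<in> p}"
   using valuation_S[OF p(1) ab(1) a0] valuation_S[OF p(1) bL(1,3)] p(1) by auto
 qed
 then show ?thesis using finite_height_one_containing[OF ab(1) a0] finite_height_one_containing[OF bL(1,3)]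
  by (meson finite_Un finite_subset)
qed

text \<open>Start with an element of the right order at \<open>p\<close>. Its finitely many defects at other primes are repaired by
multiplying with elements that lie in these primes but not in \<open>p\<close>.\<close>

lemma exists_prescribed_valuation:
 assumes p: "height_one p" and d: "finite {q. height_one q \<and> d q \<noteq> (0::int)}"
 shows "\<exists>f\<in>carrier L. f \<noteq> \<zero> \<and> valuation p f = d p \<and> (\<forall>q. height_one q \<longrightarrow> d q \<le> valuation q f)"
proof -
 have pp: "prime_id p" using p height_one_def by blast
 obtain f0 where f0: "f0 \<in> carrier L" "f0 \<noteq> \<zero>" "valuation p f0 = d p" using exists_valuation_eq[OF p] by blast
 have corr: "\<exists>g\<in>S. g \<notin> p \<and> (\<forall>q\<in>Q. m q \<le> valuation q g)"
  if "finite Q" "\<And>q. q \<in> Q ==> height_one q \<and> q \<noteq> p" for Q and m :: "'a set \<Rightarrow> int"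
  using that
 proof (induction rule: finite_induct)
  case empty then show ?case using sub(2) prime_idD(6)[OF pp] by blast
 next
  case (insert q Q)
  then obtain g where g: "g \<in> S" "g \<notin> p" "\<forall>q\<in>Q. m q \<le> valuation q g" by blast
  have q: "height_one q" "q \<noteq> p" using insert.prems by auto
  then have "\<not> q \<subseteq> p" using p unfolding height_one_def by blast
  then obtain x where x: "x \<in> q" "x \<notin> p" by blast
  have xS: "x \<in> S" using x q height_one_def prime_idD(2) by blast
  have x0: "x \<noteq> \<zero>" "g \<noteq> \<zero>" using x g prime_idD(3)[OF pp] by auto
  note L = S_carrier[OF xS] S_carrier[OF g(1)]
  let ?g = "x [^] nat (m q) \<otimes> g"
  have "?g \<in> S" using pow_S xS g sub(4) by blast
  moreover have "?g \<notin> p" using prime_idD(7)[OF pp pow_S[OF xS] g(1)] prime_id_pow[OF pp xS] x g by blast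
  moreover have "m r \<le> valuation r ?g" if r: "r \<in> insert q Q" for r
  proof -
   have hr: "height_one r" using r insert.prems by blast
   have v: "valuation r ?g = int (nat (m q)) * valuation r x + valuation r g"
    using valuation_mult[OF hr _ nonzero_pow[OF L(1) x0(1)] L(2) x0(2)] valuation_pow[OF hr L(1) x0(1)] L by simp
   have nn: "0 \<le> valuation r x" "0 \<le> valuation r g" using valuation_S(1)[OF hr] xS g(1) x0 by auto
   show ?thesis
   proof (cases "r = q")
    case True
    then have "1 \<le> valuation r x" using valuation_S(2)[OF hr xS x0(1)] x(1) by simp
    then have "int (nat (m q)) * 1 \<le> int (nat (m q)) * valuation r x" by (intro mult_left_mono) auto
    moreover have "m r \<le> int (nat (m q))" using True by simp
    ultimately show ?thesis unfolding v using nn(2) by linarith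
   next
    case False
    then have "m r \<le> valuation r g" using r g by blast
    moreover have "0 \<le> int (nat (m q)) * valuation r x" using nn by simp
    ultimately show ?thesis unfolding v by linarith
   qed
  qed
  ultimately show ?case by blast
 qed
 define Q where "Q = {q. height_one q \<and> valuation q f0 < d q}"
 have "Q \<subseteq> {q. height_one q \<and> valuation q f0 \<noteq> 0} \<union> {q. height_one q \<and> d q \<noteq> 0}" unfolding Q_def by auto
 then have "finite Q" using finite_valuation_nonzero[OF f0(1,2)] d finite_subset by blast
 moreover have "\<And>q. q \<in> Q ==> height_one q \<and> q \<noteq> p" using f0(3) by (auto simp: Q_def)
 ultimately obtain g where g: "g \<in> S" "g \<notin> p" "\<forall>q\<in>Q. d q - valuation q f0 \<le> valuation q g"
  using corr[of Q "\<lambda>q. d q - valuation q f0"] by blast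
 have g0: "g \<in> carrier L" "g \<noteq> \<zero>" using g prime_idD(3)[OF pp] S_carrier by auto
 have "valuation p g = 0" using valuation_S[OF p g(1) g0(2)] g(2) by simp
 then have "valuation p (f0 \<otimes> g) = d p" using valuation_mult[OF p f0(1,2) g0] f0(3) by simp
 moreover have "d q \<le> valuation q (f0 \<otimes> g)" if q: "height_one q" for q
 proof (cases "q \<in> Q")
  case True then show ?thesis using g(3) valuation_mult[OF q f0(1,2) g0] by fastforce
 next
  case False
  then have "d q \<le> valuation q f0" using q Q_def by auto
  then show ?thesis using valuation_S(1)[OF q g(1) g0(2)] valuation_mult[OF q f0(1,2) g0] by simp
 qed
 ultimately show ?thesis using f0 g0 nonzero_mult by (intro bexI[of _ "f0 \<otimes> g"]) auto
qed

end

section \<open>Characters and quasitori\<close>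

text \<open>The graph of a partial character: a subgroup of \<open>G \<times> \<bbbK>\<^sup>\<times>\<close> that meets \<open>{1} \<times> \<bbbK>\<^sup>\<times>\<close> trivially.\<close>

definition partial_character :: "('a, 'b) monoid_scheme \<Rightarrow> ('a \<times> 'k::field) set \<Rightarrow> bool" where
 "partial_character G Gamma \<longleftrightarrow> Gamma \<subseteq> carrier G \<times> (UNIV - {0}) \<and> (\<one>\<^bsub>G\<^esub>, 1) \<in> Gamma \<and>
   (\<forall>x a y b. (x, a) \<in> Gamma \<longrightarrow> (y, b) \<in> Gamma \<longrightarrow> (x \<otimes>\<^bsub>G\<^esub> y, a * b) \<in> Gamma) \<and>
   (\<forall>x a. (x, a) \<in> Gamma \<longrightarrow> (inv\<^bsub>G\<^esub> x, inverse a) \<in> Gamma) \<and>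
   (\<forall>a. (\<one>\<^bsub>G\<^esub>, a) \<in> Gamma \<longrightarrow> a = 1)"

definition character_on :: "('a, 'b) monoid_scheme \<Rightarrow> ('a \<Rightarrow> 'k::field) \<Rightarrow> bool" where
 "character_on G xi \<longleftrightarrow> (\<forall>x\<in>carrier G. xi x \<noteq> 0) \<and>
   (\<forall>x\<in>carrier G. \<forall>y\<in>carrier G. xi (x \<otimes>\<^bsub>G\<^esub> y) = xi x * xi y)"

lemma character_onD:
 assumes "character_on G xi"
 shows "x \<in> carrier G ==> xi x \<noteq> 0" "x \<in> carrier G ==> y \<in> carrier G ==> xi (x \<otimes>\<^bsub>G\<^esub> y) = xi x * xi y"
 using assms by (auto simp: character_on_def)

lemma (in group) character_on_one_inv:
 assumes "character_on G xi"
 shows "xi \<one> = 1" "x \<in> carrier G ==> xi (inv x) = inverse (xi x)"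
proof -
 note X = character_onD[OF assms]
 show 1: "xi \<one> = 1" using X(2)[of \<one> \<one>] X(1)[of \<one>] by simp
 show "xi (inv x) = inverse (xi x)" if "x \<in> carrier G"
  using X(2)[of "inv x" x] X(1)[OF that] 1 that by (simp add: field_simps)
qed

context comm_group begin

lemma partial_characterD:
 assumes "partial_character G Gamma"
 shows "(x, a) \<in> Gamma ==> x \<in> carrier G" "(x, a) \<in> Gamma ==> a \<noteq> 0" "(\<one>, 1) \<in> Gamma"
  "(x, a) \<in> Gamma ==> (y, b) \<in> Gamma ==> (x \<otimes> y, a * b) \<in> Gamma"
  "(x, a) \<in> Gamma ==> (inv x, inverse a) \<in> Gamma"
  "(\<one>, a) \<in> Gamma ==> a = 1"
 using assms unfolding partial_character_def by blast+

lemma partial_character_unique: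
 assumes "partial_character G Gamma" "(x, a) \<in> Gamma" "(x, b) \<in> Gamma"
 shows "a = b"
proof -
 note D = partial_characterD[OF assms(1)]
 have "(x \<otimes> inv x, a * inverse b) \<in> Gamma" using D(4,5) assms by blast
 then have "a * inverse b = 1" using D(1)[OF assms(2)] D(6) by simp
 then show ?thesis using D(2)[OF assms(3)] by (simp add: field_simps)
qed

lemma partial_character_pow:
 assumes "partial_character G Gamma" "(x, a) \<in> Gamma"
 shows "(x [^] (i::int), a powi i) \<in> Gamma"
proof -
 note D = partial_characterD[OF assms(1)]
 have nat: "(x [^] (n::nat), a ^ n) \<in> Gamma" for n
 proof (induction n)
  case (Suc n) then show ?case using D(4)[OF Suc assms(2)] by (simp add: mult.commute)
 qed (use D(3) in simp)
 show ?thesis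
 proof (cases "i < 0")
  case True
  have "x [^] i = inv (x [^] nat (- i))" using True by (simp only: int_pow_def2 if_True)
  moreover have "a powi i = inverse (a ^ nat (- i))" using True by (simp add: power_int_def power_inverse)
  ultimately show ?thesis using D(5)[OF nat[of "nat (- i)"]] by metis
 next
  case False
  have "x [^] i = x [^] nat i" using False by (simp only: int_pow_def2 if_False)
  moreover have "a powi i = a ^ nat i" using False by (simp add: power_int_def)
  ultimately show ?thesis using nat[of "nat i"] by metis
 qed
qed

lemma partial_character_adjoin:
 fixes Gamma :: "('a \<times> 'k::field) set"
 assumes P: "partial_character G Gamma" and g: "g \<in> carrier G" and z: "z \<noteq> 0"
  and comp: "\<And>(i::int) a. (g [^] i, a) \<in> Gamma ==> a = z powi i"
 shows "\<exists>Gamma'. partial_character G Gamma' \<and> Gamma \<subseteq> Gamma' \<and> (g, z) \<in> Gamma'"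
proof -
 note D = partial_characterD[OF P]
 define Gamma' where "Gamma' = {(x \<otimes> g [^] i, a * z powi i) | x a (i::int). (x, a) \<in> Gamma}"
 have mem: "(x \<otimes> g [^] (i::int), a * z powi i) \<in> Gamma'" if "(x, a) \<in> Gamma" for x a i
  unfolding Gamma'_def using that by blast
 have sub: "Gamma \<subseteq> Gamma'"
 proof
  fix y assume "y \<in> Gamma"
  then obtain x a where y: "y = (x, a)" "(x, a) \<in> Gamma" by (cases y) auto
  then show "y \<in> Gamma'" using mem[OF y(2), of 0] D(1)[OF y(2)] by simp
 qed
 have gz: "(g, z) \<in> Gamma'" using mem[OF D(3), of 1] g by simp
 have "partial_character G Gamma'" unfolding partial_character_def
 proof (intro conjI allI impI)
  show "Gamma' \<subseteq> carrier G \<times> (UNIV - {0})" unfolding Gamma'_def using D(1,2) g z by auto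
  show "(\<one>, 1) \<in> Gamma'" using sub D(3) by blast
 next
  fix x a y b assume "(x, a) \<in> Gamma'" "(y, b) \<in> Gamma'"
  then obtain x' a' i y' b' j where *: "(x', a') \<in> Gamma" "x = x' \<otimes> g [^] (i::int)" "a = a' * z powi i"
   "(y', b') \<in> Gamma" "y = y' \<otimes> g [^] (j::int)" "b = b' * z powi j" unfolding Gamma'_def by blast
  have "x \<otimes> y = (x' \<otimes> y') \<otimes> g [^] (i + j)" using * D(1) g by (simp add: int_pow_mult m_ac)
  moreover have "a * b = (a' * b') * z powi (i + j)" using * z by (simp add: power_int_add mult_ac)
  ultimately show "(x \<otimes> y, a * b) \<in> Gamma'" using mem[OF D(4)[OF *(1,4)]] by metis
 next
  fix x a assume "(x, a) \<in> Gamma'"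
  then obtain x' a' i where *: "(x', a') \<in> Gamma" "x = x' \<otimes> g [^] (i::int)" "a = a' * z powi i" unfolding Gamma'_def by blast
  have "inv x = inv x' \<otimes> g [^] (- i)" using * D(1) g by (simp add: inv_mult int_pow_neg)
  moreover have "inverse a = inverse a' * z powi (- i)" using * z by (simp add: power_int_minus)
  ultimately show "(inv x, inverse a) \<in> Gamma'" using mem[OF D(5)[OF *(1)]] by metis
 next
  fix a assume "(\<one>, a) \<in> Gamma'"
  then obtain x' a' i where *: "(x', a') \<in> Gamma" "\<one> = x' \<otimes> g [^] (i::int)" "a = a' * z powi i" unfolding Gamma'_def by blast
  then have "x' = g [^] (- i)" using D(1)[OF *(1)] g inv_equality[of x' "g [^] i"] by (simp add: int_pow_neg)
  then have "a' = z powi (- i)" using comp *(1) by blast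
  then show "a = 1" using *(3) z by (simp add: power_int_minus)
 qed
 then show ?thesis using sub gz by blast
qed

lemma partial_character_adjoin_any:
 fixes Gamma :: "('a \<times> 'k::alg_closed_field) set"
 assumes P: "partial_character G Gamma" and g: "g \<in> carrier G"
 shows "\<exists>z Gamma'. partial_character G Gamma' \<and> Gamma \<subseteq> Gamma' \<and> (g, z) \<in> Gamma'"
proof (cases "\<exists>n a. 0 < n \<and> (g [^] (n::nat), a) \<in> Gamma")
 case False
 have "a = 1 powi i" if "(g [^] (i::int), a) \<in> Gamma" for i a
 proof (cases i "0::int" rule: linorder_cases)
  case less
  have "(g [^] (- i), inverse a) \<in> Gamma" using partial_characterD(5)[OF P that] g by (simp add: int_pow_neg)
  moreover have "g [^] (- i) = g [^] nat (- i)" using less by (simp only: pow_nat)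
  ultimately have "(g [^] nat (- i), inverse a) \<in> Gamma" by metis
  then show ?thesis using False less by (metis neg_less_0_iff_less zero_less_nat_eq neg_0_less_iff_less)
 next
  case equal then show ?thesis using partial_characterD(6)[OF P] that by simp
 next
  case greater
  then have "g [^] i = g [^] nat i" by (simp only: pow_nat)
  then have "(g [^] nat i, a) \<in> Gamma" using that by metis
  then show ?thesis using False greater by (metis zero_less_nat_eq)
 qed
 then show ?thesis using partial_character_adjoin[OF P g, of 1] by (metis one_neq_zero)
next
 case True
 define n where "n = (LEAST n::nat. 0 < n \<and> (\<exists>a. (g [^] n, a) \<in> Gamma))"
 have "\<exists>n. 0 < n \<and> (\<exists>a. (g [^] (n::nat), a) \<in> Gamma)" using True by blast
 from LeastI_ex[OF this] have "0 < n \<and> (\<exists>a. (g [^] n, a) \<in> Gamma)" unfolding n_def .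
 then obtain c where n: "0 < n" "(g [^] n, c) \<in> Gamma" by blast
 have least: "\<not> (\<exists>a. (g [^] m, a) \<in> Gamma)" if "0 < m" "m < n" for m
  using not_less_Least[of m "\<lambda>n. 0 < n \<and> (\<exists>a. (g [^] n, a) \<in> Gamma)"] that unfolding n_def[symmetric] by blast
 have "coeff (monom 1 n - [:c:]) n = 1" using n(1) by (cases n) auto
 then have "degree (monom 1 n - [:c:]) > 0" using n(1) le_degree[of "monom 1 n - [:c:]" n] by auto
 then obtain z where "poly (monom 1 n - [:c:]) z = 0" using alg_closed_imp_poly_has_root by blast
 then have z: "z ^ n = c" by (simp add: poly_monom)
 have z0: "z \<noteq> 0" using partial_characterD(2)[OF P n(2)] z n(1) by auto
 have "a = z powi i" if ia: "(g [^] (i::int), a) \<in> Gamma" for i a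
 proof -
  define q where "q = i div int n"
  define r where "r = nat (i mod int n)"
  have i: "i = int n * q + int r" using n(1) by (simp add: q_def r_def)
  have rn: "r < n" using n(1) by (simp add: r_def) (metis of_nat_0_less_iff pos_mod_bound pos_mod_sign nat_less_iff)
  have gn: "((g [^] n) [^] q, c powi q) \<in> Gamma" by (rule partial_character_pow[OF P n(2)])
  have gnq: "(g [^] n) [^] q = g [^] (int n * q)"
   using int_pow_pow[OF g, of "int n" q] by (simp add: int_pow_int)
  have "(g [^] i \<otimes> inv ((g [^] n) [^] q), a * inverse (c powi q)) \<in> Gamma"
   using partial_characterD(4,5)[OF P] ia gn by blast
  moreover have "g [^] i \<otimes> inv ((g [^] n) [^] q) = g [^] r"
  proof -
   have "g [^] i = g [^] int r \<otimes> g [^] (int n * q)" using i int_pow_mult[OF g, of "int r" "int n * q"] by (simp add: add.commute)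
   then show ?thesis unfolding gnq using g by (simp add: m_assoc int_pow_int)
  qed
  ultimately have "(g [^] r, a * inverse (c powi q)) \<in> Gamma" by simp
  then have "r = 0" using least[of r] rn by blast
  then have "(g [^] i, c powi q) \<in> Gamma" using gn gnq i by simp
  then have "a = c powi q" using partial_character_unique[OF P ia] by blast
  also have "... = z powi i" using z i \<open>r = 0\<close> by (simp add: power_int_mult flip: z)
  finally show ?thesis .
 qed
 then show ?thesis using partial_character_adjoin[OF P g z0] by blast
qed

text \<open>Since \<open>\<bbbK>\<^sup>\<times>\<close> is divisible, partial characters extend; a maximal one is defined everywhere.\<close>

lemma partial_character_total:
 fixes Gamma :: "('a \<times> 'k::alg_closed_field) set"
 assumes "partial_character G Gamma"
 shows "\<exists>xi. character_on G xi \<and> (\<forall>(x, a)\<in>Gamma. xi x = a)"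
proof -
 define A where "A = {Gamma'. partial_character G Gamma' \<and> Gamma \<subseteq> Gamma'}"
 have "\<exists>M\<in>A. \<forall>X\<in>A. M \<subseteq> X \<longrightarrow> X = M"
 proof (rule subset_Zorn_nonempty)
  show "A \<noteq> {}" using assms A_def by blast
  fix C assume C: "C \<noteq> {}" "subset.chain A C"
  then have CA: "\<And>X. X \<in> C ==> partial_character G X" "\<And>X. X \<in> C ==> Gamma \<subseteq> X"
   and lin: "\<And>X Y. X \<in> C ==> Y \<in> C ==> X \<subseteq> Y \<or> Y \<subseteq> X"
   unfolding subset_chain_def A_def by blast+
  note D = partial_characterD[OF CA(1)]
  have "partial_character G (\<Union>C)" unfolding partial_character_def
  proof (intro conjI allI impI)
   show "\<Union>C \<subseteq> carrier G \<times> (UNIV - {0})" using CA(1) unfolding partial_character_def by blast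
   show "(\<one>, 1) \<in> \<Union>C" using C(1) D(3) by blast
  next
   fix x a y b assume "(x, a) \<in> \<Union>C" "(y, b) \<in> \<Union>C"
   then obtain X Y where "X \<in> C" "Y \<in> C" "(x, a) \<in> X" "(y, b) \<in> Y" by blast
   then obtain Z where "Z \<in> C" "(x, a) \<in> Z" "(y, b) \<in> Z" using lin by blast
   then show "(x \<otimes> y, a * b) \<in> \<Union>C" using D(4) by blast
  next
   fix x a assume "(x, a) \<in> \<Union>C" then show "(inv x, inverse a) \<in> \<Union>C" using D(5) by blast
  next
   fix a assume "(\<one>, a) \<in> \<Union>C" then show "a = 1" using D(6) by blast
  qed
  then show "\<Union>C \<in> A" using CA(2) C(1) unfolding A_def by blast
 qed
 then obtain M where M: "partial_character G M" "Gamma \<subseteq> M" and max: "\<And>X. partial_character G X ==> M \<subseteq> X ==> X = M"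
  unfolding A_def by (auto dest: order.trans)
 have total: "\<exists>a. (x, a) \<in> M" if "x \<in> carrier G" for x
  using partial_character_adjoin_any[OF M(1) that] max by blast
 define xi where "xi x = (SOME a. (x, a) \<in> M)" for x
 have xM: "(x, xi x) \<in> M" if "x \<in> carrier G" for x
  unfolding xi_def by (rule someI_ex) (rule total[OF that])
 note U = partial_character_unique[OF M(1)] and D = partial_characterD[OF M(1)]
 have "character_on G xi" unfolding character_on_def
 proof (intro conjI ballI)
  show "xi x \<noteq> 0" if "x \<in> carrier G" for x using D(2) xM[OF that] by blast
  show "xi (x \<otimes> y) = xi x * xi y" if "x \<in> carrier G" "y \<in> carrier G" for x y
   using U[OF xM[of "x \<otimes> y"] D(4)[OF xM xM]] that by simp
 qed
 moreover have "\<forall>(x, a)\<in>Gamma. xi x = a" using U M(2) xM D(1) by blast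
 ultimately show ?thesis by blast
qed

lemma character_extends:
 fixes xi :: "'a \<Rightarrow> 'k::alg_closed_field"
 assumes H: "subgroup H G" and nz: "\<And>x. x \<in> H ==> xi x \<noteq> 0"
  and mult: "\<And>x y. x \<in> H ==> y \<in> H ==> xi (x \<otimes> y) = xi x * xi y"
 shows "\<exists>xi'. character_on G xi' \<and> (\<forall>x\<in>H. xi' x = xi x)"
proof -
 interpret H: subgroup H G by fact
 have one: "xi \<one> = 1" using mult[of \<one> \<one>] nz[of \<one>] by simp
 define Gamma where "Gamma = (\<lambda>x. (x, xi x)) ` H"
 have "partial_character G Gamma" unfolding partial_character_def
 proof (intro conjI allI impI)
  show "Gamma \<subseteq> carrier G \<times> (UNIV - {0})" using nz H.subset by (auto simp: Gamma_def)
  show "(\<one>, 1) \<in> Gamma" using one by (force simp: Gamma_def)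
 next
  fix x a y b assume "(x, a) \<in> Gamma" "(y, b) \<in> Gamma"
  then show "(x \<otimes> y, a * b) \<in> Gamma" using mult by (force simp: Gamma_def)
 next
  fix x a assume "(x, a) \<in> Gamma"
  then have x: "x \<in> H" "a = xi x" by (auto simp: Gamma_def)
  have "xi (inv x) * xi x = 1" using mult[of "inv x" x] x one by simp
  then have "xi (inv x) = inverse a" using nz x by (simp add: field_simps)
  then show "(inv x, inverse a) \<in> Gamma" using x by (force simp: Gamma_def)
 next
  fix a assume "(\<one>, a) \<in> Gamma" then show "a = 1" using one by (auto simp: Gamma_def)
 qed
 then obtain xi' where xi': "character_on G xi'" "\<forall>(x, a)\<in>Gamma. xi' x = a" using partial_character_total by blast
 have "xi' x = xi x" if "x \<in> H" for x using xi'(2) that by (auto simp: Gamma_def)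
 then show ?thesis using xi'(1) by blast
qed

lemma nontrivial_root_of_unity:
 assumes "n \<ge> 2"
 shows "\<exists>z::'k::{alg_closed_field,field_char_0}. z \<noteq> 1 \<and> z ^ n = 1"
proof -
 define p :: "'k poly" where "p = (\<Sum>i<n. monom 1 i)"
 have "coeff p (n - 1) = 1" using assms by (simp add: p_def coeff_sum)
 then have "degree p > 0" using assms le_degree[of p "n - 1"] by auto
 then obtain z where "poly p z = 0" using alg_closed_imp_poly_has_root by blast
 then have z: "(\<Sum>i<n. z ^ i) = 0" by (simp add: p_def poly_sum poly_monom)
 have "z ^ n - 1 = (z - 1) * (\<Sum>i<n. z ^ i)" by (rule power_diff_1_eq)
 then have "z ^ n = 1" using z by simp
 moreover have "z \<noteq> 1" using z assms by auto
 ultimately show ?thesis by blast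
qed

text \<open>A cyclic subgroup has a character that is not trivial at \<open>g\<close>, by a root of unity, and it extends.\<close>

lemma finite_characters_separate:
 assumes fin: "finite (carrier G)" and g: "g \<in> carrier G" "g \<noteq> \<one>"
 shows "\<exists>xi :: 'a \<Rightarrow> 'k::{alg_closed_field,field_char_0}. character_on G xi \<and> xi g \<noteq> 1"
proof -
 have "ord g \<noteq> 1" using g ord_eq_1 by blast
 moreover have "ord g \<ge> 1" using ord_ge_1[OF fin g(1)] .
 ultimately have "ord g \<ge> 2" by linarith
 then obtain z :: 'k where z: "z \<noteq> 1" "z ^ ord g = 1" using nontrivial_root_of_unity by blast
 have z0: "z \<noteq> 0" using z(2) \<open>ord g \<ge> 2\<close> by (metis power_0_left not_numeral_le_zero zero_neq_one)
 have "partial_character G {(\<one>, 1 :: 'k)}" by (auto simp: partial_character_def)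
 moreover have "a = z powi i" if "(g [^] (i::int), a) \<in> {(\<one>, 1)}" for i a
 proof -
  have "g [^] i = \<one>" "a = 1" using that by auto
  then have "int (ord g) dvd i" using int_pow_eq_id[OF g(1)] by blast
  then obtain k where "i = int (ord g) * k" by blast
  then show ?thesis using z(2) \<open>a = 1\<close> by (simp add: power_int_mult)
 qed
 ultimately obtain Gamma where Gamma: "partial_character G Gamma" "(g, z) \<in> Gamma"
  using partial_character_adjoin[OF _ g(1) z0] by blast
 then obtain xi where xi: "character_on G xi" "\<forall>(x, a)\<in>Gamma. xi x = a" using partial_character_total by blast
 then have "xi g = z" using Gamma(2) by auto
 then show ?thesis using xi(1) z(1) by blast
qed

end

section \<open>Characters of quasitori\<close>

text \<open>Dedekind's lemma.\<close>

lemma characters_independent: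
 fixes Y :: "('a \<Rightarrow> 'k::field) set"
 assumes "finite Y" "\<And>eta. eta \<in> Y ==> character_on G eta \<and> eta \<in> extensional (carrier G)" "group G"
  and "\<And>x. x \<in> carrier G ==> (\<Sum>eta\<in>Y. c eta * eta x) = 0" and "eta \<in> Y"
 shows "c eta = 0"
 using assms(1,2,4,5)
proof (induction Y arbitrary: c eta rule: finite_induct)
 case empty then show ?case by simp
next
 case (insert eta0 Y)
 interpret group G by fact
 note C = character_onD[OF conjunct1[OF insert.prems(1)]]
 have other: "c eta = 0" if eta: "eta \<in> Y" for eta
 proof -
  have "eta \<noteq> eta0" using eta insert.hyps by blast
  then obtain h where h: "h \<in> carrier G" "eta h \<noteq> eta0 h"
   using insert.prems(1)[of eta] insert.prems(1)[of eta0] eta extensionalityI by blast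
  have "(\<Sum>eta\<in>Y. (c eta * (eta h - eta0 h)) * eta x) = 0" if x: "x \<in> carrier G" for x
  proof -
   have "(\<Sum>eta\<in>insert eta0 Y. c eta * eta (h \<otimes>\<^bsub>G\<^esub> x)) - eta0 h * (\<Sum>eta\<in>insert eta0 Y. c eta * eta x) = 0"
    using insert.prems(2)[of "h \<otimes>\<^bsub>G\<^esub> x"] insert.prems(2)[OF x] h x by simp
   also have "(\<Sum>eta\<in>insert eta0 Y. c eta * eta (h \<otimes>\<^bsub>G\<^esub> x)) - eta0 h * (\<Sum>eta\<in>insert eta0 Y. c eta * eta x)
     = (\<Sum>eta\<in>insert eta0 Y. (c eta * (eta h - eta0 h)) * eta x)"
    unfolding sum_distrib_left sum_subtractf[symmetric]
    by (rule sum.cong) (use C h x in \<open>auto simp: algebra_simps\<close>)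
   finally show ?thesis using insert.hyps by simp
  qed
  then have "c eta * (eta h - eta0 h) = 0" using insert.IH[of "\<lambda>eta. c eta * (eta h - eta0 h)" eta] insert.prems(1) eta by blast
  then show ?thesis using h by simp
 qed
 have "c eta0 * eta0 \<one>\<^bsub>G\<^esub> = 0" using insert.prems(2)[of "\<one>\<^bsub>G\<^esub>"] insert.hyps other by simp
 then have "c eta0 = 0" using C(1)[of eta0 "\<one>\<^bsub>G\<^esub>"] by simp
 then show ?case using other insert.prems(3) by blast
qed

lemma character_group_iff:
 "eta \<in> carrier (character_group G) \<longleftrightarrow> eta \<in> regular_functions (carrier G) \<and> character_on G eta"
 by (auto simp: character_group_def character_on_def hom_def Gm_def)

lemma regular_functions_extensional: "f \<in> regular_functions V ==> f \<in> extensional V"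
 by (auto simp: regular_functions_def)

text \<open>A formal linear combination of characters, applied to an arbitrary function on characters. Taking evaluation
at a point for \<open>v\<close> gives a regular function; taking a character of the character group gives the value of its
linear extension.\<close>

definition combination :: "('k \<times> ('a \<Rightarrow> 'k)) list \<Rightarrow> (('a \<Rightarrow> 'k) \<Rightarrow> 'k) \<Rightarrow> 'k::field" where
 "combination ps v = (\<Sum>(c, eta)\<leftarrow>ps. c * v eta)"

lemma combination_simps [simp]:
 "combination [] v = 0" "combination ((c, eta) # ps) v = c * v eta + combination ps v"
 "combination (ps @ qs) v = combination ps v + combination qs v"
 by (simp_all add: combination_def)

lemma combination_cong: "(\<And>eta. eta \<in> snd ` set ps ==> v eta = w eta) ==> combination ps v = combination ps w"
 by (induction ps) auto

definition combination_mult where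
 "combination_mult m ps qs = concat (map (\<lambda>(c, eta). map (\<lambda>(d, xi). (c * d, m eta xi)) qs) ps)"

lemma combination_mult_mem:
 "\<zeta> \<in> snd ` set (combination_mult m ps qs) ==> \<exists>eta\<in>snd ` set ps. \<exists>xi\<in>snd ` set qs. \<zeta> = m eta xi"
 unfolding combination_mult_def by (auto simp: image_iff split_beta)

lemma combination_mult:
 assumes "\<And>eta xi. eta \<in> snd ` set ps ==> xi \<in> snd ` set qs ==> v (m eta xi) = v eta * v xi"
 shows "combination (combination_mult m ps qs) v = combination ps v * combination qs v"
 using assms
proof (induction ps)
 case Nil then show ?case by (simp add: combination_mult_def)
next
 case (Cons p ps)
 obtain c eta where p: "p = (c, eta)" by force
 have m: "v (m eta xi) = v eta * v xi" if "xi \<in> snd ` set qs" for xi using Cons.prems[of eta xi] that p by force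
 have "combination (map (\<lambda>(d, xi). (c * d, m eta xi)) qs) v = c * v eta * combination qs v"
  using m
 proof (induction qs)
  case (Cons q qs)
  then show ?case by (cases q) (force simp: algebra_simps)
 qed simp
 moreover have "combination (combination_mult m ps qs) v = combination ps v * combination qs v"
  using Cons.prems by (intro Cons.IH) auto
 ultimately show ?case by (simp add: combination_mult_def p algebra_simps)
qed

lemma combination_collect:
 assumes "finite Y" "snd ` set ps \<subseteq> Y"
 shows "combination ps v = (\<Sum>eta\<in>Y. (\<Sum>(c, eta')\<leftarrow>ps. if eta' = eta then c else 0) * v eta)"
 using assms(2)
proof (induction ps)
 case (Cons p ps)
 obtain c eta where p: "p = (c, eta)" by force
 have "eta \<in> Y" using Cons.prems p by simp
 then have "(\<Sum>eta'\<in>Y. (if eta = eta' then c else 0) * v eta') = c * v eta"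
  using assms(1) by (simp add: if_distrib[of "\<lambda>x. x * _"] cong: if_cong)
 then show ?case using Cons by (simp add: p distrib_right sum.distrib)
qed simp

context
 fixes N :: "('k::{alg_closed_field,field_char_0} ^ 'm::finite) monoid"
 assumes N: "quasitorus N"
begin

lemma quasitorus_group: "group N" and quasitorus_closed: "zariski_closed (carrier N)"
 using N by (auto simp: quasitorus_def affine_algebraic_group_def)

definition spanned :: "('k ^ 'm \<Rightarrow> 'k) \<Rightarrow> bool" where
 "spanned f \<longleftrightarrow> (\<exists>ps. snd ` set ps \<subseteq> carrier (character_group N) \<and>
   (\<forall>x\<in>carrier N. f x = combination ps (\<lambda>eta. eta x)))"

lemma one_character: "(\<lambda>x\<in>carrier N. 1) \<in> carrier (character_group N)"
proof -
 interpret group N by (rule quasitorus_group)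
 have "(\<lambda>x\<in>carrier N. 1) \<in> regular_functions (carrier N)"
  unfolding regular_functions_def polynomial_functions_def by (intro imageI algebra_of_functions.const)
 then show ?thesis by (simp add: character_group_iff character_on_def)
qed

lemma regular_functions_mult:
 assumes "f \<in> regular_functions V" "g \<in> regular_functions V"
 shows "(\<lambda>x\<in>V. f x * g x) \<in> regular_functions V"
proof -
 obtain p q where pq: "p \<in> poly_funs" "q \<in> poly_funs" "f = restrict p V" "g = restrict q V"
  using assms by (auto simp: regular_functions_def)
 then have "(\<lambda>x\<in>V. f x * g x) = restrict (\<lambda>x. p x * q x) V" by auto
 moreover have "(\<lambda>x. p x * q x) \<in> poly_funs"
  using pq unfolding polynomial_functions_def by (intro algebra_of_functions.mult)
 ultimately show ?thesis by (simp add: regular_functions_def)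
qed

lemma character_mult:
 assumes "eta \<in> carrier (character_group N)" "xi \<in> carrier (character_group N)"
 shows "(\<lambda>x\<in>carrier N. eta x * xi x) \<in> carrier (character_group N)"
proof -
 interpret group N by (rule quasitorus_group)
 show ?thesis using assms regular_functions_mult by (auto simp: character_group_iff character_on_def)
qed

lemma spanned_const: "spanned (\<lambda>x. c)"
 unfolding spanned_def using one_character by (intro exI[of _ "[(c, \<lambda>x\<in>carrier N. 1)]"]) auto

lemma spanned_character: "eta \<in> carrier (character_group N) ==> (\<And>x. x \<in> carrier N ==> f x = eta x) ==> spanned f"
 unfolding spanned_def by (intro exI[of _ "[(1, eta)]"]) auto

lemma spanned_add: assumes "spanned f" "spanned g" shows "spanned (\<lambda>x. f x + g x)"
proof -
 obtain ps qs where "snd ` set ps \<subseteq> carrier (character_group N)" "\<forall>x\<in>carrier N. f x = combination ps (\<lambda>eta. eta x)"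
  "snd ` set qs \<subseteq> carrier (character_group N)" "\<forall>x\<in>carrier N. g x = combination qs (\<lambda>eta. eta x)"
  using assms unfolding spanned_def by blast
 then show ?thesis unfolding spanned_def by (intro exI[of _ "ps @ qs"]) auto
qed

lemma combination_mult_characters:
 assumes "snd ` set ps \<subseteq> carrier (character_group N)" "snd ` set qs \<subseteq> carrier (character_group N)"
 shows "snd ` set (combination_mult (\<lambda>eta xi. \<lambda>x\<in>carrier N. eta x * xi x) ps qs) \<subseteq> carrier (character_group N)"
proof
 fix \<zeta> assume "\<zeta> \<in> snd ` set (combination_mult (\<lambda>eta xi. \<lambda>x\<in>carrier N. eta x * xi x) ps qs)"
 from combination_mult_mem[OF this] obtain eta xi where *: "eta \<in> snd ` set ps" "xi \<in> snd ` set qs"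
  "\<zeta> = (\<lambda>x\<in>carrier N. eta x * xi x)" by blast
 then show "\<zeta> \<in> carrier (character_group N)" unfolding *(3) using assms by (intro character_mult) blast+
qed

lemma spanned_mult: assumes "spanned f" "spanned g" shows "spanned (\<lambda>x. f x * g x)"
proof -
 obtain ps qs where *: "snd ` set ps \<subseteq> carrier (character_group N)" "\<forall>x\<in>carrier N. f x = combination ps (\<lambda>eta. eta x)"
  "snd ` set qs \<subseteq> carrier (character_group N)" "\<forall>x\<in>carrier N. g x = combination qs (\<lambda>eta. eta x)"
  using assms unfolding spanned_def by blast
 let ?m = "\<lambda>eta xi. \<lambda>x\<in>carrier N. eta x * xi x"
 have "combination (combination_mult ?m ps qs) (\<lambda>eta. eta x) = f x * g x" if "x \<in> carrier N" for x
  using * that by (subst combination_mult) auto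
 then show ?thesis unfolding spanned_def using combination_mult_characters[OF *(1,3)]
  by (intro exI[of _ "combination_mult ?m ps qs"]) auto
qed

lemma spanned_cong: "spanned f ==> (\<And>x. x \<in> carrier N ==> g x = f x) ==> spanned g"
 unfolding spanned_def by auto

lemma spanned_sum: "finite I ==> (\<And>i. i \<in> I ==> spanned (f i)) ==> spanned (\<lambda>x. \<Sum>i\<in>I. f i x)"
 by (induction I rule: finite_induct) (auto intro: spanned_const spanned_add)

lemma spanned_prod: "finite I ==> (\<And>i. i \<in> I ==> spanned (f i)) ==> spanned (\<lambda>x. \<Prod>i\<in>I. f i x)"
 by (induction I rule: finite_induct) (auto intro: spanned_const spanned_mult)

text \<open>On the torus the coordinates are characters. Characters separate the points of the finite factor, so that the
delta functions there are polynomials in them.\<close>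

lemma regular_functions_spanned:
 assumes "f \<in> regular_functions (carrier N)"
 shows "spanned f"
proof -
 interpret group N by (rule quasitorus_group)
 obtain r A ph where A: "comm_group A" "finite (carrier A)" and ph: "ph \<in> iso N (torus r \<times>\<times> A)"
  and eq: "(\<lambda>h. \<lambda>x \<in> carrier N. h (ph x)) ` torus_finite_functions r A = regular_functions (carrier N)"
  using N unfolding quasitorus_def by blast
 interpret A: comm_group A by fact
 have hom: "ph \<in> hom N (torus r \<times>\<times> A)" using ph iso_imp_homomorphism by blast
 have phc: "fst (ph x) \<in> carrier (torus r)" "snd (ph x) \<in> carrier A" if "x \<in> carrier N" for x
  using hom_in_carrier[OF hom that] by (auto simp: mem_Times_iff)
 have phm: "fst (ph (x \<otimes>\<^bsub>N\<^esub> y)) = fst (ph x) \<otimes>\<^bsub>torus r\<^esub> fst (ph y)" "snd (ph (x \<otimes>\<^bsub>N\<^esub> y)) = snd (ph x) \<otimes>\<^bsub>A\<^esub> snd (ph y)"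
  if "x \<in> carrier N" "y \<in> carrier N" for x y
  using hom_mult[OF hom that] by (auto simp: mult_DirProd' split_beta)
 let ?Gen = "((\<lambda>i z. fst z i) ` {..<r} \<union> (\<lambda>i z. inverse (fst z i)) ` {..<r} \<union> range (\<lambda>g z. g (snd z)))
  :: ((nat \<Rightarrow> 'k) \<times> nat \<Rightarrow> 'k) set"
 have reg: "(\<lambda>x\<in>carrier N. h (ph x)) \<in> regular_functions (carrier N)" if h: "h \<in> algebra_of_functions ?Gen" for h
 proof -
  have "restrict h (carrier (torus r \<times>\<times> A)) \<in> torus_finite_functions r A"
   using h unfolding torus_finite_functions_def by blast
  then have "(\<lambda>x\<in>carrier N. restrict h (carrier (torus r \<times>\<times> A)) (ph x)) \<in> regular_functions (carrier N)"
   unfolding eq[symmetric] by (rule imageI)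
  moreover have "(\<lambda>x\<in>carrier N. restrict h (carrier (torus r \<times>\<times> A)) (ph x)) = (\<lambda>x\<in>carrier N. h (ph x))"
   using hom_in_carrier[OF hom] by (intro restrict_ext) auto
  ultimately show ?thesis by simp
 qed
 have gen: "h \<in> ?Gen ==> h \<in> algebra_of_functions ?Gen" for h by (rule algebra_of_functions.gen)
 have coord: "fst (ph x) i \<noteq> 0" if "x \<in> carrier N" "i < r" for x i
  using phc(1)[OF that(1)] that(2) by (auto simp: torus_def product_group_def Gm_def)
 have tm: "fst (ph (x \<otimes>\<^bsub>N\<^esub> y)) i = fst (ph x) i * fst (ph y) i" if "x \<in> carrier N" "y \<in> carrier N" "i < r" for x y i
  using that by (simp add: phm torus_def product_group_def Gm_def)
 have sp_snd: "spanned (\<lambda>x. g (snd (ph x)))" for g :: "nat \<Rightarrow> 'k"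
 proof -
  have ch: "spanned (\<lambda>x. rho (snd (ph x)))" if rho: "character_on A rho" for rho
  proof (rule spanned_character)
   show "(\<lambda>x\<in>carrier N. rho (snd (ph x))) \<in> carrier (character_group N)"
    unfolding character_group_iff
    using reg[OF gen[of "\<lambda>z. rho (snd z)"]] phc(2) phm(2) character_onD[OF rho] by (auto simp: character_on_def)
  qed simp
  have "\<exists>rho. character_on A rho \<and> rho a \<noteq> (rho b :: 'k)" if ab: "a \<in> carrier A" "b \<in> carrier A" "a \<noteq> b" for a b
  proof -
   have "a \<otimes>\<^bsub>A\<^esub> inv\<^bsub>A\<^esub> b \<noteq> \<one>\<^bsub>A\<^esub>" using that A.inv_equality[of a "inv\<^bsub>A\<^esub> b"] by (auto simp: A.inv_inv)
   then obtain rho :: "nat \<Rightarrow> 'k" where rho: "character_on A rho" "rho (a \<otimes>\<^bsub>A\<^esub> inv\<^bsub>A\<^esub> b) \<noteq> 1"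
    using A.finite_characters_separate[OF A(2), of "a \<otimes>\<^bsub>A\<^esub> inv\<^bsub>A\<^esub> b"] ab by auto
   have "rho (a \<otimes>\<^bsub>A\<^esub> inv\<^bsub>A\<^esub> b) = rho a * inverse (rho b)"
    using character_onD(2)[OF rho(1)] A.character_on_one_inv(2)[OF rho(1)] that by simp
   then show ?thesis using rho character_onD(1)[OF rho(1) ab(2)] by (metis right_inverse)
  qed
  then obtain rho where rho: "\<And>a b. a \<in> carrier A ==> b \<in> carrier A ==> a \<noteq> b ==>
    character_on A (rho a b) \<and> rho a b a \<noteq> (rho a b b :: 'k)" by metis
  define delta where "delta a y = (\<Prod>b\<in>carrier A - {a}. (rho a b y + - rho a b b) * inverse (rho a b a - rho a b b))" for a y
  have delta: "delta a y = (if y = a then 1 else 0)" if "a \<in> carrier A" "y \<in> carrier A" for a y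
  proof (cases "y = a")
   case True
   then have "delta a y = (\<Prod>b\<in>carrier A - {a}. 1)" unfolding delta_def
    using rho that by (intro prod.cong) auto
   then show ?thesis using True by simp
  next
   case False
   then have "delta a y = 0" unfolding delta_def using that A(2) by (auto intro!: prod_zero bexI[of _ y])
   then show ?thesis using False by simp
  qed
  have spdelta: "spanned (\<lambda>x. delta a (snd (ph x)))" if "a \<in> carrier A" for a
   unfolding delta_def using A(2) rho that
   by (intro spanned_prod spanned_mult spanned_add ch spanned_const) auto
  have "spanned (\<lambda>x. \<Sum>a\<in>carrier A. g a * delta a (snd (ph x)))"
   using A(2) by (intro spanned_sum spanned_mult spanned_const spdelta)
  then show ?thesis
  proof (rule spanned_cong)
   fix x assume "x \<in> carrier N"
   then have "snd (ph x) \<in> carrier A" by (rule phc)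
   then show "g (snd (ph x)) = (\<Sum>a\<in>carrier A. g a * delta a (snd (ph x)))"
    using A(2) by (simp add: delta if_distrib[of "\<lambda>x. _ * x"] cong: if_cong)
  qed
 qed
 have "spanned (\<lambda>x. h (ph x))" if "h \<in> algebra_of_functions ?Gen" for h
  using that
 proof induction
  case (gen h)
  then consider i where "i < r" "h = (\<lambda>z. fst z i)" | i where "i < r" "h = (\<lambda>z. inverse (fst z i))"
   | g where "h = (\<lambda>z. g (snd z))" by blast
  then show ?case
  proof cases
   case (1 i)
   show ?thesis
   proof (rule spanned_character)
    show "(\<lambda>x\<in>carrier N. h (ph x)) \<in> carrier (character_group N)"
     unfolding character_group_iff using reg[OF algebra_of_functions.gen[OF gen]] coord tm 1 by (auto simp: character_on_def)
   qed simp
  next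
   case (2 i)
   show ?thesis
   proof (rule spanned_character)
    show "(\<lambda>x\<in>carrier N. h (ph x)) \<in> carrier (character_group N)"
     unfolding character_group_iff using reg[OF algebra_of_functions.gen[OF gen]] coord tm 2 by (auto simp: character_on_def)
   qed simp
  next
   case (3 g)
   then show ?thesis using sp_snd by simp
  qed
 next
  case (const c) show ?case by (rule spanned_const)
 next
  case (add f g) then show ?case using spanned_add by blast
 next
  case (mult f g) then show ?case using spanned_mult by blast
 qed
 moreover obtain h where h: "h \<in> algebra_of_functions ?Gen" "f = (\<lambda>x\<in>carrier N. restrict h (carrier (torus r \<times>\<times> A)) (ph x))"
  using assms unfolding eq[symmetric] torus_finite_functions_def by blast
 ultimately have "spanned (\<lambda>x. h (ph x))" by blast
 then show ?thesis by (rule spanned_cong) (use h(2) hom_in_carrier[OF hom] in auto)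
qed

text \<open>The coordinates are linear combinations of characters.\<close>

lemma characters_separate_points:
 assumes t: "t \<in> carrier N" "\<And>eta. eta \<in> carrier (character_group N) ==> eta t = 1"
 shows "t = \<one>\<^bsub>N\<^esub>"
proof -
 interpret group N by (rule quasitorus_group)
 have "t $ i = \<one>\<^bsub>N\<^esub> $ i" for i
 proof -
  have "(\<lambda>x\<in>carrier N. x $ i) \<in> regular_functions (carrier N)"
   unfolding regular_functions_def polynomial_functions_def by (auto intro: algebra_of_functions.gen)
  then obtain ps where ps: "snd ` set ps \<subseteq> carrier (character_group N)"
   "\<forall>x\<in>carrier N. (\<lambda>x\<in>carrier N. x $ i) x = combination ps (\<lambda>eta. eta x)"
   using regular_functions_spanned unfolding spanned_def by blast
  have "eta t = eta \<one>\<^bsub>N\<^esub>" if "eta \<in> snd ` set ps" for eta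
   using t(2)[of eta] that ps(1) character_on_one_inv(1)[of eta] character_group_iff[of eta] by auto
  then have "combination ps (\<lambda>eta. eta t) = combination ps (\<lambda>eta. eta \<one>\<^bsub>N\<^esub>)"
   by (rule combination_cong)
  then show ?thesis using ps(2) t(1) by simp
 qed
 then show ?thesis by (simp add: vec_eq_iff)
qed

text \<open>A character of the character group extends linearly to an algebra homomorphism from the regular
 functions to \<open>\<bbbK>\<close>, by Dedekind's lemma, and thus is the evaluation at a point.\<close>

lemma character_of_characters_is_evaluation:
 assumes xi: "\<And>eta mu. eta \<in> carrier (character_group N) ==> mu \<in> carrier (character_group N) ==>
   xi (\<lambda>x\<in>carrier N. eta x * mu x) = xi eta * xi mu"
  and nz: "\<And>eta. eta \<in> carrier (character_group N) ==> xi eta \<noteq> 0"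
 shows "\<exists>t\<in>carrier N. \<forall>eta\<in>carrier (character_group N). eta t = xi eta"
proof -
 interpret group N by (rule quasitorus_group)
 let ?X = "carrier (character_group N)" and ?m = "\<lambda>eta xi. \<lambda>x\<in>carrier N. eta x * xi x"
 define repr where "repr f ps \<longleftrightarrow> snd ` set ps \<subseteq> ?X \<and> (\<forall>x\<in>carrier N. f x = combination ps (\<lambda>eta. eta x))"
  for f ps
 have zero: "combination ps xi = 0" if ps: "snd ` set ps \<subseteq> ?X" "\<And>x. x \<in> carrier N ==> combination ps (\<lambda>eta. eta x) = 0" for ps
 proof -
  define C where "C eta = (\<Sum>(c, eta')\<leftarrow>ps. if eta' = eta then c else 0)" for eta
  have coll: "combination ps v = (\<Sum>eta\<in>snd ` set ps. C eta * v eta)" for v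
   unfolding C_def by (rule combination_collect) auto
  have "C eta = 0" if "eta \<in> snd ` set ps" for eta
  proof (rule characters_independent[where Y = "snd ` set ps" and G = N and c = C and eta = eta])
   show "character_on N eta \<and> eta \<in> extensional (carrier N)" if "eta \<in> snd ` set ps" for eta
    using that ps(1) regular_functions_extensional character_group_iff by blast
   show "(\<Sum>eta\<in>snd ` set ps. C eta * eta x) = 0" if "x \<in> carrier N" for x using ps(2)[OF that] coll by simp
  qed (use quasitorus_group that in auto)
  then show ?thesis unfolding coll by simp
 qed
 have uniq: "combination ps xi = combination qs xi" if "repr f ps" "repr f qs" for f ps qs
 proof -
  define rs where "rs = ps @ map (\<lambda>(c, eta). (- c, eta)) qs"
  have neg: "combination (map (\<lambda>(c, eta). (- c, eta)) qs) v = - combination qs v" for v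
   by (induction qs) auto
  have "snd ` set rs \<subseteq> ?X" using that unfolding repr_def rs_def by force
  moreover have "combination rs (\<lambda>eta. eta x) = 0" if "x \<in> carrier N" for x
   using \<open>repr f ps\<close> \<open>repr f qs\<close> that unfolding repr_def by (simp add: rs_def neg)
  ultimately have "combination rs xi = 0" by (rule zero)
  then show ?thesis by (simp add: rs_def neg)
 qed
 define Phi where "Phi f = (THE y. \<exists>ps. repr f ps \<and> y = combination ps xi)" for f
 have Phi: "Phi f = combination ps xi" if "repr f ps" for f ps
  unfolding Phi_def using that uniq by (intro the_equality) blast+
 have ex: "\<exists>ps. repr p ps" if "p \<in> poly_funs" for p
 proof -
  have "restrict p (carrier N) \<in> regular_functions (carrier N)" using that unfolding regular_functions_def by blast
  from regular_functions_spanned[OF this] show ?thesis unfolding spanned_def repr_def by simp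
 qed
 define t where "t = vec_lambda (\<lambda>i. Phi (\<lambda>x. x $ i))"
 have one: "xi (\<lambda>x\<in>carrier N. 1) = 1"
 proof -
  have "(\<lambda>x\<in>carrier N. (\<lambda>x\<in>carrier N. 1) x * (\<lambda>x\<in>carrier N. 1) x) = (\<lambda>x\<in>carrier N. 1 :: 'k)" by auto
  then show ?thesis using xi[OF one_character one_character] nz[OF one_character] by simp
 qed
 have ev: "Phi p = p t" if "p \<in> poly_funs" for p
  unfolding t_def
 proof (rule polynomial_hom_is_evaluation[OF _ _ _ that])
  fix c
  have "repr (\<lambda>_. c) [(c, \<lambda>x\<in>carrier N. 1)]" unfolding repr_def using one_character by auto
  from Phi[OF this] show "Phi (\<lambda>_. c) = c" using one by simp
 next
  fix f g :: "'k ^ 'm \<Rightarrow> 'k" assume "f \<in> poly_funs" "g \<in> poly_funs"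
  then obtain ps qs where *: "repr f ps" "repr g qs" using ex by blast
  then have "repr (\<lambda>x. f x + g x) (ps @ qs)" unfolding repr_def by auto
  from Phi[OF this] show "Phi (\<lambda>x. f x + g x) = Phi f + Phi g" using Phi[OF *(1)] Phi[OF *(2)] by simp
  have X: "snd ` set ps \<subseteq> ?X" "snd ` set qs \<subseteq> ?X" using * unfolding repr_def by auto
  have "combination (combination_mult ?m ps qs) (\<lambda>eta. eta x) = f x * g x" if "x \<in> carrier N" for x
   using * that unfolding repr_def by (subst combination_mult) auto
  then have "repr (\<lambda>x. f x * g x) (combination_mult ?m ps qs)"
   unfolding repr_def using combination_mult_characters[OF X] by auto
  from Phi[OF this] have "Phi (\<lambda>x. f x * g x) = combination (combination_mult ?m ps qs) xi" .
  also have "... = combination ps xi * combination qs xi"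
   by (rule combination_mult, rule xi) (use X in auto)
  finally show "Phi (\<lambda>x. f x * g x) = Phi f * Phi g" using Phi[OF *(1)] Phi[OF *(2)] by simp
 qed
 have "t \<in> carrier N"
 proof -
  obtain S where S: "S \<subseteq> poly_funs" "carrier N = {x. \<forall>p\<in>S. p x = 0}"
   using quasitorus_closed unfolding zariski_closed_def by blast
  have "p t = 0" if "p \<in> S" for p
  proof -
   have "repr p []" unfolding repr_def using S(2) that by auto
   from Phi[OF this] show ?thesis using ev[of p] S(1) that by auto
  qed
  then show ?thesis using S(2) by blast
 qed
 moreover have "eta t = xi eta" if eta: "eta \<in> ?X" for eta
 proof -
  obtain p where p: "p \<in> poly_funs" "eta = restrict p (carrier N)"
   using eta unfolding character_group_iff regular_functions_def by blast
  have "repr p [(1, eta)]" unfolding repr_def using p eta by auto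
  from Phi[OF this] show ?thesis using ev[OF p(1)] \<open>t \<in> carrier N\<close> p(2) by simp
 qed
 ultimately show ?thesis by blast
qed

end

section \<open>Automorphisms and valuations\<close>

lemma (in domain) automorphism_of_fraction_field:
 assumes h: "h \<in> ring_hom R R" and bij: "bij_betw h (carrier R) (carrier R)"
 shows "\<exists>sigma. sigma \<in> ring_hom (fraction_field R) (fraction_field R) \<and>
  bij_betw sigma (carrier (fraction_field R)) (carrier (fraction_field R)) \<and>
  (\<forall>a\<in>carrier R. sigma (to_frac R a) = to_frac R (h a))"
proof -
 let ?L = "fraction_field R"
 have hc: "h a \<in> carrier R" if "a \<in> carrier R" for a using ring_hom_closed[OF h that] .
 have h0: "h \<zero> = \<zero>" using ring_hom_zero[OF h ring_axioms ring_axioms] .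
 have hinj: "h a = h b \<longleftrightarrow> a = b" if "a \<in> carrier R" "b \<in> carrier R" for a b
  using bij that unfolding bij_betw_def inj_on_def by blast
 have hn: "h b \<in> carrier R - {\<zero>}" if "b \<in> carrier R - {\<zero>}" for b
  using hinj[of b \<zero>] h0 hc that by auto
 have hsurj: "\<exists>a\<in>carrier R. h a = b" if "b \<in> carrier R" for b using bij that unfolding bij_betw_def by (metis imageE)
 have eq: "frac R (h a) (h b) = frac R (h c) (h d) \<longleftrightarrow> frac R a b = frac R c d"
  if "a \<in> carrier R" "b \<in> carrier R - {\<zero>}" "c \<in> carrier R" "d \<in> carrier R - {\<zero>}" for a b c d
 proof -
  have "h a \<otimes> h d = h (a \<otimes> d)" "h c \<otimes> h b = h (c \<otimes> b)" using that ring_hom_mult[OF h] by auto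
  moreover have "h (a \<otimes> d) = h (c \<otimes> b) \<longleftrightarrow> a \<otimes> d = c \<otimes> b" using that by (intro hinj) auto
  ultimately show ?thesis
   unfolding frac_eq_iff[OF that] frac_eq_iff[OF hc[OF that(1)] hn[OF that(2)] hc[OF that(3)] hn[OF that(4)]] by simp
 qed
 define sigma where "sigma x = (let y = (SOME y. y \<in> x) in frac R (h (fst y)) (h (snd y)))" for x
 have sigma: "sigma (frac R a b) = frac R (h a) (h b)" if ab: "a \<in> carrier R" "b \<in> carrier R - {\<zero>}" for a b
 proof -
  define y where "y = (SOME y. y \<in> frac R a b)"
  have "y \<in> frac R a b" unfolding y_def by (rule someI) (rule frac_self[OF ab])
  then have "(fst y, snd y) \<in> frac R a b" by simp
  note y = frac_memD[OF this ab]
  show ?thesis using eq[OF y(1,2) ab] y(3) by (simp add: sigma_def y_def[symmetric])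
 qed
 have "sigma \<in> ring_hom ?L ?L"
 proof (rule ring_hom_memI)
  fix x y assume "x \<in> carrier ?L" "y \<in> carrier ?L"
  then obtain a b c d where *: "a \<in> carrier R" "b \<in> carrier R - {\<zero>}" "c \<in> carrier R" "d \<in> carrier R - {\<zero>}"
   and xy: "x = frac R a b" "y = frac R c d" by (metis fraction_field_cases)
  show "sigma x \<in> carrier ?L" unfolding xy sigma[OF *(1,2)] using hc[OF *(1)] hn[OF *(2)] by (rule frac_closed)
  have R: "b \<in> carrier R" "d \<in> carrier R" using * by auto
  have c: "a \<otimes> c \<in> carrier R" "a \<otimes> d \<oplus> c \<otimes> b \<in> carrier R" "b \<otimes> d \<in> carrier R - {\<zero>}" using * R denom_mult[OF *(2,4)] by auto
  note hh = hc[OF *(1)] hn[OF *(2)] hc[OF *(3)] hn[OF *(4)]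
  show "sigma (x \<otimes>\<^bsub>?L\<^esub> y) = sigma x \<otimes>\<^bsub>?L\<^esub> sigma y"
   unfolding xy frac_mult_add(1)[OF *] sigma[OF *(1,2)] sigma[OF *(3,4)] sigma[OF c(1,3)] frac_mult_add(1)[OF hh]
   using * R ring_hom_mult[OF h] by simp
  show "sigma (x \<oplus>\<^bsub>?L\<^esub> y) = sigma x \<oplus>\<^bsub>?L\<^esub> sigma y"
   unfolding xy frac_mult_add(2)[OF *] sigma[OF *(1,2)] sigma[OF *(3,4)] sigma[OF c(2,3)] frac_mult_add(2)[OF hh]
   using * R ring_hom_mult[OF h] ring_hom_add[OF h] by simp
 next
  show "sigma \<one>\<^bsub>?L\<^esub> = \<one>\<^bsub>?L\<^esub>" unfolding fraction_field_one_zero by (subst sigma) (auto simp: ring_hom_one[OF h])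
 qed
 moreover have "bij_betw sigma (carrier ?L) (carrier ?L)"
  unfolding bij_betw_def
 proof
  show "inj_on sigma (carrier ?L)"
  proof (rule inj_onI)
   fix x y assume "x \<in> carrier ?L" "y \<in> carrier ?L" and e: "sigma x = sigma y"
   then obtain a b c d where *: "a \<in> carrier R" "b \<in> carrier R - {\<zero>}" "c \<in> carrier R" "d \<in> carrier R - {\<zero>}"
    and xy: "x = frac R a b" "y = frac R c d" by (metis fraction_field_cases)
   show "x = y" using e unfolding xy sigma[OF *(1,2)] sigma[OF *(3,4)] eq[OF *] .
  qed
  show "sigma ` carrier ?L = carrier ?L"
  proof (intro equalityI subsetI)
   fix x assume "x \<in> sigma ` carrier ?L"
   then obtain y where "y \<in> carrier ?L" "x = sigma y" by blast
   then show "x \<in> carrier ?L" using ring_hom_closed[OF \<open>sigma \<in> ring_hom ?L ?L\<close>] by blast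
  next
   fix x assume "x \<in> carrier ?L"
   then obtain a b where ab: "a \<in> carrier R" "b \<in> carrier R - {\<zero>}" "x = frac R a b" by (metis fraction_field_cases)
   obtain c d where cd: "c \<in> carrier R" "h c = a" "d \<in> carrier R" "h d = b" using hsurj ab by (metis DiffD1)
   then have "d \<in> carrier R - {\<zero>}" using ab h0 by auto
   then show "x \<in> sigma ` carrier ?L" using sigma[OF cd(1), of d] cd ab frac_closed[OF cd(1)] by (intro image_eqI[of _ _ "frac R c d"]) auto
  qed
 qed
 moreover have "\<forall>a\<in>carrier R. sigma (to_frac R a) = to_frac R (h a)"
  unfolding to_frac_def by (auto simp: sigma ring_hom_one[OF h])
 ultimately show ?thesis by blast
qed

context noetherian_normal_domain begin

context
 fixes sigma assumes sigma: "sigma \<in> ring_hom L L" "bij_betw sigma (carrier L) (carrier L)" "sigma ` S = S"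
begin

lemma automorphism_simps:
 shows "x \<in> carrier L ==> sigma x \<in> carrier L" "x \<in> carrier L ==> y \<in> carrier L ==> sigma (x \<otimes> y) = sigma x \<otimes> sigma y"
  "x \<in> carrier L ==> y \<in> carrier L ==> sigma (x \<oplus> y) = sigma x \<oplus> sigma y" "sigma \<one> = \<one>" "sigma \<zero> = \<zero>"
  "x \<in> carrier L ==> y \<in> carrier L ==> sigma x = sigma y \<longleftrightarrow> x = y"
  "x \<in> carrier L ==> sigma x = \<zero> \<longleftrightarrow> x = \<zero>"
proof -
 show inj: "sigma x = sigma y \<longleftrightarrow> x = y" if "x \<in> carrier L" "y \<in> carrier L" for x y
  using sigma(2) that unfolding bij_betw_def inj_on_def by blast
 show z: "sigma \<zero> = \<zero>" using ring_hom_zero[OF sigma(1) ring_axioms ring_axioms] .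
 show "sigma x = \<zero> \<longleftrightarrow> x = \<zero>" if "x \<in> carrier L" using inj[OF that zero_closed] z by simp
qed (use ring_hom_closed[OF sigma(1)] ring_hom_mult[OF sigma(1)] ring_hom_add[OF sigma(1)] ring_hom_one[OF sigma(1)] in auto)

lemma automorphism_mem: "x \<in> carrier L ==> X \<subseteq> carrier L ==> sigma x \<in> sigma ` X \<longleftrightarrow> x \<in> X"
 using automorphism_simps(6) by blast

lemma automorphism_prime_id:
 assumes p: "prime_id p" shows "prime_id (sigma ` p)"
 unfolding prime_id_def ideal_in_def
proof (intro conjI ballI impI)
 note P = prime_idD[OF p]
 have pL: "p \<subseteq> carrier L" "S \<subseteq> carrier L" using P(2) sub(1) by auto
 show "sigma ` p \<subseteq> S" using P(2) sigma(3) by blast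
 show "\<zero> \<in> sigma ` p" using P(3) automorphism_simps(5) by (metis imageI)
 show "x \<oplus> y \<in> sigma ` p" if "x \<in> sigma ` p" "y \<in> sigma ` p" for x y
 proof -
  obtain a b where ab: "a \<in> p" "b \<in> p" "x = sigma a" "y = sigma b" using \<open>x \<in> sigma ` p\<close> \<open>y \<in> sigma ` p\<close> by blast
  then have "x \<oplus> y = sigma (a \<oplus> b)" using automorphism_simps(3)[of a b] subsetD[OF pL(1)] by simp
  then show ?thesis using P(4) ab by blast
 qed
 show "s \<otimes> x \<in> sigma ` p" if "s \<in> S" "x \<in> sigma ` p" for s x
 proof -
  have "s \<in> sigma ` S" using \<open>s \<in> S\<close> sigma(3) by simp
  then obtain a b where ab: "a \<in> p" "b \<in> S" "x = sigma a" "s = sigma b" using \<open>x \<in> sigma ` p\<close> by blast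
  then have "s \<otimes> x = sigma (b \<otimes> a)" using automorphism_simps(2)[of b a] subsetD[OF pL(1)] subsetD[OF pL(2)] by simp
  then show ?thesis using P(5) ab by blast
 qed
 show "\<one> \<notin> sigma ` p" using automorphism_mem[OF one_closed pL(1)] automorphism_simps(4) P(6) by simp
 show "x \<in> sigma ` p \<or> y \<in> sigma ` p" if xy: "x \<in> S" "y \<in> S" "x \<otimes> y \<in> sigma ` p" for x y
 proof -
  have "x \<in> sigma ` S" "y \<in> sigma ` S" using xy(1,2) sigma(3) by auto
  then obtain a b where ab: "a \<in> S" "b \<in> S" "x = sigma a" "y = sigma b" by (elim imageE) simp
  then have "sigma (a \<otimes> b) \<in> sigma ` p" using xy automorphism_simps(2)[of a b] subsetD[OF pL(2)] by simp
  then have "a \<otimes> b \<in> p" using automorphism_mem[OF _ pL(1), of "a \<otimes> b"] ab subsetD[OF pL(2)] by simp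
  then show ?thesis using P(7) ab by blast
 qed
qed

lemma automorphism_loc:
 assumes p: "prime_id p"
 shows "loc (sigma ` p) = sigma ` loc p" "loc_max (sigma ` p) = sigma ` loc_max p"
proof -
 have pL: "p \<subseteq> carrier L" "S \<subseteq> carrier L" using prime_idD(2)[OF p] sub(1) by auto
 have "sigma ` (S - p) = sigma ` S - sigma ` p"
  by (rule inj_on_image_set_diff[of _ "carrier L"]) (use sigma(2) pL in \<open>auto simp: bij_betw_def\<close>)
 then have SP: "S - sigma ` p = sigma ` (S - p)" using sigma(3) by simp
 have *: "{f \<in> carrier L. \<exists>h\<in>S - sigma ` p. h \<otimes> f \<in> sigma ` X} = sigma ` {f \<in> carrier L. \<exists>h\<in>S - p. h \<otimes> f \<in> X}"
  if X: "X \<subseteq> carrier L" for X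
 proof (intro equalityI subsetI)
  fix f assume "f \<in> {f \<in> carrier L. \<exists>h\<in>S - sigma ` p. h \<otimes> f \<in> sigma ` X}"
  then obtain h where f: "f \<in> carrier L" and h: "h \<in> S - p" "sigma h \<otimes> f \<in> sigma ` X" unfolding SP by blast
  obtain g where g: "g \<in> carrier L" "f = sigma g" using f sigma(2) unfolding bij_betw_def by blast
  have hL: "h \<in> carrier L" using h pL by blast
  have "sigma (h \<otimes> g) \<in> sigma ` X" using h g hL automorphism_simps(2) by simp
  then have "h \<otimes> g \<in> X" using automorphism_mem[OF _ X] hL g by blast
  then show "f \<in> sigma ` {f \<in> carrier L. \<exists>h\<in>S - p. h \<otimes> f \<in> X}" using g h by blast
 next
  fix f assume "f \<in> sigma ` {f \<in> carrier L. \<exists>h\<in>S - p. h \<otimes> f \<in> X}"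
  then obtain g h where g: "g \<in> carrier L" "f = sigma g" and h: "h \<in> S - p" "h \<otimes> g \<in> X" by blast
  have hL: "h \<in> carrier L" using h pL by blast
  have "sigma h \<otimes> f = sigma (h \<otimes> g)" using g hL automorphism_simps(2) by simp
  then have "sigma h \<otimes> f \<in> sigma ` X" using h by blast
  then show "f \<in> {f \<in> carrier L. \<exists>h\<in>S - sigma ` p. h \<otimes> f \<in> sigma ` X}"
   unfolding SP using g h automorphism_simps(1) by blast
 qed
 show "loc (sigma ` p) = sigma ` loc p" using *[OF pL(2)] unfolding sigma(3) loc_def .
 show "loc_max (sigma ` p) = sigma ` loc_max p" using *[OF pL(1)] unfolding loc_max_def .
qed

text \<open>Generators of the maximal ideal at \<open>p\<close> are carried to generators at the image of \<open>p\<close>.\<close>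

lemma automorphism_uniformizer:
 assumes p: "height_one p"
 shows "height_one (sigma ` p)" "f \<in> carrier L ==> f \<noteq> \<zero> ==> valuation (sigma ` p) (sigma f) = valuation p f"
proof -
 obtain t where t: "prime_id p" "p \<noteq> {\<zero>}" "t \<in> loc_max p" "loc_max p = (\<lambda>h. t \<otimes> h) ` loc p"
  using height_one_cases[OF p] .
 note P = automorphism_prime_id[OF t(1)] and E = automorphism_loc[OF t(1)]
 have lL: "loc p \<subseteq> carrier L" by (auto simp: loc_def)
 have lmL: "loc_max p \<subseteq> carrier L" by (auto simp: loc_max_def)
 have n0: "sigma ` p \<noteq> {\<zero>}"
 proof -
  obtain a where "a \<in> p" "a \<noteq> \<zero>" using t(2) prime_idD(3)[OF t(1)] by blast
  then have "sigma a \<in> sigma ` p" "sigma a \<noteq> \<zero>" using automorphism_simps(7)[of a] prime_idD(2)[OF t(1)] S_carrier by auto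
  then show ?thesis by blast
 qed
 have t': "sigma t \<in> loc_max (sigma ` p)" unfolding E using t(3) by blast
 have gen: "loc_max (sigma ` p) = (\<lambda>h. sigma t \<otimes> h) ` loc (sigma ` p)"
  unfolding E t(4) image_image
 proof (rule image_cong[OF refl])
  fix h assume "h \<in> loc p"
  then show "sigma (t \<otimes> h) = sigma t \<otimes> sigma h" using automorphism_simps(2) lL lmL t(3) by blast
 qed
 show h1: "height_one (sigma ` p)" by (rule principal_imp_height_one[OF P n0 t' gen])
 show "valuation (sigma ` p) (sigma f) = valuation p f" if f: "f \<in> carrier L" "f \<noteq> \<zero>"
 proof -
  define n where "n = valuation p f"
  obtain u where u: "u \<in> loc p - loc_max p" "f = u \<otimes> t [^] n"
   using decompose_valuation[OF t f] unfolding n_def by metis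
  note T = unif_L[OF t]
  have uL: "u \<in> carrier L" using u lL by blast
  have "sigma u \<in> loc (sigma ` p) - loc_max (sigma ` p)" unfolding E using u(1) automorphism_mem[OF uL lL] automorphism_mem[OF uL lmL] by blast
  moreover have "sigma f = sigma u \<otimes> sigma t [^] n"
  proof -
   have nat: "sigma (t [^] (k::nat)) = sigma t [^] k" for k
    by (induction k) (use T automorphism_simps in auto)
   have "sigma (t [^] n) = sigma t [^] n"
   proof (cases "n < 0")
    case False
    then have "t [^] n = t [^] nat n" "sigma t [^] n = sigma t [^] nat n" by (simp_all only: int_pow_def2 if_False)
    then show ?thesis using nat by metis
   next
    case True
    then have e: "t [^] n = inv (t [^] nat (- n))" "sigma t [^] n = inv (sigma t [^] nat (- n))" by (simp_all only: int_pow_def2 if_True)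
    have tk: "t [^] nat (- n) \<in> carrier L" "t [^] nat (- n) \<noteq> \<zero>" using T nonzero_pow by auto
    note i = nonzero_inv[OF tk]
    have "inv (sigma (t [^] nat (- n))) = sigma (inv (t [^] nat (- n)))"
     by (rule inv_unique_field) (use automorphism_simps(1,2,4) tk i in \<open>auto simp flip: automorphism_simps(2)\<close>)
    then show ?thesis unfolding e nat by simp
   qed
   then show ?thesis unfolding u(2) using automorphism_simps(2)[OF uL] int_pow_field(1)[OF T] by simp
  qed
  ultimately show ?thesis unfolding n_def[symmetric] by (rule valuation_eqI[OF P n0 t' gen])
 qed
qed

end

end

section \<open>Regular and rational functions of normal affine varieties\<close>

locale normal_variety =
 fixes V :: "('k::{alg_closed_field,field_char_0} ^ 'n::finite) set"
 assumes normal: "normal_affine_variety V"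
begin

abbreviation "A \<equiv> coordinate_ring V"
abbreviation "L \<equiv> function_field V"
abbreviation "S \<equiv> to_frac A ` carrier A"
abbreviation "gamma p \<equiv> to_frac A (restrict p V)"
abbreviation mult_A (infixl "\<otimes>\<^sub>A" 70) where "x \<otimes>\<^sub>A y \<equiv> x \<otimes>\<^bsub>A\<^esub> y"
abbreviation add_A (infixl "\<oplus>\<^sub>A" 65) where "x \<oplus>\<^sub>A y \<equiv> x \<oplus>\<^bsub>A\<^esub> y"
abbreviation zero_A ("\<zero>\<^sub>A") where "\<zero>\<^sub>A \<equiv> \<zero>\<^bsub>A\<^esub>"
abbreviation one_A ("\<one>\<^sub>A") where "\<one>\<^sub>A \<equiv> \<one>\<^bsub>A\<^esub>"
abbreviation mult_L (infixl "\<cdot>" 70) where "x \<cdot> y \<equiv> x \<otimes>\<^bsub>L\<^esub> y"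
abbreviation add_L (infixl "\<oplus>\<^sub>L" 65) where "x \<oplus>\<^sub>L y \<equiv> x \<oplus>\<^bsub>L\<^esub> y"
abbreviation zero_L ("\<zero>\<^sub>L") where "\<zero>\<^sub>L \<equiv> \<zero>\<^bsub>L\<^esub>"
abbreviation one_L ("\<one>\<^sub>L") where "\<one>\<^sub>L \<equiv> \<one>\<^bsub>L\<^esub>"
abbreviation "lookup \<equiv> Poly_Mapping.lookup"
abbreviation "Div \<equiv> carrier (WDiv V)"
abbreviation "Classes \<equiv> carrier (Cl V)"
abbreviation "Primes \<equiv> prime_divisors V"
abbreviation "Prin \<equiv> principal_divisors V"
abbreviation "dv \<equiv> div_of V"
abbreviation "cl \<equiv> div_class V"
abbreviation "sec \<equiv> sections V"

lemma domain_A: "domain A"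
 using normal by (simp add: normal_affine_variety_def integrally_closed_domain_def)

sublocale A: domain A by (rule domain_A)

sublocale L: field L
 unfolding function_field_def by (rule A.field_fraction_field)

lemma V_irreducible: "irreducible_closed V"
 using normal by (simp add: normal_affine_variety_def)

lemma V_closed: "zariski_closed V"
 using V_irreducible unfolding irreducible_closed_def by (rule conjunct1)

lemma A_simps:
 "carrier A = regular_functions V" "\<one>\<^sub>A = (\<lambda>x\<in>V. 1)" "\<zero>\<^sub>A = (\<lambda>x\<in>V. 0)"
 "f \<otimes>\<^sub>A g = (\<lambda>x\<in>V. f x * g x)" "f \<oplus>\<^sub>A g = (\<lambda>x\<in>V. f x + g x)"
 by (simp_all add: coordinate_ring_def)

lemma to_frac_ring_hom: "to_frac A \<in> ring_hom A L"
 unfolding function_field_def by (rule A.to_frac_hom)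

lemma to_frac_simps:
 "a \<in> carrier A ==> to_frac A a \<in> carrier L"
 "a \<in> carrier A ==> b \<in> carrier A ==> to_frac A (a \<otimes>\<^sub>A b) = to_frac A a \<cdot> to_frac A b"
 "a \<in> carrier A ==> b \<in> carrier A ==> to_frac A (a \<oplus>\<^sub>A b) = to_frac A a \<oplus>\<^sub>L to_frac A b"
 "to_frac A \<one>\<^sub>A = \<one>\<^sub>L" "to_frac A \<zero>\<^sub>A = \<zero>\<^sub>L"
 using ring_hom_closed[OF to_frac_ring_hom] ring_hom_mult[OF to_frac_ring_hom] ring_hom_add[OF to_frac_ring_hom]
  ring_hom_one[OF to_frac_ring_hom] ring_hom_zero[OF to_frac_ring_hom A.ring_axioms L.ring_axioms] by auto

lemma restrict_A: "p \<in> poly_funs ==> restrict p V \<in> carrier A"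
 by (simp add: A_simps regular_functions_def)

lemma A_polynomial: "a \<in> carrier A ==> \<exists>p\<in>poly_funs. a = restrict p V"
 by (auto simp: A_simps regular_functions_def)

lemma polynomial_subring: "subring1 poly_funs"
 unfolding polynomial_functions_def by (rule algebra_of_functions_subring)

lemma gamma_simps:
 assumes "p \<in> poly_funs" "q \<in> poly_funs"
 shows "gamma p \<in> S" "gamma (p + q) = gamma p \<oplus>\<^sub>L gamma q" "gamma (p * q) = gamma p \<cdot> gamma q"
  "gamma p = gamma q \<longleftrightarrow> (\<forall>x\<in>V. p x = q x)"
proof -
 note r = restrict_A[OF assms(1)] restrict_A[OF assms(2)]
 show "gamma p \<in> S" using r by blast
 have "restrict (p + q) V = restrict p V \<oplus>\<^sub>A restrict q V" "restrict (p * q) V = restrict p V \<otimes>\<^sub>A restrict q V"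
  by (auto simp: A_simps)
 then show "gamma (p + q) = gamma p \<oplus>\<^sub>L gamma q" "gamma (p * q) = gamma p \<cdot> gamma q" using to_frac_simps(2,3)[OF r] by auto
 show "gamma p = gamma q \<longleftrightarrow> (\<forall>x\<in>V. p x = q x)"
  unfolding A.to_frac_inj[OF r] by (auto simp: fun_eq_iff restrict_def)
qed

lemma gamma_zero_one: "gamma 0 = \<zero>\<^sub>L" "gamma 1 = \<one>\<^sub>L"
proof -
 have "restrict 0 V = \<zero>\<^sub>A" "restrict 1 V = \<one>\<^sub>A" by (auto simp: A_simps)
 then show "gamma 0 = \<zero>\<^sub>L" "gamma 1 = \<one>\<^sub>L" using to_frac_simps(4,5) by auto
qed

lemma S_cases: assumes "s \<in> S" obtains p where "p \<in> poly_funs" "s = gamma p"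
 using assms A_polynomial by blast

lemma S_noetherian:
 fixes a :: "nat \<Rightarrow> _"
 assumes "range a \<subseteq> S"
 shows "\<exists>n c. (\<forall>i<n. c i \<in> S) \<and> a n = (\<Oplus>\<^bsub>L\<^esub>i\<in>{..<n}. c i \<cdot> a i)"
proof -
 have "\<exists>p. p \<in> poly_funs \<and> a n = gamma p" for n using assms S_cases by (metis rangeI subsetD)
 then obtain p where p: "\<And>n. p n \<in> poly_funs" "\<And>n. a n = gamma (p n)" by metis
 have "seq_noetherian (poly_funs :: ('k ^ 'n \<Rightarrow> 'k) set)"
  unfolding polynomial_functions_def by (rule algebra_of_functions_noetherian) simp
 moreover have "range p \<subseteq> poly_funs" using p(1) by blast
 ultimately have "\<exists>n c. (\<forall>i<n. c i \<in> poly_funs) \<and> p n = (\<Sum>i<n. c i * p i)"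
  unfolding seq_noetherian_def by (elim allE[of _ p]) simp
 then obtain n c where c: "\<forall>i<n. c i \<in> poly_funs" "p n = (\<Sum>i<n. c i * p i)" by blast
 have "gamma (\<Sum>i<m. c i * p i) = (\<Oplus>\<^bsub>L\<^esub>i\<in>{..<m}. gamma (c i) \<cdot> a i)" if "m \<le> n" for m
  using that
 proof (induction m)
  case 0
  show ?case unfolding lessThan_0 sum.empty L.finsum_empty by (rule gamma_zero_one)
 next
  case (Suc m)
  have cl: "gamma (c i) \<cdot> a i \<in> carrier L" if "i \<le> m" for i
   using to_frac_simps(1) restrict_A c(1) p that Suc.prems by (intro L.m_closed) auto
  have pol: "(\<Sum>i<m. c i * p i) \<in> poly_funs" "c m * p m \<in> poly_funs"
   using c(1) p(1) Suc.prems by (auto intro!: subring1_sum[OF polynomial_subring] subring1D(6)[OF polynomial_subring])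
  have "gamma (\<Sum>i<Suc m. c i * p i) = (\<Oplus>\<^bsub>L\<^esub>i\<in>{..<m}. gamma (c i) \<cdot> a i) \<oplus>\<^sub>L (gamma (c m) \<cdot> a m)"
  proof -
   have "c m \<in> poly_funs" using c(1) Suc.prems by simp
   moreover have "gamma (\<Sum>i<m. c i * p i) = (\<Oplus>\<^bsub>L\<^esub>i\<in>{..<m}. gamma (c i) \<cdot> a i)" by (rule Suc.IH) (use Suc.prems in simp)
   ultimately show ?thesis unfolding sum.lessThan_Suc gamma_simps(2)[OF pol] by (simp only: gamma_simps(3)[OF _ p(1)] p(2)[of m])
  qed
  also have "... = (\<Oplus>\<^bsub>L\<^esub>i\<in>{..<Suc m}. gamma (c i) \<cdot> a i)"
   unfolding lessThan_Suc by (subst L.finsum_insert) (use cl in \<open>auto simp: L.a_comm\<close>)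
  finally show ?case .
 qed
 then have "a n = (\<Oplus>\<^bsub>L\<^esub>i\<in>{..<n}. gamma (c i) \<cdot> a i)" using p(2) c(2) by simp
 moreover have "\<forall>i<n. gamma (c i) \<in> S" using c(1) gamma_simps(1) by blast
 ultimately show ?thesis by (intro exI[of _ n] exI[of _ "\<lambda>i. gamma (c i)"]) blast
qed

sublocale N: noetherian_normal_domain L S
proof (unfold_locales)
 show "S \<subseteq> carrier L" using to_frac_simps(1) by blast
 show "\<one>\<^sub>L \<in> S" using to_frac_simps(4) A.one_closed by (metis imageI)
 show "x \<oplus>\<^sub>L y \<in> S" if xy: "x \<in> S" "y \<in> S" for x y
 proof -
  obtain a b where ab: "a \<in> carrier A" "b \<in> carrier A" "x = to_frac A a" "y = to_frac A b" using xy by blast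
  then have "x \<oplus>\<^sub>L y = to_frac A (a \<oplus>\<^sub>A b)" using to_frac_simps(3)[OF ab(1,2)] by simp
  then show ?thesis using A.a_closed[OF ab(1,2)] by blast
 qed
 show "x \<cdot> y \<in> S" if xy: "x \<in> S" "y \<in> S" for x y
 proof -
  obtain a b where ab: "a \<in> carrier A" "b \<in> carrier A" "x = to_frac A a" "y = to_frac A b" using xy by blast
  then have "x \<cdot> y = to_frac A (a \<otimes>\<^sub>A b)" using to_frac_simps(2)[OF ab(1,2)] by simp
  then show ?thesis using A.m_closed[OF ab(1,2)] by blast
 qed
 show "\<ominus>\<^bsub>L\<^esub> x \<in> S" if x: "x \<in> S" for x
 proof -
  obtain a where a: "a \<in> carrier A" "x = to_frac A a" using x by blast
  have "to_frac A (\<ominus>\<^bsub>A\<^esub> a) \<oplus>\<^sub>L x = \<zero>\<^sub>L"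
   using to_frac_simps(3)[of "\<ominus>\<^bsub>A\<^esub> a" a] a by (simp add: A.l_neg to_frac_simps(5))
  then have "\<ominus>\<^bsub>L\<^esub> x = to_frac A (\<ominus>\<^bsub>A\<^esub> a)" using a to_frac_simps(1) by (intro L.minus_equality) auto
  then show ?thesis using a by simp
 qed
 show "\<exists>a\<in>S. \<exists>b\<in>S - {\<zero>\<^sub>L}. x \<cdot> b = a" if x: "x \<in> carrier L" for x
 proof -
  obtain a b where ab: "a \<in> carrier A" "b \<in> carrier A - {\<zero>\<^sub>A}" "x = frac A a b"
   using A.fraction_field_cases x unfolding function_field_def by blast
  then have "x \<cdot> to_frac A b = to_frac A a" unfolding function_field_def using A.frac_times_denominator by simp
  moreover have "to_frac A b \<noteq> \<zero>\<^sub>L" using A.to_frac_inj[of b "\<zero>\<^sub>A"] ab to_frac_simps(5) by auto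
  ultimately show ?thesis using ab by blast
 qed
 show "\<exists>n c. (\<forall>i<n. c i \<in> S) \<and> a n = (\<Oplus>\<^bsub>L\<^esub>i\<in>{..<n}. c i \<cdot> a i)" if "range a \<subseteq> S" for a :: "nat \<Rightarrow> _"
  using S_noetherian[OF that] .
 show "x \<in> S" if "x \<in> carrier L" "integral_over L S x" for x
  using normal that unfolding normal_affine_variety_def integrally_closed_domain_def function_field_def by blast
qed

text \<open>The dictionary between closed subsets of \<open>V\<close> and ideals of \<open>S\<close>, the copy of the coordinate ring in the
function field.\<close>

definition vanishing :: "('k ^ 'n) set \<Rightarrow> ('k, 'n) ratfun set" where
 "vanishing P = to_frac A ` {a \<in> carrier A. \<forall>x\<in>P. a x = 0}"

definition zeros :: "('k, 'n) ratfun set \<Rightarrow> ('k ^ 'n) set" where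
 "zeros q = {x \<in> V. \<forall>p\<in>poly_funs. gamma p \<in> q \<longrightarrow> p x = 0}"

lemma vanishing_iff:
 assumes "p \<in> poly_funs" "P \<subseteq> V" shows "gamma p \<in> vanishing P \<longleftrightarrow> (\<forall>x\<in>P. p x = 0)"
proof
 assume "gamma p \<in> vanishing P"
 then obtain a where a: "a \<in> carrier A" "\<forall>x\<in>P. a x = 0" "gamma p = to_frac A a" unfolding vanishing_def by blast
 then have "restrict p V = a" using A.to_frac_inj[OF restrict_A[OF assms(1)] a(1)] by blast
 then have "a x = p x" if "x \<in> V" for x using that by auto
 then show "\<forall>x\<in>P. p x = 0" using a(2) assms(2) by (metis subsetD)
next
 assume "\<forall>x\<in>P. p x = 0"
 then have "restrict p V \<in> {a \<in> carrier A. \<forall>x\<in>P. a x = 0}" using restrict_A[OF assms(1)] assms(2) by auto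
 then show "gamma p \<in> vanishing P" unfolding vanishing_def by (rule imageI)
qed

lemma closed_Int_zero:
 assumes "zariski_closed P" "f \<in> poly_funs" shows "zariski_closed {x \<in> P. f x = 0}"
proof -
 obtain T where "T \<subseteq> poly_funs" "P = {x. \<forall>p\<in>T. p x = 0}" using assms(1) zariski_closed_def by blast
 then show ?thesis unfolding zariski_closed_def using assms(2) by (intro exI[of _ "insert f T"]) auto
qed

lemma vanishing_prime:
 assumes P: "irreducible_closed P" "P \<subseteq> V"
 shows "N.prime_id (vanishing P)"
 unfolding N.prime_id_def N.ideal_in_def
proof (intro conjI ballI impI)
 note iff = vanishing_iff[OF _ P(2)]
 note R = subring1D[OF polynomial_subring]
 have sub: "vanishing P \<subseteq> S" unfolding vanishing_def by blast
 then show "vanishing P \<subseteq> S" .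
 show "\<zero>\<^sub>L \<in> vanishing P" unfolding gamma_zero_one[symmetric] iff[OF R(2)] by simp
 obtain x0 where "x0 \<in> P" using P(1) unfolding irreducible_closed_def by blast
 then show "\<one>\<^sub>L \<notin> vanishing P" unfolding gamma_zero_one[symmetric] iff[OF R(1)] by auto
 show "x \<oplus>\<^sub>L y \<in> vanishing P" if xy: "x \<in> vanishing P" "y \<in> vanishing P" for x y
 proof -
  have xS: "x \<in> S" and yS: "y \<in> S" using xy sub by blast+
  obtain p where p: "p \<in> poly_funs" "x = gamma p" using S_cases[OF xS] .
  obtain q where q: "q \<in> poly_funs" "y = gamma q" using S_cases[OF yS] .
  have "\<forall>z\<in>P. (p + q) z = 0" using xy iff[OF p(1)] iff[OF q(1)] p(2) q(2) by simp
  then have "gamma (p + q) \<in> vanishing P" using iff[OF R(4)[OF p(1) q(1)]] by blast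
  then show ?thesis unfolding gamma_simps(2)[OF p(1) q(1)] p(2) q(2) .
 qed
 show "s \<cdot> x \<in> vanishing P" if sx: "s \<in> S" "x \<in> vanishing P" for s x
 proof -
  have xS: "x \<in> S" using sx sub by blast
  obtain p where p: "p \<in> poly_funs" "s = gamma p" using S_cases[OF sx(1)] .
  obtain q where q: "q \<in> poly_funs" "x = gamma q" using S_cases[OF xS] .
  have "\<forall>z\<in>P. (p * q) z = 0" using sx iff[OF q(1)] q(2) by simp
  then have "gamma (p * q) \<in> vanishing P" using iff[OF R(6)[OF p(1) q(1)]] by blast
  then show ?thesis unfolding gamma_simps(3)[OF p(1) q(1)] p(2) q(2) .
 qed
 show "x \<in> vanishing P \<or> y \<in> vanishing P" if xy: "x \<in> S" "y \<in> S" "x \<cdot> y \<in> vanishing P" for x y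
 proof -
  obtain p where p: "p \<in> poly_funs" "x = gamma p" using S_cases[OF xy(1)] .
  obtain q where q: "q \<in> poly_funs" "y = gamma q" using S_cases[OF xy(2)] .
  have pq: "p \<in> poly_funs" "x = gamma p" "q \<in> poly_funs" "y = gamma q" by fact+
  have "gamma (p * q) \<in> vanishing P" using xy(3) unfolding gamma_simps(3)[OF p(1) q(1)] p(2) q(2) .
  then have "\<forall>x\<in>P. p x * q x = 0" using iff[OF R(6)[OF pq(1,3)]] by simp
  then have "P = {x \<in> P. p x = 0} \<union> {x \<in> P. q x = 0}" by auto
  moreover have "zariski_closed P" using P(1) irreducible_closed_def by blast
  ultimately have "P = {x \<in> P. p x = 0} \<or> P = {x \<in> P. q x = 0}"
   using P(1) closed_Int_zero[OF _ pq(1)] closed_Int_zero[OF _ pq(3)] unfolding irreducible_closed_def by blast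
  then show ?thesis using iff[OF pq(1)] iff[OF pq(3)] pq by blast
 qed
qed

lemma zeros_vanishing:
 assumes P: "zariski_closed P" "P \<subseteq> V" shows "zeros (vanishing P) = P"
proof
 obtain T where T: "T \<subseteq> poly_funs" "P = {x. \<forall>p\<in>T. p x = 0}" using P(1) zariski_closed_def by blast
 have "gamma p \<in> vanishing P" if "p \<in> T" for p using vanishing_iff[OF _ P(2), of p] T that by blast
 then show "zeros (vanishing P) \<subseteq> P" unfolding zeros_def using T by blast
 show "P \<subseteq> zeros (vanishing P)" unfolding zeros_def using vanishing_iff[OF _ P(2)] P(2) by blast
qed

lemma prime_pullback:
 assumes q: "N.prime_id q"
 shows "prime_in poly_funs {p \<in> poly_funs. gamma p \<in> q}"
 unfolding prime_in_def
proof (intro conjI ballI impI)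
 note Q = N.prime_idD[OF q] and R = subring1D[OF polynomial_subring]
 show "0 \<in> {p \<in> poly_funs. gamma p \<in> q}" unfolding mem_Collect_eq gamma_zero_one using R(2) Q(3) by (rule conjI)
 show "1 \<notin> {p \<in> poly_funs. gamma p \<in> q}" unfolding mem_Collect_eq gamma_zero_one using Q(6) by blast
 show "x + y \<in> {p \<in> poly_funs. gamma p \<in> q}"
  if xy: "x \<in> {p \<in> poly_funs. gamma p \<in> q}" "y \<in> {p \<in> poly_funs. gamma p \<in> q}" for x y
 proof -
  have 1: "x \<in> poly_funs" "y \<in> poly_funs" and 2: "gamma x \<in> q" "gamma y \<in> q" using xy by blast+
  show ?thesis unfolding mem_Collect_eq gamma_simps(2)[OF 1] using R(4)[OF 1] Q(4)[OF 2] by (rule conjI)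
 qed
 show "r * x \<in> {p \<in> poly_funs. gamma p \<in> q}"
  if rx: "r \<in> poly_funs" "x \<in> {p \<in> poly_funs. gamma p \<in> q}" for r x
 proof -
  have 1: "r \<in> poly_funs" "x \<in> poly_funs" and 2: "gamma x \<in> q" using rx by blast+
  show ?thesis unfolding mem_Collect_eq gamma_simps(3)[OF 1] using R(6)[OF 1] Q(5)[OF gamma_simps(1)[OF 1] 2] by (rule conjI)
 qed
 show "x \<in> {p \<in> poly_funs. gamma p \<in> q} \<or> y \<in> {p \<in> poly_funs. gamma p \<in> q}"
  if xy: "x \<in> poly_funs" "y \<in> poly_funs" "x * y \<in> {p \<in> poly_funs. gamma p \<in> q}" for x y
 proof -
  have "gamma (x * y) \<in> q" using xy(3) by blast
  then have "gamma x \<in> q \<or> gamma y \<in> q"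
   unfolding gamma_simps(3)[OF xy(1,2)] by (rule Q(7)[OF gamma_simps(1)[OF xy(1,1)] gamma_simps(1)[OF xy(2,2)]])
  then show ?thesis using xy(1,2) by blast
 qed
qed blast

text \<open>The Nullstellensatz: a function outside of the prime does not vanish on its zero set.\<close>

lemma vanishing_zeros:
 assumes q: "N.prime_id q" shows "vanishing (zeros q) = q"
proof (intro equalityI subsetI)
 have zV: "zeros q \<subseteq> V" unfolding zeros_def by blast
 fix s assume "s \<in> q"
 then obtain p where p: "p \<in> poly_funs" "s = gamma p" using N.prime_idD(2)[OF q] S_cases by blast
 then show "s \<in> vanishing (zeros q)" using vanishing_iff[OF p(1) zV] \<open>s \<in> q\<close> unfolding zeros_def by blast
next
 have zV: "zeros q \<subseteq> V" unfolding zeros_def by blast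
 fix s assume s: "s \<in> vanishing (zeros q)"
 then have "s \<in> S" unfolding vanishing_def by blast
 then obtain f where f: "f \<in> poly_funs" "s = gamma f" using S_cases by blast
 show "s \<in> q"
 proof (rule ccontr)
  assume "s \<notin> q"
  then have "f \<notin> {p \<in> poly_funs. gamma p \<in> q}" using f by simp
  then obtain x where x: "\<forall>g\<in>{p \<in> poly_funs. gamma p \<in> q}. g x = 0" "f x \<noteq> 0"
   using nullstellensatz[OF prime_pullback[OF q] f(1)] by blast
  obtain T where T: "T \<subseteq> poly_funs" "V = {x. \<forall>p\<in>T. p x = 0}"
   using V_closed unfolding zariski_closed_def by blast
  have "gamma p \<in> q" if "p \<in> T" for p
  proof -
   have pp: "p \<in> poly_funs" using T(1) that by blast
   have "\<forall>x\<in>V. p x = 0 x" using T(2) that by auto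
   then have "gamma p = gamma 0" using gamma_simps(4)[OF pp subring1D(2)[OF polynomial_subring]] by blast
   then show ?thesis unfolding gamma_zero_one using N.prime_idD(3)[OF q] by metis
  qed
  then have "x \<in> V" using x(1) T by blast
  then have "x \<in> zeros q" unfolding zeros_def using x(1) by blast
  then show False using vanishing_iff[OF f(1) zV] s f(2) x(2) by blast
 qed
qed

lemma zeros_irreducible:
 assumes q: "N.prime_id q" shows "irreducible_closed (zeros q)" "zeros q \<subseteq> V"
proof -
 note QD = N.prime_idD[OF q]
 show zV: "zeros q \<subseteq> V" unfolding zeros_def by blast
 obtain T where T: "T \<subseteq> poly_funs" and VT: "V = {x. \<forall>p\<in>T. p x = 0}"
  using V_closed unfolding zariski_closed_def by blast
 have T2: "x \<in> V \<longleftrightarrow> (\<forall>p\<in>T. p x = 0)" for x by (subst VT) (rule mem_Collect_eq)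
 define Q where "Q = {p \<in> poly_funs. gamma p \<in> q}"
 have "zeros q = {x. \<forall>p\<in>T \<union> Q. p x = 0}" unfolding zeros_def Q_def using T2 by blast
 moreover have "T \<union> Q \<subseteq> poly_funs" using T by (auto simp: Q_def)
 ultimately have closed: "zariski_closed (zeros q)" unfolding zariski_closed_def by blast
 show "irreducible_closed (zeros q)" unfolding irreducible_closed_def
 proof (intro conjI allI impI)
  show "zariski_closed (zeros q)" by fact
  have "\<one>\<^sub>L \<notin> vanishing (zeros q)" unfolding vanishing_zeros[OF q] by (rule QD(6))
  moreover have "gamma 1 \<in> vanishing {}" using vanishing_iff[OF subring1D(1)[OF polynomial_subring], of "{}"] by simp
  ultimately show "zeros q \<noteq> {}" using gamma_zero_one by metis
  fix Y Z assume YZ: "zariski_closed Y \<and> zariski_closed Z \<and> zeros q = Y \<union> Z"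
  have sep: "\<exists>f\<in>poly_funs. (\<forall>x\<in>W. f x = 0) \<and> gamma f \<notin> q" if W: "zariski_closed W" "W \<subseteq> zeros q" "zeros q \<noteq> W" for W
  proof -
   obtain T' where T': "T' \<subseteq> poly_funs" "W = {x. \<forall>p\<in>T'. p x = 0}" using W(1) zariski_closed_def by blast
   obtain x where x: "x \<in> zeros q" "x \<notin> W" using W by blast
   then obtain f where f: "f \<in> T'" "f x \<noteq> 0" using T' by blast
   then have "gamma f \<notin> q" using x(1) T' unfolding zeros_def by blast
   then show ?thesis using f T' by blast
  qed
  show "zeros q = Y \<or> zeros q = Z"
  proof (rule ccontr)
   assume "\<not> ?thesis"
   then obtain f g where f: "f \<in> poly_funs" "\<forall>x\<in>Y. f x = 0" "gamma f \<notin> q"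
    and g: "g \<in> poly_funs" "\<forall>x\<in>Z. g x = 0" "gamma g \<notin> q"
    using sep[of Y] sep[of Z] YZ by blast
   have "gamma (f * g) \<in> vanishing (zeros q)"
    using vanishing_iff[OF subring1D(6)[OF polynomial_subring f(1) g(1)] zV] YZ f(2) g(2) by auto
   then have "gamma f \<cdot> gamma g \<in> q" unfolding vanishing_zeros[OF q] gamma_simps(3)[OF f(1) g(1)] .
   then show False using QD(7)[OF gamma_simps(1)[OF f(1) f(1)] gamma_simps(1)[OF g(1) g(1)]] f(3) g(3) by blast
  qed
 qed
qed

lemma vanishing_antimono: "P \<subseteq> P' ==> vanishing P' \<subseteq> vanishing P"
 unfolding vanishing_def by blast

lemma zeros_antimono: "p \<subseteq> q ==> zeros q \<subseteq> zeros p"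
 unfolding zeros_def by blast

lemma vanishing_V: "vanishing V = {\<zero>\<^sub>L}"
proof -
 have "a = \<zero>\<^sub>A" if a: "a \<in> carrier A" "\<forall>x\<in>V. a x = 0" for a
  using a regular_functions_extensional[of a V]
  by (intro extensionalityI[of _ V]) (auto simp: A_simps)
 moreover have "\<forall>x\<in>V. \<zero>\<^sub>A x = 0" by (simp add: A_simps)
 ultimately have "{a \<in> carrier A. \<forall>x\<in>V. a x = 0} = {\<zero>\<^sub>A}" using A.zero_closed by blast
 then show ?thesis unfolding vanishing_def by (simp add: to_frac_simps)
qed

text \<open>By the Nullstellensatz prime divisors correspond to the primes of height one.\<close>

lemma prime_divisor_height_one:
 assumes "P \<in> Primes"
 shows "N.height_one (vanishing P)" "zeros (vanishing P) = P"
proof -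
 have P: "irreducible_closed P" "P \<subset> V" "\<And>Z. irreducible_closed Z ==> P \<subset> Z ==> Z \<subset> V ==> False"
  using assms unfolding prime_divisors_def by blast+
 have PV: "P \<subseteq> V" and Pc: "zariski_closed P" using P(1,2) unfolding irreducible_closed_def by simp_all
 show zv: "zeros (vanishing P) = P" by (rule zeros_vanishing[OF Pc PV])
 note Vc = V_closed
 show "N.height_one (vanishing P)" unfolding N.height_one_def
 proof (intro conjI allI impI)
  show "N.prime_id (vanishing P)" by (rule vanishing_prime[OF P(1) PV])
  show "vanishing P \<noteq> {\<zero>\<^sub>L}" using zv zeros_vanishing[OF Vc subset_refl] vanishing_V P(2) by auto
  fix q assume q: "N.prime_id q \<and> q \<noteq> {\<zero>\<^sub>L} \<and> q \<subseteq> vanishing P"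
  then have "P \<subseteq> zeros q" using zeros_antimono zv by blast
  moreover have "zeros q \<noteq> V" using q vanishing_zeros[of q] vanishing_V by auto
  ultimately have "zeros q = P" using P(3)[OF zeros_irreducible(1)] zeros_irreducible(2) q by blast
  then show "q = vanishing P" using vanishing_zeros q by blast
 qed
qed

lemma height_one_prime_divisor:
 assumes "N.height_one q" shows "zeros q \<in> Primes" "vanishing (zeros q) = q"
proof -
 have q: "N.prime_id q" "q \<noteq> {\<zero>\<^sub>L}" "\<And>q'. N.prime_id q' ==> q' \<noteq> {\<zero>\<^sub>L} ==> q' \<subseteq> q ==> q' = q"
  using assms unfolding N.height_one_def by blast+
 show vz: "vanishing (zeros q) = q" by (rule vanishing_zeros[OF q(1)])
 have nV: "zeros q \<noteq> V" using vz vanishing_V q(2) by auto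
 show "zeros q \<in> Primes" unfolding prime_divisors_def
 proof (intro CollectI conjI notI)
  show "irreducible_closed (zeros q)" "zeros q \<subset> V" using zeros_irreducible[OF q(1)] nV by auto
  assume "\<exists>Z. irreducible_closed Z \<and> zeros q \<subset> Z \<and> Z \<subset> V"
  then obtain Z where Z: "irreducible_closed Z" "zeros q \<subset> Z" "Z \<subset> V" by blast
  have ZV: "Z \<subseteq> V" and Zc: "zariski_closed Z" using Z(1,3) unfolding irreducible_closed_def by simp_all
  have "vanishing Z \<subseteq> q" using vanishing_antimono[of "zeros q" Z] Z(2) vz by auto
  moreover have "vanishing Z \<noteq> {\<zero>\<^sub>L}"
  proof
   assume "vanishing Z = {\<zero>\<^sub>L}"
   then have "zeros (vanishing Z) = zeros (vanishing V)" using vanishing_V by simp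
   then show False using zeros_vanishing[OF Zc ZV] zeros_vanishing[OF V_closed subset_refl] Z(3) by blast
  qed
  ultimately have "vanishing Z = q" using q(3) vanishing_prime[OF Z(1) ZV] by blast
  then show False using zeros_vanishing[OF Zc ZV] Z(2) by auto
 qed
qed

lemma local_ring_eq:
 assumes P: "P \<in> Primes"
 shows "local_ring V P = N.loc (vanishing P)" "local_max_ideal V P = N.loc_max (vanishing P)"
proof -
 have PV: "P \<subseteq> V" using P unfolding prime_divisors_def by blast
 have van: "to_frac A a \<in> vanishing P \<longleftrightarrow> (\<forall>x\<in>P. a x = 0)" if "a \<in> carrier A" for a
  using that A.to_frac_inj unfolding vanishing_def by (auto simp: image_iff)
 have *: "{frac A a b | a b. a \<in> regular_functions V \<and> b \<in> regular_functions V \<and> to_frac A a \<in> X \<and> (\<exists>x\<in>P. b x \<noteq> 0)}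
   = {f \<in> carrier L. \<exists>h\<in>S - vanishing P. h \<cdot> f \<in> X}" if X: "X \<subseteq> S" for X
 proof (intro equalityI subsetI)
  fix f assume "f \<in> {frac A a b | a b. a \<in> regular_functions V \<and> b \<in> regular_functions V \<and> to_frac A a \<in> X \<and> (\<exists>x\<in>P. b x \<noteq> 0)}"
  then obtain a b where ab: "a \<in> carrier A" "b \<in> carrier A" "to_frac A a \<in> X" "\<exists>x\<in>P. b x \<noteq> 0" and f: "f = frac A a b"
   unfolding A_simps by blast
  have b0: "b \<in> carrier A - {\<zero>\<^sub>A}" using ab(2,4) PV by (auto simp: A_simps)
  have fL: "f \<in> carrier L" unfolding f function_field_def by (rule A.frac_closed[OF ab(1) b0])
  have "to_frac A b \<cdot> f = to_frac A a"
   using A.frac_times_denominator[OF ab(1) b0] fL ab(2) to_frac_simps(1) unfolding f function_field_def[symmetric] by (simp add: L.m_comm)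
  then have "to_frac A b \<cdot> f \<in> X" using ab(3) by simp
  moreover have "to_frac A b \<in> S - vanishing P" using ab(2,4) van[OF ab(2)] by blast
  ultimately show "f \<in> {f \<in> carrier L. \<exists>h\<in>S - vanishing P. h \<cdot> f \<in> X}" using fL by blast
 next
  fix f assume "f \<in> {f \<in> carrier L. \<exists>h\<in>S - vanishing P. h \<cdot> f \<in> X}"
  then obtain b where f: "f \<in> carrier L" and b: "b \<in> carrier A" "to_frac A b \<notin> vanishing P" "to_frac A b \<cdot> f \<in> X" by blast
  then obtain a where a: "a \<in> carrier A" "to_frac A b \<cdot> f = to_frac A a" using X by blast
  have ex: "\<exists>x\<in>P. b x \<noteq> 0" using van[OF b(1)] b(2) by blast
  then have b0: "b \<in> carrier A - {\<zero>\<^sub>A}" using b(1) PV by (auto simp: A_simps)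
  have tb: "to_frac A b \<in> carrier L" "to_frac A b \<noteq> \<zero>\<^sub>L"
   using to_frac_simps(1)[OF b(1)] A.to_frac_inj[of b "\<zero>\<^sub>A"] b0 to_frac_simps(5) by auto
  have g: "frac A a b \<in> carrier L" unfolding function_field_def by (rule A.frac_closed[OF a(1) b0])
  have "to_frac A b \<cdot> frac A a b = to_frac A a"
   using A.frac_times_denominator[OF a(1) b0] g tb unfolding function_field_def[symmetric] by (simp add: L.m_comm)
  then have "f = frac A a b" using a(2) L.m_lcancel[OF tb(2,1) f g] by simp
  then show "f \<in> {frac A a b | a b. a \<in> regular_functions V \<and> b \<in> regular_functions V \<and> to_frac A a \<in> X \<and> (\<exists>x\<in>P. b x \<noteq> 0)}"
   using a b ex unfolding A_simps by auto
 qed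
 have 1: "local_ring V P = {frac A a b | a b. a \<in> regular_functions V \<and> b \<in> regular_functions V \<and> to_frac A a \<in> S \<and> (\<exists>x\<in>P. b x \<noteq> 0)}"
  unfolding local_ring_def A_simps by blast
 show "local_ring V P = N.loc (vanishing P)" unfolding 1 *[OF subset_refl] N.loc_def ..
 have 2: "local_max_ideal V P = {frac A a b | a b. a \<in> regular_functions V \<and> b \<in> regular_functions V \<and> to_frac A a \<in> vanishing P \<and> (\<exists>x\<in>P. b x \<noteq> 0)}"
  unfolding local_max_ideal_def using van unfolding A_simps by blast
 have vS: "vanishing P \<subseteq> S" unfolding vanishing_def by blast
 show "local_max_ideal V P = N.loc_max (vanishing P)" unfolding 2 *[OF vS] N.loc_max_def ..
qed

lemma ord_along_eq: "P \<in> Primes ==> ord_along V P f = N.valuation (vanishing P) f"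
 unfolding ord_along_def N.valuation_def local_ring_eq ..

end

section \<open>Weil divisors\<close>

context normal_variety begin

lemma lookup_div_of:
 assumes f: "f \<in> carrier L" "f \<noteq> \<zero>\<^sub>L"
 shows "lookup (dv f) P = (if P \<in> Primes then ord_along V P f else 0)"
proof -
 let ?o = "\<lambda>P. if P \<in> Primes then ord_along V P f else 0"
 have "{P. ?o P \<noteq> 0} \<subseteq> zeros ` {p. N.height_one p \<and> N.valuation p f \<noteq> 0}"
 proof
  fix P assume "P \<in> {P. ?o P \<noteq> 0}"
  then have P: "P \<in> Primes" "ord_along V P f \<noteq> 0" by (auto split: if_splits)
  then have "vanishing P \<in> {p. N.height_one p \<and> N.valuation p f \<noteq> 0}"
   using prime_divisor_height_one(1) ord_along_eq by auto
  then show "P \<in> zeros ` {p. N.height_one p \<and> N.valuation p f \<noteq> 0}"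
   by (rule image_eqI[rotated]) (simp add: prime_divisor_height_one(2)[OF P(1)])
 qed
 then have "finite {P. ?o P \<noteq> 0}" by (rule finite_subset) (intro finite_imageI N.finite_valuation_nonzero[OF f])
 then show ?thesis unfolding div_of_def by (simp add: Abs_poly_mapping_inverse)
qed

lemma W_iff: "D \<in> Div \<longleftrightarrow> Poly_Mapping.keys D \<subseteq> Primes"
 by (simp add: WDiv_def)

lemma W_lookup: "D \<in> Div ==> P \<notin> Primes ==> lookup D P = 0"
 unfolding W_iff by (metis in_keys_iff subsetD)

lemma W_I: "(\<And>P. P \<notin> Primes ==> lookup D P = 0) ==> D \<in> Div"
 unfolding W_iff by (meson in_keys_iff subsetI)

lemma W_simps: "\<one>\<^bsub>WDiv V\<^esub> = 0" "D \<otimes>\<^bsub>WDiv V\<^esub> E = D + E" "D \<in> Div ==> inv\<^bsub>WDiv V\<^esub> D = - D"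
 by (simp_all add: WDiv_def)

lemma comm_group_W: "comm_group (WDiv V)"
 unfolding WDiv_def by (rule abelian_free_Abelian_group)

lemma W_closed:
 "0 \<in> Div" "D \<in> Div ==> E \<in> Div ==> D + E \<in> Div"
 "D \<in> Div ==> - D \<in> Div" "D \<in> Div ==> E \<in> Div ==> D - E \<in> Div"
 by (auto intro!: W_I simp: W_lookup lookup_add lookup_minus)

context
 fixes f assumes f: "f \<in> carrier L" "f \<noteq> \<zero>\<^sub>L"
begin

lemma div_of_W: "dv f \<in> Div"
 by (rule W_I) (simp add: lookup_div_of[OF f])

lemma div_of_mult:
 assumes g: "g \<in> carrier L" "g \<noteq> \<zero>\<^sub>L"
 shows "dv (f \<cdot> g) = dv f + dv g"
proof (rule poly_mapping_eqI)
 fix P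
 have fg: "f \<cdot> g \<in> carrier L" "f \<cdot> g \<noteq> \<zero>\<^sub>L" using f g L.nonzero_mult by auto
 show "lookup (dv (f \<cdot> g)) P = lookup (dv f + dv g) P"
  using N.valuation_mult[OF prime_divisor_height_one(1) f g]
  by (simp add: lookup_add lookup_div_of[OF f] lookup_div_of[OF g] lookup_div_of[OF fg] ord_along_eq)
qed

lemma effective_div_of: "effective (dv f) \<longleftrightarrow> f \<in> S"
proof
 assume e: "effective (dv f)"
 show "f \<in> S"
 proof (rule N.intersection_of_localizations[OF f])
  fix p assume p: "N.height_one p"
  have "0 \<le> lookup (dv f) (zeros p)" using e unfolding effective_def by blast
  then show "0 \<le> N.valuation p f"
   using height_one_prime_divisor[OF p] by (simp add: lookup_div_of[OF f] ord_along_eq)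
 qed
next
 assume "f \<in> S"
 then show "effective (dv f)" unfolding effective_def
  using N.valuation_S(1)[OF prime_divisor_height_one(1) _ f(2)] by (simp add: lookup_div_of[OF f] ord_along_eq)
qed

lemma div_of_inv: "dv (inv\<^bsub>L\<^esub> f) = - dv f"
proof (rule poly_mapping_eqI)
 fix P
 note i = L.nonzero_inv[OF f]
 show "lookup (dv (inv\<^bsub>L\<^esub> f)) P = lookup (- dv f) P"
  using N.valuation_inv[OF prime_divisor_height_one(1) f]
  by (simp add: lookup_div_of[OF f] lookup_div_of[OF i(1,2)] ord_along_eq)
qed

lemma section_iff: "f \<in> sec D \<longleftrightarrow> effective (dv f + D)"
 using f by (simp add: sections_def)

end

lemma div_of_one: "dv \<one>\<^sub>L = 0"
 using div_of_mult[of "\<one>\<^sub>L" "\<one>\<^sub>L"] by simp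

lemma div_of_add_ge:
 assumes f: "f \<in> carrier L" "f \<noteq> \<zero>\<^sub>L" and g: "g \<in> carrier L" "g \<noteq> \<zero>\<^sub>L" and fg: "f \<oplus>\<^sub>L g \<noteq> \<zero>\<^sub>L"
  and e: "effective (dv f + D)" "effective (dv g + D)"
 shows "effective (dv (f \<oplus>\<^sub>L g) + D)"
 unfolding effective_def
proof
 fix P
 have fgL: "f \<oplus>\<^sub>L g \<in> carrier L" using f g by simp
 have e': "0 \<le> lookup (dv f) P + lookup D P"
  "0 \<le> lookup (dv g) P + lookup D P"
  using e unfolding effective_def lookup_add by blast+
 show "0 \<le> lookup (dv (f \<oplus>\<^sub>L g) + D) P"
 proof (cases "P \<in> Primes")
  case True
  then show ?thesis
   using N.valuation_add[OF prime_divisor_height_one(1)[OF True] f g fg, of "- lookup D P"] e'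
   by (simp add: lookup_add lookup_div_of[OF f] lookup_div_of[OF g] lookup_div_of[OF fgL fg] ord_along_eq)
 next
  case False
  then show ?thesis using e' by (simp add: lookup_add lookup_div_of[OF f] lookup_div_of[OF fgL fg])
 qed
qed

text \<open>The approximation lemma for valuations, translated to divisors.\<close>

lemma section_with_order:
 assumes D: "D \<in> Div" and P: "P \<in> Primes"
 shows "\<exists>f\<in>carrier L. f \<noteq> \<zero>\<^sub>L \<and> f \<in> sec D \<and> lookup (dv f) P = - lookup D P"
proof -
 note h = prime_divisor_height_one[OF P]
 let ?d = "\<lambda>q. - lookup D (zeros q)"
 have "{q. N.height_one q \<and> ?d q \<noteq> 0} \<subseteq> vanishing ` Poly_Mapping.keys D"
 proof
  fix q assume "q \<in> {q. N.height_one q \<and> ?d q \<noteq> 0}"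
  then have q: "N.height_one q" "zeros q \<in> Poly_Mapping.keys D" by (auto simp: in_keys_iff)
  then show "q \<in> vanishing ` Poly_Mapping.keys D"
   by (intro image_eqI[OF _ q(2)]) (simp add: height_one_prime_divisor(2)[OF q(1)])
 qed
 then have "finite {q. N.height_one q \<and> ?d q \<noteq> 0}" by (rule finite_subset) simp
 from N.exists_prescribed_valuation[OF h(1) this] obtain f where f: "f \<in> carrier L" "f \<noteq> \<zero>\<^sub>L"
  "N.valuation (vanishing P) f = ?d (vanishing P)" "\<And>q. N.height_one q ==> ?d q \<le> N.valuation q f" by blast
 have "f \<in> sec D" unfolding section_iff[OF f(1,2)] effective_def
 proof
  fix Q
  show "0 \<le> lookup (dv f + D) Q"
  proof (cases "Q \<in> Primes")
   case True
   then show ?thesis using f(4)[OF prime_divisor_height_one(1)[OF True]] prime_divisor_height_one(2)[OF True]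
    by (simp add: lookup_add lookup_div_of[OF f(1,2)] ord_along_eq)
  qed (simp add: lookup_add lookup_div_of[OF f(1,2)] W_lookup[OF D])
 qed
 moreover have "lookup (dv f) P = - lookup D P"
  using f(3) h(2) P by (simp add: lookup_div_of[OF f(1,2)] ord_along_eq)
 ultimately show ?thesis using f(1,2) by blast
qed

lemma nonzero_section:
 assumes D: "D \<in> Div"
 shows "\<exists>f\<in>carrier L. f \<noteq> \<zero>\<^sub>L \<and> f \<in> sec D"
proof (cases "Primes = {}")
 case False then show ?thesis using section_with_order[OF D] by blast
next
 case True
 then have "D = 0" using D unfolding W_iff by simp
 then have "\<one>\<^sub>L \<in> sec D" using section_iff[of "\<one>\<^sub>L" D] div_of_one by (simp add: effective_def)
 then show ?thesis using L.one_not_zero by blast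
qed

text \<open>The image of a divisor under an automorphism of the function field with inverse \<open>tau\<close>.\<close>

definition push :: "(('k, 'n) ratfun \<Rightarrow> ('k, 'n) ratfun) \<Rightarrow> ('k, 'n) divisor \<Rightarrow> ('k, 'n) divisor" where
 "push tau D = Abs_poly_mapping
   (\<lambda>Q. if Q \<in> Primes then lookup D (zeros (tau ` vanishing Q)) else 0)"

context
 fixes sigma tau
 assumes sigma: "sigma \<in> ring_hom L L" "bij_betw sigma (carrier L) (carrier L)" "sigma ` S = S"
  and tau: "tau \<in> ring_hom L L" "bij_betw tau (carrier L) (carrier L)" "tau ` S = S"
  and st: "\<forall>x\<in>carrier L. sigma (tau x) = x" and ts: "\<forall>x\<in>carrier L. tau (sigma x) = x"
begin

lemma move_back_vanishing: "sigma ` tau ` vanishing Q = vanishing Q"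
proof -
 have "vanishing Q \<subseteq> carrier L" unfolding vanishing_def using to_frac_simps(1) by blast
 then have "(\<lambda>x. sigma (tau x)) ` vanishing Q = (\<lambda>x. x) ` vanishing Q" using st by (intro image_cong) auto
 then show ?thesis by (simp add: image_image)
qed

lemma moved_prime_divisor:
 assumes "Q \<in> Primes"
 shows "zeros (tau ` vanishing Q) \<in> Primes" "vanishing (zeros (tau ` vanishing Q)) = tau ` vanishing Q"
  "zeros (sigma ` vanishing (zeros (tau ` vanishing Q))) = Q"
proof -
 note h = N.automorphism_uniformizer(1)[OF tau prime_divisor_height_one(1)[OF assms]]
 show "zeros (tau ` vanishing Q) \<in> Primes" and v: "vanishing (zeros (tau ` vanishing Q)) = tau ` vanishing Q"
  using height_one_prime_divisor[OF h] by auto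
 show "zeros (sigma ` vanishing (zeros (tau ` vanishing Q))) = Q"
  unfolding v move_back_vanishing using prime_divisor_height_one(2)[OF assms] by simp
qed

end

context
 fixes sigma tau
 assumes sigma: "sigma \<in> ring_hom L L" "bij_betw sigma (carrier L) (carrier L)" "sigma ` S = S"
  and tau: "tau \<in> ring_hom L L" "bij_betw tau (carrier L) (carrier L)" "tau ` S = S"
  and st: "\<forall>x\<in>carrier L. sigma (tau x) = x" and ts: "\<forall>x\<in>carrier L. tau (sigma x) = x"
begin

lemmas to_Q = moved_prime_divisor[OF sigma tau st ts]
lemmas from_Q = moved_prime_divisor[OF tau sigma ts st]

lemma lookup_push:
 "lookup (push tau D) Q = (if Q \<in> Primes then lookup D (zeros (tau ` vanishing Q)) else 0)"
proof -
 let ?o = "\<lambda>Q. if Q \<in> Primes then lookup D (zeros (tau ` vanishing Q)) else 0"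
 have "{Q. ?o Q \<noteq> 0} \<subseteq> (\<lambda>P. zeros (sigma ` vanishing P)) ` Poly_Mapping.keys D"
 proof
  fix Q assume "Q \<in> {Q. ?o Q \<noteq> 0}"
  then have Q: "Q \<in> Primes" "zeros (tau ` vanishing Q) \<in> Poly_Mapping.keys D" by (auto simp: in_keys_iff split: if_splits)
  then show "Q \<in> (\<lambda>P. zeros (sigma ` vanishing P)) ` Poly_Mapping.keys D"
   using to_Q(3)[OF Q(1)] by (intro image_eqI[of _ _ "zeros (tau ` vanishing Q)"]) auto
 qed
 then have "finite {Q. ?o Q \<noteq> 0}" by (rule finite_subset) simp
 then show ?thesis unfolding push_def by (simp add: Abs_poly_mapping_inverse)
qed

lemma push_W: "push tau D \<in> Div"
 by (rule W_I) (simp add: lookup_push)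

lemma push_add: "push tau (D + E) = push tau D + push tau E"
 by (rule poly_mapping_eqI) (simp add: lookup_push lookup_add)

lemma push_div_of:
 assumes f: "f \<in> carrier L" "f \<noteq> \<zero>\<^sub>L"
 shows "push tau (dv f) = dv (sigma f)"
proof (rule poly_mapping_eqI)
 fix Q
 have sf: "sigma f \<in> carrier L" "sigma f \<noteq> \<zero>\<^sub>L" using N.automorphism_simps(1,7)[OF sigma] f by auto
 show "lookup (push tau (dv f)) Q = lookup (dv (sigma f)) Q"
 proof (cases "Q \<in> Primes")
  case True
  note move_back_vanishing[OF sigma tau st ts, of Q]
  then have "N.valuation (tau ` vanishing Q) f = N.valuation (vanishing Q) (sigma f)"
   using N.automorphism_uniformizer(2)[OF sigma N.automorphism_uniformizer(1)[OF tau prime_divisor_height_one(1)[OF True]] f] by simp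
  then show ?thesis using True to_Q[OF True]
   by (simp add: lookup_push lookup_div_of[OF f] lookup_div_of[OF sf] ord_along_eq)
 qed (simp add: lookup_push lookup_div_of[OF sf])
qed

lemma push_inverse: 
 assumes "D \<in> Div"
 shows "push tau (push sigma D) = D"
proof (rule poly_mapping_eqI)
 fix Q
 show "lookup (push tau (push sigma D)) Q = lookup D Q"
 proof (cases "Q \<in> Primes")
  case True
  have "lookup (push sigma D) (zeros (tau ` vanishing Q)) = lookup D Q"
  proof -
   let ?P = "zeros (tau ` vanishing Q)"
   have "{P. (if P \<in> Primes then lookup D (zeros (sigma ` vanishing P)) else 0) \<noteq> 0}
     \<subseteq> (\<lambda>P. zeros (tau ` vanishing P)) ` Poly_Mapping.keys D" (is "?X \<subseteq> _")
   proof
    fix P assume "P \<in> ?X"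
    then have P: "P \<in> Primes" "zeros (sigma ` vanishing P) \<in> Poly_Mapping.keys D" by (auto simp: in_keys_iff split: if_splits)
    then show "P \<in> (\<lambda>P. zeros (tau ` vanishing P)) ` Poly_Mapping.keys D"
     using from_Q(3)[OF P(1)] by (intro image_eqI[of _ _ "zeros (sigma ` vanishing P)"]) auto
   qed
   then have "finite ?X" by (rule finite_subset) simp
   then show ?thesis unfolding push_def using to_Q[OF True] by (simp add: Abs_poly_mapping_inverse)
  qed
  then show ?thesis using True by (simp add: lookup_push)
 qed (simp add: lookup_push W_lookup[OF assms])
qed

lemma effective_push:
 assumes D: "D \<in> Div" shows "effective (push tau D) \<longleftrightarrow> effective D"
 unfolding effective_def
proof
 assume e: "\<forall>P. 0 \<le> lookup (push tau D) P"
 show "\<forall>P. 0 \<le> lookup D P"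
 proof
  fix P
  show "0 \<le> lookup D P"
  proof (cases "P \<in> Primes")
   case True
   then show ?thesis using e[rule_format, of "zeros (sigma ` vanishing P)"] from_Q[OF True] by (simp add: lookup_push)
  qed (simp add: W_lookup[OF D])
 qed
qed (simp add: lookup_push)

end

end

section \<open>Divisor classes and the divisorial algebra\<close>

locale cox_data = normal_variety V for V :: "('k::{alg_closed_field,field_char_0} ^ 'n::finite) set" +
 fixes K :: "('k, 'n) divisor set" and F :: "('k, 'n) divisor \<Rightarrow> ('k, 'n) ratfun"
 assumes K: "subgroup K (WDiv V)" and coh: "coherent V K F" and surj: "div_class V ` K = carrier (Cl V)"
begin

abbreviation "K0 \<equiv> principal_subgroup V K"
abbreviation "T \<equiv> divisorial_algebra V K"
abbreviation "I \<equiv> cox_ideal V K F"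
abbreviation "R \<equiv> cox_ring V K F"
abbreviation "hg \<equiv> homogeneous V"
abbreviation mult_T (infixl "\<otimes>\<^sub>T" 70) where "x \<otimes>\<^sub>T y \<equiv> x \<otimes>\<^bsub>T\<^esub> y"
abbreviation add_T (infixl "\<oplus>\<^sub>T" 65) where "x \<oplus>\<^sub>T y \<equiv> x \<oplus>\<^bsub>T\<^esub> y"
abbreviation zero_T ("\<zero>\<^sub>T") where "\<zero>\<^sub>T \<equiv> \<zero>\<^bsub>T\<^esub>"
abbreviation one_T ("\<one>\<^sub>T") where "\<one>\<^sub>T \<equiv> \<one>\<^bsub>T\<^esub>"
abbreviation mult_R (infixl "\<otimes>\<^sub>R" 70) where "x \<otimes>\<^sub>R y \<equiv> x \<otimes>\<^bsub>R\<^esub> y"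
abbreviation add_R (infixl "\<oplus>\<^sub>R" 65) where "x \<oplus>\<^sub>R y \<equiv> x \<oplus>\<^bsub>R\<^esub> y"
abbreviation zero_R ("\<zero>\<^sub>R") where "\<zero>\<^sub>R \<equiv> \<zero>\<^bsub>R\<^esub>"
abbreviation one_R ("\<one>\<^sub>R") where "\<one>\<^sub>R \<equiv> \<one>\<^bsub>R\<^esub>"

sublocale W: comm_group "WDiv V" by (rule comm_group_W)

lemma principal_iff: "D \<in> Prin \<longleftrightarrow> (\<exists>f\<in>carrier L. f \<noteq> \<zero>\<^sub>L \<and> D = dv f)"
 by (auto simp: principal_divisors_def)

lemma principal_subgroup_W: "subgroup (Prin) (WDiv V)"
proof (rule W.subgroupI)
 show "Prin \<subseteq> Div"
 proof
  fix D assume "D \<in> Prin"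
  then obtain f where "f \<in> carrier L" "f \<noteq> \<zero>\<^sub>L" "D = dv f" unfolding principal_iff by blast
  then show "D \<in> Div" using div_of_W by simp
 qed
 have "dv \<one>\<^sub>L \<in> Prin" unfolding principal_iff using L.one_closed L.one_not_zero by blast
 then show "Prin \<noteq> {}" by blast
 fix D assume "D \<in> Prin"
 then obtain f where f: "f \<in> carrier L" "f \<noteq> \<zero>\<^sub>L" "D = dv f" unfolding principal_iff by blast
 then have "- D = dv (inv\<^bsub>L\<^esub> f)" "D \<in> Div"
  using div_of_inv[OF f(1,2)] div_of_W[OF f(1,2)] by simp_all
 then show "inv\<^bsub>WDiv V\<^esub> D \<in> Prin"
  unfolding principal_iff using L.nonzero_inv(1,2)[OF f(1,2)] W_simps(3)[of D] by (intro bexI[of _ "inv\<^bsub>L\<^esub> f"]) simp_all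
 fix E assume "E \<in> Prin"
 then obtain g where g: "g \<in> carrier L" "g \<noteq> \<zero>\<^sub>L" "E = dv g" unfolding principal_iff by blast
 have "D + E = dv (f \<cdot> g)" using div_of_mult[OF f(1,2) g(1,2)] f g by simp
 then show "D \<otimes>\<^bsub>WDiv V\<^esub> E \<in> Prin" 
  unfolding W_simps principal_iff using L.nonzero_mult[OF f(1) g(1) f(2) g(2)] L.m_closed[OF f(1) g(1)] by blast
qed

lemma principal_normal: "Prin \<lhd> WDiv V"
 by (rule W.subgroup_imp_normal[OF principal_subgroup_W])

lemma Cl_comm_group: "comm_group (Cl V)"
 unfolding Cl_def by (rule W.abelian_FactGroup[OF principal_subgroup_W])

lemma Cl_simps:
 "Classes = cl ` Div"
 "D \<in> Div ==> E \<in> Div ==> cl D \<otimes>\<^bsub>Cl V\<^esub> cl E = cl (D + E)"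
 "\<one>\<^bsub>Cl V\<^esub> = Prin"
proof -
 show "Classes = cl ` Div"
  by (auto simp: Cl_def FactGroup_def RCOSETS_def div_class_def)
 show "cl D \<otimes>\<^bsub>Cl V\<^esub> cl E = cl (D + E)" if "D \<in> Div" "E \<in> Div"
  using normal.rcos_sum[OF principal_normal that] by (simp add: Cl_def FactGroup_def div_class_def W_simps)
 show "\<one>\<^bsub>Cl V\<^esub> = Prin" by (simp add: Cl_def FactGroup_def)
qed

lemma mem_div_class:
 assumes "D \<in> Div" shows "E \<in> cl D \<longleftrightarrow> E - D \<in> Prin"
proof
 assume "E \<in> cl D"
 then obtain P where "P \<in> Prin" "E = P + D" by (auto simp: div_class_def r_coset_def W_simps)
 then show "E - D \<in> Prin" by simp
next
 assume "E - D \<in> Prin"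
 then show "E \<in> cl D" unfolding div_class_def r_coset_def W_simps by (auto intro!: bexI[of _ "E - D"])
qed

lemma div_class_eq_iff:
 assumes "D \<in> Div" "E \<in> Div"
 shows "cl D = cl E \<longleftrightarrow> D - E \<in> Prin"
proof -
 interpret P: subgroup "Prin" "WDiv V" by (rule principal_subgroup_W)
 have P0: "0 \<in> Prin" using P.one_closed W_simps by simp
 have Padd: "x + y \<in> Prin" if "x \<in> Prin" "y \<in> Prin" for x y
  using P.m_closed[OF that] W_simps by simp
 have Pneg: "- x \<in> Prin" if "x \<in> Prin" for x
  using P.m_inv_closed[OF that] W_simps(3) P.mem_carrier[OF that] by simp
 show ?thesis
 proof
  assume "cl D = cl E"
  moreover have "D \<in> cl D" using mem_div_class[OF assms(1)] P0 by simp
  ultimately show "D - E \<in> Prin" using mem_div_class[OF assms(2)] by blast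
 next
  assume DE: "D - E \<in> Prin"
  show "cl D = cl E"
  proof (rule Set.set_eqI)
   fix X
   have "X - D \<in> Prin \<longleftrightarrow> X - E \<in> Prin"
    using Padd[OF _ DE, of "X - D"] Padd[OF _ Pneg[OF DE], of "X - E"] by auto
   then show "X \<in> cl D \<longleftrightarrow> X \<in> cl E" using mem_div_class assms by blast
  qed
 qed
qed

lemma K_W: "D \<in> K ==> D \<in> Div"
 using subgroup.mem_carrier[OF K] .

lemma K_closed: "0 \<in> K" "D \<in> K ==> E \<in> K ==> D + E \<in> K" "D \<in> K ==> E \<in> K ==> D - E \<in> K" "D \<in> K ==> - D \<in> K"
proof -
 interpret K: subgroup K "WDiv V" by (rule K)
 show "0 \<in> K" using K.one_closed W_simps by simp
 show add: "\<And>D E. D \<in> K ==> E \<in> K ==> D + E \<in> K" using K.m_closed W_simps by simp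
 show neg: "\<And>D. D \<in> K ==> - D \<in> K" using K.m_inv_closed W_simps(3) K_W by metis
 show "D \<in> K ==> E \<in> K ==> D - E \<in> K" using add[of D "- E"] neg[of E] by simp
qed

lemma K0_iff: "D \<in> K0 \<longleftrightarrow> D \<in> K \<and> D \<in> Prin"
proof -
 have "cl D = Prin \<longleftrightarrow> D \<in> Prin" if "D \<in> Div"
 proof -
  have "cl 0 = Prin" using mem_div_class[OF W_closed(1)] by auto
  then show ?thesis using div_class_eq_iff[OF that W_closed(1)] by simp
 qed
 then show ?thesis unfolding principal_subgroup_def Cl_simps using K_W by blast
qed

lemma div_class_eq_K: "D \<in> K ==> E \<in> K ==> cl D = cl E \<longleftrightarrow> D - E \<in> K0"
 using div_class_eq_iff[OF K_W K_W, of D E] K_closed(3)[of D E] by (simp add: K0_iff)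

lemma K0_closed: "0 \<in> K0" "D \<in> K0 ==> E \<in> K0 ==> D + E \<in> K0" "D \<in> K0 ==> - D \<in> K0"
 "D \<in> K0 ==> E \<in> K0 ==> D - E \<in> K0"
proof -
 interpret P: subgroup "Prin" "WDiv V" by (rule principal_subgroup_W)
 show "0 \<in> K0" using P.one_closed K_closed W_simps unfolding K0_iff by simp
 show add: "D \<in> K0 ==> E \<in> K0 ==> D + E \<in> K0" for D E using P.m_closed[of D E] K_closed(2) W_simps unfolding K0_iff by simp
 show neg: "D \<in> K0 ==> - D \<in> K0" for D using P.m_inv_closed[of D] K_closed(4) W_simps(3)[of D] K_W[of D] unfolding K0_iff by simp
 show "D \<in> K0 ==> E \<in> K0 ==> D - E \<in> K0" using add[of D "- E"] neg[of E] by simp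
qed

lemma F_facts:
 "D \<in> K0 ==> F D \<in> carrier L" "D \<in> K0 ==> F D \<noteq> \<zero>\<^sub>L" "D \<in> K0 ==> dv (F D) = D"
 "D \<in> K0 ==> E \<in> K0 ==> F (D + E) = F D \<cdot> F E" "F 0 = \<one>\<^sub>L"
proof -
 show F: "D \<in> K0 ==> F D \<in> carrier L" "D \<in> K0 ==> F D \<noteq> \<zero>\<^sub>L" "D \<in> K0 ==> dv (F D) = D" for D
  using coh unfolding coherent_def by auto
 show Fm: "D \<in> K0 ==> E \<in> K0 ==> F (D + E) = F D \<cdot> F E" for D E
  using coh unfolding coherent_def by blast
 have "F 0 \<cdot> F 0 = F (0 + 0)" by (rule Fm[OF K0_closed(1) K0_closed(1), symmetric])
 also have "... = F 0 \<cdot> \<one>\<^sub>L" using F(1)[OF K0_closed(1)] by simp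
 finally have "F 0 \<cdot> F 0 = F 0 \<cdot> \<one>\<^sub>L" .
 then show "F 0 = \<one>\<^sub>L" using L.m_lcancel[OF F(2)[OF K0_closed(1)] F(1)[OF K0_closed(1)] F(1)[OF K0_closed(1)] L.one_closed] by simp
qed

section \<open>The algebra of divisorial sections\<close>

lemma sections_L: "f \<in> sec D ==> f \<in> carrier L"
 by (simp add: sections_def)

lemma sections_zero: "\<zero>\<^sub>L \<in> sec D"
 by (simp add: sections_def)

lemma sections_mult:
 assumes "f \<in> sec D" "g \<in> sec E" shows "f \<cdot> g \<in> sec (D + E)"
proof (cases "f = \<zero>\<^sub>L \<or> g = \<zero>\<^sub>L")
 case True
 then show ?thesis using assms sections_L sections_zero by auto
next
 case False
 note L = assms[THEN sections_L]
 have fg: "f \<cdot> g \<noteq> \<zero>\<^sub>L" "f \<cdot> g \<in> carrier L" using False L L.nonzero_mult by auto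
 have "effective (dv f + D)" "effective (dv g + E)" using assms False section_iff L by auto
 then have "effective ((dv f + D) + (dv g + E))" unfolding effective_def
  by (simp only: lookup_add[of "dv f + D"]) simp
 then have "effective (dv f + dv g + (D + E))" by (simp add: ac_simps)
 then show ?thesis using section_iff[OF fg(2,1)] div_of_mult[OF L(1) _ L(2)] False by simp
qed

lemma sections_0: "sec 0 = S"
proof -
 have "f \<in> sec 0 \<longleftrightarrow> f \<in> S" if "f \<in> carrier L" for f
  using that section_iff[of f 0] effective_div_of[of f] sections_zero N.zero_S by (cases "f = \<zero>\<^sub>L") auto
 then show ?thesis using sections_L N.S_carrier by blast
qed

lemma sections_scale: "a \<in> S ==> f \<in> sec D ==> a \<cdot> f \<in> sec D"
 using sections_mult[of a 0 f D] sections_0 by simp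

lemma sections_neg: "f \<in> sec D ==> \<ominus>\<^bsub>L\<^esub> f \<in> sec D"
 using sections_scale[OF N.sub(5)[OF N.sub(2)]] sections_L L.l_minus[OF L.one_closed] by (metis L.l_one)

lemma sections_add:
 assumes "f \<in> sec D" "g \<in> sec D" shows "f \<oplus>\<^sub>L g \<in> sec D"
proof -
 note L = assms[THEN sections_L]
 consider "f = \<zero>\<^sub>L" | "g = \<zero>\<^sub>L" | "f \<oplus>\<^sub>L g = \<zero>\<^sub>L" | "f \<noteq> \<zero>\<^sub>L" "g \<noteq> \<zero>\<^sub>L" "f \<oplus>\<^sub>L g \<noteq> \<zero>\<^sub>L" by blast
 then show ?thesis
 proof cases
  case 4
  have "effective (dv f + D)" "effective (dv g + D)" using section_iff L 4 assms by auto
  from div_of_add_ge[OF L(1) 4(1) L(2) 4(2,3) this] show ?thesis using section_iff[of "f \<oplus>\<^sub>L g"] 4 L by simp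
 qed (use assms L sections_zero in auto)
qed

lemma sections_F:
 assumes "D1 \<in> K" "D2 \<in> K" "D1 - D2 \<in> K0" "f \<in> sec D1"
 shows "F (D1 - D2) \<cdot> f \<in> sec D2"
proof -
 have "F (D1 - D2) \<in> sec (- (D1 - D2))"
  using section_iff[OF F_facts(1,2)[OF assms(3)]] F_facts(3)[OF assms(3)] by (simp add: effective_def)
 from sections_mult[OF this assms(4)] show ?thesis by simp
qed

abbreviation "supp s \<equiv> {D. s D \<noteq> \<zero>\<^sub>L}"

lemma T_carrier: "s \<in> carrier T \<longleftrightarrow> (\<forall>D\<in>K. s D \<in> sec D) \<and> (\<forall>D. D \<notin> K \<longrightarrow> s D = \<zero>\<^sub>L) \<and> finite (supp s)"
 by (simp add: divisorial_algebra_def Let_def)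

lemma T_ops: "\<one>\<^sub>T = hg 0 \<one>\<^sub>L" "\<zero>\<^sub>T = (\<lambda>D. \<zero>\<^sub>L)" "s \<oplus>\<^sub>T t = (\<lambda>D. s D \<oplus>\<^sub>L t D)"
 "s \<otimes>\<^sub>T t = (\<lambda>D. \<Oplus>\<^bsub>L\<^esub>E\<in>supp s. s E \<cdot> t (D - E))"
 by (simp_all add: divisorial_algebra_def Let_def homogeneous_def)

lemma T_L: "s \<in> carrier T ==> s D \<in> carrier L"
 using sections_L unfolding T_carrier by (metis L.zero_closed)

lemma T_sec: "s \<in> carrier T ==> D \<in> K ==> s D \<in> sec D" "s \<in> carrier T ==> s D \<noteq> \<zero>\<^sub>L ==> D \<in> K"
 "s \<in> carrier T ==> finite (supp s)"
 unfolding T_carrier by blast+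

lemma hg_T: "D \<in> K ==> f \<in> sec D ==> hg D f \<in> carrier T"
 unfolding T_carrier homogeneous_def using sections_zero by (auto intro: finite_subset[of _ "{D}"])

lemma finsum_supp:
 assumes "s \<in> carrier T" "finite X" "supp s \<subseteq> X" "\<And>D. g D \<in> carrier L"
 shows "(\<Oplus>\<^bsub>L\<^esub>D\<in>supp s. s D \<cdot> g D) = (\<Oplus>\<^bsub>L\<^esub>D\<in>X. s D \<cdot> g D)"
 by (rule L.add.finprod_mono_neutral_cong_left) (use assms T_L in auto)

lemma T_mult_superset:
 assumes "s \<in> carrier T" "t \<in> carrier T" "finite X" "supp s \<subseteq> X"
 shows "(s \<otimes>\<^sub>T t) D = (\<Oplus>\<^bsub>L\<^esub>E\<in>X. s E \<cdot> t (D - E))"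
 unfolding T_ops(4) by (rule finsum_supp[OF assms(1,3,4)]) (use T_L[OF assms(2)] in auto)

lemma T_add_closed: assumes "s \<in> carrier T" "t \<in> carrier T" shows "s \<oplus>\<^sub>T t \<in> carrier T"
 unfolding T_carrier T_ops
proof (intro conjI ballI allI impI)
 show "s D \<oplus>\<^sub>L t D \<in> sec D" if "D \<in> K" for D
  using sections_add[OF T_sec(1)[OF assms(1) that] T_sec(1)[OF assms(2) that]] .
 show "s D \<oplus>\<^sub>L t D = \<zero>\<^sub>L" if "D \<notin> K" for D using assms that by (simp add: T_carrier)
 have "s D \<oplus>\<^sub>L t D = \<zero>\<^sub>L" if "s D = \<zero>\<^sub>L" "t D = \<zero>\<^sub>L" for D using that by simp
 then have "supp (\<lambda>D. s D \<oplus>\<^sub>L t D) \<subseteq> supp s \<union> supp t" by blast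
 then show "finite (supp (\<lambda>D. s D \<oplus>\<^sub>L t D))" using T_sec(3) assms finite_subset by blast
qed

lemma T_mult_closed: assumes "s \<in> carrier T" "t \<in> carrier T" shows "s \<otimes>\<^sub>T t \<in> carrier T"
proof -
 have fin: "finite (supp s)" "finite (supp t)" using T_sec(3) assms by auto
 have z: "(s \<otimes>\<^sub>T t) D = \<zero>\<^sub>L" if "\<And>E. s E \<noteq> \<zero>\<^sub>L ==> t (D - E) = \<zero>\<^sub>L" for D
 proof -
  have "(s \<otimes>\<^sub>T t) D = (\<Oplus>\<^bsub>L\<^esub>E\<in>supp s. \<zero>\<^sub>L)" unfolding T_ops
   by (rule L.finsum_cong') (use that T_L[OF assms(1)] in auto)
  then show ?thesis by simp
 qed
 show ?thesis unfolding T_carrier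
 proof (intro conjI ballI allI impI)
  fix D assume D: "D \<in> K"
  show "(s \<otimes>\<^sub>T t) D \<in> sec D" unfolding T_ops
  proof (rule L.finsum_in[OF _ sections_zero sections_add fin(1)])
   show "sec D \<subseteq> carrier L" using sections_L by blast
   fix E assume "E \<in> supp s"
   then have E: "E \<in> K" using T_sec(2)[OF assms(1)] by blast
   have "s E \<cdot> t (D - E) \<in> sec (E + (D - E))"
    by (rule sections_mult[OF T_sec(1)[OF assms(1) E] T_sec(1)[OF assms(2) K_closed(3)[OF D E]]])
   then show "s E \<cdot> t (D - E) \<in> sec D" by simp
  qed
 next
  fix D assume D: "D \<notin> K"
  show "(s \<otimes>\<^sub>T t) D = \<zero>\<^sub>L"
  proof (rule z)
   fix E assume "s E \<noteq> \<zero>\<^sub>L"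
   then have E: "E \<in> K" using T_sec(2)[OF assms(1)] by blast
   show "t (D - E) = \<zero>\<^sub>L"
   proof (rule ccontr)
    assume "t (D - E) \<noteq> \<zero>\<^sub>L"
    then have "D - E \<in> K" using T_sec(2)[OF assms(2)] by blast
    then show False using K_closed(2)[OF _ E, of "D - E"] D by simp
   qed
  qed
 next
  have "supp (s \<otimes>\<^sub>T t) \<subseteq> (\<lambda>(E, E'). E + E') ` (supp s \<times> supp t)"
  proof
   fix D assume "D \<in> supp (s \<otimes>\<^sub>T t)"
   then obtain E where "s E \<noteq> \<zero>\<^sub>L" "t (D - E) \<noteq> \<zero>\<^sub>L" using z[of D] by blast
   then show "D \<in> (\<lambda>(E, E'). E + E') ` (supp s \<times> supp t)" by (intro image_eqI[of _ _ "(E, D - E)"]) auto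
  qed
  then show "finite (supp (s \<otimes>\<^sub>T t))" 
   by (rule finite_subset) (intro finite_imageI finite_cartesian_product fin)
 qed
qed

lemma T_abelian: "abelian_group T"
proof (rule abelian_groupI)
 show "\<zero>\<^sub>T \<in> carrier T" unfolding T_carrier T_ops using sections_zero by simp
 fix s t u assume s: "s \<in> carrier T" and t: "t \<in> carrier T" and u: "u \<in> carrier T"
 show "s \<oplus>\<^sub>T t \<in> carrier T" by (rule T_add_closed[OF s t])
 show "s \<oplus>\<^sub>T t \<oplus>\<^sub>T u = s \<oplus>\<^sub>T (t \<oplus>\<^sub>T u)" "s \<oplus>\<^sub>T t = t \<oplus>\<^sub>T s" "\<zero>\<^sub>T \<oplus>\<^sub>T s = s"
  using T_L s t u by (auto simp: T_ops L.a_ac)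
 have "(\<lambda>D. \<ominus>\<^bsub>L\<^esub> s D) \<in> carrier T"
  using s T_L[OF s] sections_neg L.minus_zero unfolding T_carrier by (auto intro: finite_subset[of _ "supp s"])
 moreover have "(\<lambda>D. \<ominus>\<^bsub>L\<^esub> s D) \<oplus>\<^sub>T s = \<zero>\<^sub>T" using T_L[OF s] by (simp add: T_ops L.l_neg)
 ultimately show "\<exists>t\<in>carrier T. t \<oplus>\<^sub>T s = \<zero>\<^sub>T" by blast
qed

sublocale TG: abelian_group T by (rule T_abelian)

lemma T_distrib:
 assumes "s \<in> carrier T" "s' \<in> carrier T" "t \<in> carrier T"
 shows "(s \<oplus>\<^sub>T s') \<otimes>\<^sub>T t = (s \<otimes>\<^sub>T t) \<oplus>\<^sub>T (s' \<otimes>\<^sub>T t)"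
  "t \<otimes>\<^sub>T (s \<oplus>\<^sub>T s') = (t \<otimes>\<^sub>T s) \<oplus>\<^sub>T (t \<otimes>\<^sub>T s')"
proof -
 let ?X = "supp s \<union> supp s'"
 have fin: "finite ?X" "finite (supp t)" using T_sec(3) assms by auto
 note c = T_L[OF assms(1)] T_L[OF assms(2)] T_L[OF assms(3)]
 show "(s \<oplus>\<^sub>T s') \<otimes>\<^sub>T t = (s \<otimes>\<^sub>T t) \<oplus>\<^sub>T (s' \<otimes>\<^sub>T t)"
 proof
  fix D
  have "(s \<oplus>\<^sub>T s') E = \<zero>\<^sub>L" if "s E = \<zero>\<^sub>L" "s' E = \<zero>\<^sub>L" for E using that by (simp add: T_ops)
  then have "supp (s \<oplus>\<^sub>T s') \<subseteq> ?X" by blast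
  then have "((s \<oplus>\<^sub>T s') \<otimes>\<^sub>T t) D = (\<Oplus>\<^bsub>L\<^esub>E\<in>?X. (s \<oplus>\<^sub>T s') E \<cdot> t (D - E))"
   by (rule T_mult_superset[OF T_add_closed[OF assms(1,2)] assms(3) fin(1)])
  also have "... = (\<Oplus>\<^bsub>L\<^esub>E\<in>?X. s E \<cdot> t (D - E) \<oplus>\<^sub>L s' E \<cdot> t (D - E))"
   by (rule L.finsum_cong') (use c in \<open>auto simp: T_ops L.l_distr\<close>)
  also have "... = (\<Oplus>\<^bsub>L\<^esub>E\<in>?X. s E \<cdot> t (D - E)) \<oplus>\<^sub>L (\<Oplus>\<^bsub>L\<^esub>E\<in>?X. s' E \<cdot> t (D - E))"
   by (rule L.finsum_addf) (use c in auto)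
  also have "... = (s \<otimes>\<^sub>T t) D \<oplus>\<^sub>L (s' \<otimes>\<^sub>T t) D"
   using T_mult_superset[OF assms(1,3) fin(1)] T_mult_superset[OF assms(2,3) fin(1)] by simp
  finally show "((s \<oplus>\<^sub>T s') \<otimes>\<^sub>T t) D = ((s \<otimes>\<^sub>T t) \<oplus>\<^sub>T (s' \<otimes>\<^sub>T t)) D" by (simp add: T_ops(3))
 qed
 show "t \<otimes>\<^sub>T (s \<oplus>\<^sub>T s') = (t \<otimes>\<^sub>T s) \<oplus>\<^sub>T (t \<otimes>\<^sub>T s')"
 proof
  fix D
  have "(\<Oplus>\<^bsub>L\<^esub>E\<in>supp t. t E \<cdot> (s (D - E) \<oplus>\<^sub>L s' (D - E)))
    = (\<Oplus>\<^bsub>L\<^esub>E\<in>supp t. t E \<cdot> s (D - E) \<oplus>\<^sub>L t E \<cdot> s' (D - E))"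
   by (rule L.finsum_cong') (use c in \<open>auto simp: L.r_distr\<close>)
  also have "... = (\<Oplus>\<^bsub>L\<^esub>E\<in>supp t. t E \<cdot> s (D - E)) \<oplus>\<^sub>L (\<Oplus>\<^bsub>L\<^esub>E\<in>supp t. t E \<cdot> s' (D - E))"
   by (rule L.finsum_addf) (use c in auto)
  finally show "(t \<otimes>\<^sub>T (s \<oplus>\<^sub>T s')) D = ((t \<otimes>\<^sub>T s) \<oplus>\<^sub>T (t \<otimes>\<^sub>T s')) D" by (simp add: T_ops(3,4))
 qed
qed

lemma hg_mult_apply:
 assumes "D \<in> K" "f \<in> sec D" "s \<in> carrier T"
 shows "(hg D f \<otimes>\<^sub>T s) E = f \<cdot> s (E - D)"
proof -
 have "supp (hg D f) \<subseteq> {D}" by (auto simp: homogeneous_def)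
 then have "(hg D f \<otimes>\<^sub>T s) E = (\<Oplus>\<^bsub>L\<^esub>E'\<in>{D}. hg D f E' \<cdot> s (E - E'))"
  by (intro T_mult_superset hg_T assms) auto
 also have "... = f \<cdot> s (E - D)"
  using sections_L[OF assms(2)] T_L[OF assms(3)] by (simp add: homogeneous_def)
 finally show ?thesis .
qed

lemma hg_mult:
 assumes "D \<in> K" "f \<in> sec D" "E \<in> K" "g \<in> sec E"
 shows "hg D f \<otimes>\<^sub>T hg E g = hg (D + E) (f \<cdot> g)"
 using hg_mult_apply[OF assms(1,2) hg_T[OF assms(3,4)]] sections_L[OF assms(2)]
 by (auto simp: fun_eq_iff homogeneous_def algebra_simps)

lemma hg_add: "f \<in> sec D ==> g \<in> sec D ==> hg D f \<oplus>\<^sub>T hg D g = hg D (f \<oplus>\<^sub>L g)"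
 by (auto simp: fun_eq_iff homogeneous_def T_ops)

lemma hg_zero: "hg D \<zero>\<^sub>L = \<zero>\<^sub>T"
 by (auto simp: homogeneous_def T_ops)

lemma T_induct [consumes 1, case_names zero add]:
 assumes s: "s \<in> carrier T" and 0: "P \<zero>\<^sub>T"
  and add: "\<And>D f s. D \<in> K ==> f \<in> sec D ==> f \<noteq> \<zero>\<^sub>L ==> s \<in> carrier T ==> s D = \<zero>\<^sub>L ==> P s ==> P (hg D f \<oplus>\<^sub>T s)"
 shows "P s"
 using s
proof (induction "card (supp s)" arbitrary: s)
 case 0
 then have "s = \<zero>\<^sub>T" using T_sec(3)[OF 0(2)] by (auto simp: T_ops fun_eq_iff)
 then show ?case using assms(2) by simp
next
 case (Suc n)
 then obtain D where D: "s D \<noteq> \<zero>\<^sub>L" by (metis (mono_tags, lifting) Collect_empty_eq card.empty nat.distinct(1))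
 have DK: "D \<in> K" using T_sec(2)[OF Suc.prems D] .
 define s' where "s' = s(D := \<zero>\<^sub>L)"
 have supp': "supp s' = supp s - {D}" by (auto simp: s'_def)
 have s': "s' \<in> carrier T" using Suc.prems sections_zero supp' unfolding T_carrier by (auto simp: s'_def)
 have "card (supp s') = n" unfolding supp' using Suc.hyps(2) D T_sec(3)[OF Suc.prems] by simp
 then have "P s'" using Suc.hyps(1)[of s'] s' by simp
 moreover have "s = hg D (s D) \<oplus>\<^sub>T s'" using T_L[OF Suc.prems] by (auto simp: fun_eq_iff homogeneous_def T_ops s'_def)
 ultimately show ?case using add[OF DK T_sec(1)[OF Suc.prems DK] D s'] by (metis fun_upd_same s'_def)
qed

lemma T_zero_mult: "s \<in> carrier T ==> \<zero>\<^sub>T \<otimes>\<^sub>T s = \<zero>\<^sub>T" "s \<in> carrier T ==> s \<otimes>\<^sub>T \<zero>\<^sub>T = \<zero>\<^sub>T"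
proof -
 assume s: "s \<in> carrier T"
 have z: "\<zero>\<^sub>T \<in> carrier T" by (rule TG.zero_closed)
 have cancel: "x = \<zero>\<^sub>T" if "x \<in> carrier T" "x = x \<oplus>\<^sub>T x" for x
  using that TG.add.r_cancel_one' by metis
 have zz: "\<zero>\<^sub>T \<oplus>\<^sub>T \<zero>\<^sub>T = \<zero>\<^sub>T" using z by simp
 show "\<zero>\<^sub>T \<otimes>\<^sub>T s = \<zero>\<^sub>T" 
  by (rule cancel[OF T_mult_closed[OF z s]]) (rule T_distrib(1)[OF z z s, unfolded zz])
 show "s \<otimes>\<^sub>T \<zero>\<^sub>T = \<zero>\<^sub>T" 
  by (rule cancel[OF T_mult_closed[OF s z]]) (rule T_distrib(2)[OF z z s, unfolded zz])
qed

lemma T_comm: assumes s: "s \<in> carrier T" and t: "t \<in> carrier T" shows "s \<otimes>\<^sub>T t = t \<otimes>\<^sub>T s"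
 using s
proof (induction rule: T_induct)
 case zero then show ?case using T_zero_mult[OF t] by simp
next
 case (add D f s)
 have h: "hg D f \<in> carrier T" by (rule hg_T[OF add(1,2)])
 have "hg D f \<otimes>\<^sub>T t = t \<otimes>\<^sub>T hg D f"
  using t
 proof (induction rule: T_induct)
  case zero then show ?case using T_zero_mult[OF h] by simp
 next
  case (add E g t)
  have h': "hg E g \<in> carrier T" by (rule hg_T[OF add(1,2)])
  have "hg D f \<otimes>\<^sub>T hg E g = hg E g \<otimes>\<^sub>T hg D f"
   using hg_mult \<open>D \<in> K\<close> \<open>f \<in> sec D\<close> add(1,2) sections_L L.m_comm by (simp add: add.commute)
  then show ?case using T_distrib h h' add by simp
 qed
 then show ?case using T_distrib h add t by simp
qed

lemma T_assoc:
 assumes s: "s \<in> carrier T" and t: "t \<in> carrier T" and u: "u \<in> carrier T"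
 shows "s \<otimes>\<^sub>T t \<otimes>\<^sub>T u = s \<otimes>\<^sub>T (t \<otimes>\<^sub>T u)"
 using s
proof (induction rule: T_induct)
 case zero then show ?case using T_zero_mult t u T_mult_closed by simp
next
 case (add D f s)
 note D = add(1,2)
 have h: "hg D f \<in> carrier T" by (rule hg_T[OF D])
 have "hg D f \<otimes>\<^sub>T t \<otimes>\<^sub>T u = hg D f \<otimes>\<^sub>T (t \<otimes>\<^sub>T u)"
  using t
 proof (induction rule: T_induct)
  case zero then show ?case using T_zero_mult h u by simp
 next
  case (add E g t)
  have h': "hg E g \<in> carrier T" by (rule hg_T[OF add(1,2)])
  have "hg D f \<otimes>\<^sub>T hg E g \<otimes>\<^sub>T u = hg D f \<otimes>\<^sub>T (hg E g \<otimes>\<^sub>T u)"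
  proof
   fix X
   have fg: "D + E \<in> K" "f \<cdot> g \<in> sec (D + E)" using K_closed(2) sections_mult D add(1,2) by auto
   show "(hg D f \<otimes>\<^sub>T hg E g \<otimes>\<^sub>T u) X = (hg D f \<otimes>\<^sub>T (hg E g \<otimes>\<^sub>T u)) X"
    unfolding hg_mult[OF D add(1,2)] hg_mult_apply[OF fg u] hg_mult_apply[OF D T_mult_closed[OF h' u]] hg_mult_apply[OF add(1,2) u]
    using sections_L D add(1,2) T_L[OF u] by (simp add: L.m_assoc diff_diff_eq)
  qed
  then show ?case using T_distrib h h' add u T_mult_closed by simp
 qed
 then show ?case using T_distrib h add t u T_mult_closed by simp
qed

lemma T_cring: "cring T"
proof (rule cringI)
 show "abelian_group T" by (rule T_abelian)
 have one: "\<one>\<^sub>L \<in> sec 0" unfolding sections_0 by (rule N.sub(2))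
 show "comm_monoid T"
 proof (rule comm_monoidI)
  show "\<one>\<^sub>T \<in> carrier T" unfolding T_ops by (rule hg_T[OF K_closed(1) one])
  show "\<one>\<^sub>T \<otimes>\<^sub>T s = s" if "s \<in> carrier T" for s
   unfolding T_ops(1) using hg_mult_apply[OF K_closed(1) one that] T_L[OF that] by (auto simp: fun_eq_iff)
 qed (use T_mult_closed T_comm T_assoc in auto)
qed (use T_distrib in auto)

sublocale T: cring T by (rule T_cring)

end

section \<open>Homogeneous elements of the Cox ring\<close>

context cox_data begin

definition relations where
 "relations = {hg D\<^sub>1 f \<ominus>\<^bsub>T\<^esub> hg D\<^sub>2 (F (D\<^sub>1 - D\<^sub>2) \<cdot> f) | D\<^sub>1 D\<^sub>2 f.
    D\<^sub>1 \<in> K \<and> D\<^sub>2 \<in> K \<and> D\<^sub>1 - D\<^sub>2 \<in> K0 \<and> f \<in> sec D\<^sub>1}"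

lemma cox_ideal_relations: "I = Idl\<^bsub>T\<^esub> relations"
 by (simp add: cox_ideal_def relations_def Let_def)

lemma relations_cases:
 assumes "r \<in> relations"
 obtains D1 D2 f where "D1 \<in> K" "D2 \<in> K" "D1 - D2 \<in> K0" "f \<in> sec D1"
  "r = hg D1 f \<ominus>\<^bsub>T\<^esub> hg D2 (F (D1 - D2) \<cdot> f)"
 using assms unfolding relations_def by blast

lemma relations_T: "relations \<subseteq> carrier T"
proof
 fix r assume "r \<in> relations"
 then obtain D1 D2 f where *: "D1 \<in> K" "D2 \<in> K" "D1 - D2 \<in> K0" "f \<in> sec D1"
  and r: "r = hg D1 f \<ominus>\<^bsub>T\<^esub> hg D2 (F (D1 - D2) \<cdot> f)" by (rule relations_cases)
 show "r \<in> carrier T" unfolding r by (rule TG.minus_closed[OF hg_T[OF *(1,4)] hg_T[OF *(2) sections_F[OF *]]])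
qed

lemma cox_ideal_is_ideal: "ideal I T"
 unfolding cox_ideal_relations by (rule T.genideal_ideal[OF relations_T])

sublocale I: ideal I T by (rule cox_ideal_is_ideal)

lemma R_cring: "cring R"
 unfolding cox_ring_def by (rule I.quotient_is_cring[OF T_cring])

sublocale R: cring R by (rule R_cring)

abbreviation "proj s \<equiv> I +>\<^bsub>T\<^esub> s"

text \<open>The class in the Cox ring of the section \<open>f\<close> of \<open>D\<close>; elements of this form generate it additively.\<close>

definition e :: "('k, 'n) divisor \<Rightarrow> ('k, 'n) ratfun \<Rightarrow> ('k, 'n) divisorial set" where
 "e D f = proj (hg D f)"

lemma proj_hom: "(+>\<^bsub>T\<^esub>) I \<in> ring_hom T R"
 unfolding cox_ring_def by (rule I.rcos_ring_hom)

lemma proj_simps: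
 "s \<in> carrier T ==> proj s \<in> carrier R"
 "s \<in> carrier T ==> t \<in> carrier T ==> proj (s \<oplus>\<^sub>T t) = proj s \<oplus>\<^sub>R proj t"
 "s \<in> carrier T ==> t \<in> carrier T ==> proj (s \<otimes>\<^sub>T t) = proj s \<otimes>\<^sub>R proj t"
 "proj \<one>\<^sub>T = \<one>\<^sub>R" "proj \<zero>\<^sub>T = \<zero>\<^sub>R"
 using ring_hom_closed[OF proj_hom] ring_hom_add[OF proj_hom] ring_hom_mult[OF proj_hom] ring_hom_one[OF proj_hom]
  ring_hom_zero[OF proj_hom T.ring_axioms R.ring_axioms] by simp_all

lemma R_cases: assumes "x \<in> carrier R" obtains s where "s \<in> carrier T" "x = proj s"
 using assms unfolding cox_ring_def FactRing_def A_RCOSETS_def' by auto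

lemma proj_eq_iff: "s \<in> carrier T ==> t \<in> carrier T ==> proj s = proj t \<longleftrightarrow> s \<ominus>\<^bsub>T\<^esub> t \<in> I"
 using T.quotient_eq_iff_same_a_r_cos[OF cox_ideal_is_ideal] by simp

text \<open>The coefficient of \<open>s\<close> in the class of \<open>D\<close>, moved to degree \<open>D\<close>. It vanishes on the Cox ideal and hence
 shows that the components of the Cox ring are not smaller than the spaces of sections.\<close>

definition transition where "transition D E = (if E - D \<in> K0 then F (E - D) else \<zero>\<^sub>L)"

definition coefficient where "coefficient D s = (\<Oplus>\<^bsub>L\<^esub>E\<in>supp s. s E \<cdot> transition D E)"

lemma transition_L: "transition D E \<in> carrier L"
 by (simp add: transition_def F_facts)

lemma coefficient_superset:
 "s \<in> carrier T ==> finite X ==> supp s \<subseteq> X ==> coefficient D s = (\<Oplus>\<^bsub>L\<^esub>E\<in>X. s E \<cdot> transition D E)"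
 unfolding coefficient_def by (rule finsum_supp) (simp_all add: transition_L)

lemma coefficient_L: "s \<in> carrier T ==> coefficient D s \<in> carrier L"
 unfolding coefficient_def by (rule L.finsum_closed) (simp add: transition_L T_L)

lemma coefficient_add:
 assumes "s \<in> carrier T" "t \<in> carrier T"
 shows "coefficient D (s \<oplus>\<^sub>T t) = coefficient D s \<oplus>\<^sub>L coefficient D t"
proof -
 let ?X = "supp s \<union> supp t"
 have fin: "finite ?X" using T_sec(3) assms by simp
 note c = T_L[OF assms(1)] T_L[OF assms(2)] transition_L
 have "(s \<oplus>\<^sub>T t) E = \<zero>\<^sub>L" if "s E = \<zero>\<^sub>L" "t E = \<zero>\<^sub>L" for E using that by (simp add: T_ops)
 then have "supp (s \<oplus>\<^sub>T t) \<subseteq> ?X" by blast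
 then have "coefficient D (s \<oplus>\<^sub>T t) = (\<Oplus>\<^bsub>L\<^esub>E\<in>?X. (s \<oplus>\<^sub>T t) E \<cdot> transition D E)"
  by (rule coefficient_superset[OF T_add_closed[OF assms] fin])
 also have "... = (\<Oplus>\<^bsub>L\<^esub>E\<in>?X. s E \<cdot> transition D E \<oplus>\<^sub>L t E \<cdot> transition D E)"
  by (rule L.finsum_cong') (simp_all add: c T_ops L.l_distr)
 also have "... = coefficient D s \<oplus>\<^sub>L coefficient D t"
  unfolding coefficient_superset[OF assms(1) fin Un_upper1] coefficient_superset[OF assms(2) fin Un_upper2]
  by (rule L.finsum_addf) (simp_all add: c)
 finally show ?thesis .
qed

lemma coefficient_hg:
 assumes "E \<in> K" "f \<in> sec E" shows "coefficient D (hg E f) = f \<cdot> transition D E"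
proof -
 have "supp (hg E f) \<subseteq> {E}" by (simp add: homogeneous_def subset_iff)
 then have "coefficient D (hg E f) = (\<Oplus>\<^bsub>L\<^esub>E'\<in>{E}. hg E f E' \<cdot> transition D E')"
  by (intro coefficient_superset hg_T assms) auto
 then show ?thesis using sections_L[OF assms(2)] transition_L by (simp add: homogeneous_def)
qed

lemma coefficient_hg_mult:
 assumes E: "E \<in> K" "f \<in> sec E" and s: "s \<in> carrier T"
 shows "coefficient D (hg E f \<otimes>\<^sub>T s) = f \<cdot> coefficient (D - E) s"
proof -
 note fL = sections_L[OF E(2)] and c = T_L[OF s] transition_L
 let ?X = "(\<lambda>X. X + E) ` supp s"
 have "(hg E f \<otimes>\<^sub>T s) X = \<zero>\<^sub>L" if "s (X - E) = \<zero>\<^sub>L" for X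
  unfolding hg_mult_apply[OF E s] that using fL by simp
 then have sub: "supp (hg E f \<otimes>\<^sub>T s) \<subseteq> ?X"
  by (intro subsetI image_eqI[of _ _ "_ - E"]) (simp, blast)
 have "coefficient D (hg E f \<otimes>\<^sub>T s) = (\<Oplus>\<^bsub>L\<^esub>X\<in>?X. (hg E f \<otimes>\<^sub>T s) X \<cdot> transition D X)"
  by (rule coefficient_superset[OF T_mult_closed[OF hg_T[OF E] s] finite_imageI[OF T_sec(3)[OF s]] sub])
 also have "... = (\<Oplus>\<^bsub>L\<^esub>X\<in>supp s. (hg E f \<otimes>\<^sub>T s) (X + E) \<cdot> transition D (X + E))"
  by (rule L.finsum_reindex) (simp_all add: T_L[OF T_mult_closed[OF hg_T[OF E] s]] transition_L inj_on_def)
 also have "... = (\<Oplus>\<^bsub>L\<^esub>X\<in>supp s. f \<cdot> (s X \<cdot> transition (D - E) X))"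
 proof (rule L.finsum_cong')
  fix X
  have "X + E - D = X - (D - E)" by simp
  then have "transition D (X + E) = transition (D - E) X" by (simp only: transition_def)
  then show "(hg E f \<otimes>\<^sub>T s) (X + E) \<cdot> transition D (X + E) = f \<cdot> (s X \<cdot> transition (D - E) X)"
   unfolding hg_mult_apply[OF E s] using fL c by (simp add: L.m_assoc)
 qed (use fL c in simp_all)
 also have "... = f \<cdot> coefficient (D - E) s"
  unfolding coefficient_def by (rule L.finsum_rdistr[symmetric]) (use T_sec(3)[OF s] fL c in simp_all)
 finally show ?thesis .
qed

lemma coefficient_cox_ideal:
 assumes "s \<in> I" "D \<in> K" shows "coefficient D s = \<zero>\<^sub>L"
proof -
 define Z where "Z = {s \<in> carrier T. \<forall>D\<in>K. coefficient D s = \<zero>\<^sub>L}"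
 have zero: "coefficient D \<zero>\<^sub>T = \<zero>\<^sub>L" for D by (simp add: coefficient_def T_ops)
 have absorb: "x \<otimes>\<^sub>T s \<in> Z" if s: "s \<in> Z" and x: "x \<in> carrier T" for s x
  using x
 proof (induction rule: T_induct)
  case zero
  then show ?case using s T_zero_mult(1)[of s] \<open>\<And>D. coefficient D \<zero>\<^sub>T = \<zero>\<^sub>L\<close> by (simp add: Z_def)
 next
  case (add E f x)
  have sT: "s \<in> carrier T" and s0: "\<And>D. D \<in> K ==> coefficient D s = \<zero>\<^sub>L" using s by (simp_all add: Z_def)
  have h: "hg E f \<in> carrier T" by (rule hg_T[OF add(1,2)])
  have xs: "x \<otimes>\<^sub>T s \<in> carrier T" "\<And>D. D \<in> K ==> coefficient D (x \<otimes>\<^sub>T s) = \<zero>\<^sub>L" using add by (simp_all add: Z_def)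
  have "coefficient D ((hg E f \<oplus>\<^sub>T x) \<otimes>\<^sub>T s) = \<zero>\<^sub>L" if D: "D \<in> K" for D
   unfolding T_distrib(1)[OF h add(4) sT] coefficient_add[OF T_mult_closed[OF h sT] xs(1)] coefficient_hg_mult[OF add(1,2) sT]
   using xs(2)[OF D] s0[OF K_closed(3)[OF D add(1)]] sections_L[OF add(2)] by simp
  then show ?case using T_mult_closed[OF T_add_closed[OF h add(4)] sT] by (simp add: Z_def)
 qed
 have "ideal Z T"
 proof (rule idealI)
  show "ring T" by (rule T.ring_axioms)
  show "subgroup Z (add_monoid T)"
  proof (rule TG.add.subgroupI)
   show "Z \<subseteq> carrier T" by (simp add: Z_def subset_iff)
   show "Z \<noteq> {}" using zero TG.zero_closed unfolding Z_def by blast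
   fix a assume a: "a \<in> Z"
   then have aT: "a \<in> carrier T" by (simp add: Z_def)
   have "coefficient D (\<ominus>\<^bsub>T\<^esub> a) = \<zero>\<^sub>L" if D: "D \<in> K" for D
   proof -
    have a0: "coefficient D a = \<zero>\<^sub>L" using a D by (simp add: Z_def)
    have "coefficient D (\<ominus>\<^bsub>T\<^esub> a) \<oplus>\<^sub>L \<zero>\<^sub>L = \<zero>\<^sub>L"
     using coefficient_add[OF TG.a_inv_closed[OF aT] aT, of D] unfolding TG.l_neg[OF aT] zero a0 by (rule sym)
    then show ?thesis unfolding L.r_zero[OF coefficient_L[OF TG.a_inv_closed[OF aT]]] .
   qed
   then show "\<ominus>\<^bsub>T\<^esub> a \<in> Z" using aT by (simp add: Z_def)
   fix b assume "b \<in> Z"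
   then show "a \<oplus>\<^sub>T b \<in> Z" using a coefficient_add by (simp add: Z_def)
  qed
  show "x \<otimes>\<^sub>T a \<in> Z" if "a \<in> Z" "x \<in> carrier T" for a x using absorb that .
  show "a \<otimes>\<^sub>T x \<in> Z" if a: "a \<in> Z" and x: "x \<in> carrier T" for a x
   using absorb[OF a x] T_comm[OF x, of a] a by (simp add: Z_def)
 qed
 moreover have "relations \<subseteq> Z"
 proof
  fix r assume "r \<in> relations"
  then obtain D1 D2 f where *: "D1 \<in> K" "D2 \<in> K" "D1 - D2 \<in> K0" "f \<in> sec D1"
   and r: "r = hg D1 f \<ominus>\<^bsub>T\<^esub> hg D2 (F (D1 - D2) \<cdot> f)" by (rule relations_cases)
  note T1 = hg_T[OF *(1,4)] and T2 = hg_T[OF *(2) sections_F[OF *]]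
  have rT: "r \<in> carrier T" unfolding r by (rule TG.minus_closed[OF T1 T2])
  have eq: "hg D1 f = r \<oplus>\<^sub>T hg D2 (F (D1 - D2) \<cdot> f)"
   unfolding r using T1 T2 by (simp add: a_minus_def TG.a_assoc TG.l_neg)
  have fL: "f \<in> carrier L" "F (D1 - D2) \<in> carrier L" using sections_L[OF *(4)] F_facts(1)[OF *(3)] .
  have "coefficient D r = \<zero>\<^sub>L" if D: "D \<in> K" for D
  proof -
   have "transition D D1 = F (D1 - D2) \<cdot> transition D D2"
   proof (cases "D2 - D \<in> K0")
    case True
    have "D1 - D = (D1 - D2) + (D2 - D)" by simp
    then show ?thesis using F_facts(4)[OF *(3) True] K0_closed(2)[OF *(3) True] True by (simp add: transition_def)
   next
    case False
    then have "D1 - D \<notin> K0" using K0_closed(4)[OF _ *(3), of "D1 - D"] by (auto simp: algebra_simps)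
    then show ?thesis using False fL by (simp add: transition_def)
   qed
   then have "f \<cdot> transition D D1 = F (D1 - D2) \<cdot> f \<cdot> transition D D2"
    using fL transition_L by (simp add: L.m_ac)
   moreover have "f \<cdot> transition D D1 = coefficient D r \<oplus>\<^sub>L F (D1 - D2) \<cdot> f \<cdot> transition D D2"
    using arg_cong[OF eq, of "coefficient D"] unfolding coefficient_hg[OF *(1,4)] coefficient_add[OF rT T2]
     coefficient_hg[OF *(2) sections_F[OF *]] .
   ultimately have "coefficient D r \<oplus>\<^sub>L F (D1 - D2) \<cdot> f \<cdot> transition D D2 = F (D1 - D2) \<cdot> f \<cdot> transition D D2"
    by simp
   then show ?thesis using L.add.r_cancel_one[of "F (D1 - D2) \<cdot> f \<cdot> transition D D2" "coefficient D r"]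
    fL transition_L coefficient_L[OF rT] by simp
  qed
  then show "r \<in> Z" using rT by (simp add: Z_def)
 qed
 ultimately have "I \<subseteq> Z" unfolding cox_ideal_relations by (rule T.genideal_minimal)
 then show ?thesis using assms unfolding Z_def by blast
qed

section \<open>Homogeneous elements of the Cox ring\<close>

lemma e_closed: "D \<in> K ==> f \<in> sec D ==> e D f \<in> carrier R"
 unfolding e_def by (rule proj_simps(1)[OF hg_T])

lemma e_add: "D \<in> K ==> f \<in> sec D ==> g \<in> sec D ==> e D (f \<oplus>\<^sub>L g) = e D f \<oplus>\<^sub>R e D g"
 unfolding e_def by (simp add: hg_add[symmetric] proj_simps(2) hg_T)

lemma e_zero: "e D \<zero>\<^sub>L = \<zero>\<^sub>R"
 unfolding e_def hg_zero by (rule proj_simps(5))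

lemma e_one: "e 0 \<one>\<^sub>L = \<one>\<^sub>R"
 unfolding e_def T_ops(1)[symmetric] by (rule proj_simps(4))

lemma e_mult:
 "D \<in> K ==> f \<in> sec D ==> E \<in> K ==> g \<in> sec E ==> e D f \<otimes>\<^sub>R e E g = e (D + E) (f \<cdot> g)"
 unfolding e_def by (simp add: hg_mult[symmetric] proj_simps(3) hg_T)

lemma e_move:
 assumes "D1 \<in> K" "D2 \<in> K" "D1 - D2 \<in> K0" "f \<in> sec D1"
 shows "e D1 f = e D2 (F (D1 - D2) \<cdot> f)"
proof -
 have "hg D1 f \<ominus>\<^bsub>T\<^esub> hg D2 (F (D1 - D2) \<cdot> f) \<in> relations" unfolding relations_def using assms by blast
 then have "hg D1 f \<ominus>\<^bsub>T\<^esub> hg D2 (F (D1 - D2) \<cdot> f) \<in> I"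
  unfolding cox_ideal_relations using T.genideal_self[OF relations_T] by blast
 then show ?thesis unfolding e_def using proj_eq_iff[OF hg_T[OF assms(1,4)] hg_T[OF assms(2) sections_F[OF assms]]] by simp
qed

lemma e_eqD:
 assumes D: "D \<in> K" "f \<in> sec D" and D': "D' \<in> K" "f' \<in> sec D'" and eq: "e D f = e D' f'"
 shows "f = f' \<cdot> transition D D'"
proof -
 note h = hg_T[OF D] and h' = hg_T[OF D']
 define r where "r = hg D f \<ominus>\<^bsub>T\<^esub> hg D' f'"
 have rI: "r \<in> I" unfolding r_def using proj_eq_iff[OF h h'] eq by (simp add: e_def)
 have rT: "r \<in> carrier T" unfolding r_def by (rule TG.minus_closed[OF h h'])
 have "hg D f = r \<oplus>\<^sub>T hg D' f'" unfolding r_def using h h' by (simp add: a_minus_def TG.a_assoc TG.l_neg)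
 then have "coefficient D (hg D f) = coefficient D r \<oplus>\<^sub>L coefficient D (hg D' f')" using coefficient_add[OF rT h'] by simp
 then have "f \<cdot> transition D D = f' \<cdot> transition D D'"
  unfolding coefficient_hg[OF D] coefficient_hg[OF D'] coefficient_cox_ideal[OF rI D(1)]
  using sections_L[OF D'(2)] transition_L by simp
 moreover have "transition D D = \<one>\<^sub>L" using K0_closed(1) F_facts(5) by (simp add: transition_def)
 ultimately show ?thesis using sections_L[OF D(2)] by simp
qed

lemma e_inj: "D \<in> K ==> f \<in> sec D ==> g \<in> sec D ==> e D f = e D g \<longleftrightarrow> f = g"
 using e_eqD[of D f D g] K0_closed(1) F_facts(5) sections_L by (auto simp: transition_def)

lemma R_induct [consumes 1, case_names zero add]:
 assumes x: "x \<in> carrier R" and 0: "P \<zero>\<^sub>R"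
  and add: "\<And>D f x. D \<in> K ==> f \<in> sec D ==> f \<noteq> \<zero>\<^sub>L ==> x \<in> carrier R ==> P x ==> P (e D f \<oplus>\<^sub>R x)"
 shows "P x"
proof -
 obtain s where s: "s \<in> carrier T" "x = proj s" using R_cases[OF x] .
 have "P (proj s)" using s(1)
 proof (induction rule: T_induct)
  case zero then show ?case using 0 by (simp add: proj_simps)
 next
  case (add D f s)
  then show ?case using assms(3)[OF add(1,2,3) proj_simps(1)[OF add(4)] add(6)] by (simp add: proj_simps(2) hg_T e_def)
 qed
 then show ?thesis using s by simp
qed

lemma ring_hom_eqI:
 assumes h: "h \<in> ring_hom R R" "h' \<in> ring_hom R R"
  and eq: "\<And>D f. D \<in> K ==> f \<in> sec D ==> f \<noteq> \<zero>\<^sub>L ==> h (e D f) = h' (e D f)" and x: "x \<in> carrier R"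
 shows "h x = h' x"
 using x
proof (induction rule: R_induct)
 case zero then show ?case
  using ring_hom_zero[OF h(1) R.ring_axioms R.ring_axioms] ring_hom_zero[OF h(2) R.ring_axioms R.ring_axioms] by simp
next
 case (add D f x)
 then show ?case using ring_hom_add[OF h(1)] ring_hom_add[OF h(2)] eq e_closed by simp
qed

text \<open>All degrees in the class of \<open>D\<close> are moved to \<open>D\<close> by the relations.\<close>

lemma cox_component_eq:
 assumes D: "D \<in> K"
 shows "cox_component V K F (cl D) = e D ` sec D"
proof (intro equalityI subsetI)
 fix x assume "x \<in> e D ` sec D"
 then obtain f where f: "f \<in> sec D" "x = proj (hg D f)" unfolding e_def by blast
 have "D \<in> cl D" unfolding mem_div_class[OF K_W[OF D]] using K0_closed(1) K0_iff by simp
 then have "\<forall>E. hg D f E \<noteq> \<zero>\<^sub>L \<longrightarrow> E \<in> cl D" by (simp add: homogeneous_def)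
 then show "x \<in> cox_component V K F (cl D)" unfolding cox_component_def using f hg_T[OF D f(1)] by blast
next
 fix x assume "x \<in> cox_component V K F (cl D)"
 then obtain s where s: "s \<in> carrier T" "\<forall>E. s E \<noteq> \<zero>\<^sub>L \<longrightarrow> E \<in> cl D" "x = proj s"
  unfolding cox_component_def by blast
 have "(\<forall>E. s E \<noteq> \<zero>\<^sub>L \<longrightarrow> E \<in> cl D) \<longrightarrow> proj s \<in> e D ` sec D"
  using s(1)
 proof (induction rule: T_induct)
  case zero
  show ?case using e_zero[of D] sections_zero proj_simps(5) by (metis imageI)
 next
  case (add E f s)
  show ?case
  proof
   assume cls: "\<forall>X. (hg E f \<oplus>\<^sub>T s) X \<noteq> \<zero>\<^sub>L \<longrightarrow> X \<in> cl D"
   note L = sections_L[OF add(2)] T_L[OF add(4)]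
   have at: "(hg E f \<oplus>\<^sub>T s) X = (if X = E then f else s X)" for X
    using add(5) L by (simp add: T_ops homogeneous_def)
   have "E \<in> cl D" using cls[rule_format, of E] add(3) by (simp add: at)
   then have ED: "E - D \<in> K0" unfolding mem_div_class[OF K_W[OF D]] K0_iff using K_closed(3)[OF add(1) D] by simp
   have "X \<in> cl D" if sX: "s X \<noteq> \<zero>\<^sub>L" for X
   proof -
    have "X \<noteq> E" using sX add(5) by metis
    then show ?thesis using cls[rule_format, of X] sX by (simp add: at)
   qed
   then obtain g where g: "g \<in> sec D" "proj s = e D g" using add(6) by blast
   have "proj (hg E f \<oplus>\<^sub>T s) = e E f \<oplus>\<^sub>R e D g" using g add proj_simps(2) hg_T by (simp add: e_def)
   also have "... = e D (F (E - D) \<cdot> f \<oplus>\<^sub>L g)"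
    unfolding e_move[OF add(1) D ED add(2)] by (rule e_add[OF D sections_F[OF add(1) D ED add(2)] g(1), symmetric])
   finally show "proj (hg E f \<oplus>\<^sub>T s) \<in> e D ` sec D"
    using sections_add[OF sections_F[OF add(1) D ED add(2)] g(1)] by blast
  qed
 qed
 then show "x \<in> e D ` sec D" using s by blast
qed

text \<open>The universal property: homomorphisms from the Cox ring are compatible families of maps on
 homogeneous sections.\<close>

lemma cox_ring_hom_exists:
 assumes cl: "\<And>D f. D \<in> K ==> f \<in> sec D ==> ph D f \<in> carrier R"
  and ad: "\<And>D f g. D \<in> K ==> f \<in> sec D ==> g \<in> sec D ==> ph D (f \<oplus>\<^sub>L g) = ph D f \<oplus>\<^sub>R ph D g"
  and mu: "\<And>D f E g. D \<in> K ==> f \<in> sec D ==> E \<in> K ==> g \<in> sec E ==>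
   ph (D + E) (f \<cdot> g) = ph D f \<otimes>\<^sub>R ph E g"
  and on: "ph 0 \<one>\<^sub>L = \<one>\<^sub>R"
  and re: "\<And>D E f. D \<in> K ==> E \<in> K ==> D - E \<in> K0 ==> f \<in> sec D ==> ph D f = ph E (F (D - E) \<cdot> f)"
 shows "\<exists>Phi\<in>ring_hom R R. \<forall>D\<in>K. \<forall>f\<in>sec D. Phi (e D f) = ph D f"
proof -
 have z: "ph D \<zero>\<^sub>L = \<zero>\<^sub>R" if D: "D \<in> K" for D
 proof -
  have c: "ph D \<zero>\<^sub>L \<in> carrier R" by (rule cl[OF D sections_zero])
  have "ph D \<zero>\<^sub>L = ph D \<zero>\<^sub>L \<oplus>\<^sub>R ph D \<zero>\<^sub>L" using ad[OF D sections_zero sections_zero] by simp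
  then show ?thesis using R.add.l_cancel_one[OF c c] by simp
 qed
 have cls: "ph D (s D) \<in> carrier R" if "D \<in> K" "s \<in> carrier T" for D s
  by (rule cl[OF that(1) T_sec(1)[OF that(2,1)]])
 define Psi where "Psi s = (\<Oplus>\<^bsub>R\<^esub>D\<in>supp s. ph D (s D))" for s
 have sup: "Psi s = (\<Oplus>\<^bsub>R\<^esub>D\<in>X. ph D (s D))" if s: "s \<in> carrier T" and X: "finite X" "supp s \<subseteq> X" "X \<subseteq> K" for s X
  unfolding Psi_def
 proof (rule R.add.finprod_mono_neutral_cong_left[OF X(1,2)])
  show "ph D (s D) = \<zero>\<^sub>R" if "D \<in> X - supp s" for D using that X(3) z by auto
  show "(\<lambda>D. ph D (s D)) \<in> X \<rightarrow> carrier R" using cls[OF _ s] X(3) by auto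
 qed simp
 have suppK: "supp s \<subseteq> K" if "s \<in> carrier T" for s using T_sec(2)[OF that] by blast
 have clPsi: "Psi s \<in> carrier R" if s: "s \<in> carrier T" for s
  unfolding Psi_def by (rule R.finsum_closed) (use cls[OF _ s] suppK[OF s] in auto)
 have addPsi: "Psi (s \<oplus>\<^sub>T t) = Psi s \<oplus>\<^sub>R Psi t" if s: "s \<in> carrier T" and t: "t \<in> carrier T" for s t
 proof -
  let ?X = "supp s \<union> supp t"
  have X: "finite ?X" "?X \<subseteq> K" using T_sec(3) s t suppK by simp_all
  have "(s \<oplus>\<^sub>T t) E = \<zero>\<^sub>L" if "s E = \<zero>\<^sub>L" "t E = \<zero>\<^sub>L" for E using that by (simp add: T_ops)
  then have "supp (s \<oplus>\<^sub>T t) \<subseteq> ?X" by blast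
  then have "Psi (s \<oplus>\<^sub>T t) = (\<Oplus>\<^bsub>R\<^esub>D\<in>?X. ph D ((s \<oplus>\<^sub>T t) D))" by (rule sup[OF T_add_closed[OF s t] X(1) _ X(2)])
  also have "... = (\<Oplus>\<^bsub>R\<^esub>D\<in>?X. ph D (s D) \<oplus>\<^sub>R ph D (t D))"
  proof (rule R.finsum_cong')
   show "(\<lambda>D. ph D (s D) \<oplus>\<^sub>R ph D (t D)) \<in> ?X \<rightarrow> carrier R"
    using cls[OF _ s] cls[OF _ t] X(2) by (intro Pi_I R.a_closed) auto
   fix D assume "D \<in> ?X"
   then have DK: "D \<in> K" using X(2) by blast
   show "ph D ((s \<oplus>\<^sub>T t) D) = ph D (s D) \<oplus>\<^sub>R ph D (t D)" 
    unfolding T_ops by (rule ad[OF DK T_sec(1)[OF s DK] T_sec(1)[OF t DK]])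
  qed simp
  also have "... = (\<Oplus>\<^bsub>R\<^esub>D\<in>?X. ph D (s D)) \<oplus>\<^sub>R (\<Oplus>\<^bsub>R\<^esub>D\<in>?X. ph D (t D))"
   by (rule R.finsum_addf) (use cls[OF _ s] cls[OF _ t] X(2) in auto)
  finally show ?thesis unfolding sup[OF s X(1) Un_upper1 X(2)] sup[OF t X(1) Un_upper2 X(2)] .
 qed
 have hgPsi: "Psi (hg D f) = ph D f" if D: "D \<in> K" "f \<in> sec D" for D f
 proof -
  have "supp (hg D f) \<subseteq> {D}" by (simp add: homogeneous_def subset_iff)
  then have "Psi (hg D f) = (\<Oplus>\<^bsub>R\<^esub>E\<in>{D}. ph E (hg D f E))" using D by (intro sup hg_T) auto
  then show ?thesis using cl[OF D] by (simp add: homogeneous_def)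
 qed
 have zPsi: "Psi \<zero>\<^sub>T = \<zero>\<^sub>R" by (simp add: Psi_def T_ops)
 have multPsi: "Psi (s \<otimes>\<^sub>T t) = Psi s \<otimes>\<^sub>R Psi t" if s: "s \<in> carrier T" and t: "t \<in> carrier T" for s t
  using s
 proof (induction rule: T_induct)
  case zero then show ?case using T_zero_mult(1)[OF t] zPsi clPsi[OF t] by simp
 next
  case (add D f s)
  note D = add(1,2)
  have h: "hg D f \<in> carrier T" by (rule hg_T[OF D])
  have "Psi (hg D f \<otimes>\<^sub>T t) = Psi (hg D f) \<otimes>\<^sub>R Psi t"
   using t
  proof (induction rule: T_induct)
   case zero then show ?case using T_zero_mult(2)[OF h] zPsi clPsi[OF h] by simp
  next
   case (add E g t)
   have h': "hg E g \<in> carrier T" by (rule hg_T[OF add(1,2)])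
   have "Psi (hg D f \<otimes>\<^sub>T hg E g) = Psi (hg D f) \<otimes>\<^sub>R Psi (hg E g)"
    unfolding hg_mult[OF D add(1,2)] hgPsi[OF D] hgPsi[OF add(1,2)]
    using hgPsi[OF K_closed(2)[OF D(1) add(1)] sections_mult[OF D(2) add(2)]] mu[OF D add(1,2)] by simp
   then show ?case
    unfolding T_distrib(2)[OF h' add(4) h] addPsi[OF T_mult_closed[OF h h'] T_mult_closed[OF h add(4)]] addPsi[OF h' add(4)] add(6)
    using clPsi h h' add(4) by (simp add: R.r_distr)
  qed
  then show ?case
   unfolding T_distrib(1)[OF h add(4) t] addPsi[OF T_mult_closed[OF h t] T_mult_closed[OF add(4) t]] addPsi[OF h add(4)] add(6)
   using clPsi h add(4) t by (simp add: R.l_distr)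
 qed
 have onePsi: "Psi \<one>\<^sub>T = \<one>\<^sub>R" unfolding T_ops(1) using hgPsi[OF K_closed(1), of "\<one>\<^sub>L"] on sections_0 N.sub(2) by simp
 have hom: "ring_hom_ring T R Psi"
  by (rule ring_hom_ringI[OF T.ring_axioms R.ring_axioms]) (simp_all add: clPsi multPsi addPsi onePsi)
 interpret H: ring_hom_ring T R Psi by (rule hom)
 have "relations \<subseteq> a_kernel T R Psi"
 proof
  fix r assume "r \<in> relations"
  then obtain D1 D2 f where *: "D1 \<in> K" "D2 \<in> K" "D1 - D2 \<in> K0" "f \<in> sec D1"
   and r: "r = hg D1 f \<ominus>\<^bsub>T\<^esub> hg D2 (F (D1 - D2) \<cdot> f)" by (rule relations_cases)
  note T1 = hg_T[OF *(1,4)] and T2 = hg_T[OF *(2) sections_F[OF *]]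
  have "Psi r = Psi (hg D1 f) \<ominus>\<^bsub>R\<^esub> Psi (hg D2 (F (D1 - D2) \<cdot> f))"
   unfolding r a_minus_def using T1 T2 by (simp add: addPsi)
  also have "... = \<zero>\<^sub>R" unfolding hgPsi[OF *(1,4)] hgPsi[OF *(2) sections_F[OF *]] re[OF *]
   using cl[OF *(2) sections_F[OF *]] by (simp add: a_minus_def R.r_neg)
  finally show "r \<in> a_kernel T R Psi" unfolding a_kernel_def' using TG.minus_closed[OF T1 T2] r by simp
 qed
 then have ker: "I \<subseteq> a_kernel T R Psi"
  unfolding cox_ideal_relations by (rule T.genideal_minimal[OF H.kernel_is_ideal])
 define Phi where "Phi x = Psi (SOME s. s \<in> carrier T \<and> x = proj s)" for x
 have Phi: "Phi (proj s) = Psi s" if s: "s \<in> carrier T" for s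
 proof -
  define t where "t = (SOME t. t \<in> carrier T \<and> proj s = proj t)"
  have t: "t \<in> carrier T \<and> proj s = proj t" unfolding t_def by (rule someI[of _ s]) (use s in simp)
  then have "t \<ominus>\<^bsub>T\<^esub> s \<in> I" using proj_eq_iff[of t s] s by simp
  then have "Psi (t \<ominus>\<^bsub>T\<^esub> s) = \<zero>\<^sub>R" using ker unfolding a_kernel_def' by blast
  moreover have "t = (t \<ominus>\<^bsub>T\<^esub> s) \<oplus>\<^sub>T s" using t s by (simp add: a_minus_def TG.a_assoc TG.l_neg)
  ultimately have "Psi t = \<zero>\<^sub>R \<oplus>\<^sub>R Psi s" using addPsi[OF TG.minus_closed s, of t s] t s by simp
  then show ?thesis using clPsi[OF s] by (simp add: Phi_def t_def)
 qed
 have "Phi \<in> ring_hom R R"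
 proof (rule ring_hom_memI)
  show "Phi \<one>\<^sub>R = \<one>\<^sub>R" using Phi[OF T.one_closed] onePsi proj_simps(4) by simp
  fix x assume "x \<in> carrier R"
  then obtain s where s: "s \<in> carrier T" "x = proj s" by (rule R_cases)
  show "Phi x \<in> carrier R" using Phi[OF s(1)] clPsi[OF s(1)] s(2) by simp
  fix y assume "y \<in> carrier R"
  then obtain t where t: "t \<in> carrier T" "y = proj t" by (rule R_cases)
  show "Phi (x \<otimes>\<^sub>R y) = Phi x \<otimes>\<^sub>R Phi y" unfolding s(2) t(2) proj_simps(3)[OF s(1) t(1), symmetric]
   using Phi s(1) t(1) T_mult_closed multPsi by simp
  show "Phi (x \<oplus>\<^sub>R y) = Phi x \<oplus>\<^sub>R Phi y" unfolding s(2) t(2) proj_simps(2)[OF s(1) t(1), symmetric]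
   using Phi s(1) t(1) T_add_closed addPsi by simp
 qed
 moreover have "\<forall>D\<in>K. \<forall>f\<in>sec D. Phi (e D f) = ph D f" unfolding e_def using Phi hg_T hgPsi by simp
 ultimately show ?thesis by blast
qed

end

section \<open>Invariants of homogeneous elements and lifts of automorphisms\<close>

locale cox_units = cox_data V K F for V :: "('k::{alg_closed_field,field_char_0} ^ 'n::finite) set" and K F +
 assumes units: "Units (coordinate_ring V) = const_fun V ` (UNIV - {0})"
begin

abbreviation "kappa c \<equiv> to_frac A (const_fun V c)"
abbreviation "Lx \<equiv> {f \<in> carrier L. f \<noteq> \<zero>\<^sub>L}"

lemma kappa_gamma: "kappa c = gamma (\<lambda>_. c)"
 by (simp add: const_fun_def)

lemma const_polynomial: "(\<lambda>_. c) \<in> poly_funs"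
 unfolding polynomial_functions_def by (rule algebra_of_functions.const)

lemma const_fun_A: "const_fun V c \<in> carrier A"
 unfolding const_fun_def by (rule restrict_A[OF const_polynomial])

lemma kappa_simps: "kappa c \<in> S" "kappa (c * d) = kappa c \<cdot> kappa d" "kappa 1 = \<one>\<^sub>L" "kappa 0 = \<zero>\<^sub>L" "kappa c = kappa d \<longleftrightarrow> c = d"
proof -
 show "kappa c \<in> S" using const_fun_A by blast
 have "(\<lambda>_ :: 'k ^ 'n. c * d) = (\<lambda>_. c) * (\<lambda>_. d)" by (simp add: times_fun_def)
 then have "gamma (\<lambda>_. c * d) = gamma ((\<lambda>_. c) * (\<lambda>_. d))" by (rule arg_cong)
 then show "kappa (c * d) = kappa c \<cdot> kappa d"
  unfolding kappa_gamma gamma_simps(3)[OF const_polynomial const_polynomial] .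
 show "kappa 1 = \<one>\<^sub>L" unfolding kappa_gamma gamma_zero_one(2)[symmetric] one_fun_def ..
 show "kappa 0 = \<zero>\<^sub>L" unfolding kappa_gamma gamma_zero_one(1)[symmetric] zero_fun_def ..
 have "V \<noteq> {}" using V_irreducible unfolding irreducible_closed_def by simp
 then show "kappa c = kappa d \<longleftrightarrow> c = d" unfolding kappa_gamma gamma_simps(4)[OF const_polynomial const_polynomial] by auto
qed

lemma kappa_L: "kappa c \<in> carrier L"
 by (rule N.S_carrier[OF kappa_simps(1)])

lemma kappa_Lx: "kappa c \<in> Lx \<longleftrightarrow> c \<noteq> 0"
 using kappa_simps(5)[of c 0] kappa_L unfolding kappa_simps(4) by blast

lemma Lx_closed: "f \<in> Lx ==> g \<in> Lx ==> f \<cdot> g \<in> Lx" "f \<in> Lx ==> inv\<^bsub>L\<^esub> f \<in> Lx" "\<one>\<^sub>L \<in> Lx"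
 using L.nonzero_mult L.nonzero_inv L.one_not_zero by simp_all

lemma div_Lx:
 "f \<in> Lx ==> dv f \<in> Div"
 "f \<in> Lx ==> g \<in> Lx ==> dv (f \<cdot> g) = dv f + dv g"
 "f \<in> Lx ==> dv (inv\<^bsub>L\<^esub> f) = - dv f"
 "f \<in> Lx ==> f \<in> sec D \<longleftrightarrow> effective (dv f + D)"
 using div_of_W div_of_mult div_of_inv section_iff by simp_all

lemma div_kappa: assumes "c \<noteq> 0" shows "dv (kappa c) = 0"
proof (rule poly_mapping_eqI)
 fix P
 have x: "kappa c \<in> Lx" "kappa (inverse c) \<in> Lx" using assms kappa_Lx by simp_all
 have "kappa c \<cdot> kappa (inverse c) = \<one>\<^sub>L" using assms kappa_simps(2)[of c "inverse c"] kappa_simps(3) by simp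
 then have "dv (kappa c) + dv (kappa (inverse c)) = 0" using div_Lx(2)[OF x] div_of_one by simp
 then have "lookup (dv (kappa c)) P + lookup (dv (kappa (inverse c))) P = 0"
  by (metis lookup_add lookup_zero)
 moreover have "effective (dv (kappa c))" "effective (dv (kappa (inverse c)))"
  using effective_div_of x kappa_simps(1) by simp_all
 ultimately show "lookup (dv (kappa c)) P = lookup 0 P"
  unfolding effective_def by (simp add: add_nonneg_eq_0_iff)
qed

text \<open>Such a function and its inverse are regular, so it is a unit of the coordinate ring.\<close>

lemma div_zero_constant:
 assumes f: "f \<in> Lx" "dv f = 0" shows "\<exists>c. c \<noteq> 0 \<and> f = kappa c"
proof -
 have e0: "effective (0 :: ('k, 'n) divisor)" by (simp add: effective_def)
 note i = Lx_closed(2)[OF f(1)]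
 have "f \<in> S" "inv\<^bsub>L\<^esub> f \<in> S" using effective_div_of[of f] effective_div_of[of "inv\<^bsub>L\<^esub> f"] f i div_Lx(3)[OF f(1)] e0 by simp_all
 then obtain a b where ab: "a \<in> carrier A" "b \<in> carrier A" "f = to_frac A a" "inv\<^bsub>L\<^esub> f = to_frac A b" by blast
 have "to_frac A (a \<otimes>\<^sub>A b) = f \<cdot> inv\<^bsub>L\<^esub> f" using ab to_frac_simps(2)[OF ab(1,2)] by simp
 also have "... = to_frac A \<one>\<^sub>A" using L.nonzero_inv(3)[of f] f(1) unfolding to_frac_simps(4) by simp
 finally have "a \<otimes>\<^sub>A b = \<one>\<^sub>A" using A.to_frac_inj[of "a \<otimes>\<^sub>A b" "\<one>\<^sub>A"] ab by simp
 then have "a \<in> Units A" unfolding Units_def using ab A.m_comm[OF ab(1,2)] by auto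
 then obtain c where "c \<noteq> 0" "a = const_fun V c" unfolding units by blast
 then show ?thesis using ab(3) by blast
qed

text \<open>A homomorphism from \<open>K \<times> \<bbbK>(X)\<^sup>\<times>\<close> to \<open>\<bbbK>\<^sup>\<times>\<close> whose value on \<open>(E, c F\<^sub>E\<^sup>-\<^sup>1)\<close> is \<open>c\<close>.
 Together with its divisor it determines a homogeneous element of the Cox ring.\<close>

definition is_invariant :: "(('k, 'n) divisor \<Rightarrow> ('k, 'n) ratfun \<Rightarrow> 'k) \<Rightarrow> bool" where
 "is_invariant p \<longleftrightarrow> (\<forall>D\<in>K. \<forall>f\<in>Lx. p D f \<noteq> 0) \<and>
   (\<forall>D\<in>K. \<forall>E\<in>K. \<forall>f\<in>Lx. \<forall>g\<in>Lx. p (D + E) (f \<cdot> g) = p D f * p E g) \<and>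
   (\<forall>E\<in>K0. \<forall>h\<in>Lx. \<forall>c. h \<cdot> F E = kappa c \<longrightarrow> p E h = c)"

text \<open>The condition on the elements \<open>(E, h)\<close> with \<open>h F\<^sub>E\<close> constant defines a character of a subgroup, and characters with
values in \<open>\<bbbK>\<^sup>\<times>\<close> extend.\<close>

lemma invariant_exists: "\<exists>p. is_invariant p"
proof -
 interpret M: group "mult_of L" by (rule L.field_mult_group)
 interpret KG: group "WDiv V\<lparr>carrier := K\<rparr>" by (rule subgroup.subgroup_is_group[OF K W.is_group])
 define G where "G = WDiv V\<lparr>carrier := K\<rparr> \<times>\<times> mult_of L"
 have Gs: "(D, f) \<in> carrier G \<longleftrightarrow> D \<in> K \<and> f \<in> Lx" "(D, f) \<otimes>\<^bsub>G\<^esub> (E, g) = (D + E, f \<cdot> g)" "\<one>\<^bsub>G\<^esub> = (0, \<one>\<^sub>L)"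
  for D E f g by (auto simp: G_def W_simps)
 have "group G" unfolding G_def by (rule DirProd_group[OF KG.is_group M.is_group])
 then interpret G: group G .
 interpret G: comm_group G
 proof (rule G.group_comm_groupI)
  fix x y assume "x \<in> carrier G" "y \<in> carrier G"
  then show "x \<otimes>\<^bsub>G\<^esub> y = y \<otimes>\<^bsub>G\<^esub> x" by (cases x; cases y) (simp add: Gs add.commute L.m_comm)
 qed
 have Ginv: "inv\<^bsub>G\<^esub> (D, f) = (- D, inv\<^bsub>L\<^esub> f)" if "D \<in> K" "f \<in> Lx" for D f
  by (rule G.inv_equality) (use that K_closed(4) Lx_closed(2) L.nonzero_inv in \<open>simp_all add: Gs\<close>)
 define H where "H = {(E, h). E \<in> K0 \<and> h \<in> Lx \<and> (\<exists>c. h \<cdot> F E = kappa c)}"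
 have HI: "(E, h) \<in> H" if "E \<in> K0" "h \<in> Lx" "h \<cdot> F E = kappa c" for E h c using that H_def by blast
 have K0K: "E \<in> K0 ==> E \<in> K" for E using K0_iff by simp
 have FLx: "F E \<in> Lx" if "E \<in> K0" for E using F_facts(1,2)[OF that] by simp
 have c0: "c \<noteq> 0" if "E \<in> K0" "h \<in> Lx" "h \<cdot> F E = kappa c" for E h c
  using Lx_closed(1)[OF that(2) FLx[OF that(1)]] kappa_Lx[of c] unfolding that(3) by blast
 have prod: "h \<cdot> h' \<cdot> F (E + E') = kappa (c * c')"
  if "E \<in> K0" "h \<in> Lx" "h \<cdot> F E = kappa c" "E' \<in> K0" "h' \<in> Lx" "h' \<cdot> F E' = kappa c'" for E h c E' h' c'
 proof -
  have L: "h \<in> carrier L" "h' \<in> carrier L" "F E \<in> carrier L" "F E' \<in> carrier L" using that FLx by simp_all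
  have "h \<cdot> h' \<cdot> F (E + E') = (h \<cdot> F E) \<cdot> (h' \<cdot> F E')"
   unfolding F_facts(4)[OF that(1,4)] using L by (simp add: L.m_ac)
  then show ?thesis unfolding that(3,6) kappa_simps(2) .
 qed
 have "subgroup H G"
 proof (rule G.subgroupI)
  show "H \<subseteq> carrier G" using K0K by (auto simp: H_def Gs)
  show "H \<noteq> {}" using HI[OF K0_closed(1) Lx_closed(3), of 1] F_facts(5) kappa_simps(3) by auto
  fix x assume "x \<in> H"
  then obtain E h c where x: "x = (E, h)" "E \<in> K0" "h \<in> Lx" "h \<cdot> F E = kappa c" unfolding H_def by blast
  note c = c0[OF x(2-4)]
  have "inv\<^bsub>L\<^esub> h \<cdot> F (- E) = kappa (inverse c)"
  proof -
   have hL: "h \<in> carrier L" "h \<noteq> \<zero>\<^sub>L" using x(3) by simp_all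
   have ihL: "inv\<^bsub>L\<^esub> h \<in> carrier L" using L.nonzero_inv(1)[OF hL] .
   have Fm: "F (- E) \<in> carrier L" "F E \<in> carrier L" using FLx[OF K0_closed(3)[OF x(2)]] FLx[OF x(2)] by simp_all
   have "kappa c \<cdot> (inv\<^bsub>L\<^esub> h \<cdot> F (- E)) = (h \<cdot> inv\<^bsub>L\<^esub> h) \<cdot> F (E + - E)"
    unfolding x(4)[symmetric] F_facts(4)[OF x(2) K0_closed(3)[OF x(2)]] using hL(1) ihL Fm
    by (simp add: L.m_ac del: L.Units_r_inv L.Units_l_inv)
   also have "... = kappa c \<cdot> kappa (inverse c)"
    using L.nonzero_inv(3)[OF hL] F_facts(5) c unfolding kappa_simps(2)[symmetric] by (simp add: kappa_simps(3))
   finally show ?thesis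
    using L.m_lcancel[of "kappa c" "inv\<^bsub>L\<^esub> h \<cdot> F (- E)" "kappa (inverse c)"] kappa_Lx[of c] c kappa_L ihL Fm by simp
  qed
  then show "inv\<^bsub>G\<^esub> x \<in> H" unfolding x(1) Ginv[OF K0K[OF x(2)] x(3)]
   by (rule HI[OF K0_closed(3)[OF x(2)] Lx_closed(2)[OF x(3)]])
  fix y assume "y \<in> H"
  then obtain E' h' c' where y: "y = (E', h')" "E' \<in> K0" "h' \<in> Lx" "h' \<cdot> F E' = kappa c'" unfolding H_def by blast
  show "x \<otimes>\<^bsub>G\<^esub> y \<in> H" unfolding x(1) y(1) Gs
   by (rule HI[OF K0_closed(2)[OF x(2) y(2)] Lx_closed(1)[OF x(3) y(3)] prod[OF x(2-4) y(2-4)]])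
 qed
 define xi where "xi x = (THE c. snd x \<cdot> F (fst x) = kappa c)" for x
 have xi: "xi (E, h) = c" if "h \<cdot> F E = kappa c" for E h c
  unfolding xi_def using that kappa_simps(5) by (intro the_equality) auto
 have "\<exists>xi'. character_on G xi' \<and> (\<forall>x\<in>H. xi' x = xi x)"
 proof (rule G.character_extends[OF \<open>subgroup H G\<close>])
  fix x assume "x \<in> H"
  then obtain E h c where x: "x = (E, h)" "E \<in> K0" "h \<in> Lx" "h \<cdot> F E = kappa c" unfolding H_def by blast
  show "xi x \<noteq> 0" unfolding x(1) xi[OF x(4)] by (rule c0[OF x(2-4)])
  fix y assume "y \<in> H"
  then obtain E' h' c' where y: "y = (E', h')" "E' \<in> K0" "h' \<in> Lx" "h' \<cdot> F E' = kappa c'" unfolding H_def by blast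
  show "xi (x \<otimes>\<^bsub>G\<^esub> y) = xi x * xi y" unfolding x(1) y(1) Gs xi[OF x(4)] xi[OF y(4)]
   by (rule xi[OF prod[OF x(2-4) y(2-4)]])
 qed
 then obtain xi' where xi': "character_on G xi'" "\<forall>x\<in>H. xi' x = xi x" by blast
 note X = character_onD[OF xi'(1)]
 have "is_invariant (\<lambda>D f. xi' (D, f))" unfolding is_invariant_def
 proof (intro conjI ballI allI impI)
  show "xi' (D, f) \<noteq> 0" if "D \<in> K" "f \<in> Lx" for D f by (rule X(1)) (simp only: Gs that simp_thms)
  show "xi' (D + E, f \<cdot> g) = xi' (D, f) * xi' (E, g)" if "D \<in> K" "E \<in> K" "f \<in> Lx" "g \<in> Lx" for D E f g
   unfolding Gs(2)[symmetric] by (rule X(2)) (simp_all only: Gs that simp_thms)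
  show "xi' (E, h) = c" if "E \<in> K0" "h \<in> Lx" "h \<cdot> F E = kappa c" for E h c
   using xi'(2) HI[OF that] xi[OF that(3)] by simp
 qed
 then show ?thesis by blast
qed

definition p where "p = (SOME p. is_invariant p)"

lemma p_facts:
 "D \<in> K ==> f \<in> Lx ==> p D f \<noteq> 0"
 "D \<in> K ==> E \<in> K ==> f \<in> Lx ==> g \<in> Lx ==> p (D + E) (f \<cdot> g) = p D f * p E g"
 "E \<in> K0 ==> h \<in> Lx ==> h \<cdot> F E = kappa c ==> p E h = c"
proof -
 have "is_invariant p" unfolding p_def by (rule someI_ex[OF invariant_exists])
 then show "D \<in> K ==> f \<in> Lx ==> p D f \<noteq> 0"
  "D \<in> K ==> E \<in> K ==> f \<in> Lx ==> g \<in> Lx ==> p (D + E) (f \<cdot> g) = p D f * p E g"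
  "E \<in> K0 ==> h \<in> Lx ==> h \<cdot> F E = kappa c ==> p E h = c"
  unfolding is_invariant_def by simp_all
qed

lemma p_kappa: "c \<noteq> 0 ==> p 0 (kappa c) = c"
 by (rule p_facts(3)[OF K0_closed(1)]) (use kappa_Lx kappa_L F_facts(5) in simp_all)

lemma p_split: "D \<in> K ==> f \<in> Lx ==> g \<in> Lx ==> p D (f \<cdot> g) = p 0 f * p D g"
 using p_facts(2)[OF K_closed(1), of D f g] by simp

lemma F_Lx: "E \<in> K0 ==> F E \<in> Lx"
 using F_facts by simp

lemma p_move:
 assumes "D \<in> K" "E \<in> K" "D - E \<in> K0" "f \<in> Lx" shows "p E (F (D - E) \<cdot> f) = p D f"
proof -
 note FL = F_Lx[OF assms(3)]
 have "p D (inv\<^bsub>L\<^esub> (F (D - E)) \<cdot> (F (D - E) \<cdot> f)) = p (D - E) (inv\<^bsub>L\<^esub> (F (D - E))) * p E (F (D - E) \<cdot> f)"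
  using p_facts(2)[of "D - E" E "inv\<^bsub>L\<^esub> (F (D - E))" "F (D - E) \<cdot> f"] K_closed(3)[OF assms(1,2)] assms(2)
   Lx_closed(2)[OF FL] Lx_closed(1)[OF FL assms(4)] by simp
 moreover have "p (D - E) (inv\<^bsub>L\<^esub> (F (D - E))) = 1"
  by (rule p_facts(3)[OF assms(3) Lx_closed(2)[OF FL]]) (use L.nonzero_inv(4)[of "F (D - E)"] FL kappa_simps(3) in simp)
 moreover have "inv\<^bsub>L\<^esub> (F (D - E)) \<cdot> (F (D - E) \<cdot> f) = f"
  by (rule L.cancel_inv(1)) (use FL assms(4) in simp_all)
 ultimately show ?thesis by simp
qed

text \<open>Every divisor is linearly equivalent to one in \<open>K\<close>, and constants adjust the invariant.\<close>

lemma realize: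
 assumes "Delta \<in> Div" "c \<noteq> 0"
 shows "\<exists>D\<in>K. \<exists>f\<in>Lx. dv f + D = Delta \<and> p D f = c"
proof -
 have "cl Delta \<in> cl ` K" unfolding surj Cl_simps(1) using assms(1) by (rule imageI)
 then obtain D where D: "D \<in> K" "cl Delta = cl D" by blast
 then have "Delta - D \<in> Prin" using div_class_eq_iff[OF assms(1) K_W[OF D(1)]] by blast
 then obtain g where g: "g \<in> Lx" "Delta - D = dv g" unfolding principal_iff by blast
 define a where "a = c / p D g"
 have a: "a \<noteq> 0" using assms(2) p_facts(1)[OF D(1) g(1)] by (simp add: a_def)
 then have ka: "kappa a \<in> Lx" using kappa_Lx by blast
 have "dv (kappa a \<cdot> g) + D = Delta" unfolding div_Lx(2)[OF ka g(1)] div_kappa[OF a] g(2)[symmetric] by simp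
 moreover have "p D (kappa a \<cdot> g) = c" unfolding p_split[OF D(1) ka g(1)] p_kappa[OF a]
  using p_facts(1)[OF D(1) g(1)] by (simp add: a_def)
 ultimately show ?thesis using D(1) Lx_closed(1)[OF ka g(1)] by blast
qed

text \<open>The quotient of two elements with the same divisor is \<open>c F\<^sub>E\<^sup>-\<^sup>1\<close>, and the invariant forces \<open>c = 1\<close>; this is the
relation by which \<open>F\<close> identifies the two degrees.\<close>

lemma same_invariants:
 assumes D: "D \<in> K" "f \<in> Lx" and D': "D' \<in> K" "f' \<in> Lx"
  and div: "dv f + D = dv f' + D'" and pp: "p D f = p D' f'" and sec: "f \<in> sec D"
 shows "e D f = e D' f'"
proof -
 have L: "f \<in> carrier L" "f' \<in> carrier L" "f' \<noteq> \<zero>\<^sub>L" using D D' by simp_all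
 define h where "h = f \<cdot> inv\<^bsub>L\<^esub> f'"
 have h: "h \<in> Lx" unfolding h_def by (rule Lx_closed(1)[OF D(2) Lx_closed(2)[OF D'(2)]])
 have dh: "dv h = - (D - D')" unfolding h_def div_Lx(2)[OF D(2) Lx_closed(2)[OF D'(2)]] div_Lx(3)[OF D'(2)]
  using div by (simp add: algebra_simps)
 have "D - D' = dv (inv\<^bsub>L\<^esub> h)" unfolding div_Lx(3)[OF h] dh by simp
 then have E: "D - D' \<in> K0" unfolding K0_iff principal_iff using K_closed(3)[OF D(1) D'(1)] Lx_closed(2)[OF h] by blast
 have hF: "h \<cdot> F (D - D') \<in> Lx" by (rule Lx_closed(1)[OF h F_Lx[OF E]])
 have "dv (h \<cdot> F (D - D')) = 0" unfolding div_Lx(2)[OF h F_Lx[OF E]] dh F_facts(3)[OF E] by simp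
 then obtain c where c: "h \<cdot> F (D - D') = kappa c" using div_zero_constant[OF hF] by blast
 have hf: "h \<cdot> f' = f" unfolding h_def using L L.nonzero_inv[OF L(2,3)] by (simp add: L.m_assoc)
 have "p D f = p (D - D') h * p D' f'"
  using p_facts(2)[OF K_closed(3)[OF D(1) D'(1)] D'(1) h D'(2)] unfolding hf by simp
 then have "p (D - D') h = 1" using pp p_facts(1)[OF D'] by simp
 then have "c = 1" using p_facts(3)[OF E h c] by simp
 have FL: "F (D - D') \<in> carrier L" "h \<in> carrier L" using F_Lx[OF E] h by simp_all
 have "F (D - D') \<cdot> f = (h \<cdot> F (D - D')) \<cdot> f'" unfolding hf[symmetric] using FL L by (simp add: L.m_ac)
 also have "... = f'" unfolding c \<open>c = 1\<close> kappa_simps(3) using L by simp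
 finally show ?thesis using e_move[OF D(1) D'(1) E sec] by simp
qed

text \<open>The lift of an automorphism with inverse \<open>tau\<close> is prescribed on homogeneous elements by its effect on the two
invariants: it transports the divisor and corrects the other invariant by the character \<open>mu\<close>.\<close>

definition lifts where
 "lifts Phi tau mu \<longleftrightarrow> Phi \<in> ring_hom R R \<and> (\<forall>D\<in>K. \<forall>f\<in>Lx. f \<in> sec D \<longrightarrow> (\<forall>D'\<in>K. \<forall>f'\<in>Lx.
   dv f' + D' = push tau (dv f + D) \<longrightarrow> p D' f' = p D f * mu (dv f + D) \<longrightarrow> Phi (e D f) = e D' f'))"

text \<open>The last condition makes the prescription compatible with multiplication by rational functions: \<open>g\<close> in degree
zero must go to \<open>sigma g\<close>.\<close>

definition liftable where
 "liftable sigma tau mu \<longleftrightarrow> sigma \<in> ring_hom L L \<and> bij_betw sigma (carrier L) (carrier L) \<and> sigma ` S = S \<and>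
   tau \<in> ring_hom L L \<and> bij_betw tau (carrier L) (carrier L) \<and> tau ` S = S \<and>
   (\<forall>x\<in>carrier L. sigma (tau x) = x) \<and> (\<forall>x\<in>carrier L. tau (sigma x) = x) \<and>
   character_on (WDiv V) mu \<and> (\<forall>g\<in>Lx. mu (dv g) * p 0 g = p 0 (sigma g))"

lemma D_sum_W: "D \<in> K ==> f \<in> Lx ==> dv f + D \<in> Div"
 by (rule W_closed(2)[OF div_Lx(1) K_W])

context
 fixes sigma tau mu assumes lift: "liftable sigma tau mu"
begin

lemma lift_sigma: "sigma \<in> ring_hom L L" "bij_betw sigma (carrier L) (carrier L)" "sigma ` S = S"
 and lift_tau: "tau \<in> ring_hom L L" "bij_betw tau (carrier L) (carrier L)" "tau ` S = S"
 and lift_st: "\<forall>x\<in>carrier L. sigma (tau x) = x" and lift_ts: "\<forall>x\<in>carrier L. tau (sigma x) = x"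
 and lift_mu: "character_on (WDiv V) mu" and lift_mup: "g \<in> Lx ==> mu (dv g) * p 0 g = p 0 (sigma g)"
 using lift unfolding liftable_def by simp_all

abbreviation "M \<equiv> push tau"

lemmas sigma_simps = N.automorphism_simps[OF lift_sigma]
lemmas M_W = push_W[OF lift_sigma lift_tau lift_st lift_ts]
 and M_add = push_add[OF lift_sigma lift_tau lift_st lift_ts]
 and M_div = push_div_of[OF lift_sigma lift_tau lift_st lift_ts]
 and M_eff = effective_push[OF lift_sigma lift_tau lift_st lift_ts]
 and M_inverse = push_inverse[OF lift_sigma lift_tau lift_st lift_ts]
 and M'_inverse = push_inverse[OF lift_tau lift_sigma lift_ts lift_st]
 and M'_div = push_div_of[OF lift_tau lift_sigma lift_ts lift_st]
 and M'_W = push_W[OF lift_tau lift_sigma lift_ts lift_st]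
 and M'_add = push_add[OF lift_tau lift_sigma lift_ts lift_st]

lemma sigma_Lx: "f \<in> Lx ==> sigma f \<in> Lx"
 using sigma_simps(1,7) by simp

lemma M_zero: "M 0 = 0"
 using M_add[of 0 0] by simp

text \<open>For each \<open>D\<close> in \<open>K\<close> choose one homogeneous function \<open>h D\<close> with the transported invariants. On the sections of \<open>D\<close>
the lift is \<open>f \<mapsto> sigma f \<cdot> h D\<close>, hence additive. The invariants do not depend on the choices, and as they are
multiplicative and invariant under the relations of the Cox ring, so is the lift.\<close>

lemma lifts_exists: "\<exists>Phi. lifts Phi tau mu"
proof -
 note mu = character_onD[OF lift_mu]
 have muadd: "mu (D + E) = mu D * mu E" if "D \<in> Div" "E \<in> Div" for D E
  using mu(2)[OF that] by (simp add: W_simps)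
 have "\<forall>D. \<exists>x. D \<in> K \<longrightarrow> fst x \<in> K \<and> snd x \<in> Lx \<and> dv (snd x) + fst x = M D \<and> p (fst x) (snd x) = p D \<one>\<^sub>L * mu D"
 proof
  fix D
  show "\<exists>x. D \<in> K \<longrightarrow> fst x \<in> K \<and> snd x \<in> Lx \<and> dv (snd x) + fst x = M D \<and> p (fst x) (snd x) = p D \<one>\<^sub>L * mu D"
  proof (cases "D \<in> K")
   case True
   have "p D \<one>\<^sub>L * mu D \<noteq> 0" using p_facts(1)[OF True Lx_closed(3)] mu(1)[OF K_W[OF True]] by simp
   from realize[OF M_W this] obtain D' f' where "D' \<in> K" "f' \<in> Lx" "dv f' + D' = M D" "p D' f' = p D \<one>\<^sub>L * mu D" by blast
   then show ?thesis by (intro exI[of _ "(D', f')"]) simp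
  qed simp
 qed
 from choice[OF this] obtain x where x: "\<forall>D. D \<in> K \<longrightarrow> fst (x D) \<in> K \<and> snd (x D) \<in> Lx \<and>
  dv (snd (x D)) + fst (x D) = M D \<and> p (fst (x D)) (snd (x D)) = p D \<one>\<^sub>L * mu D" by blast
 define s where "s D = fst (x D)" for D
 define h where "h D = snd (x D)" for D
 have sK: "s D \<in> K" and hLx: "h D \<in> Lx" and divh: "dv (h D) + s D = M D" and ph: "p (s D) (h D) = p D \<one>\<^sub>L * mu D"
  if "D \<in> K" for D using x that unfolding s_def h_def by simp_all
 have hL: "h D \<in> carrier L" if "D \<in> K" for D using hLx[OF that] by simp
 define g where "g D f = sigma f \<cdot> h D" for D f
 have gLx: "g D f \<in> Lx" if "D \<in> K" "f \<in> Lx" for D f unfolding g_def by (rule Lx_closed(1)[OF sigma_Lx[OF that(2)] hLx[OF that(1)]])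
 have g0: "g D \<zero>\<^sub>L = \<zero>\<^sub>L" if "D \<in> K" for D unfolding g_def sigma_simps(5) using hL[OF that] by simp
 have divg: "dv (g D f) + s D = M (dv f + D)" if "D \<in> K" "f \<in> Lx" for D f
 proof -
  have "dv (g D f) + s D = dv (sigma f) + (dv (h D) + s D)"
   unfolding g_def div_Lx(2)[OF sigma_Lx[OF that(2)] hLx[OF that(1)]] by (simp add: add.assoc)
  also have "dv (sigma f) = M (dv f)" using M_div[of f] that(2) by simp
  finally show ?thesis unfolding divh[OF that(1)] M_add .
 qed
 have pg: "p (s D) (g D f) = p D f * mu (dv f + D)" if D: "D \<in> K" "f \<in> Lx" for D f
 proof -
  have "p (s D) (g D f) = p 0 (sigma f) * (p D \<one>\<^sub>L * mu D)"
   unfolding g_def p_split[OF sK[OF D(1)] sigma_Lx[OF D(2)] hLx[OF D(1)]] ph[OF D(1)] ..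
  also have "... = (p 0 f * p D \<one>\<^sub>L) * (mu (dv f) * mu D)" unfolding lift_mup[OF D(2), symmetric] by (simp add: mult_ac)
  also have "p 0 f * p D \<one>\<^sub>L = p D f" using p_split[OF D Lx_closed(3)] D(2) by simp
  also have "mu (dv f) * mu D = mu (dv f + D)" using muadd[OF div_Lx(1)[OF D(2)] K_W[OF D(1)]] by simp
  finally show ?thesis .
 qed
 have sec: "g D f \<in> sec (s D)" if D: "D \<in> K" "f \<in> sec D" for D f
 proof (cases "f = \<zero>\<^sub>L")
  case True then show ?thesis using g0[OF D(1)] sections_zero by simp
 next
  case False
  then have f: "f \<in> Lx" using sections_L[OF D(2)] by simp
  show ?thesis unfolding div_Lx(4)[OF gLx[OF D(1) f]] divg[OF D(1) f] M_eff[OF D_sum_W[OF D(1) f]]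
   using D(2) div_Lx(4)[OF f] by blast
 qed
 have match: "e (s D) (g D f) = e D' f'" if D: "D \<in> K" "f \<in> Lx" "f \<in> sec D" and D': "D' \<in> K" "f' \<in> Lx"
  and 1: "dv f' + D' = M (dv f + D)" and 2: "p D' f' = p D f * mu (dv f + D)" for D f D' f'
  by (rule same_invariants[OF sK[OF D(1)] gLx[OF D(1,2)] D' _ _ sec[OF D(1,3)]])
   (use 1 2 divg[OF D(1,2)] pg[OF D(1,2)] in simp_all)
 have "\<exists>Phi\<in>ring_hom R R. \<forall>D\<in>K. \<forall>f\<in>sec D. Phi (e D f) = e (s D) (g D f)"
 proof (rule cox_ring_hom_exists)
  show "e (s D) (g D f) \<in> carrier R" if "D \<in> K" "f \<in> sec D" for D f by (rule e_closed[OF sK[OF that(1)] sec[OF that]])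
  show "e (s D) (g D (f \<oplus>\<^sub>L f')) = e (s D) (g D f) \<oplus>\<^sub>R e (s D) (g D f')"
   if D: "D \<in> K" "f \<in> sec D" "f' \<in> sec D" for D f f'
  proof -
   have "g D (f \<oplus>\<^sub>L f') = g D f \<oplus>\<^sub>L g D f'"
    unfolding g_def sigma_simps(3)[OF sections_L[OF D(2)] sections_L[OF D(3)]]
    by (rule L.l_distr) (use sigma_simps(1) sections_L[OF D(2)] sections_L[OF D(3)] hL[OF D(1)] in simp_all)
   then show ?thesis using e_add[OF sK[OF D(1)] sec[OF D(1,2)] sec[OF D(1,3)]] by simp
  qed
  show "e (s 0) (g 0 \<one>\<^sub>L) = \<one>\<^sub>R" unfolding e_one[symmetric]
  proof (rule match[OF K_closed(1) Lx_closed(3) _ K_closed(1) Lx_closed(3)])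
   show "\<one>\<^sub>L \<in> sec 0" unfolding sections_0 by (rule N.sub(2))
   have "mu 0 = 1" using W.character_on_one_inv(1)[OF lift_mu] by (simp add: W_simps)
   then show "p 0 \<one>\<^sub>L = p 0 \<one>\<^sub>L * mu (dv \<one>\<^sub>L + 0)" by (simp add: div_of_one)
  qed (simp add: div_of_one M_zero)
  show "e (s (D + E)) (g (D + E) (f \<cdot> f')) = e (s D) (g D f) \<otimes>\<^sub>R e (s E) (g E f')"
   if D: "D \<in> K" "f \<in> sec D" and E: "E \<in> K" "f' \<in> sec E" for D f E f'
  proof -
   note fL = sections_L[OF D(2)] and fL' = sections_L[OF E(2)]
   have r: "e (s D) (g D f) \<otimes>\<^sub>R e (s E) (g E f') = e (s D + s E) (g D f \<cdot> g E f')"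
    by (rule e_mult[OF sK[OF D(1)] sec[OF D] sK[OF E(1)] sec[OF E]])
   note gL = sections_L[OF sec[OF D]] sections_L[OF sec[OF E]]
   show ?thesis
   proof (cases "f = \<zero>\<^sub>L \<or> f' = \<zero>\<^sub>L")
    case True
    have "f \<cdot> f' = \<zero>\<^sub>L" using True fL fL' by (elim disjE) simp_all
    moreover have "g D f \<cdot> g E f' = \<zero>\<^sub>L" using True gL g0[OF D(1)] g0[OF E(1)] by (elim disjE) simp_all
    ultimately show ?thesis unfolding r using g0[OF K_closed(2)[OF D(1) E(1)]] e_zero by simp
   next
    case False
    then have f: "f \<in> Lx" "f' \<in> Lx" using fL fL' by simp_all
    note DE = K_closed(2)[OF D(1) E(1)] and ff = Lx_closed(1)[OF f]
    have gg: "g D f \<in> Lx" "g E f' \<in> Lx" by (rule gLx[OF D(1) f(1)], rule gLx[OF E(1) f(2)])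
    have sum: "dv (f \<cdot> f') + (D + E) = (dv f + D) + (dv f' + E)"
     unfolding div_Lx(2)[OF f] by (simp add: ac_simps)
    show ?thesis unfolding r
    proof (rule match[OF DE ff sections_mult[OF D(2) E(2)] K_closed(2)[OF sK[OF D(1)] sK[OF E(1)]] Lx_closed(1)[OF gg]])
     have "dv (g D f \<cdot> g E f') + (s D + s E) = (dv (g D f) + s D) + (dv (g E f') + s E)"
      unfolding div_Lx(2)[OF gg] by (simp add: ac_simps)
     then show "dv (g D f \<cdot> g E f') + (s D + s E) = M (dv (f \<cdot> f') + (D + E))"
      unfolding sum M_add divg[OF D(1) f(1)] divg[OF E(1) f(2)] .
     show "p (s D + s E) (g D f \<cdot> g E f') = p (D + E) (f \<cdot> f') * mu (dv (f \<cdot> f') + (D + E))"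
      unfolding sum muadd[OF D_sum_W[OF D(1) f(1)] D_sum_W[OF E(1) f(2)]] p_facts(2)[OF D(1) E(1) f]
       p_facts(2)[OF sK[OF D(1)] sK[OF E(1)] gg] pg[OF D(1) f(1)] pg[OF E(1) f(2)] by (simp add: mult_ac)
    qed
   qed
  qed
  show "e (s D) (g D f) = e (s E) (g E (F (D - E) \<cdot> f))"
   if D: "D \<in> K" and E: "E \<in> K" and DE: "D - E \<in> K0" and f: "f \<in> sec D" for D E f
  proof (cases "f = \<zero>\<^sub>L")
   case True
   then show ?thesis using g0[OF D] g0[OF E] F_facts(1)[OF DE] e_zero by simp
  next
   case False
   then have fx: "f \<in> Lx" using sections_L[OF f] by simp
   note Ff = Lx_closed(1)[OF F_Lx[OF DE] fx]
   have sum: "dv (F (D - E) \<cdot> f) + E = dv f + D"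
    unfolding div_Lx(2)[OF F_Lx[OF DE] fx] F_facts(3)[OF DE] by simp
   show ?thesis
   proof (rule match[OF D fx f sK[OF E] gLx[OF E Ff]])
    show "dv (g E (F (D - E) \<cdot> f)) + s E = M (dv f + D)" unfolding divg[OF E Ff] sum ..
    show "p (s E) (g E (F (D - E) \<cdot> f)) = p D f * mu (dv f + D)"
     unfolding pg[OF E Ff] sum p_move[OF D E DE fx] ..
   qed
  qed
 qed
 then obtain Phi where Phi: "Phi \<in> ring_hom R R" "\<And>D f. D \<in> K ==> f \<in> sec D ==> Phi (e D f) = e (s D) (g D f)" by blast
 have "lifts Phi tau mu" unfolding lifts_def
 proof (intro conjI ballI impI)
  fix D f D' f' assume a: "D \<in> K" "f \<in> Lx" "f \<in> sec D" "D' \<in> K" "f' \<in> Lx"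
   "dv f' + D' = M (dv f + D)" "p D' f' = p D f * mu (dv f + D)"
  show "Phi (e D f) = e D' f'" unfolding Phi(2)[OF a(1,3)] by (rule match[OF a])
 qed (rule Phi(1))
 then show ?thesis by blast
qed

lemma liftable_inverse: "liftable tau sigma (\<lambda>D. inverse (mu (push sigma D)))"
 unfolding liftable_def
proof (intro conjI ballI)
 note mu = character_onD[OF lift_mu]
 show "character_on (WDiv V) (\<lambda>D. inverse (mu (push sigma D)))" unfolding character_on_def W_simps(2)
 proof (intro conjI ballI)
  show "inverse (mu (push sigma D)) \<noteq> 0" for D using mu(1)[OF M'_W] by simp
  show "inverse (mu (push sigma (D + E))) = inverse (mu (push sigma D)) * inverse (mu (push sigma E))" for D E
   using mu(2)[OF M'_W M'_W, of D E] by (simp add: W_simps(2) M'_add)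
 qed
 fix g assume g: "g \<in> Lx"
 have tg: "tau g \<in> Lx" using N.automorphism_simps(1,7)[OF lift_tau, of g] g by simp
 have "mu (dv (tau g)) * p 0 (tau g) = p 0 g" using lift_mup[OF tg] lift_st g by simp
 moreover have "push sigma (dv g) = dv (tau g)" using M'_div[of g] g by simp
 ultimately show "inverse (mu (push sigma (dv g))) * p 0 g = p 0 (tau g)"
  using mu(1)[OF div_Lx(1)[OF tg]] by (simp add: field_simps)
qed (use lift_sigma lift_tau lift_st lift_ts in simp_all)

end

lemma liftsD:
 assumes "lifts Phi tau mu" "D \<in> K" "f \<in> Lx" "f \<in> sec D" "D' \<in> K" "f' \<in> Lx"
  "dv f' + D' = push tau (dv f + D)" "p D' f' = p D f * mu (dv f + D)"
 shows "Phi (e D f) = e D' f'"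
 using assms unfolding lifts_def by simp

lemma lifts_compose:
 assumes l: "liftable sigma tau mu" and Phi: "lifts Phi tau mu"
  and Phi': "lifts Phi' sigma (\<lambda>D. inverse (mu (push sigma D)))" and x: "x \<in> carrier R"
 shows "Phi' (Phi x) = x"
proof -
 have hom: "Phi \<in> ring_hom R R" "Phi' \<in> ring_hom R R" using Phi Phi' by (simp_all add: lifts_def)
 note mu = character_onD[OF lift_mu[OF l]]
 have "(Phi' \<circ> Phi) x = id x"
 proof (rule ring_hom_eqI[OF ring_hom_trans[OF hom] id_ring_hom _ x])
  fix D f assume D: "D \<in> K" "f \<in> sec D" "f \<noteq> \<zero>\<^sub>L"
  then have f: "f \<in> Lx" using sections_L by simp
  let ?Delta = "dv f + D"
  note W = D_sum_W[OF D(1) f]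
  have "p D f * mu ?Delta \<noteq> 0" using p_facts(1)[OF D(1) f] mu(1)[OF W] by simp
  from realize[OF M_W[OF l] this] obtain D' f' where D': "D' \<in> K" "f' \<in> Lx"
   and eq: "dv f' + D' = push tau ?Delta" "p D' f' = p D f * mu ?Delta" by blast
  have sec': "f' \<in> sec D'" unfolding div_Lx(4)[OF D'(2)] eq M_eff[OF l W] using D(2) div_Lx(4)[OF f] by blast
  have ret: "push sigma (push tau ?Delta) = ?Delta" by (rule M'_inverse[OF l W])
  have "Phi' (e D' f') = e D f"
   by (rule liftsD[OF Phi' D' sec' D(1) f]) (use mu(1)[OF W] in \<open>simp_all add: eq ret\<close>)
  then show "(Phi' \<circ> Phi) (e D f) = id (e D f)" using liftsD[OF Phi D(1) f D(2) D' eq] by simp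
 qed
 then show ?thesis by simp
qed

lemma component_of_W:
 assumes "D \<in> Div"
 obtains E where "E \<in> K" "cl D = cl E" "cox_component V K F (cl D) = e E ` sec E"
proof -
 have "cl D \<in> cl ` K" unfolding surj Cl_simps(1) using assms by (rule imageI)
 then obtain E where E: "E \<in> K" "cl D = cl E" by blast
 show thesis using that[OF E] cox_component_eq[OF E(1)] E(2) by simp
qed

lemma push_class:
 assumes l: "liftable sigma tau mu" and D: "D \<in> Div" and E: "E \<in> Div"
  and eq: "cl D = cl E"
 shows "cl (push tau D) = cl (push tau E)"
proof -
 have "D - E \<in> Prin" using eq div_class_eq_iff[OF D E] by blast
 then obtain g where g: "g \<in> Lx" "D - E = dv g" unfolding principal_iff by blast
 have "push tau D = push tau (dv g + E)" using g(2)[symmetric] by simp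
 also have "... = dv (sigma g) + push tau E" unfolding M_add[OF l] using M_div[OF l, of g] g(1) by simp
 finally have "push tau D - push tau E = dv (sigma g)" by simp
 then show ?thesis unfolding div_class_eq_iff[OF M_W[OF l] M_W[OF l]] principal_iff using sigma_Lx[OF l g(1)] by blast
qed

lemma lifts_component:
 assumes l: "liftable sigma tau mu" and Phi: "lifts Phi tau mu" and D: "D \<in> Div"
  and x: "x \<in> cox_component V K F (cl D)"
 shows "Phi x \<in> cox_component V K F (cl (push tau D))"
proof -
 have hom: "Phi \<in> ring_hom R R" using Phi by (simp add: lifts_def)
 note mu = character_onD[OF lift_mu[OF l]]
 obtain E where E: "E \<in> K" "cl D = cl E" "cox_component V K F (cl D) = e E ` sec E"
  using component_of_W[OF D] .
 then obtain f where f: "f \<in> sec E" "x = e E f" using x by blast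
 have cls: "cl (push tau D) = cl (push tau E)" by (rule push_class[OF l D K_W[OF E(1)] E(2)])
 show ?thesis
 proof (cases "f = \<zero>\<^sub>L")
  case True
  then have "Phi x = \<zero>\<^sub>R" using f(2) e_zero ring_hom_zero[OF hom R.ring_axioms R.ring_axioms] by simp
  moreover obtain E' where "cox_component V K F (cl (push tau D)) = e E' ` sec E'"
   using component_of_W[OF M_W[OF l]] .
  ultimately show ?thesis using e_zero[of E'] sections_zero[of E'] by (metis imageI)
 next
  case False
  then have fx: "f \<in> Lx" using sections_L[OF f(1)] by simp
  let ?Delta = "dv f + E"
  note W = D_sum_W[OF E(1) fx]
  have "p E f * mu ?Delta \<noteq> 0" using p_facts(1)[OF E(1) fx] mu(1)[OF W] by simp
  from realize[OF M_W[OF l] this] obtain D' f' where D': "D' \<in> K" "f' \<in> Lx"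
   and eq: "dv f' + D' = push tau ?Delta" "p D' f' = p E f * mu ?Delta" by blast
  have sec': "f' \<in> sec D'" unfolding div_Lx(4)[OF D'(2)] eq M_eff[OF l W] using f(1) div_Lx(4)[OF fx] by blast
  have "Phi x = e D' f'" unfolding f(2) by (rule liftsD[OF Phi E(1) fx f(1) D' eq])
  moreover have "cl D' = cl (push tau E)"
  proof -
   have "dv f' + D' = dv (sigma f) + push tau E" unfolding eq(1) M_add[OF l] using M_div[OF l, of f] fx by simp
   then have "D' - push tau E = dv (sigma f) + - dv f'" by (simp add: algebra_simps)
   also have "... = dv (sigma f \<cdot> inv\<^bsub>L\<^esub> f')"
    unfolding div_Lx(2)[OF sigma_Lx[OF l fx] Lx_closed(2)[OF D'(2)]] div_Lx(3)[OF D'(2)] ..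
   finally show ?thesis unfolding div_class_eq_iff[OF K_W[OF D'(1)] M_W[OF l]] principal_iff
    using Lx_closed(1)[OF sigma_Lx[OF l fx] Lx_closed(2)[OF D'(2)]] by blast
  qed
  ultimately show ?thesis unfolding cls using cox_component_eq[OF D'(1)] sec' by auto
 qed
qed

text \<open>Transport of divisors respects principal divisors because it sends the divisor of \<open>g\<close> to that of \<open>sigma g\<close>.\<close>

lemma class_automorphism:
 assumes l: "liftable sigma tau mu"
 shows "\<exists>ph\<^sub>0\<in>auto (Cl V). \<forall>D\<in>Div. ph\<^sub>0 (cl D) = cl (push tau D)"
proof -
 define ph0 where "ph0 = (\<lambda>u\<in>Classes. cl (push tau (SOME D. D \<in> Div \<and> u = cl D)))"
 have ph0: "ph0 (cl D) = cl (push tau D)" if D: "D \<in> Div" for D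
 proof -
  define E where "E = (SOME E. E \<in> Div \<and> cl D = cl E)"
  have E: "E \<in> Div \<and> cl D = cl E" unfolding E_def by (rule someI[of _ D]) (use D in simp)
  have "ph0 (cl D) = cl (push tau E)" using D by (simp add: ph0_def Cl_simps(1) E_def)
  then show ?thesis using push_class[OF l D conjunct1[OF E] conjunct2[OF E]] by simp
 qed
 note l' = liftable_inverse[OF l]
 have "ph0 \<in> hom (Cl V) (Cl V)"
 proof (rule homI)
  fix u assume "u \<in> Classes"
  then obtain D where D: "D \<in> Div" "u = cl D" unfolding Cl_simps(1) by blast
  show "ph0 u \<in> Classes" unfolding D(2) ph0[OF D(1)] Cl_simps(1) by (rule imageI[OF M_W[OF l]])
  fix v assume "v \<in> Classes"
  then obtain E where E: "E \<in> Div" "v = cl E" unfolding Cl_simps(1) by blast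
  show "ph0 (u \<otimes>\<^bsub>Cl V\<^esub> v) = ph0 u \<otimes>\<^bsub>Cl V\<^esub> ph0 v"
   unfolding D(2) E(2) Cl_simps(2)[OF D(1) E(1)] ph0[OF D(1)] ph0[OF E(1)] ph0[OF W_closed(2)[OF D(1) E(1)]] M_add[OF l]
    Cl_simps(2)[OF M_W[OF l] M_W[OF l]] ..
 qed
 moreover have "bij_betw ph0 (Classes) (Classes)" unfolding bij_betw_def
 proof
  show "inj_on ph0 (Classes)"
  proof (rule inj_onI)
   fix u v assume "u \<in> Classes" "v \<in> Classes" and eq: "ph0 u = ph0 v"
   then obtain D E where D: "D \<in> Div" "u = cl D" and E: "E \<in> Div" "v = cl E"
    unfolding Cl_simps(1) by blast
   have "cl (push tau D) = cl (push tau E)" using eq unfolding D(2) E(2) ph0[OF D(1)] ph0[OF E(1)] .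
   from push_class[OF l' M_W[OF l] M_W[OF l] this] show "u = v"
    unfolding M'_inverse[OF l D(1)] M'_inverse[OF l E(1)] D(2) E(2) .
  qed
  show "ph0 ` Classes = Classes"
  proof (intro equalityI subsetI)
   fix u assume "u \<in> ph0 ` Classes"
   then show "u \<in> Classes" using hom_in_carrier[OF \<open>ph0 \<in> hom (Cl V) (Cl V)\<close>] by blast
  next
   fix u assume "u \<in> Classes"
   then obtain D where D: "D \<in> Div" "u = cl D" unfolding Cl_simps(1) by blast
   have "ph0 (cl (push sigma D)) = u" unfolding ph0[OF M'_W[OF l]] M_inverse[OF l D(1)] D(2) ..
   moreover have "cl (push sigma D) \<in> Classes" unfolding Cl_simps(1) by (rule imageI[OF M'_W[OF l]])
   ultimately show "u \<in> ph0 ` Classes" by blast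
  qed
 qed
 moreover have "ph0 \<in> extensional (Classes)" by (simp add: ph0_def)
 ultimately have "ph0 \<in> auto (Cl V)" by (simp add: auto_def Bij_def)
 then show ?thesis using ph0 by blast
qed

lemma cox_embed_e: "cox_embed V K F f = e 0 (to_frac A f)" "cox_scalar V K F c = e 0 (kappa c)"
 by (simp_all add: cox_embed_def cox_scalar_def e_def)

text \<open>The lift and the lift of the inverse, with the inverse correction \<open>mu\<close>, are inverse to each other because
both are determined by divisors and invariants.\<close>

lemma lift_automorphism:
 assumes l: "liftable sigma tau mu" and kappa: "\<And>c. sigma (kappa c) = kappa c"
 shows "\<exists>ph\<in>carrier (graded_automorphisms V K F). lifts ph tau mu"
proof -
 note l' = liftable_inverse[OF l]
 obtain Phi where Phi: "lifts Phi tau mu" using lifts_exists[OF l] by blast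
 obtain Phi' where Phi': "lifts Phi' sigma (\<lambda>D. inverse (mu (push sigma D)))" using lifts_exists[OF l'] by blast
 have hom: "Phi \<in> ring_hom R R" "Phi' \<in> ring_hom R R" using Phi Phi' by (simp_all add: lifts_def)
 have 1: "Phi' (Phi x) = x" if "x \<in> carrier R" for x by (rule lifts_compose[OF l Phi Phi' that])
 have 2: "Phi (Phi' x) = x" if x: "x \<in> carrier R" for x
 proof (rule lifts_compose[OF l' Phi' _ x])
  have ii: "inverse (inverse (mu (push sigma (push tau D)))) = mu D" if "D \<in> Div" for D
   using M'_inverse[OF l that] by simp
  show "lifts Phi tau (\<lambda>D. inverse (inverse (mu (push sigma (push tau D)))))"
   unfolding lifts_def
  proof (intro conjI ballI impI)
   fix D f D' f' assume a: "D \<in> K" "f \<in> Lx" "f \<in> sec D" "D' \<in> K" "f' \<in> Lx"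
    "dv f' + D' = push tau (dv f + D)"
    and b: "p D' f' = p D f * inverse (inverse (mu (push sigma (push tau (dv f + D)))))"
   show "Phi (e D f) = e D' f'"
    by (rule liftsD[OF Phi a b[unfolded ii[OF D_sum_W[OF a(1,2)]]]])
  qed (rule hom(1))
 qed
 define ph where "ph = restrict Phi (carrier R)"
 have ph: "ph x = Phi x" if "x \<in> carrier R" for x using that by (simp add: ph_def)
 have phhom: "ph \<in> ring_hom R R"
  by (rule ring_hom_memI) (use ph ring_hom_closed[OF hom(1)] ring_hom_mult[OF hom(1)] ring_hom_add[OF hom(1)] ring_hom_one[OF hom(1)] in simp_all)
 have lifts: "lifts ph tau mu" unfolding lifts_def
 proof (intro conjI ballI impI)
  fix D f D' f' assume a: "D \<in> K" "f \<in> Lx" "f \<in> sec D" "D' \<in> K" "f' \<in> Lx"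
   "dv f' + D' = push tau (dv f + D)" "p D' f' = p D f * mu (dv f + D)"
  show "ph (e D f) = e D' f'" unfolding ph[OF e_closed[OF a(1,3)]] by (rule liftsD[OF Phi a])
 qed (rule phhom)
 have "bij_betw ph (carrier R) (carrier R)"
  by (rule bij_betwI[where g = Phi']) (use ring_hom_closed[OF hom(1)] ring_hom_closed[OF hom(2)] ph 1 2 in auto)
 then have bij: "ph \<in> Bij (carrier R)" by (simp add: Bij_def ph_def)
 have scal: "ph (cox_scalar V K F c) = cox_scalar V K F c" for c
 proof (cases "c = 0")
  case True
  then show ?thesis unfolding cox_embed_e True kappa_simps(4) e_zero
   using ring_hom_zero[OF phhom R.ring_axioms R.ring_axioms] by simp
 next
  case False
  then have k: "kappa c \<in> Lx" using kappa_Lx by blast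
  have "mu 0 = 1" using W.character_on_one_inv(1)[OF lift_mu[OF l]] by (simp add: W_simps)
  then show ?thesis unfolding cox_embed_e
   by (intro liftsD[OF lifts K_closed(1) k _ K_closed(1) k]) (simp_all add: div_kappa[OF False] M_zero[OF l] sections_0 kappa_simps(1) del: image_iff)
 qed
 obtain ph0 where ph0: "ph0 \<in> auto (Cl V)" "\<And>D. D \<in> Div ==> ph0 (cl D) = cl (push tau D)"
  using class_automorphism[OF l] by blast
 have compR: "cox_component V K F (cl D) \<subseteq> carrier R" if D: "D \<in> Div" for D
 proof -
  obtain E where E: "E \<in> K" "cox_component V K F (cl D) = e E ` sec E" using component_of_W[OF D] .
  show ?thesis unfolding E(2) by (rule image_subsetI) (rule e_closed[OF E(1)])
 qed
 have comp: "ph ` cox_component V K F u = cox_component V K F (ph0 u)" if u: "u \<in> Classes" for u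
 proof -
  obtain D where D: "D \<in> Div" "u = cl D" using u unfolding Cl_simps(1) by blast
  show ?thesis unfolding D(2) ph0(2)[OF D(1)]
  proof (intro equalityI subsetI)
   fix y assume "y \<in> ph ` cox_component V K F (cl D)"
   then show "y \<in> cox_component V K F (cl (push tau D))" using lifts_component[OF l lifts D(1)] by blast
  next
   fix y assume y: "y \<in> cox_component V K F (cl (push tau D))"
   then have yR: "y \<in> carrier R" using compR[OF M_W[OF l]] by blast
   have "Phi' y \<in> cox_component V K F (cl D)"
    using lifts_component[OF l' Phi' M_W[OF l] y] unfolding M'_inverse[OF l D(1)] .
   moreover have "ph (Phi' y) = y" using 2[OF yR] ph ring_hom_closed[OF hom(2) yR] by simp
   ultimately show "y \<in> ph ` cox_component V K F (cl D)" by (metis imageI)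
  qed
 qed
 have "ph \<in> carrier (graded_automorphisms V K F)"
  unfolding graded_automorphisms_def using bij phhom scal ph0(1) comp by auto
 then show ?thesis using lifts by blast
qed

end

section \<open>The groups of automorphisms\<close>

lemma Bij_facts:
 assumes "f \<in> Bij X"
 shows "x \<in> X ==> f x \<in> X" "f \<in> extensional X" "x \<in> X ==> inv_into X f x \<in> X"
  "x \<in> X ==> f (inv_into X f x) = x" "x \<in> X ==> inv_into X f (f x) = x"
  "x \<in> X ==> y \<in> X ==> f x = f y \<longleftrightarrow> x = y"
proof -
 have b: "bij_betw f X X" and "f \<in> extensional X" using assms by (simp_all add: Bij_def)
 then show "f \<in> extensional X" by simp
 have i: "inj_on f X" "f ` X = X" using b by (simp_all add: bij_betw_def)
 show "x \<in> X ==> f x \<in> X" using i(2) by blast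
 show "x \<in> X ==> inv_into X f x \<in> X" using inv_into_into[of x f X] i(2) by simp
 show "x \<in> X ==> f (inv_into X f x) = x" using f_inv_into_f[of x f X] i(2) by simp
 show "x \<in> X ==> inv_into X f (f x) = x" by (rule inv_into_f_f[OF i(1)])
 show "x \<in> X ==> y \<in> X ==> f x = f y \<longleftrightarrow> x = y" by (rule inj_on_eq_iff[OF i(1)])
qed

lemma group_of_bijections:
 assumes C: "C \<subseteq> Bij X" "(\<lambda>x\<in>X. x) \<in> C" "\<And>f g. f \<in> C ==> g \<in> C ==> compose X f g \<in> C"
  "\<And>f. f \<in> C ==> (\<lambda>x\<in>X. inv_into X f x) \<in> C"
 shows "group (BijGroup X\<lparr>carrier := C\<rparr>)"
proof -
 interpret B: group "BijGroup X" by (rule group_BijGroup)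
 have "subgroup C (BijGroup X)"
 proof (rule B.subgroupI)
  show "C \<subseteq> carrier (BijGroup X)" using C(1) by (simp add: BijGroup_def)
  show "C \<noteq> {}" using C(2) by blast
  fix f assume f: "f \<in> C"
  then have fB: "f \<in> Bij X" using C(1) by blast
  show "inv\<^bsub>BijGroup X\<^esub> f \<in> C" unfolding inv_BijGroup[OF fB] by (rule C(4)[OF f])
  fix g assume g: "g \<in> C"
  then have "g \<in> Bij X" using C(1) by blast
  then show "f \<otimes>\<^bsub>BijGroup X\<^esub> g \<in> C" using C(3)[OF f g] fB by (simp add: BijGroup_def)
 qed
 then show ?thesis by (rule subgroup.subgroup_is_group) (rule B.is_group)
qed

lemma regular_map_cong:
 assumes "\<And>x. x \<in> V ==> psi x = psi' x" shows "regular_map V Y psi \<longleftrightarrow> regular_map V Y psi'"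
proof -
 have "(\<lambda>x\<in>V. psi x $ i) = (\<lambda>x\<in>V. psi' x $ i)" for i using assms by (simp cong: restrict_cong)
 then show ?thesis using assms by (simp add: regular_map_def Pi_def)
qed

context cox_units begin

abbreviation "AutR \<equiv> graded_automorphisms V K F"
abbreviation "AutV \<equiv> variety_automorphisms V"
abbreviation "piece \<equiv> cox_component V K F"
abbreviation "emb \<equiv> cox_embed V K F"
abbreviation "scalar \<equiv> cox_scalar V K F"

lemma AutV_iff: "psi \<in> carrier AutV \<longleftrightarrow> psi \<in> Bij V \<and> regular_map V V psi \<and> regular_map V V (inv_into V psi)"
 by (simp add: variety_automorphisms_def)

lemma AutV_ops: "\<one>\<^bsub>AutV\<^esub> = (\<lambda>x\<in>V. x)"
 "psi \<in> carrier AutV ==> psi' \<in> carrier AutV ==> psi \<otimes>\<^bsub>AutV\<^esub> psi' = compose V psi psi'"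
 by (simp_all add: variety_automorphisms_def BijGroup_def)

lemma AutR_iff: "ph \<in> carrier AutR \<longleftrightarrow> ph \<in> Bij (carrier R) \<and> ph \<in> ring_hom R R \<and> (\<forall>c. ph (scalar c) = scalar c) \<and>
  (\<exists>ph\<^sub>0\<in>auto (Cl V). \<forall>u\<in>Classes. ph ` piece u = piece (ph\<^sub>0 u))"
 by (simp add: graded_automorphisms_def)

lemma AutR_facts:
 assumes "ph \<in> carrier AutR"
 shows "ph \<in> Bij (carrier R)" "ph \<in> ring_hom R R" "ph (scalar c) = scalar c"
  "\<exists>ph\<^sub>0\<in>auto (Cl V). \<forall>u\<in>Classes. ph ` piece u = piece (ph\<^sub>0 u)"
 using assms unfolding AutR_iff by simp_all

lemma AutR_ops: "\<one>\<^bsub>AutR\<^esub> = (\<lambda>x\<in>carrier R. x)"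
 "ph \<in> carrier AutR ==> ph' \<in> carrier AutR ==> ph \<otimes>\<^bsub>AutR\<^esub> ph' = compose (carrier R) ph ph'"
 by (simp_all add: graded_automorphisms_def BijGroup_def)

lemma class_cases:
 assumes "u \<in> Classes"
 obtains D where "D \<in> K" "u = cl D" "piece u = e D ` sec D"
proof -
 have "u \<in> cl ` K" using assms surj by simp
 then obtain D where "D \<in> K" "u = cl D" by blast
 then show thesis using that cox_component_eq by blast
qed

lemma class_K: "D \<in> K ==> cl D \<in> Classes"
 unfolding surj[symmetric] by (rule imageI)

lemma comp_R: "u \<in> Classes ==> piece u \<subseteq> carrier R"
 by (erule class_cases) (simp add: image_subset_iff e_closed)

lemma emb_hom: "emb \<in> ring_hom A R"
proof (rule ring_hom_memI)
 show "emb a \<in> carrier R" if "a \<in> carrier A" for a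
  unfolding cox_embed_e by (rule e_closed[OF K_closed(1)]) (use that sections_0 in simp)
 show "emb \<one>\<^sub>A = \<one>\<^sub>R" unfolding cox_embed_e to_frac_simps(4) by (rule e_one)
 fix a b assume ab: "a \<in> carrier A" "b \<in> carrier A"
 then have s: "to_frac A a \<in> sec 0" "to_frac A b \<in> sec 0" unfolding sections_0 by simp_all
 show "emb (a \<otimes>\<^sub>A b) = emb a \<otimes>\<^sub>R emb b"
  unfolding cox_embed_e to_frac_simps(2)[OF ab] e_mult[OF K_closed(1) s(1) K_closed(1) s(2)] by simp
 show "emb (a \<oplus>\<^sub>A b) = emb a \<oplus>\<^sub>R emb b"
  unfolding cox_embed_e to_frac_simps(3)[OF ab] by (rule e_add[OF K_closed(1) s])
qed

lemma emb_inj: "a \<in> carrier A ==> b \<in> carrier A ==> emb a = emb b \<longleftrightarrow> a = b"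
 unfolding cox_embed_e using e_inj[OF K_closed(1), of "to_frac A a" "to_frac A b"] A.to_frac_inj sections_0 by simp

lemma scalar_emb: "scalar c = emb (const_fun V c)"
 by (simp add: cox_scalar_def)

lemma comp_zero: "piece \<one>\<^bsub>Cl V\<^esub> = emb ` carrier A"
proof -
 have "cl 0 = \<one>\<^bsub>Cl V\<^esub>" using K0_closed(1) by (simp add: principal_subgroup_def)
 then have "piece \<one>\<^bsub>Cl V\<^esub> = e 0 ` S" using cox_component_eq[OF K_closed(1)] sections_0 by simp
 then show ?thesis by (simp add: cox_embed_e image_image)
qed

lemma group_AutR: "group AutR"
proof -
 interpret Cl: comm_group "Cl V" by (rule Cl_comm_group)
 let ?C = "carrier AutR"
 have sub: "?C \<subseteq> Bij (carrier R)" using AutR_iff by blast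
 have scR: "scalar c \<in> carrier R" for c unfolding scalar_emb by (rule ring_hom_closed[OF emb_hom const_fun_A])
 have "(\<lambda>x\<in>carrier R. x) ` piece u = piece ((\<lambda>u\<in>Classes. u) u)" if "u \<in> Classes" for u
  using comp_R[OF that] that by (simp add: subset_iff)
 then have "\<exists>ph\<^sub>0\<in>auto (Cl V). \<forall>u\<in>Classes. (\<lambda>x\<in>carrier R. x) ` piece u = piece (ph\<^sub>0 u)"
  using Cl.id_in_auto by (intro bexI[of _ "\<lambda>u\<in>Classes. u"]) simp_all
 moreover have "(\<lambda>x\<in>carrier R. x) \<in> ring_hom R R" by (rule ring_hom_memI) simp_all
 ultimately have id: "(\<lambda>x\<in>carrier R. x) \<in> ?C" unfolding AutR_iff using id_Bij scR by simp
 have inverse: "(\<lambda>x\<in>carrier R. inv_into (carrier R) ph x) \<in> ?C" if ph: "ph \<in> carrier AutR" for ph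
 proof -
 note P = AutR_facts[OF ph] and h = AutR_facts(2)[OF ph]
 note B = Bij_facts[OF P(1)]
 obtain ph0 where ph0: "ph0 \<in> auto (Cl V)" "\<And>u. u \<in> Classes ==> ph ` piece u = piece (ph0 u)" using P(4) by blast
 have ph0B: "ph0 \<in> Bij (Classes)" using ph0(1) by (simp add: auto_def)
 note B0 = Bij_facts[OF ph0B]
 let ?i = "\<lambda>x\<in>carrier R. inv_into (carrier R) ph x" and ?j = "\<lambda>u\<in>Classes. inv_into (Classes) ph0 u"
 have i0: "?j \<in> auto (Cl V)" using subgroup.m_inv_closed[OF Cl.subgroup_auto ph0(1)] unfolding inv_BijGroup[OF ph0B] .
 have "?i \<in> ring_hom R R"
 proof (rule ring_hom_memI)
  show "?i x \<in> carrier R" if "x \<in> carrier R" for x using B(3) that by simp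
  show "?i \<one>\<^sub>R = \<one>\<^sub>R" using B(5)[of "\<one>\<^sub>R"] ring_hom_one[OF h] by simp
  fix x y assume xy: "x \<in> carrier R" "y \<in> carrier R"
  note ixy = B(3)[OF xy(1)] B(3)[OF xy(2)]
  have "inv_into (carrier R) ph (x \<otimes>\<^sub>R y) = inv_into (carrier R) ph x \<otimes>\<^sub>R inv_into (carrier R) ph y"
   using B(5)[of "inv_into (carrier R) ph x \<otimes>\<^sub>R inv_into (carrier R) ph y"] ring_hom_mult[OF h ixy] B(4) xy ixy by simp
  then show "?i (x \<otimes>\<^sub>R y) = ?i x \<otimes>\<^sub>R ?i y" using xy by simp
  have "inv_into (carrier R) ph (x \<oplus>\<^sub>R y) = inv_into (carrier R) ph x \<oplus>\<^sub>R inv_into (carrier R) ph y"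
   using B(5)[of "inv_into (carrier R) ph x \<oplus>\<^sub>R inv_into (carrier R) ph y"] ring_hom_add[OF h ixy] B(4) xy ixy by simp
  then show "?i (x \<oplus>\<^sub>R y) = ?i x \<oplus>\<^sub>R ?i y" using xy by simp
 qed
 moreover have "?i (scalar c) = scalar c" for c using B(5)[OF scR, of c] P(3) scR by simp
 moreover have "?i ` piece u = piece (?j u)" if u: "u \<in> Classes" for u
 proof -
  define v where "v = inv_into (Classes) ph0 u"
  have v: "v \<in> Classes" "ph0 v = u" unfolding v_def using B0(3,4)[OF u] by simp_all
  have "?i ` piece u = ?i ` ph ` piece v" using ph0(2)[OF v(1)] v(2) by simp
  also have "... = id ` piece v" unfolding image_image using comp_R[OF v(1)] B(1,5) by (intro image_cong) auto
  finally show ?thesis using u v_def by simp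
 qed
 ultimately show ?thesis unfolding AutR_iff using restrict_inv_into_Bij[OF P(1)] i0 by blast
 qed
 have compose: "compose (carrier R) ph ph' \<in> ?C" if ph: "ph \<in> carrier AutR" and ph': "ph' \<in> carrier AutR" for ph ph'
 proof -
 note P = AutR_facts[OF ph] and h = AutR_facts(2)[OF ph]
 obtain ph0 where ph0: "ph0 \<in> auto (Cl V)" "\<And>u. u \<in> Classes ==> ph ` piece u = piece (ph0 u)" using P(4) by blast
 have ph0B: "ph0 \<in> Bij (Classes)" using ph0(1) by (simp add: auto_def)
 note P' = AutR_facts[OF ph'] and h' = AutR_facts(2)[OF ph']
 note B' = Bij_facts[OF P'(1)]
 obtain ph0' where ph0': "ph0' \<in> auto (Cl V)" "\<And>u. u \<in> Classes ==> ph' ` piece u = piece (ph0' u)" using P'(4) by blast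
 have ph0'B: "ph0' \<in> Bij (Classes)" using ph0'(1) by (simp add: auto_def)
 have "compose (Classes) ph0 ph0' \<in> auto (Cl V)"
  using subgroup.m_closed[OF Cl.subgroup_auto ph0(1) ph0'(1)] ph0B ph0'B by (simp add: BijGroup_def)
 moreover have "compose (carrier R) ph ph' ` piece u = piece (compose (Classes) ph0 ph0' u)" if u: "u \<in> Classes" for u
 proof -
  have "compose (carrier R) ph ph' ` piece u = (\<lambda>x. ph (ph' x)) ` piece u"
   using comp_R[OF u] by (intro image_cong) (auto simp: compose_def)
  also have "... = ph ` piece (ph0' u)" using ph0'(2)[OF u] by (metis image_image)
  finally show ?thesis using ph0(2)[OF Bij_facts(1)[OF ph0'B u]] u by (simp add: compose_def)
 qed
 moreover have "compose (carrier R) ph ph' \<in> ring_hom R R"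
  by (rule ring_hom_memI) (use B'(1) ring_hom_closed[OF h] ring_hom_closed[OF h'] ring_hom_mult[OF h] ring_hom_mult[OF h'] ring_hom_add[OF h]
   ring_hom_add[OF h'] ring_hom_one[OF h] ring_hom_one[OF h'] in \<open>simp_all add: compose_def\<close>)
 moreover have "compose (carrier R) ph ph' (scalar c) = scalar c" for c using P(3) P'(3) scR by (simp add: compose_def)
 ultimately show ?thesis unfolding AutR_iff using compose_Bij[OF P(1) P'(1)] by blast
 qed
 have "group (BijGroup (carrier R)\<lparr>carrier := ?C\<rparr>)"
  by (rule group_of_bijections[OF sub id compose inverse])
 then show ?thesis by (simp add: graded_automorphisms_def)
qed

lemma pullback_A:
 assumes psi: "regular_map V V psi" and a: "a \<in> carrier A" shows "pullback V psi a \<in> carrier A"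
proof -
 obtain p where p: "p \<in> poly_funs" "a = restrict p V" using A_polynomial[OF a] by blast
 have psiV: "psi x \<in> V" if "x \<in> V" for x using psi that by (auto simp: regular_map_def)
 have "(\<lambda>x\<in>V. p (psi x)) \<in> carrier A" using p(1) unfolding polynomial_functions_def
 proof (induction rule: algebra_of_functions.induct)
  case (gen g)
  then obtain i where g: "g = (\<lambda>x. x $ i)" by blast
  show ?case using psi unfolding g regular_map_def A_simps(1) by blast
 next
  case (const c)
  show ?case by (rule const_fun_A[unfolded const_fun_def])
 next
  case (add f g)
  have "(\<lambda>x\<in>V. f (psi x)) \<oplus>\<^sub>A (\<lambda>x\<in>V. g (psi x)) = (\<lambda>x\<in>V. f (psi x) + g (psi x))"
   by (simp add: A_simps(5) cong: restrict_cong)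
  then show ?case using A.a_closed[OF add(3,4)] by (simp only:)
 next
  case (mult f g)
  have "(\<lambda>x\<in>V. f (psi x)) \<otimes>\<^sub>A (\<lambda>x\<in>V. g (psi x)) = (\<lambda>x\<in>V. f (psi x) * g (psi x))"
   by (simp add: A_simps(4) cong: restrict_cong)
  then show ?case using A.m_closed[OF mult(3,4)] by (simp only:)
 qed
 moreover have "pullback V psi a = (\<lambda>x\<in>V. p (psi x))" unfolding pullback_def p(2) using psiV by (simp cong: restrict_cong)
 ultimately show ?thesis by simp
qed

lemma regular_map_V: "regular_map V V psi ==> x \<in> V ==> psi x \<in> V"
 by (auto simp: regular_map_def)

lemma pullback_hom:
 assumes psi: "regular_map V V psi" shows "pullback V psi \<in> ring_hom A A" "pullback V psi (const_fun V c) = const_fun V c"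
proof -
 show "pullback V psi \<in> ring_hom A A"
 proof (rule ring_hom_memI)
  show "pullback V psi a \<in> carrier A" if "a \<in> carrier A" for a by (rule pullback_A[OF psi that])
  show "pullback V psi (a \<otimes>\<^sub>A b) = pullback V psi a \<otimes>\<^sub>A pullback V psi b" for a b
   unfolding pullback_def A_simps using regular_map_V[OF psi] by (simp cong: restrict_cong)
  show "pullback V psi (a \<oplus>\<^sub>A b) = pullback V psi a \<oplus>\<^sub>A pullback V psi b" for a b
   unfolding pullback_def A_simps using regular_map_V[OF psi] by (simp cong: restrict_cong)
  show "pullback V psi \<one>\<^sub>A = \<one>\<^sub>A"
   unfolding pullback_def A_simps using regular_map_V[OF psi] by (simp cong: restrict_cong)
 qed
 show "pullback V psi (const_fun V c) = const_fun V c"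
  unfolding pullback_def const_fun_def using regular_map_V[OF psi] by (simp cong: restrict_cong)
qed

lemma coordinate_A: "(\<lambda>x\<in>V. x $ i) \<in> carrier A"
proof -
 have "(\<lambda>x. x $ i) \<in> poly_funs" unfolding polynomial_functions_def by (rule algebra_of_functions.gen) (rule rangeI)
 from restrict_A[OF this] show ?thesis .
qed

text \<open>Coordinate functions separate the points of \<open>V\<close>.\<close>

lemma pullback_determines:
 assumes "psi \<in> V \<rightarrow> V" "psi' \<in> V \<rightarrow> V" "\<And>a. a \<in> carrier A ==> pullback V psi a = pullback V psi' a" "x \<in> V"
 shows "psi x = psi' x"
proof -
 have "psi x $ i = psi' x $ i" for i
  using fun_cong[OF assms(3)[OF coordinate_A[of i]], of x] assms(1,2,4) by (simp add: pullback_def Pi_def)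
 then show ?thesis by (simp add: vec_eq_iff)
qed

text \<open>The images of the coordinate functions are the components of the map; the equations of \<open>V\<close> hold for it because
the homomorphism preserves them.\<close>

lemma algebra_hom_is_pullback:
 assumes h: "h \<in> ring_hom A A" and konst: "\<And>c. h (const_fun V c) = const_fun V c"
 shows "\<exists>psi. regular_map V V psi \<and> (\<forall>a\<in>carrier A. h a = pullback V psi a)"
proof -
 define psi :: "'k ^ 'n \<Rightarrow> 'k ^ 'n" where "psi x = vec_lambda (\<lambda>i. h (\<lambda>x\<in>V. x $ i) x)" for x
 have A: "restrict p V \<in> carrier A" if "p \<in> algebra_of_functions (range (\<lambda>i x. x $ i))" for p :: "'k ^ 'n \<Rightarrow> 'k"
  using restrict_A[unfolded polynomial_functions_def, OF that] .
 have hp: "h (restrict p V) = (\<lambda>x\<in>V. p (psi x))" if p: "p \<in> poly_funs" for p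
  using p unfolding polynomial_functions_def
 proof (induction rule: algebra_of_functions.induct)
  case (gen g)
  then obtain i where g: "g = (\<lambda>x. x $ i)" by blast
  have "h (\<lambda>x\<in>V. x $ i) \<in> extensional V"
   using ring_hom_closed[OF h coordinate_A[of i]] unfolding A_simps(1) by (rule regular_functions_extensional)
  then have "h (\<lambda>x\<in>V. x $ i) = (\<lambda>x\<in>V. h (\<lambda>x\<in>V. x $ i) x)" by (rule extensional_restrict[symmetric])
  then show ?case unfolding g psi_def vec_lambda_beta .
 next
  case (const c)
  show ?case by (rule konst[unfolded const_fun_def])
 next
  case (add f g)
  have "restrict (\<lambda>x. f x + g x) V = restrict f V \<oplus>\<^sub>A restrict g V" by (simp add: A_simps(5) cong: restrict_cong)
  moreover have "(\<lambda>x\<in>V. f (psi x)) \<oplus>\<^sub>A (\<lambda>x\<in>V. g (psi x)) = (\<lambda>x\<in>V. f (psi x) + g (psi x))"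
   by (simp add: A_simps(5) cong: restrict_cong)
  ultimately show ?case using ring_hom_add[OF h A[OF add(1)] A[OF add(2)]] add(3,4) by (simp only:)
 next
  case (mult f g)
  have "restrict (\<lambda>x. f x * g x) V = restrict f V \<otimes>\<^sub>A restrict g V" by (simp add: A_simps(4) cong: restrict_cong)
  moreover have "(\<lambda>x\<in>V. f (psi x)) \<otimes>\<^sub>A (\<lambda>x\<in>V. g (psi x)) = (\<lambda>x\<in>V. f (psi x) * g (psi x))"
   by (simp add: A_simps(4) cong: restrict_cong)
  ultimately show ?case using ring_hom_mult[OF h A[OF mult(1)] A[OF mult(2)]] mult(3,4) by (simp only:)
 qed
 obtain Z where Z: "Z \<subseteq> poly_funs" "V = {x. \<forall>p\<in>Z. p x = 0}" using V_closed unfolding zariski_closed_def by blast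
 have psiV: "psi x \<in> V" if x: "x \<in> V" for x
 proof -
  have "p (psi x) = 0" if p: "p \<in> Z" for p
  proof -
   have "\<forall>y\<in>V. p y = 0" using Z(2) p by blast
   then have "restrict p V = const_fun V 0" by (simp add: const_fun_def cong: restrict_cong)
   then have "(\<lambda>x\<in>V. p (psi x)) = const_fun V 0" using hp[of p] konst[of 0] Z(1) p by auto
   from fun_cong[OF this, of x] show ?thesis using x by (simp add: const_fun_def)
  qed
  then show ?thesis by (subst Z(2)) simp
 qed
 have "(\<lambda>x\<in>V. psi x $ i) \<in> regular_functions V" for i
 proof -
  have "(\<lambda>x. x $ i) \<in> poly_funs" unfolding polynomial_functions_def by (rule algebra_of_functions.gen) (rule rangeI)
  from hp[OF this] show ?thesis using ring_hom_closed[OF h coordinate_A[of i]] unfolding A_simps(1) by simp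
 qed
 then have "regular_map V V psi" using psiV by (simp add: regular_map_def)
 moreover have "h a = pullback V psi a" if a: "a \<in> carrier A" for a
 proof -
  obtain p where p: "p \<in> poly_funs" "a = restrict p V" using A_polynomial[OF a] by blast
  show ?thesis unfolding p(2) hp[OF p(1)] pullback_def using psiV by (simp cong: restrict_cong)
 qed
 ultimately show ?thesis by blast
qed

lemma regular_map_compose:
 assumes "regular_map V V psi" "regular_map V V psi'" shows "regular_map V V (\<lambda>x. psi (psi' x))"
proof -
 have "(\<lambda>x\<in>V. psi (psi' x) $ i) \<in> regular_functions V" for i
 proof -
  have "(\<lambda>x\<in>V. psi x $ i) \<in> carrier A" using assms(1) unfolding regular_map_def A_simps(1) by blast
  from pullback_A[OF assms(2) this] show ?thesis
   unfolding pullback_def A_simps(1) using regular_map_V[OF assms(2)] by (simp cong: restrict_cong)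
 qed
 then show ?thesis using regular_map_V[OF assms(1)] regular_map_V[OF assms(2)] by (simp add: regular_map_def)
qed

lemma inv_compose:
 assumes "psi \<in> Bij V" "psi' \<in> Bij V" "x \<in> V"
 shows "inv_into V (compose V psi psi') x = inv_into V psi' (inv_into V psi x)"
proof -
 note B = Bij_facts[OF assms(1)] and B' = Bij_facts[OF assms(2)] and BB = Bij_facts[OF compose_Bij[OF assms(1,2)]]
 let ?y = "inv_into V psi' (inv_into V psi x)"
 have y: "?y \<in> V" using B(3) B'(3) assms(3) by simp
 have "compose V psi psi' ?y = x" using y B(3,4)[OF assms(3)] B'(4) by (simp add: compose_def)
 then show ?thesis using BB(5)[OF y] by simp
qed

lemma AutV_inverse:
 assumes "psi \<in> carrier AutV"
 shows "(\<lambda>x\<in>V. inv_into V psi x) \<in> carrier AutV" "x \<in> V ==> inv_into V (\<lambda>x\<in>V. inv_into V psi x) x = psi x"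
proof -
 have P: "psi \<in> Bij V" "regular_map V V psi" "regular_map V V (inv_into V psi)" using assms unfolding AutV_iff by simp_all
 note B = Bij_facts[OF P(1)]
 note Bi = restrict_inv_into_Bij[OF P(1)]
 show *: "inv_into V (\<lambda>x\<in>V. inv_into V psi x) x = psi x" if "x \<in> V" for x
  using Bij_facts(5)[OF Bi B(1)[OF that]] B(1,5)[OF that] by simp
 show "(\<lambda>x\<in>V. inv_into V psi x) \<in> carrier AutV" unfolding AutV_iff
 proof (intro conjI)
  show "regular_map V V (\<lambda>x\<in>V. inv_into V psi x)"
   using P(3) regular_map_cong[of V "\<lambda>x\<in>V. inv_into V psi x" "inv_into V psi" V] by simp
  show "regular_map V V (inv_into V (\<lambda>x\<in>V. inv_into V psi x))"
   using P(2) regular_map_cong[of V "inv_into V (\<lambda>x\<in>V. inv_into V psi x)" psi V] * by blast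
 qed (rule Bi)
qed

lemma AutV_compose:
 assumes "psi \<in> carrier AutV" "psi' \<in> carrier AutV" shows "compose V psi psi' \<in> carrier AutV"
proof -
 have P: "psi \<in> Bij V" "regular_map V V psi" "regular_map V V (inv_into V psi)" using assms(1) unfolding AutV_iff by simp_all
 have P': "psi' \<in> Bij V" "regular_map V V psi'" "regular_map V V (inv_into V psi')" using assms(2) unfolding AutV_iff by simp_all
 show ?thesis unfolding AutV_iff
 proof (intro conjI)
  show "regular_map V V (compose V psi psi')"
   using regular_map_compose[OF P(2) P'(2)] regular_map_cong[of V "compose V psi psi'" "\<lambda>x. psi (psi' x)" V] by (simp add: compose_def)
  show "regular_map V V (inv_into V (compose V psi psi'))"
   using regular_map_compose[OF P'(3) P(3)] inv_compose[OF P(1) P'(1)]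
    regular_map_cong[of V "inv_into V (compose V psi psi')" "\<lambda>x. inv_into V psi' (inv_into V psi x)" V] by blast
 qed (rule compose_Bij[OF P(1) P'(1)])
qed

lemma id_AutV: "(\<lambda>x\<in>V. x) \<in> carrier AutV" "x \<in> V ==> inv_into V (\<lambda>x\<in>V. x) x = x"
proof -
 show i: "inv_into V (\<lambda>x\<in>V. x) x = x" if "x \<in> V" for x using Bij_facts(5)[OF id_Bij that] that by simp
 have "regular_map V V (\<lambda>x. x)" unfolding regular_map_def using coordinate_A unfolding A_simps(1) by simp
 moreover have "regular_map V V (\<lambda>x\<in>V. x) \<longleftrightarrow> regular_map V V (\<lambda>x. x)"
  "regular_map V V (inv_into V (\<lambda>x\<in>V. x)) \<longleftrightarrow> regular_map V V (\<lambda>x. x)"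
  by (rule regular_map_cong, use i in simp)+
 ultimately show "(\<lambda>x\<in>V. x) \<in> carrier AutV" unfolding AutV_iff using id_Bij[of V] by blast
qed

lemma group_AutV: "group AutV"
proof -
 have "group (BijGroup V\<lparr>carrier := carrier AutV\<rparr>)"
 proof (rule group_of_bijections)
  show "carrier AutV \<subseteq> Bij V" using AutV_iff by blast
 qed (rule id_AutV(1), rule AutV_compose, simp_all add: AutV_inverse(1) del: restrict_apply)
 then show ?thesis by (simp add: variety_automorphisms_def)
qed

end

section \<open>Restriction to degree zero\<close>

context cox_units begin

text \<open>The inverse turns the contravariant pullback into a homomorphism of groups.\<close>

definition induces where
 "induces ph psi \<longleftrightarrow> psi \<in> carrier AutV \<and> (\<forall>a\<in>carrier A. emb (pullback V (inv_into V psi) a) = ph (emb a))"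

lemma A_extensional: "a \<in> carrier A ==> a \<in> extensional V"
 unfolding A_simps(1) by (rule regular_functions_extensional)

lemma pullback_id:
 assumes "a \<in> carrier A" "\<And>x. x \<in> V ==> psi x = x" shows "pullback V psi a = a"
proof -
 have "pullback V psi a = restrict a V" unfolding pullback_def using assms(2) by (simp cong: restrict_cong)
 also have "... = a" by (rule extensional_restrict[OF A_extensional[OF assms(1)]])
 finally show ?thesis .
qed

lemma pullback_compose:
 assumes "\<And>x. x \<in> V ==> psi x \<in> V" shows "pullback V psi (pullback V psi' a) = pullback V (\<lambda>x. psi' (psi x)) a"
 unfolding pullback_def using assms by (simp cong: restrict_cong)

lemma emb_A: "a \<in> carrier A ==> emb a \<in> carrier R"
 by (rule ring_hom_closed[OF emb_hom])

text \<open>An automorphism of the class group fixes the neutral class, so the degree zero part is preserved.\<close>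

lemma AutR_restricts:
 assumes ph: "ph \<in> carrier AutR"
 shows "\<exists>psi. regular_map V V psi \<and> (\<forall>a\<in>carrier A. emb (pullback V psi a) = ph (emb a))"
proof -
 interpret Cl: comm_group "Cl V" by (rule Cl_comm_group)
 note P = AutR_facts[OF ph]
 obtain ph0 where ph0: "ph0 \<in> auto (Cl V)" "\<And>u. u \<in> Classes ==> ph ` piece u = piece (ph0 u)" using P(4) by blast
 have "ph0 \<in> hom (Cl V) (Cl V)" using ph0(1) by (simp add: auto_def)
 then have "ph0 \<one>\<^bsub>Cl V\<^esub> = \<one>\<^bsub>Cl V\<^esub>" by (rule hom_one) (rule Cl.is_group)+
 then have im: "ph ` emb ` carrier A = emb ` carrier A" using ph0(2)[OF Cl.one_closed] by (simp add: comp_zero)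
 define h where "h a = (SOME b. b \<in> carrier A \<and> ph (emb a) = emb b)" for a
 have h: "h a \<in> carrier A" "ph (emb a) = emb (h a)" if "a \<in> carrier A" for a
 proof -
  have "ph (emb a) \<in> ph ` emb ` carrier A" using that by (intro imageI)
  then have "ph (emb a) \<in> emb ` carrier A" unfolding im .
  then have "\<exists>b. b \<in> carrier A \<and> ph (emb a) = emb b" by blast
  from someI_ex[OF this] show "h a \<in> carrier A" "ph (emb a) = emb (h a)" unfolding h_def by simp_all
 qed
 have hI: "h a = b" if "a \<in> carrier A" "b \<in> carrier A" "ph (emb a) = emb b" for a b
  using emb_inj[OF h(1)[OF that(1)] that(2)] h(2)[OF that(1)] that(3) by simp
 have "h \<in> ring_hom A A"
 proof (rule ring_hom_memI)
  show "h a \<in> carrier A" if "a \<in> carrier A" for a using h(1)[OF that] .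
  show "h \<one>\<^sub>A = \<one>\<^sub>A" by (rule hI) (simp_all add: ring_hom_one[OF emb_hom] ring_hom_one[OF P(2)])
  fix a b assume ab: "a \<in> carrier A" "b \<in> carrier A"
  note hab = h(1)[OF ab(1)] h(1)[OF ab(2)] and eab = emb_A[OF ab(1)] emb_A[OF ab(2)]
  show "h (a \<otimes>\<^sub>A b) = h a \<otimes>\<^sub>A h b"
   by (rule hI) (use ab hab in \<open>simp_all add: ring_hom_mult[OF emb_hom] ring_hom_mult[OF P(2) eab] h(2)\<close>)
  show "h (a \<oplus>\<^sub>A b) = h a \<oplus>\<^sub>A h b"
   by (rule hI) (use ab hab in \<open>simp_all add: ring_hom_add[OF emb_hom] ring_hom_add[OF P(2) eab] h(2)\<close>)
 qed
 moreover have "h (const_fun V c) = const_fun V c" for c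
  by (rule hI[OF const_fun_A const_fun_A]) (use P(3)[of c] in \<open>simp add: scalar_emb\<close>)
 ultimately obtain psi where psi: "regular_map V V psi" "\<forall>a\<in>carrier A. h a = pullback V psi a"
  using algebra_hom_is_pullback by blast
 have "emb (pullback V psi a) = ph (emb a)" if "a \<in> carrier A" for a using psi(2) h(2)[OF that] that by simp
 then show ?thesis using psi(1) by blast
qed

lemma AutR_inverse:
 assumes "ph \<in> carrier AutR"
 obtains ph' where "ph' \<in> carrier AutR" "\<And>x. x \<in> carrier R ==> ph (ph' x) = x" "\<And>x. x \<in> carrier R ==> ph' (ph x) = x"
proof -
 interpret G: group AutR by (rule group_AutR)
 note i = G.inv_closed[OF assms]
 have 1: "compose (carrier R) ph (inv\<^bsub>AutR\<^esub> ph) = (\<lambda>x\<in>carrier R. x)"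
  using G.r_inv[OF assms] unfolding AutR_ops(1) AutR_ops(2)[OF assms i] .
 have 2: "compose (carrier R) (inv\<^bsub>AutR\<^esub> ph) ph = (\<lambda>x\<in>carrier R. x)"
  using G.l_inv[OF assms] unfolding AutR_ops(1) AutR_ops(2)[OF i assms] .
 have "ph ((inv\<^bsub>AutR\<^esub> ph) x) = x" "(inv\<^bsub>AutR\<^esub> ph) (ph x) = x" if "x \<in> carrier R" for x
  using fun_cong[OF 1, of x] fun_cong[OF 2, of x] that by (simp_all add: compose_def)
 then show thesis using that[OF i] by blast
qed

lemma mutually_inverse:
 assumes psi: "regular_map V V psi" "regular_map V V psi'"
  and eq: "\<And>a. a \<in> carrier A ==> pullback V psi (pullback V psi' a) = a" and x: "x \<in> V"
 shows "psi' (psi x) = x"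
proof (rule pullback_determines[where psi = "\<lambda>x. psi' (psi x)" and psi' = "\<lambda>x. x", OF _ _ _ x])
 show "pullback V (\<lambda>x. psi' (psi x)) a = pullback V (\<lambda>x. x) a" if "a \<in> carrier A" for a
  using eq[OF that] pullback_id[OF that, of "\<lambda>x. x"] pullback_compose[of psi psi' a] regular_map_V[OF psi(1)] by simp
qed (use regular_map_V[OF psi(1)] regular_map_V[OF psi(2)] in auto)

lemma induced_exists:
 assumes ph: "ph \<in> carrier AutR" shows "\<exists>psi. induces ph psi"
proof -
 obtain ph' where ph': "ph' \<in> carrier AutR" "\<And>x. x \<in> carrier R ==> ph (ph' x) = x" "\<And>x. x \<in> carrier R ==> ph' (ph x) = x"
  using AutR_inverse[OF ph] by blast
 obtain psi where psi: "regular_map V V psi" "\<And>a. a \<in> carrier A ==> emb (pullback V psi a) = ph (emb a)"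
  using AutR_restricts[OF ph] by blast
 obtain psi' where psi': "regular_map V V psi'" "\<And>a. a \<in> carrier A ==> emb (pullback V psi' a) = ph' (emb a)"
  using AutR_restricts[OF ph'(1)] by blast
 have 1: "pullback V psi (pullback V psi' a) = a" if a: "a \<in> carrier A" for a
 proof -
  note pa = pullback_A[OF psi'(1) a]
  have "emb (pullback V psi (pullback V psi' a)) = emb a" unfolding psi(2)[OF pa] psi'(2)[OF a] by (rule ph'(2)[OF emb_A[OF a]])
  then show ?thesis using emb_inj[OF pullback_A[OF psi(1) pa] a] by simp
 qed
 have 2: "pullback V psi' (pullback V psi a) = a" if a: "a \<in> carrier A" for a
 proof -
  note pa = pullback_A[OF psi(1) a]
  have "emb (pullback V psi' (pullback V psi a)) = emb a" unfolding psi'(2)[OF pa] psi(2)[OF a] by (rule ph'(3)[OF emb_A[OF a]])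
  then show ?thesis using emb_inj[OF pullback_A[OF psi'(1) pa] a] by simp
 qed
 have m1: "psi' (psi x) = x" and m2: "psi (psi' x) = x" if "x \<in> V" for x
  by (rule mutually_inverse[OF psi(1) psi'(1) 1 that], assumption, rule mutually_inverse[OF psi'(1) psi(1) 2 that], assumption)
 define \<chi>' where "\<chi>' = restrict psi' V"
 have "bij_betw \<chi>' V V"
  by (rule bij_betwI[where g = psi]) (use regular_map_V[OF psi(1)] regular_map_V[OF psi'(1)] m1 m2 in \<open>auto simp: \<chi>'_def\<close>)
 then have B: "\<chi>' \<in> Bij V" by (simp add: Bij_def \<chi>'_def)
 have i: "inv_into V \<chi>' x = psi x" if x: "x \<in> V" for x
  using Bij_facts(5)[OF B regular_map_V[OF psi(1) x]] regular_map_V[OF psi(1) x] m1[OF x] by (simp add: \<chi>'_def)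
 have "\<chi>' \<in> carrier AutV" unfolding AutV_iff
 proof (intro conjI)
  show "regular_map V V \<chi>'" using psi'(1) regular_map_cong[of V \<chi>' psi' V] unfolding \<chi>'_def by simp
  show "regular_map V V (inv_into V \<chi>')" using psi(1) regular_map_cong[of V "inv_into V \<chi>'" psi V] i by simp
 qed (rule B)
 moreover have "pullback V (inv_into V \<chi>') a = pullback V psi a" for a unfolding pullback_def using i by (simp cong: restrict_cong)
 ultimately have "induces ph \<chi>'" unfolding induces_def using psi(2) by simp
 then show ?thesis by blast
qed

lemma AutV_facts:
 assumes "psi \<in> carrier AutV"
 shows "psi \<in> Bij V" "regular_map V V psi" "regular_map V V (inv_into V psi)" "inv_into V psi \<in> V \<rightarrow> V"
 using assms by (simp_all add: AutV_iff regular_map_def)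

lemma induced_unique:
 assumes "induces ph psi" "induces ph psi'" shows "psi = psi'"
proof -
 have psi: "psi \<in> carrier AutV" "psi' \<in> carrier AutV" using assms by (simp_all add: induces_def)
 note P = AutV_facts[OF psi(1)] and P' = AutV_facts[OF psi(2)]
 note B = Bij_facts[OF P(1)] and B' = Bij_facts[OF P'(1)]
 have "pullback V (inv_into V psi) a = pullback V (inv_into V psi') a" if a: "a \<in> carrier A" for a
  using emb_inj[OF pullback_A[OF P(3) a] pullback_A[OF P'(3) a]] assms a by (simp add: induces_def)
 then have i: "inv_into V psi x = inv_into V psi' x" if "x \<in> V" for x by (rule pullback_determines[OF P(4) P'(4) _ that])
 show ?thesis
 proof (rule extensionalityI[OF B(2) B'(2)])
  fix x assume x: "x \<in> V"
  have "x = inv_into V psi' (psi x)" using i[OF B(1)[OF x]] B(5)[OF x] by simp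
  then show "psi x = psi' x" using B'(4)[OF B(1)[OF x]] by simp
 qed
qed

lemma induces_compose:
 assumes ph: "ph \<in> carrier AutR" "ph' \<in> carrier AutR" and i: "induces ph psi" "induces ph' psi'"
 shows "induces (ph \<otimes>\<^bsub>AutR\<^esub> ph') (psi \<otimes>\<^bsub>AutV\<^esub> psi')"
proof -
 have psi: "psi \<in> carrier AutV" "psi' \<in> carrier AutV" using i by (simp_all add: induces_def)
 note P = AutV_facts[OF psi(1)] and P' = AutV_facts[OF psi(2)]
 have "emb (pullback V (inv_into V (compose V psi psi')) a) = compose (carrier R) ph ph' (emb a)" if a: "a \<in> carrier A" for a
 proof -
  note pa = pullback_A[OF P'(3) a]
  have "pullback V (inv_into V (compose V psi psi')) a = pullback V (inv_into V psi) (pullback V (inv_into V psi') a)"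
   unfolding pullback_def using inv_compose[OF P(1) P'(1)] P(4) by (simp add: Pi_def cong: restrict_cong)
  moreover have "emb (pullback V (inv_into V psi) (pullback V (inv_into V psi') a)) = ph (emb (pullback V (inv_into V psi') a))"
   using i(1) pa by (simp add: induces_def)
  moreover have "emb (pullback V (inv_into V psi') a) = ph' (emb a)" using i(2) a by (simp add: induces_def)
  ultimately show ?thesis using emb_A[OF a] by (simp add: compose_def)
 qed
 then show ?thesis unfolding induces_def AutV_ops(2)[OF psi] AutR_ops(2)[OF ph] using AutV_compose[OF psi] by blast
qed

lemma induces_one_iff:
 "induces ph \<one>\<^bsub>AutV\<^esub> \<longleftrightarrow> (\<forall>a\<in>carrier A. ph (emb a) = emb a)"
proof -
 have "pullback V (inv_into V (\<lambda>x\<in>V. x)) a = a" if "a \<in> carrier A" for a by (rule pullback_id[OF that id_AutV(2)])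
 then show ?thesis unfolding induces_def AutV_ops(1) using id_AutV(1) by auto
qed

lemma ring_automorphism_from_variety:
 assumes psi: "psi \<in> carrier AutV"
 shows "bij_betw (pullback V (inv_into V psi)) (carrier A) (carrier A)"
proof (rule bij_betwI[where g = "pullback V psi"])
 note P = AutV_facts[OF psi] and B = Bij_facts[OF AutV_facts(1)[OF psi]]
 show "pullback V (inv_into V psi) \<in> carrier A \<rightarrow> carrier A" "pullback V psi \<in> carrier A \<rightarrow> carrier A"
  by (rule Pi_I, rule pullback_A[OF P(3)], assumption, rule Pi_I, rule pullback_A[OF P(2)], assumption)
 show "pullback V psi (pullback V (inv_into V psi) a) = a" if "a \<in> carrier A" for a
  using pullback_compose[of psi "inv_into V psi" a] B(1) pullback_id[OF that, of "\<lambda>x. inv_into V psi (psi x)"] B(5) by simp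
 show "pullback V (inv_into V psi) (pullback V psi a) = a" if "a \<in> carrier A" for a
  using pullback_compose[of "inv_into V psi" psi a] B(3) pullback_id[OF that, of "\<lambda>x. psi (inv_into V psi x)"] B(4) by simp
qed

text \<open>The required values on principal divisors are well defined, since functions with the same divisor differ by a
constant, which \<open>sigma\<close> fixes. They extend to all divisors.\<close>

lemma correction_character:
 assumes sigma: "sigma \<in> ring_hom L L" "bij_betw sigma (carrier L) (carrier L)" "sigma ` S = S" and kappa: "\<And>c. sigma (kappa c) = kappa c"
 shows "\<exists>mu. character_on (WDiv V) mu \<and> (\<forall>g\<in>Lx. mu (dv g) * p 0 g = p 0 (sigma g))"
proof -
 note s = N.automorphism_simps[OF sigma]
 have sigmax: "sigma g \<in> Lx" if "g \<in> Lx" for g using s(1,7) that by simp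
 note p0 = p_facts(1)[OF K_closed(1)] and pm = p_split[OF K_closed(1)]
 define m where "m g = p 0 (sigma g) / p 0 g" for g
 have m0: "m g \<noteq> 0" if "g \<in> Lx" for g unfolding m_def using p0[OF that] p0[OF sigmax[OF that]] by simp
 have mm: "m (g \<cdot> g') = m g * m g'" if g: "g \<in> Lx" "g' \<in> Lx" for g g'
 proof -
  have "sigma (g \<cdot> g') = sigma g \<cdot> sigma g'" using s(2) g by simp
  then show ?thesis unfolding m_def using pm[OF g] pm[OF sigmax[OF g(1)] sigmax[OF g(2)]] by simp
 qed
 have mkappa: "m (kappa c) = 1" if "c \<noteq> 0" for c unfolding m_def kappa p_kappa[OF that] using that by simp
 have eq: "m g = m g'" if g: "g \<in> Lx" "g' \<in> Lx" and d: "dv g = dv g'" for g g'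
 proof -
  note q = Lx_closed(1)[OF g(1) Lx_closed(2)[OF g(2)]]
  have "dv (g \<cdot> inv\<^bsub>L\<^esub> g') = 0" unfolding div_Lx(2)[OF g(1) Lx_closed(2)[OF g(2)]] div_Lx(3)[OF g(2)] d by simp
  then obtain c where c: "c \<noteq> 0" "g \<cdot> inv\<^bsub>L\<^esub> g' = kappa c" using div_zero_constant[OF q] by blast
  have "g = kappa c \<cdot> g'" unfolding c(2)[symmetric] using g L.nonzero_inv[of g'] by (simp add: L.m_assoc)
  then show ?thesis using mm[of "kappa c" g'] kappa_Lx[of c] c(1) g(2) mkappa[OF c(1)] by simp
 qed
 define xi where "xi Delta = m (SOME g. g \<in> Lx \<and> dv g = Delta)" for Delta
 have xi: "xi (dv g) = m g" if g: "g \<in> Lx" for g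
 proof -
  have "\<exists>g'. g' \<in> Lx \<and> dv g' = dv g" using g by blast
  from someI_ex[OF this] show ?thesis unfolding xi_def using eq g by blast
 qed
 have pr: "\<exists>g. g \<in> Lx \<and> Delta = dv g" if "Delta \<in> Prin" for Delta using that unfolding principal_iff by blast
 have "\<exists>mu. character_on (WDiv V) mu \<and> (\<forall>x\<in>Prin. mu x = xi x)"
 proof (rule W.character_extends[OF principal_subgroup_W])
  fix Delta assume "Delta \<in> Prin"
  then obtain g where g: "g \<in> Lx" "Delta = dv g" using pr by blast
  show "xi Delta \<noteq> 0" unfolding g(2) xi[OF g(1)] by (rule m0[OF g(1)])
  fix Delta' assume "Delta' \<in> Prin"
  then obtain g' where g': "g' \<in> Lx" "Delta' = dv g'" using pr by blast
  show "xi (Delta \<otimes>\<^bsub>WDiv V\<^esub> Delta') = xi Delta * xi Delta'"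
   unfolding g(2) g'(2) W_simps(2) div_Lx(2)[OF g(1) g'(1), symmetric] xi[OF g(1)] xi[OF g'(1)] xi[OF Lx_closed(1)[OF g(1) g'(1)]]
   by (rule mm[OF g(1) g'(1)])
 qed
 then obtain mu where mu: "character_on (WDiv V) mu" "\<forall>x\<in>Prin. mu x = xi x" by blast
 have "mu (dv g) * p 0 g = p 0 (sigma g)" if g: "g \<in> Lx" for g
 proof -
  have "dv g \<in> Prin" unfolding principal_iff using g by blast
  then have "mu (dv g) = m g" using mu(2) xi[OF g] by simp
  then show ?thesis unfolding m_def using p0[OF g] by simp
 qed
 then show ?thesis using mu(1) by blast
qed

lemma variety_automorphism_lifts:
 assumes psi: "psi \<in> carrier AutV" shows "\<exists>ph\<in>carrier AutR. induces ph psi"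
proof -
 define h where "h = pullback V (inv_into V psi)"
 note P = AutV_facts[OF psi]
 have h: "h \<in> ring_hom A A" "bij_betw h (carrier A) (carrier A)" "\<And>c. h (const_fun V c) = const_fun V c"
  unfolding h_def by (rule pullback_hom[OF P(3)], rule ring_automorphism_from_variety[OF psi], rule pullback_hom[OF P(3)])
 obtain sigma where sigma: "sigma \<in> ring_hom L L" "bij_betw sigma (carrier L) (carrier L)" "\<And>a. a \<in> carrier A ==> sigma (to_frac A a) = to_frac A (h a)"
  using A.automorphism_of_fraction_field[OF h(1,2)] unfolding function_field_def by blast
 have hA: "h ` carrier A = carrier A" using h(2) by (simp add: bij_betw_def)
 have "sigma ` S = to_frac A ` h ` carrier A" unfolding image_image using sigma(3) by (intro image_cong) simp_all
 then have sigmaS: "sigma ` S = S" unfolding hA .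
 define tau where "tau = inv_into (carrier L) sigma"
 have "sigma \<in> ring_iso L L" using sigma by (simp add: ring_iso_def)
 then have "tau \<in> ring_iso L L" unfolding tau_def by (rule ring_iso_set_sym[OF L.ring_axioms])
 then have tau: "tau \<in> ring_hom L L" "bij_betw tau (carrier L) (carrier L)" by (simp_all add: ring_iso_def)
 have st: "sigma (tau x) = x" "tau (sigma x) = x" if "x \<in> carrier L" for x
  using that bij_betw_inv_into_right[OF sigma(2) that] bij_betw_inv_into_left[OF sigma(2) that] by (simp_all add: tau_def)
 have "tau ` S = tau ` sigma ` S" unfolding sigmaS ..
 also have "... = id ` S" unfolding image_image[of tau sigma] by (rule image_cong) (use st(2) N.S_carrier in auto)
 finally have tauS: "tau ` S = S" by simp
 have kappa: "sigma (kappa c) = kappa c" for c using sigma(3)[OF const_fun_A] h(3) by simp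
 from correction_character[OF sigma(1,2) sigmaS kappa]
 obtain mu where mu: "character_on (WDiv V) mu" "\<forall>g\<in>Lx. mu (dv g) * p 0 g = p 0 (sigma g)"
  by (elim exE conjE) (rule that)
 have l: "liftable sigma tau mu"
  unfolding liftable_def by (intro conjI ballI sigma(1,2) sigmaS tau tauS st mu(1) mu(2)[rule_format])
 obtain ph where ph: "ph \<in> carrier AutR" "lifts ph tau mu" using lift_automorphism[OF l kappa] by blast
 have "emb (h a) = ph (emb a)" if a: "a \<in> carrier A" for a
 proof (cases "to_frac A a = \<zero>\<^sub>L")
  case True
  then have "to_frac A (h a) = \<zero>\<^sub>L" using sigma(3)[OF a] N.automorphism_simps(5)[OF sigma(1,2) sigmaS] by simp
  then show ?thesis unfolding cox_embed_e True
   using e_zero ring_hom_zero[OF AutR_facts(2)[OF ph(1)] R.ring_axioms R.ring_axioms] by simp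
 next
  case False
  then have f: "to_frac A a \<in> Lx" using to_frac_simps(1)[OF a] by simp
  have "ph (e 0 (to_frac A a)) = e 0 (sigma (to_frac A a))"
  proof (rule liftsD[OF ph(2) K_closed(1) f _ K_closed(1) sigma_Lx[OF l f]])
   show "to_frac A a \<in> sec 0" unfolding sections_0 using a by simp
   show "dv (sigma (to_frac A a)) + 0 = push tau (dv (to_frac A a) + 0)"
    using M_div[OF l, of "to_frac A a"] f by simp
   show "p 0 (sigma (to_frac A a)) = p 0 (to_frac A a) * mu (dv (to_frac A a) + 0)" using mu(2) f by (simp add: mult.commute)
  qed
  then show ?thesis unfolding cox_embed_e sigma(3)[OF a] ..
 qed
 then have "induces ph psi" unfolding induces_def h_def[symmetric] using psi by blast
 then show ?thesis using ph(1) by blast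
qed

end

section \<open>The action of the quasitorus and exactness\<close>

locale cox_quasitorus = cox_units V K F
 for V :: "('k::{alg_closed_field,field_char_0} ^ 'n::finite) set" and K F +
 fixes N :: "('k ^ 'm::finite) monoid" and theta :: "('k, 'n) divisor set \<Rightarrow> ('k ^ 'm \<Rightarrow> 'k)"
 assumes N: "quasitorus N" and theta: "theta \<in> iso (Cl V) (character_group N)"
begin

sublocale NG: group N by (rule quasitorus_group[OF N])

definition chi where "chi D t = theta (cl D) t"

lemma theta_facts: "u \<in> Classes ==> theta u \<in> carrier (character_group N)"
 "u \<in> Classes ==> v \<in> Classes ==> theta (u \<otimes>\<^bsub>Cl V\<^esub> v) = (\<lambda>x\<in>carrier N. theta u x * theta v x)"
 "inj_on theta (Classes)" "theta ` Classes = carrier (character_group N)"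
proof -
 have h: "theta \<in> hom (Cl V) (character_group N)" and b: "bij_betw theta (Classes) (carrier (character_group N))"
  using theta by (simp_all add: iso_def)
 show "u \<in> Classes ==> theta u \<in> carrier (character_group N)" by (rule hom_in_carrier[OF h])
 show "u \<in> Classes ==> v \<in> Classes ==> theta (u \<otimes>\<^bsub>Cl V\<^esub> v) = (\<lambda>x\<in>carrier N. theta u x * theta v x)"
  using hom_mult[OF h] by (simp add: character_group_def)
 show "inj_on theta (Classes)" "theta ` Classes = carrier (character_group N)" using b by (simp_all add: bij_betw_def)
qed

lemma class_W: "D \<in> Div ==> cl D \<in> Classes"
 unfolding Cl_simps(1) by (rule imageI)

lemma chi_facts:
 "D \<in> Div ==> E \<in> Div ==> t \<in> carrier N ==> chi (D + E) t = chi D t * chi E t"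
 "D \<in> Div ==> t \<in> carrier N ==> chi D t \<noteq> 0"
 "D \<in> Div ==> t \<in> carrier N ==> s \<in> carrier N ==> chi D (t \<otimes>\<^bsub>N\<^esub> s) = chi D t * chi D s"
 "D \<in> Prin ==> t \<in> carrier N ==> chi D t = 1"
proof -
 show add: "chi (D + E) t = chi D t * chi E t" if "D \<in> Div" "E \<in> Div" "t \<in> carrier N" for D E t
  unfolding chi_def Cl_simps(2)[OF that(1,2), symmetric] theta_facts(2)[OF class_W[OF that(1)] class_W[OF that(2)]] using that(3) by simp
 have c: "character_on N (theta (cl D))" if "D \<in> Div" for D
  using theta_facts(1)[OF class_W[OF that]] character_group_iff by blast
 show nz: "chi D t \<noteq> 0" if "D \<in> Div" "t \<in> carrier N" for D t
  unfolding chi_def by (rule character_onD(1)[OF c[OF that(1)] that(2)])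
 show "chi D (t \<otimes>\<^bsub>N\<^esub> s) = chi D t * chi D s" if "D \<in> Div" "t \<in> carrier N" "s \<in> carrier N"
  unfolding chi_def by (rule character_onD(2)[OF c[OF that(1)] that(2,3)])
 show "chi D t = 1" if D: "D \<in> Prin" and t: "t \<in> carrier N"
 proof -
  have W: "D \<in> Div" using D subgroup.mem_carrier[OF principal_subgroup_W] by blast
  have "cl D = cl 0" using div_class_eq_iff[OF W W_closed(1)] D by simp
  then have "chi D t = chi 0 t" by (simp add: chi_def)
  moreover have "chi 0 t = 1" using add[OF W_closed(1) W_closed(1) t] nz[OF W_closed(1) t] by simp
  ultimately show ?thesis by simp
 qed
qed

lemma scalar_e:
 assumes "D \<in> K" "f \<in> sec D"
 shows "scalar c \<otimes>\<^sub>R e D f = e D (kappa c \<cdot> f)"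
proof -
 have "kappa c \<in> sec 0" unfolding sections_0 by (rule kappa_simps(1))
 from e_mult[OF K_closed(1) this assms] show ?thesis unfolding cox_embed_e by simp
qed

definition acts where
 "acts t ph \<longleftrightarrow> (\<forall>u\<in>Classes. \<forall>f\<in>piece u. ph f = scalar (theta u t) \<otimes>\<^sub>R f)"

lemma acts_iff: "acts t ph \<longleftrightarrow> (\<forall>D\<in>K. \<forall>f\<in>sec D. ph (e D f) = e D (kappa (chi D t) \<cdot> f))"
proof
 assume a: "acts t ph"
 show "\<forall>D\<in>K. \<forall>f\<in>sec D. ph (e D f) = e D (kappa (chi D t) \<cdot> f)"
 proof (intro ballI)
  fix D f assume D: "D \<in> K" "f \<in> sec D"
  have "e D f \<in> piece (cl D)" unfolding cox_component_eq[OF D(1)] using D(2) by (rule imageI)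
  then show "ph (e D f) = e D (kappa (chi D t) \<cdot> f)"
   using a class_K[OF D(1)] unfolding acts_def chi_def scalar_e[OF D, symmetric] by blast
 qed
next
 assume a: "\<forall>D\<in>K. \<forall>f\<in>sec D. ph (e D f) = e D (kappa (chi D t) \<cdot> f)"
 show "acts t ph" unfolding acts_def
 proof (intro ballI)
  fix u x assume u: "u \<in> Classes" and x: "x \<in> piece u"
  obtain D where D: "D \<in> K" "u = cl D" "piece u = e D ` sec D" using class_cases[OF u] .
  then obtain f where f: "f \<in> sec D" "x = e D f" using x by blast
  show "ph x = scalar (theta u t) \<otimes>\<^sub>R x" unfolding f(2) D(2) chi_def[symmetric] scalar_e[OF D(1) f(1)] using a D(1) f(1) by blast
 qed
qed

lemma acts_unique:
 assumes "ph \<in> carrier AutR" "ph' \<in> carrier AutR" "acts t ph" "acts t ph'" shows "ph = ph'"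
proof (rule extensionalityI[OF Bij_facts(2)[OF AutR_facts(1)[OF assms(1)]] Bij_facts(2)[OF AutR_facts(1)[OF assms(2)]]])
 show "ph x = ph' x" if "x \<in> carrier R" for x
  by (rule ring_hom_eqI[OF AutR_facts(2)[OF assms(1)] AutR_facts(2)[OF assms(2)] _ that])
   (use assms(3,4) in \<open>simp add: acts_iff\<close>)
qed

lemma push_id:
 assumes "D \<in> Div" shows "push id D = D"
proof (rule poly_mapping_eqI)
 fix Q
 have "id \<in> ring_hom L L" "bij_betw id (carrier L) (carrier L)" "id ` S = S" by (simp_all add: id_ring_hom)
 from lookup_push[OF this this, of D Q] show "lookup (push id D) Q = lookup D Q"
  using prime_divisor_height_one(2)[of Q] W_lookup[OF assms, of Q] by simp
qed

text \<open>The action of a point of \<open>N\<close> is a lift of the identity, with the corresponding character of the class group as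
correction.\<close>

lemma liftable_id:
 assumes t: "t \<in> carrier N" shows "liftable id id (\<lambda>D. chi D t)"
proof -
 have "character_on (WDiv V) (\<lambda>D. chi D t)"
  unfolding character_on_def W_simps(2) using chi_facts(1,2) t by blast
 moreover have "chi (dv g) t * p 0 g = p 0 (id g)" if "g \<in> Lx" for g
 proof -
  have "dv g \<in> Prin" unfolding principal_iff using that by blast
  then show ?thesis using chi_facts(4) t by simp
 qed
 ultimately show ?thesis unfolding liftable_def by (simp add: id_ring_hom)
qed

lemma action_exists:
 assumes t: "t \<in> carrier N" shows "\<exists>ph. ph \<in> carrier AutR \<and> acts t ph"
proof -
 obtain ph where ph: "ph \<in> carrier AutR" "lifts ph id (\<lambda>D. chi D t)"
  using lift_automorphism[OF liftable_id[OF t]] by auto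
 have "ph (e D f) = e D (kappa (chi D t) \<cdot> f)" if D: "D \<in> K" "f \<in> sec D" for D f
 proof (cases "f = \<zero>\<^sub>L")
  case True
  then show ?thesis using e_zero ring_hom_zero[OF AutR_facts(2)[OF ph(1)] R.ring_axioms R.ring_axioms] kappa_L by simp
 next
  case False
  then have f: "f \<in> Lx" using sections_L[OF D(2)] by simp
  note c = chi_facts(2)[OF K_W[OF D(1)] t]
  then have k: "kappa (chi D t) \<in> Lx" using kappa_Lx by blast
  have d: "dv (kappa (chi D t) \<cdot> f) = dv f" unfolding div_Lx(2)[OF k f] div_kappa[OF c] by simp
  have pr: "dv f \<in> Prin" unfolding principal_iff using f by blast
  show ?thesis
  proof (rule liftsD[OF ph(2) D(1) f D(2) D(1) Lx_closed(1)[OF k f]])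
   show "dv (kappa (chi D t) \<cdot> f) + D = push id (dv f + D)"
    unfolding d push_id[OF D_sum_W[OF D(1) f]] ..
   show "p D (kappa (chi D t) \<cdot> f) = p D f * chi (dv f + D) t"
    unfolding p_split[OF D(1) k f] p_kappa[OF c] chi_facts(1)[OF div_Lx(1)[OF f] K_W[OF D(1)] t] chi_facts(4)[OF pr t] by simp
  qed
 qed
 then show ?thesis unfolding acts_iff using ph(1) by blast
qed

lemma acts_compose:
 assumes ts: "t \<in> carrier N" "s \<in> carrier N" and ph: "ph \<in> carrier AutR" "ph' \<in> carrier AutR" and a: "acts t ph" "acts s ph'"
 shows "acts (t \<otimes>\<^bsub>N\<^esub> s) (ph \<otimes>\<^bsub>AutR\<^esub> ph')"
 unfolding acts_iff AutR_ops(2)[OF ph]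
proof (intro ballI)
 fix D f assume D: "D \<in> K" "f \<in> sec D"
 have s: "kappa (chi D s) \<cdot> f \<in> sec D" by (rule sections_scale[OF kappa_simps(1) D(2)])
 have "compose (carrier R) ph ph' (e D f) = e D (kappa (chi D t) \<cdot> (kappa (chi D s) \<cdot> f))"
  using a D s e_closed[OF D] unfolding acts_iff by (simp add: compose_def)
 also have "... = e D (kappa (chi D (t \<otimes>\<^bsub>N\<^esub> s)) \<cdot> f)"
  unfolding chi_facts(3)[OF K_W[OF D(1)] ts] kappa_simps(2) using kappa_L sections_L[OF D(2)] by (simp add: L.m_assoc)
 finally show "compose (carrier R) ph ph' (e D f) = e D (kappa (chi D (t \<otimes>\<^bsub>N\<^esub> s)) \<cdot> f)" .
qed

lemma kappa_cancel:
 assumes "f \<in> Lx" "kappa c \<cdot> f = kappa d \<cdot> f" shows "c = d"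
proof -
 have "kappa c = kappa d" using L.m_rcancel[of f "kappa c" "kappa d"] assms kappa_L by simp
 then show ?thesis using kappa_simps(5) by blast
qed

lemma section_in:
 assumes "D \<in> Div" obtains f where "f \<in> Lx" "f \<in> sec D"
proof -
 obtain f where "f \<in> carrier L" "f \<noteq> \<zero>\<^sub>L" "f \<in> sec D" using nonzero_section[OF assms] by blast
 then show thesis using that[of f] by simp
qed

text \<open>Every component contains an element other than zero, so the action determines all characters at the point.\<close>

lemma action_faithful:
 assumes ts: "t \<in> carrier N" "s \<in> carrier N" and a: "acts t ph" "acts s ph" shows "t = s"
proof -
 have chi: "chi D t = chi D s" if D: "D \<in> K" for D
 proof -
  obtain f where f: "f \<in> Lx" "f \<in> sec D" using section_in[OF K_W[OF D]] .
  note sc = sections_scale[OF kappa_simps(1) f(2)]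
  have "e D (kappa (chi D t) \<cdot> f) = e D (kappa (chi D s) \<cdot> f)" using a D f(2) unfolding acts_iff by simp
  then have "kappa (chi D t) \<cdot> f = kappa (chi D s) \<cdot> f" using e_inj[OF D sc sc] by simp
  then show ?thesis by (rule kappa_cancel[OF f(1)])
 qed
 have "t \<otimes>\<^bsub>N\<^esub> inv\<^bsub>N\<^esub> s = \<one>\<^bsub>N\<^esub>"
 proof (rule characters_separate_points[OF N])
  show "t \<otimes>\<^bsub>N\<^esub> inv\<^bsub>N\<^esub> s \<in> carrier N" using ts by simp
  fix eta assume eta: "eta \<in> carrier (character_group N)"
  then have "eta \<in> theta ` cl ` K" unfolding theta_facts(4)[symmetric] surj .
  then obtain D where D: "D \<in> K" "eta = theta (cl D)" by blast
  have c: "character_on N eta" using eta character_group_iff by blast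
  have "eta t = eta s" using chi[OF D(1)] unfolding chi_def D(2) .
  then show "eta (t \<otimes>\<^bsub>N\<^esub> inv\<^bsub>N\<^esub> s) = 1"
   using character_onD(2)[OF c ts(1) NG.inv_closed[OF ts(2)]] NG.character_on_one_inv(2)[OF c ts(2)] character_onD(1)[OF c ts(2)] by simp
 qed
 then have "t \<otimes>\<^bsub>N\<^esub> inv\<^bsub>N\<^esub> s \<otimes>\<^bsub>N\<^esub> s = s" using ts by simp
 then show ?thesis using ts by (simp add: NG.m_assoc)
qed

text \<open>The product of a section of \<open>D\<close> with a fixed section of \<open>- D\<close> has degree zero and does not move. Dividing by
the image of the latter gives one rational function that multiplies all sections of \<open>D\<close>.\<close>

lemma automorphism_over_V_multiplies:
 assumes ph: "ph \<in> carrier AutR" and fixed: "\<forall>a\<in>carrier A. ph (emb a) = emb a" and D: "D \<in> K"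
 obtains D' h where "D' \<in> K" "h \<in> Lx" "ph ` e D ` sec D = e D' ` sec D'"
  "\<forall>f\<in>sec D. h \<cdot> f \<in> sec D' \<and> ph (e D f) = e D' (h \<cdot> f)"
proof -
 interpret Cl: comm_group "Cl V" by (rule Cl_comm_group)
 note P = AutR_facts[OF ph] and hom = AutR_facts(2)[OF ph]
 note B = Bij_facts[OF P(1)]
 obtain ph0 where ph0: "ph0 \<in> auto (Cl V)" "\<And>u. u \<in> Classes ==> ph ` piece u = piece (ph0 u)" using P(4) by blast
 have ph0B: "ph0 \<in> Bij (Classes)" using ph0(1) by (simp add: auto_def)
 have target: "\<exists>E'\<in>K. ph ` e E ` sec E = e E' ` sec E'" if E: "E \<in> K" for E
 proof -
  obtain E' where E': "E' \<in> K" "ph0 (cl E) = cl E'" "piece (ph0 (cl E)) = e E' ` sec E'"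
   using class_cases[OF Bij_facts(1)[OF ph0B class_K[OF E]]] .
  have "ph ` e E ` sec E = e E' ` sec E'"
   using ph0(2)[OF class_K[OF E]] unfolding E'(3) cox_component_eq[OF E] .
  then show ?thesis using E'(1) by (rule bexI)
 qed
 have nonzero: "m \<noteq> \<zero>\<^sub>L" if E: "E \<in> K" "f \<in> sec E" "f \<noteq> \<zero>\<^sub>L" and eq: "ph (e E f) = e E' m" for E f E' m
 proof
  assume "m = \<zero>\<^sub>L"
  then have "ph (e E f) = ph (e E \<zero>\<^sub>L)" using eq e_zero ring_hom_zero[OF hom R.ring_axioms R.ring_axioms] by simp
  then have "e E f = e E \<zero>\<^sub>L" using B(6)[OF e_closed[OF E(1,2)] e_closed[OF E(1) sections_zero]] by simp
  then show False using e_inj[OF E(1,2) sections_zero] E(3) by simp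
 qed
 obtain D' where D': "D' \<in> K" "ph ` e D ` sec D = e D' ` sec D'" using target[OF D] by blast
 have mD: "- D \<in> K" by (rule K_closed(4)[OF D])
 obtain D'' where D'': "D'' \<in> K" "ph ` e (- D) ` sec (- D) = e D'' ` sec D''" using target[OF mD] by blast
 obtain f1 where f1: "f1 \<in> Lx" "f1 \<in> sec (- D)" using section_in[OF K_W[OF mD]] .
 obtain f0 where f0: "f0 \<in> Lx" "f0 \<in> sec D" using section_in[OF K_W[OF D]] .
 have "ph (e (- D) f1) \<in> e D'' ` sec D''" unfolding D''(2)[symmetric] by (intro imageI f1(2))
 then obtain n where n: "n \<in> sec D''" "ph (e (- D) f1) = e D'' n" by blast
 have "n \<noteq> \<zero>\<^sub>L" by (rule nonzero[OF mD f1(2) _ n(2)]) (use f1(1) in simp)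
 then have nL: "n \<in> Lx" using sections_L[OF n(1)] by simp
 define tr where "tr = transition (D' + D'') 0"
 have tr: "tr \<in> carrier L" unfolding tr_def by (rule transition_L)
 \<comment> \<open>The product with a fixed section of \<open>- D\<close> has degree zero, hence is fixed.\<close>
 have mn: "m \<cdot> n = f1 \<cdot> f \<cdot> tr" if f: "f \<in> sec D" and m: "m \<in> sec D'" "ph (e D f) = e D' m" for f m
 proof -
  have s0: "f1 \<cdot> f \<in> sec 0" using sections_mult[OF f1(2) f] by simp
  then obtain a where a: "a \<in> carrier A" "f1 \<cdot> f = to_frac A a" unfolding sections_0 by blast
  have prod: "e (- D) f1 \<otimes>\<^sub>R e D f = emb a" unfolding e_mult[OF mD f1(2) D f] cox_embed_e a(2) by simp
  have "ph (emb a) = ph (e (- D) f1) \<otimes>\<^sub>R ph (e D f)"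
   unfolding prod[symmetric] by (rule ring_hom_mult[OF hom e_closed[OF mD f1(2)] e_closed[OF D f]])
  also have "... = e (D' + D'') (m \<cdot> n)" unfolding n(2) m(2) e_mult[OF D''(1) n(1) D'(1) m(1)]
   using L.m_comm[OF sections_L[OF n(1)] sections_L[OF m(1)]] by (simp add: add.commute)
  finally have "e (D' + D'') (m \<cdot> n) = e 0 (f1 \<cdot> f)"
   using bspec[OF fixed a(1)] unfolding cox_embed_e a(2) by simp
  from e_eqD[OF K_closed(2)[OF D'(1) D''(1)] sections_mult[OF m(1) n(1)] K_closed(1) s0 this] show ?thesis unfolding tr_def .
 qed
 have ex: "\<exists>m\<in>sec D'. ph (e D f) = e D' m" if "f \<in> sec D" for f
 proof -
  have "ph (e D f) \<in> e D' ` sec D'" unfolding D'(2)[symmetric] by (intro imageI that)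
  then show ?thesis by blast
 qed
 define h where "h = f1 \<cdot> tr \<cdot> inv\<^bsub>L\<^esub> n"
 have inL: "inv\<^bsub>L\<^esub> n \<in> carrier L" "n \<in> carrier L" "f1 \<in> carrier L" using Lx_closed(2)[OF nL] nL f1(1) by simp_all
 have mh: "m = h \<cdot> f" if f: "f \<in> sec D" and m: "m \<in> sec D'" "ph (e D f) = e D' m" for f m
 proof -
  note fL = sections_L[OF f] and mL = sections_L[OF m(1)]
  have "m = (m \<cdot> n) \<cdot> inv\<^bsub>L\<^esub> n" using mL inL L.nonzero_inv(3)[of n] nL by (simp add: L.m_assoc)
  also have "... = h \<cdot> f" unfolding mn[OF f m] h_def using fL tr inL(1,3) by (simp add: L.m_ac)
  finally show ?thesis .
 qed
 have "h \<noteq> \<zero>\<^sub>L"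
 proof
  assume h0: "h = \<zero>\<^sub>L"
  obtain m where m: "m \<in> sec D'" "ph (e D f0) = e D' m" using ex[OF f0(2)] by blast
  have "m = \<zero>\<^sub>L" using mh[OF f0(2) m] h0 f0(1) by simp
  moreover have "m \<noteq> \<zero>\<^sub>L" by (rule nonzero[OF D f0(2) _ m(2)]) (use f0(1) in simp)
  ultimately show False by simp
 qed
 then have hx: "h \<in> Lx" unfolding h_def using tr inL by simp
 have "\<forall>f\<in>sec D. h \<cdot> f \<in> sec D' \<and> ph (e D f) = e D' (h \<cdot> f)"
 proof
  fix f assume f: "f \<in> sec D"
  obtain m where m: "m \<in> sec D'" "ph (e D f) = e D' m" using ex[OF f] by blast
  show "h \<cdot> f \<in> sec D' \<and> ph (e D f) = e D' (h \<cdot> f)" using m unfolding mh[OF f m] by (rule conjI)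
 qed
 then show thesis by (rule that[OF D'(1) hx D'(2)])
qed

text \<open>Sections attain the orders allowed by their divisor, so multiplication by \<open>h\<close> maps the sections of
 \<open>D\<close> onto those of \<open>D'\<close> only if the divisors differ by that of \<open>h\<close>.\<close>

lemma multiplier_divisor:
 assumes D: "D \<in> Div" "D' \<in> Div" and h: "h \<in> Lx"
  and into: "\<And>f. f \<in> sec D ==> h \<cdot> f \<in> sec D'"
  and onto: "\<And>m. m \<in> sec D' ==> \<exists>f\<in>sec D. m = h \<cdot> f"
 shows "dv h = D - D'"
proof (rule poly_mapping_eqI)
 fix P
 note [simp] = lookup_add lookup_minus
 show "lookup (dv h) P = lookup (D - D') P"
 proof (cases "P \<in> Primes")
  case False
  then show ?thesis using W_lookup[OF D(1) False] W_lookup[OF D(2) False] W_lookup[OF div_Lx(1)[OF h] False] by simp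
 next
  case True
  obtain f where f: "f \<in> carrier L" "f \<noteq> \<zero>\<^sub>L" "f \<in> sec D"
   "lookup (dv f) P = - lookup D P" using section_with_order[OF D(1) True] by blast
  then have fx: "f \<in> Lx" by simp
  have "effective (dv (h \<cdot> f) + D')" using into[OF f(3)] div_Lx(4)[OF Lx_closed(1)[OF h fx]] by blast
  then have "lookup (dv (h \<cdot> f) + D') P \<ge> 0" unfolding effective_def by blast
  then have 1: "lookup (dv h) P \<ge> lookup D P - lookup D' P"
   unfolding div_Lx(2)[OF h fx] using f(4) by simp
  obtain m where m: "m \<in> carrier L" "m \<noteq> \<zero>\<^sub>L" "m \<in> sec D'"
   "lookup (dv m) P = - lookup D' P" using section_with_order[OF D(2) True] by blast
  obtain g where g: "g \<in> sec D" "m = h \<cdot> g" using onto[OF m(3)] by blast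
  have gx: "g \<in> Lx" using sections_L[OF g(1)] m(2) g(2) h by auto
  have "effective (dv g + D)" using g(1) div_Lx(4)[OF gx] by blast
  then have "lookup (dv g + D) P \<ge> 0" unfolding effective_def by blast
  then have 2: "lookup (dv h) P \<le> lookup D P - lookup D' P"
   using m(4) unfolding g(2) div_Lx(2)[OF h gx] by simp
  show ?thesis using 1 2 by simp
 qed
qed

text \<open>The relations of the Cox ring move the image back to degree \<open>D\<close>, where the multiplier has trivial divisor.\<close>

lemma automorphism_over_V_scales:
 assumes ph: "ph \<in> carrier AutR" and fixed: "\<forall>a\<in>carrier A. ph (emb a) = emb a" and D: "D \<in> K"
 shows "\<exists>c. c \<noteq> 0 \<and> (\<forall>f\<in>sec D. ph (e D f) = e D (kappa c \<cdot> f))"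
proof -
 obtain D' h where D': "D' \<in> K" and h: "h \<in> Lx" and im: "ph ` e D ` sec D = e D' ` sec D'"
  and all: "\<forall>f\<in>sec D. h \<cdot> f \<in> sec D' \<and> ph (e D f) = e D' (h \<cdot> f)"
  using automorphism_over_V_multiplies[OF ph fixed D] .
 note mult = bspec[OF all]
 have onto: "\<exists>f\<in>sec D. m = h \<cdot> f" if m: "m \<in> sec D'" for m
 proof -
  have "e D' m \<in> ph ` e D ` sec D" unfolding im using m by (rule imageI)
  then obtain f where f: "f \<in> sec D" "e D' m = ph (e D f)" by blast
  then have "e D' m = e D' (h \<cdot> f)" "h \<cdot> f \<in> sec D'" using mult[OF f(1)] by simp_all
  then have "m = h \<cdot> f" using e_inj[OF D' m] by simp
  then show ?thesis using f(1) by blast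
 qed
 have div: "dv h = D - D'"
  by (rule multiplier_divisor[OF K_W[OF D] K_W[OF D'] h _ onto]) (use mult in blast)
 have "D - D' \<in> Prin" unfolding div[symmetric] principal_iff using h by blast
 then have DD: "D - D' \<in> K0" unfolding K0_iff using K_closed(3)[OF D D'] by blast
 note FL = F_Lx[OF DD]
 have "dv (h \<cdot> inv\<^bsub>L\<^esub> (F (D - D'))) = 0"
  unfolding div_Lx(2)[OF h Lx_closed(2)[OF FL]] div_Lx(3)[OF FL] div F_facts(3)[OF DD] by simp
 then obtain c where c: "c \<noteq> 0" "h \<cdot> inv\<^bsub>L\<^esub> (F (D - D')) = kappa c"
  using div_zero_constant[OF Lx_closed(1)[OF h Lx_closed(2)[OF FL]]] by blast
 have Fc: "F (D - D') \<in> carrier L" "inv\<^bsub>L\<^esub> (F (D - D')) \<in> carrier L" "h \<in> carrier L" using FL Lx_closed(2)[OF FL] h by simp_all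
 have hc: "h = F (D - D') \<cdot> kappa c" unfolding c(2)[symmetric] using Fc L.nonzero_inv(3)[of "F (D - D')"] FL
  by (simp add: L.m_lcomm)
 have "ph (e D f) = e D (kappa c \<cdot> f)" if f: "f \<in> sec D" for f
 proof -
  have "ph (e D f) = e D' (F (D - D') \<cdot> (kappa c \<cdot> f))"
   using mult[OF f] Fc(1) kappa_L[of c] sections_L[OF f] unfolding hc by (simp add: L.m_assoc)
  also have "... = e D (kappa c \<cdot> f)" by (rule e_move[OF D D' DD sections_scale[OF kappa_simps(1) f], symmetric])
  finally show ?thesis .
 qed
 then show ?thesis using c(1) by blast
qed

text \<open>The scalars on the components form a character of the class group, that is, of the character group of \<open>N\<close>,
and this is evaluation at a point.\<close>

lemma automorphism_over_V_acts:
 assumes ph: "ph \<in> carrier AutR" and fixed: "\<forall>a\<in>carrier A. ph (emb a) = emb a"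
 shows "\<exists>t\<in>carrier N. acts t ph"
proof -
 have "\<forall>D. \<exists>c. D \<in> K \<longrightarrow> c \<noteq> 0 \<and> (\<forall>f\<in>sec D. ph (e D f) = e D (kappa c \<cdot> f))"
  using automorphism_over_V_scales[OF ph fixed] by blast
 from choice[OF this] obtain c where c: "\<And>D. D \<in> K ==> c D \<noteq> 0"
  "\<And>D f. D \<in> K ==> f \<in> sec D ==> ph (e D f) = e D (kappa (c D) \<cdot> f)" by blast
 have cI: "c D = d" if D: "D \<in> K" and f: "f \<in> Lx" "f \<in> sec D" and eq: "ph (e D f) = e D (kappa d \<cdot> f)" for D f d
 proof -
  note sc = sections_scale[OF kappa_simps(1) f(2)]
  have "kappa (c D) \<cdot> f = kappa d \<cdot> f" using eq c(2)[OF D f(2)] e_inj[OF D sc sc] by simp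
  then show ?thesis by (rule kappa_cancel[OF f(1)])
 qed
 have cadd: "c (D + E) = c D * c E" if D: "D \<in> K" and E: "E \<in> K" for D E
 proof -
  obtain f where f: "f \<in> Lx" "f \<in> sec D" using section_in[OF K_W[OF D]] .
  obtain g where g: "g \<in> Lx" "g \<in> sec E" using section_in[OF K_W[OF E]] .
  note sf = sections_scale[OF kappa_simps(1) f(2)] and sg = sections_scale[OF kappa_simps(1) g(2)]
  have "ph (e (D + E) (f \<cdot> g)) = ph (e D f) \<otimes>\<^sub>R ph (e E g)"
   unfolding e_mult[OF D f(2) E g(2), symmetric] by (rule ring_hom_mult[OF AutR_facts(2)[OF ph] e_closed[OF D f(2)] e_closed[OF E g(2)]])
  also have "... = e (D + E) ((kappa (c D) \<cdot> f) \<cdot> (kappa (c E) \<cdot> g))"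
   unfolding c(2)[OF D f(2)] c(2)[OF E g(2)] by (rule e_mult[OF D sf E sg])
  also have "(kappa (c D) \<cdot> f) \<cdot> (kappa (c E) \<cdot> g) = kappa (c D * c E) \<cdot> (f \<cdot> g)"
   unfolding kappa_simps(2) using kappa_L sections_L[OF f(2)] sections_L[OF g(2)] by (simp add: L.m_ac)
  finally show ?thesis by (rule cI[OF K_closed(2)[OF D E] Lx_closed(1)[OF f(1) g(1)] sections_mult[OF f(2) g(2)]])
 qed
 have c0: "c D = 1" if D: "D \<in> K0" for D
 proof -
  have DK: "D \<in> K" using D K0_iff by blast
  obtain f where f: "f \<in> Lx" "f \<in> sec D" using section_in[OF K_W[OF DK]] .
  have D0: "D - 0 \<in> K0" using D by simp
  have m: "e D f = e 0 (F D \<cdot> f)" using e_move[OF DK K_closed(1) D0 f(2)] by simp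
  have "F D \<cdot> f \<in> S" using sections_F[OF DK K_closed(1) D0 f(2)] unfolding sections_0 by simp
  then obtain a where a: "a \<in> carrier A" "F D \<cdot> f = to_frac A a" by blast
  have "ph (e D f) = e D f" using bspec[OF fixed a(1)] unfolding m a(2) cox_embed_e .
  then have "ph (e D f) = e D (kappa 1 \<cdot> f)" using sections_L[OF f(2)] unfolding kappa_simps(3) by simp
  then show ?thesis by (rule cI[OF DK f])
 qed
 have cls: "c D = c E" if D: "D \<in> K" and E: "E \<in> K" and eq: "theta (cl D) = theta (cl E)" for D E
 proof -
  have "cl D = cl E" using inj_onD[OF theta_facts(3) eq class_K[OF D] class_K[OF E]] .
  then have "c (D - E) = 1" using div_class_eq_K[OF D E] c0 by blast
  then show ?thesis using cadd[OF K_closed(3)[OF D E] E] by simp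
 qed
 define xi where "xi eta = c (SOME D. D \<in> K \<and> theta (cl D) = eta)" for eta
 have xi: "xi (theta (cl D)) = c D" if D: "D \<in> K" for D
 proof -
  have "\<exists>E. E \<in> K \<and> theta (cl E) = theta (cl D)" using D by blast
  from someI_ex[OF this] show ?thesis unfolding xi_def using cls D by blast
 qed
 have char: "\<exists>D\<in>K. eta = theta (cl D)" if "eta \<in> carrier (character_group N)" for eta
  using that unfolding theta_facts(4)[symmetric] surj[symmetric] by blast
 have "\<exists>t\<in>carrier N. \<forall>eta\<in>carrier (character_group N). eta t = xi eta"
 proof (rule character_of_characters_is_evaluation[OF N])
  fix eta assume "eta \<in> carrier (character_group N)"
  then obtain D where D: "D \<in> K" "eta = theta (cl D)" using char by blast
  show "xi eta \<noteq> 0" unfolding D(2) xi[OF D(1)] by (rule c(1)[OF D(1)])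
  fix eta' assume "eta' \<in> carrier (character_group N)"
  then obtain E where E: "E \<in> K" "eta' = theta (cl E)" using char by blast
  have "(\<lambda>x\<in>carrier N. eta x * eta' x) = theta (cl (D + E))"
   unfolding D(2) E(2) Cl_simps(2)[OF K_W[OF D(1)] K_W[OF E(1)], symmetric] by (rule theta_facts(2)[OF class_K[OF D(1)] class_K[OF E(1)], symmetric])
  then show "xi (\<lambda>x\<in>carrier N. eta x * eta' x) = xi eta * xi eta'"
   unfolding D(2) E(2) using xi[OF D(1)] xi[OF E(1)] xi[OF K_closed(2)[OF D(1) E(1)]] cadd[OF D(1) E(1)] by simp
 qed
 then obtain t where t: "t \<in> carrier N" "\<And>eta. eta \<in> carrier (character_group N) ==> eta t = xi eta" by blast
 have "chi D t = c D" if D: "D \<in> K" for D unfolding chi_def t(2)[OF theta_facts(1)[OF class_K[OF D]]] by (rule xi[OF D])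
 then have "acts t ph" unfolding acts_iff using c(2) by simp
 then show ?thesis using t(1) by blast
qed

lemma acts_fixes_degree_zero:
 assumes ph: "acts t ph" and t: "t \<in> carrier N" and a: "a \<in> carrier A" shows "ph (emb a) = emb a"
proof -
 have "0 \<in> Prin" using K0_closed(1) K0_iff by blast
 then have 1: "chi 0 t = 1" by (rule chi_facts(4)[OF _ t])
 have s: "to_frac A a \<in> sec 0" unfolding sections_0 using a by simp
 then have "ph (emb a) = e 0 (kappa (chi 0 t) \<cdot> to_frac A a)" using ph K_closed(1) unfolding acts_iff cox_embed_e by blast
 then show ?thesis unfolding 1 kappa_simps(3) cox_embed_e using sections_L[OF s] by simp
qed

lemma exact_sequence:
 "\<exists>alpha beta. exact_1_1 N AutR AutV alpha beta \<and> (\<forall>t\<in>carrier N. acts t (alpha t)) \<and> (\<forall>ph\<in>carrier AutR. induces ph (beta ph))"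
proof -
 interpret AR: group AutR by (rule group_AutR)
 interpret AV: group AutV by (rule group_AutV)
 define alpha where "alpha t = (SOME ph. ph \<in> carrier AutR \<and> acts t ph)" for t
 define beta where "beta ph = (SOME psi. induces ph psi)" for ph
 have alpha: "alpha t \<in> carrier AutR" "acts t (alpha t)" if "t \<in> carrier N" for t
  using someI_ex[OF action_exists[OF that]] unfolding alpha_def by simp_all
 have beta: "induces ph (beta ph)" if "ph \<in> carrier AutR" for ph
  using someI_ex[OF induced_exists[OF that]] unfolding beta_def .
 have betaV: "beta ph \<in> carrier AutV" if "ph \<in> carrier AutR" for ph using beta[OF that] by (simp add: induces_def)
 have betaI: "beta ph = psi" if "ph \<in> carrier AutR" "induces ph psi" for ph psi by (rule induced_unique[OF beta[OF that(1)] that(2)])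
 have "alpha \<in> hom N AutR"
 proof (rule homI)
  show "alpha t \<in> carrier AutR" if "t \<in> carrier N" for t by (rule alpha(1)[OF that])
  fix t s assume ts: "t \<in> carrier N" "s \<in> carrier N"
  show "alpha (t \<otimes>\<^bsub>N\<^esub> s) = alpha t \<otimes>\<^bsub>AutR\<^esub> alpha s"
   by (rule acts_unique[OF alpha(1)[OF NG.m_closed[OF ts]] AR.m_closed[OF alpha(1)[OF ts(1)] alpha(1)[OF ts(2)]] alpha(2)[OF NG.m_closed[OF ts]]
    acts_compose[OF ts alpha(1)[OF ts(1)] alpha(1)[OF ts(2)] alpha(2)[OF ts(1)] alpha(2)[OF ts(2)]]])
 qed
 moreover have "inj_on alpha (carrier N)"
 proof (rule inj_onI)
  fix t s assume ts: "t \<in> carrier N" "s \<in> carrier N" "alpha t = alpha s"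
  show "t = s" by (rule action_faithful[OF ts(1,2) alpha(2)[OF ts(1), unfolded ts(3)] alpha(2)[OF ts(2)]])
 qed
 ultimately have mon: "alpha \<in> mon N AutR" by (simp add: mon_def)
 have "beta \<in> hom AutR AutV"
 proof (rule homI)
  show "beta ph \<in> carrier AutV" if "ph \<in> carrier AutR" for ph by (rule betaV[OF that])
  fix ph ph' assume ph: "ph \<in> carrier AutR" "ph' \<in> carrier AutR"
  show "beta (ph \<otimes>\<^bsub>AutR\<^esub> ph') = beta ph \<otimes>\<^bsub>AutV\<^esub> beta ph'"
   by (rule betaI[OF AR.m_closed[OF ph] induces_compose[OF ph beta[OF ph(1)] beta[OF ph(2)]]])
 qed
 moreover have "beta ` carrier AutR = carrier AutV"
 proof (intro equalityI subsetI)
  show "psi \<in> carrier AutV" if "psi \<in> beta ` carrier AutR" for psi using that betaV by blast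
  fix psi assume "psi \<in> carrier AutV"
  then obtain ph where ph: "ph \<in> carrier AutR" "induces ph psi" using variety_automorphism_lifts by blast
  show "psi \<in> beta ` carrier AutR" using betaI[OF ph] ph(1) by blast
 qed
 ultimately have epi: "beta \<in> epi AutR AutV" by (simp add: epi_def)
 have "alpha ` carrier N = kernel AutR AutV beta"
 proof (intro equalityI subsetI)
  fix ph assume "ph \<in> alpha ` carrier N"
  then obtain t where t: "t \<in> carrier N" "ph = alpha t" by blast
  have "induces ph \<one>\<^bsub>AutV\<^esub>" unfolding induces_one_iff t(2) using acts_fixes_degree_zero[OF alpha(2)[OF t(1)] t(1)] by blast
  then show "ph \<in> kernel AutR AutV beta" using betaI alpha(1)[OF t(1)] unfolding kernel_def t(2) by simp
 next
  fix ph assume "ph \<in> kernel AutR AutV beta"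
  then have ph: "ph \<in> carrier AutR" "beta ph = \<one>\<^bsub>AutV\<^esub>" by (simp_all add: kernel_def)
  have "induces ph \<one>\<^bsub>AutV\<^esub>" using beta[OF ph(1)] unfolding ph(2) .
  then obtain t where t: "t \<in> carrier N" "acts t ph" using automorphism_over_V_acts[OF ph(1)] unfolding induces_one_iff by blast
  have "ph = alpha t" by (rule acts_unique[OF ph(1) alpha(1)[OF t(1)] t(2) alpha(2)[OF t(1)]])
  then show "ph \<in> alpha ` carrier N" using t(1) by (rule image_eqI)
 qed
 then have "exact_1_1 N AutR AutV alpha beta"
  unfolding exact_1_1_def using mon epi NG.is_group AR.is_group AV.is_group by blast
 then show ?thesis using alpha(2) beta by blast
qed

end

theorem theorem5p1:
  fixes V :: "('k::{alg_closed_field, field_char_0} ^ 'n::finite) set"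
    and K :: "('k, 'n) divisor set"
    and F :: "('k, 'n) divisor \<Rightarrow> ('k, 'n) ratfun"
    and N :: "('k ^ 'm::finite) monoid"
    and \<theta> :: "('k, 'n) divisor set \<Rightarrow> ('k ^ 'm \<Rightarrow> 'k)"
  assumes "normal_affine_variety V"
    and "finitely_generated_group (Cl V)"
    and "Units (coordinate_ring V) = const_fun V ` (UNIV - {0})"
    and "subgroup K (WDiv V)"
    and "finitely_generated_group (WDiv V\<lparr>carrier := K\<rparr>)"
    and "div_class V ` K = carrier (Cl V)"
    and "coherent V K F"
    and "quasitorus N"
    and "\<theta> \<in> iso (Cl V) (character_group N)"
  shows "\<exists>\<alpha> \<beta>.
    exact_1_1 N (graded_automorphisms V K F) (variety_automorphisms V) \<alpha> \<beta> \<and>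
    (\<forall>t \<in> carrier N. \<forall>u \<in> carrier (Cl V). \<forall>f \<in> cox_component V K F u.
       \<alpha> t f = cox_scalar V K F (\<theta> u t) \<otimes>\<^bsub>cox_ring V K F\<^esub> f) \<and>
    (\<forall>\<phi> \<in> carrier (graded_automorphisms V K F). \<forall>f \<in> carrier (coordinate_ring V).
       cox_embed V K F (pullback V (inv_into V (\<beta> \<phi>)) f) = \<phi> (cox_embed V K F f))"
proof -
  interpret cox_quasitorus V K F N \<theta>
    by (intro cox_quasitorus.intro cox_units.intro cox_data.intro normal_variety.intro cox_data_axioms.intro
      cox_units_axioms.intro cox_quasitorus_axioms.intro assms)
  obtain \<alpha> \<beta> where "exact_1_1 N (graded_automorphisms V K F) (variety_automorphisms V) \<alpha> \<beta>"
    "\<forall>t\<in>carrier N. acts t (\<alpha> t)" "\<forall>\<phi>\<in>carrier (graded_automorphisms V K F). induces \<phi> (\<beta> \<phi>)"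
    using exact_sequence by blast
  then show ?thesis unfolding acts_def induces_def by blast
qed

end
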